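(* Fix $k_3\ge0$, and let $\kappa=(k_1,k_2,k_3)$ with $k_1,k_2\ge0$. For all $x\in\mathbb R^n$ and $\lambda\in\mathbb C^n$, $$G^{\mathrm{BC}}_{\kappa}(-\lambda-\rho^{\mathrm{BC}}(\kappa),x)\ \longrightarrow\ \mathcal G^{\mathrm A}_{k_3}\big(\lambda-\rho^{\mathrm A}(k_3),\cosh^2(\tfrac x2)\big)\qquad\text{as } k_1+k_2\to\infty,\ k_1/k_2\to\infty,$$ locally uniformly in $\lambda$, and the limit equals $$G^{\mathrm A}_{k_3}\big(\lambda-\rho^{\mathrm A}(k_3),\log(\cosh^2(\tfrac x2))\big)=\prod_{i=1}^n\big(\cosh^2(\tfrac{x_i}2)\big)^{\frac{\langle\lambda,\underline 1\rangle}{n}}\cdot G^{\mathrm A}_{k_3}\big(\lambda-\rho^{\mathrm A}(k_3),\pi(\log(\cosh^2(\tfrac x2)))\big),$$ where $\underline1=(1,\dots,1)$ and $\pi:\mathbb R^n\to\mathbb R^n_0=\mathrm{span}_{\mathbb R}\mathrm A_{n-1}$ is the orthogonal projection.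
   Context: All functions $\cosh^2(\cdot/2)$, $\log$, $\exp$ are applied componentwise to vectors in $\mathbb R^n$ (resp. $(0,\infty)^n$); $\langle\cdot,\cdot\rangle$ is the standard inner product on $\mathbb R^n$, extended $\mathbb C$-bilinearly to $\mathbb C^n$; $e_1,\dots,e_n$ is the standard basis. In the limit $k_1/k_2\to\infty$ the case $k_2=0$ (with $k_1/k_2=\infty$) is included. **Cherednik kernels.** Let $R\subset\mathbb R^n$ be an integral root system (finite, $0\notin R$, stable under the orthogonal reflections $s_\alpha$ in $\alpha^\perp$, with $2\langle\alpha,\beta\rangle/\langle\alpha,\alpha\rangle\in\mathbb Z$ for all $\alpha,\beta\in R$; $R$ need not span $\mathbb R^n$), $R_+$ a system of positive roots and $k:R\to[0,\infty)$ invariant under the Weyl group. Put $\rho(k)=\frac12\sum_{\alpha\in R_+}k_\alpha\alpha$ and $$D_\xi(R_+,k)=\partial_\xi-\langle\rho(k),\xi\rangle+\sum_{\alpha\in R_+}k_\alpha\langle\alpha,\xi\rangle\frac{1-s_\alpha}{1-e^{-\alpha}},\quad\xi\in\mathbb R^n,$$ with $e^{-\alpha}(x)=e^{-\langle\alpha,x\rangle}$, $(s_\alpha f)(x)=f(s_\alpha x)$. For $\lambda\in\mathbb C^n$ the Cherednik kernel $G_k(R_+;\lambda,\cdot):\mathbb R^n\to\mathbb C$ is the unique analytic function $f$ with $f(0)=1$ and $D_\xi(R_+,k)f=\langle\lambda,\xi\rangle f$ for all $\xi\in\mathbb R^n$. **Type BC.** $\mathrm{BC}_n=\{\pm e_i,\pm2e_i:1\le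 i\le n\}\cup\{\pm(e_i\pm e_j):1\le i<j\le n\}$, positive roots $\mathrm{BC}_n^+=\{e_i,2e_i\}\cup\{e_i\pm e_j: i<j\}$; $\kappa=(k_1,k_2,k_3)$ is the multiplicity with value $k_1$ on $\pm e_i$, $k_2$ on $\pm2e_i$, $k_3$ on $\pm(e_i\pm e_j)$. $G^{\mathrm{BC}}_\kappa$ is the corresponding Cherednik kernel and $\rho^{\mathrm{BC}}(\kappa)=\frac12\sum_{i=1}^n(k_1+2k_2+2k_3(n-i))e_i$. **Type A.** $\mathrm A_{n-1}=\{\pm(e_j-e_i):1\le i<j\le n\}$ with positive roots $\mathrm A_{n-1}^+=\{e_j-e_i:1\le i<j\le n\}$ and constant multiplicity $k_3$; $G^{\mathrm A}_{k_3}$ is the corresponding Cherednik kernel on $\mathbb R^n$, $\rho^{\mathrm A}(k_3)=\frac{k_3}2\sum_{i<j}(e_j-e_i)$, and $\mathcal G^{\mathrm A}_{k_3}(\lambda,x)=G^{\mathrm A}_{k_3}(\lambda,\log x)$ for $x\in(0,\infty)^n$. *)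

theory Defs
  imports "HOL-Analysis.Analysis"
begin

text \<open>Throughout, \<open>\<real>\<^sup>n\<close> is \<open>real ^ 'n\<close> for a finite linearly ordered index type \<open>'n\<close>, whose
  order plays the role of \<open>1 < 2 < \<dots> < n\<close>, and \<open>e\<^sub>i\<close> is \<open>axis i 1\<close>.\<close>

definition bilin :: "complex ^ 'n \<Rightarrow> real ^ 'n \<Rightarrow> complex"
  where "bilin l x = (\<Sum>i\<in>UNIV. l $ i * of_real (x $ i))"

definition cvec :: "real ^ 'n \<Rightarrow> complex ^ 'n"
  where "cvec x = (\<chi> i. of_real (x $ i))"

text \<open>Real analyticity on all of \<open>\<real>\<^sup>n\<close>: near every point \<open>a\<close> the function is the sum of an
  (absolutely) convergent power series, indexed by multi-indices \<open>m :: 'n \<Rightarrow> nat\<close>.\<close>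

definition real_analytic :: "(real ^ 'n \<Rightarrow> complex) \<Rightarrow> bool"
  where "real_analytic f \<longleftrightarrow>
    (\<forall>a. \<exists>c :: ('n \<Rightarrow> nat) \<Rightarrow> complex. \<exists>r>0. \<forall>x. (\<forall>i. \<bar>x $ i - a $ i\<bar> < r) \<longrightarrow>
       ((\<lambda>m. c m * of_real (\<Prod>i\<in>UNIV. (x $ i - a $ i) ^ m i)) has_sum f x) UNIV)"


subsection \<open>Cherednik operators and kernels\<close>

definition refl_root :: "real ^ 'n \<Rightarrow> real ^ 'n \<Rightarrow> real ^ 'n"
  where "refl_root a x = x - (2 * (a \<bullet> x) / (a \<bullet> a)) *\<^sub>R a"

text \<open>The function \<open>(1 - s\<^sub>a) f / (1 - e\<^sup>-\<^sup>a)\<close>. On the hyperplane \<open>a\<^sup>\<bottom>\<close>, where both numerator and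
  denominator vanish, it denotes the continuous extension.\<close>

definition diff_quot :: "real ^ 'n \<Rightarrow> (real ^ 'n \<Rightarrow> complex) \<Rightarrow> real ^ 'n \<Rightarrow> complex"
  where "diff_quot a f x =
    (let q = (\<lambda>y. (f y - f (refl_root a y)) / of_real (1 - exp (- (a \<bullet> y))))
     in if a \<bullet> x \<noteq> 0 then q x else Lim (at x within {y. a \<bullet> y \<noteq> 0}) q)"

text \<open>Here \<open>P\<close> is the set of positive roots and \<open>k\<close> the multiplicity function.\<close>

definition rho :: "(real ^ 'n) set \<Rightarrow> (real ^ 'n \<Rightarrow> real) \<Rightarrow> real ^ 'n"
  where "rho P k = (1 / 2) *\<^sub>R (\<Sum>a\<in>P. k a *\<^sub>R a)"

definition cherednik_op ::
    "(real ^ 'n) set \<Rightarrow> (real ^ 'n \<Rightarrow> real) \<Rightarrow> real ^ 'n \<Rightarrow> (real ^ 'n \<Rightarrow> complex) \<Rightarrow> real ^ 'n \<Rightarrow> complex"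
  where "cherednik_op P k \<xi> f x =
    frechet_derivative f (at x) \<xi> - of_real (rho P k \<bullet> \<xi>) * f x
      + (\<Sum>a\<in>P. of_real (k a * (a \<bullet> \<xi>)) * diff_quot a f x)"

definition is_cherednik_kernel ::
    "(real ^ 'n) set \<Rightarrow> (real ^ 'n \<Rightarrow> real) \<Rightarrow> complex ^ 'n \<Rightarrow> (real ^ 'n \<Rightarrow> complex) \<Rightarrow> bool"
  where "is_cherednik_kernel P k l f \<longleftrightarrow>
    real_analytic f \<and> f 0 = 1 \<and> (\<forall>\<xi> x. cherednik_op P k \<xi> f x = bilin l \<xi> * f x)"

definition cherednik_kernel ::
    "(real ^ 'n) set \<Rightarrow> (real ^ 'n \<Rightarrow> real) \<Rightarrow> complex ^ 'n \<Rightarrow> real ^ 'n \<Rightarrow> complex"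
  where "cherednik_kernel P k l = (THE f. is_cherednik_kernel P k l f)"


subsection \<open>Type BC\<close>

definition BC_short :: "(real ^ 'n) set"
  where "BC_short = {axis i 1 | i. True} \<union> {- axis i 1 | i. True}"

definition BC_long :: "(real ^ 'n) set"
  where "BC_long = {2 *\<^sub>R axis i 1 | i. True} \<union> {- (2 *\<^sub>R axis i 1) | i. True}"

definition BC_middle :: "(real ^ ('n :: {finite, linorder})) set"
  where "BC_middle =
    {axis i 1 + axis j 1 | i j. i < j} \<union> {- (axis i 1 + axis j 1) | i j. i < j} \<union>
    {axis i 1 - axis j 1 | i j. i < j} \<union> {- (axis i 1 - axis j 1) | i j. i < j}"

definition BC_pos :: "(real ^ ('n :: {finite, linorder})) set"
  where "BC_pos =
    {axis i 1 | i. True} \<union> {2 *\<^sub>R axis i 1 | i. True} \<union>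
    {axis i 1 + axis j 1 | i j. i < j} \<union> {axis i 1 - axis j 1 | i j. i < j}"

text \<open>The values of a multiplicity outside the root system are irrelevant; they are set to \<open>0\<close>.\<close>

definition BC_mult :: "real \<Rightarrow> real \<Rightarrow> real \<Rightarrow> real ^ ('n :: {finite, linorder}) \<Rightarrow> real"
  where "BC_mult k1 k2 k3 a =
    (if a \<in> BC_short then k1 else if a \<in> BC_long then k2 else if a \<in> BC_middle then k3 else 0)"

definition G_BC ::
    "real \<Rightarrow> real \<Rightarrow> real \<Rightarrow> complex ^ ('n :: {finite, linorder}) \<Rightarrow> real ^ ('n :: {finite, linorder}) \<Rightarrow> complex"
  where "G_BC k1 k2 k3 = cherednik_kernel BC_pos (BC_mult k1 k2 k3)"

definition rho_BC :: "real \<Rightarrow> real \<Rightarrow> real \<Rightarrow> real ^ ('n :: {finite, linorder})"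
  where "rho_BC k1 k2 k3 =
    (1 / 2) *\<^sub>R (\<Sum>i\<in>UNIV. (k1 + 2 * k2 + 2 * k3 * real (card {j. i < j})) *\<^sub>R axis i 1)"


subsection \<open>Type A\<close>

definition A_pos :: "(real ^ ('n :: {finite, linorder})) set"
  where "A_pos = {axis j 1 - axis i 1 | i j. i < j}"

definition A_roots :: "(real ^ ('n :: {finite, linorder})) set"
  where "A_roots = A_pos \<union> uminus ` A_pos"

definition G_A :: "real \<Rightarrow> complex ^ ('n :: {finite, linorder}) \<Rightarrow> real ^ ('n :: {finite, linorder}) \<Rightarrow> complex"
  where "G_A k3 = cherednik_kernel A_pos (\<lambda>_. k3)"

definition rho_A :: "real \<Rightarrow> real ^ ('n :: {finite, linorder})"
  where "rho_A k3 = (k3 / 2) *\<^sub>R (\<Sum>(i, j)\<in>{(i, j). i < j}. axis j 1 - axis i 1)"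

definition vlog :: "real ^ 'n \<Rightarrow> real ^ 'n"
  where "vlog x = (\<chi> i. ln (x $ i))"

definition cosh2_half :: "real ^ 'n \<Rightarrow> real ^ 'n"
  where "cosh2_half x = (\<chi> i. (cosh (x $ i / 2))\<^sup>2)"

text \<open>Meant for \<open>x \<in> (0, \<infinity>)\<^sup>n\<close>.\<close>

definition calG_A :: "real \<Rightarrow> complex ^ ('n :: {finite, linorder}) \<Rightarrow> real ^ ('n :: {finite, linorder}) \<Rightarrow> complex"
  where "calG_A k3 l x = G_A k3 l (vlog x)"

definition orth_proj :: "(real ^ 'n) set \<Rightarrow> real ^ 'n \<Rightarrow> real ^ 'n"
  where "orth_proj S x = (THE p. p \<in> S \<and> (\<forall>v\<in>S. (x - p) \<bullet> v = 0))"


subsection \<open>The limit regime\<close>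

text \<open>Pairs \<open>(k1, k2)\<close> with \<open>k1, k2 \<ge> 0\<close>, \<open>k1 + k2 \<rightarrow> \<infinity>\<close> and \<open>k1 / k2 \<rightarrow> \<infinity>\<close>. The quotient is taken in the
  extended reals, where \<open>k1 / 0 = \<infinity>\<close> for \<open>k1 > 0\<close>, so that \<open>k2 = 0\<close> is included.\<close>

definition mult_filter :: "(real \<times> real) filter"
  where "mult_filter =
    inf (principal {(k1, k2). 0 \<le> k1 \<and> 0 \<le> k2})
      (inf (filtercomap (\<lambda>(k1, k2). k1 + k2) at_top)
           (filtercomap (\<lambda>(k1, k2). ereal k1 / ereal k2) (nhds \<infinity>)))"

definition locally_uniform_limit ::
    "('a \<Rightarrow> 'b::topological_space \<Rightarrow> 'c::metric_space) \<Rightarrow> ('b \<Rightarrow> 'c) \<Rightarrow> 'a filter \<Rightarrow> bool"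
  where "locally_uniform_limit f l F \<longleftrightarrow>
    (\<forall>z. \<exists>U. open U \<and> z \<in> U \<and> uniform_limit U f l F)"


subsection \<open>The explicit formulas agree with the general notions\<close>

lemma rho_A_eq: "rho A_pos (\<lambda>_. k3) = (rho_A k3 :: real ^ ('n :: {finite, linorder}))"
proof -
  have inj: "inj_on (\<lambda>(i, j). axis j 1 - axis i 1 :: (real, 'n) vec) {(i :: 'n, j). i < j}"
  proof (rule inj_onI, clarify)
    fix i j k l :: 'n
    assume h: "i < j" "k < l" and e: "axis j 1 - axis i (1::real) = axis l 1 - axis k 1"
    have e': "\<And>m. axis j 1 $ m - axis i (1::real) $ m = axis l 1 $ m - axis k 1 $ m"
      using e by (metis vector_minus_component)
    have "i = k" using e'[of i] h by (cases "i = k"; cases "i = l") (auto simp: axis_def split: if_split_asm)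
    moreover have "j = l" using e'[of j] h by (cases "j = k"; cases "j = l") (auto simp: axis_def split: if_split_asm)
    ultimately show "i = k \<and> j = l" by simp
  qed
  have A: "A_pos = (\<lambda>(i, j). axis j 1 - axis i 1 :: (real, 'n) vec) ` {(i :: 'n, j). i < j}"
    by (auto simp: A_pos_def)
  show ?thesis
    unfolding rho_def rho_A_def A sum.reindex[OF inj] o_def scaleR_sum_right
    by (rule sum.cong) auto
qed

lemma eventually_mult_filter:
  "eventually P mult_filter \<longleftrightarrow>
    (\<exists>M. \<forall>k1 k2. 0 \<le> k1 \<and> 0 \<le> k2 \<and> M \<le> k1 + k2 \<and> M * k2 \<le> k1 \<longrightarrow> P (k1, k2))"
proof
  assume "eventually P mult_filter"
  then obtain Q R where QR: "eventually Q (filtercomap (\<lambda>(k1, k2). k1 + k2 :: real) at_top)"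
      "eventually R (filtercomap (\<lambda>(k1, k2). ereal k1 / ereal k2) (nhds \<infinity>))"
      "\<And>z. Q z \<Longrightarrow> R z \<Longrightarrow> z \<in> {(k1, k2). 0 \<le> k1 \<and> 0 \<le> k2} \<longrightarrow> P z"
    unfolding mult_filter_def inf_commute[of "principal _"] eventually_inf_principal
    unfolding eventually_inf by blast
  obtain M where M: "\<And>k1 k2. M \<le> k1 + k2 \<Longrightarrow> Q (k1, k2)"
    using QR(1) by (auto simp: eventually_filtercomap eventually_at_top_linorder)
  obtain N where N: "\<And>k1 k2. ereal N < ereal k1 / ereal k2 \<Longrightarrow> R (k1, k2)"
  proof -
    obtain T where T: "eventually T (nhds (\<infinity>::ereal))" "\<And>k1 k2. T (ereal k1 / ereal k2) \<Longrightarrow> R (k1, k2)"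
      using QR(2) by (auto simp: eventually_filtercomap)
    then obtain U where "open U" "(\<infinity>::ereal) \<in> U" "\<And>z. z \<in> U \<Longrightarrow> T z"
      by (auto simp: eventually_nhds)
    then obtain N where "{ereal N<..} \<subseteq> U" "\<And>z. z \<in> U \<Longrightarrow> T z" using open_PInfty[of U] by blast
    then show ?thesis using T(2) that[of N] by (meson greaterThan_iff subsetD)
  qed
  have MN: "P (k1, k2)" if "0 \<le> k1" "0 \<le> k2" "M \<le> k1 + k2" "ereal N < ereal k1 / ereal k2" for k1 k2
    using QR(3)[OF M[OF that(3)] N[OF that(4)]] that by auto
  define K where "K = max 1 (max M (max 0 N + 1))"
  have "P (k1, k2)" if h: "0 \<le> k1" "0 \<le> k2" "K \<le> k1 + k2" "K * k2 \<le> k1" for k1 k2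
  proof (rule MN)
    show "M \<le> k1 + k2" using h by (simp add: K_def)
    show "ereal N < ereal k1 / ereal k2"
    proof (cases "k2 = 0")
      case True
      have "1 \<le> K" by (simp add: K_def)
      then have "k1 > 0" using h True by simp
      then show ?thesis using True by (simp add: divide_ereal_def)
    next
      case False
      then have p: "k2 > 0" using h by simp
      have "N < K" by (simp add: K_def)
      then have "N * k2 < K * k2" using p by simp
      then have "N * k2 < k1" using h by linarith
      then show ?thesis using p by (simp add: less_divide_eq)
    qed
  qed (use h in auto)
  then show "\<exists>M. \<forall>k1 k2. 0 \<le> k1 \<and> 0 \<le> k2 \<and> M \<le> k1 + k2 \<and> M * k2 \<le> k1 \<longrightarrow> P (k1, k2)" by blast
next
  assume "\<exists>M. \<forall>k1 k2. 0 \<le> k1 \<and> 0 \<le> k2 \<and> M \<le> k1 + k2 \<and> M * k2 \<le> k1 \<longrightarrow> P (k1, k2)"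
  then obtain M where M: "\<And>k1 k2. 0 \<le> k1 \<Longrightarrow> 0 \<le> k2 \<Longrightarrow> M \<le> k1 + k2 \<Longrightarrow> M * k2 \<le> k1 \<Longrightarrow> P (k1, k2)" by blast
  have a: "eventually (\<lambda>(k1, k2). 0 \<le> k1 \<and> 0 \<le> k2) mult_filter"
    unfolding mult_filter_def by (rule filter_leD[OF inf_le1]) (simp add: eventually_principal)
  have b: "eventually (\<lambda>(k1, k2). M \<le> k1 + k2) mult_filter"
    unfolding mult_filter_def
    by (rule filter_leD[OF order_trans[OF inf_le2 inf_le1]])
       (auto simp: eventually_filtercomap intro!: exI[of _ "\<lambda>z. M \<le> z"] eventually_ge_at_top)
  have c: "eventually (\<lambda>(k1, k2). ereal M < ereal k1 / ereal k2) mult_filter"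
    unfolding mult_filter_def
    by (rule filter_leD[OF order_trans[OF inf_le2 inf_le2]])
       (auto simp: eventually_filtercomap eventually_nhds intro!: exI[of _ "\<lambda>z. ereal M < z"] exI[of _ "{ereal M<..}"])
  show "eventually P mult_filter"
    using a b c
  proof eventually_elim
    case (elim z)
    obtain k1 k2 where z: "z = (k1, k2)" by force
    have "M * k2 \<le> k1"
      using elim z by (cases "k2 = 0") (auto simp: less_divide_eq)
    then show ?case using M elim z by auto
  qed
qed

lemma rho_BC_eq: "rho BC_pos (BC_mult k1 k2 k3) = (rho_BC k1 k2 k3 :: real ^ ('n :: {finite, linorder}))"
proof -
  let ?S = "range (\<lambda>i. axis i 1) :: ((real, 'n) vec) set" and ?L = "range (\<lambda>i. 2 *\<^sub>R axis i 1) :: ((real, 'n) vec) set"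
  let ?T = "{(i :: 'n, j). i < j}"
  let ?p = "\<lambda>(i :: 'n, j). axis i 1 + axis j 1 :: (real, 'n) vec" and ?m = "\<lambda>(i :: 'n, j). axis i 1 - axis j 1 :: (real, 'n) vec"
  have nS: "norm a = 1" if "a \<in> BC_short" for a :: "(real, 'n) vec"
    using that by (auto simp: BC_short_def)
  have nL: "norm a = 2" if "a \<in> BC_long" for a :: "(real, 'n) vec"
    using that by (auto simp: BC_long_def)
  have n2: "norm (?p z) = sqrt 2" "norm (?m z) = sqrt 2" if "z \<in> ?T" for z
    using that by (auto simp: norm_eq_sqrt_inner inner_add_left inner_diff_left inner_add_right inner_diff_right inner_axis_axis)
  have s2: "sqrt 2 \<noteq> 1" "sqrt 2 \<noteq> (2::real)"
    using real_sqrt_less_iff[of 2 4] by auto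
  have mp: "BC_mult k1 k2 k3 (?p z) = k3" "BC_mult k1 k2 k3 (?m z) = k3" if "z \<in> ?T" for z
  proof -
    have "?p z \<in> BC_middle" "?m z \<in> BC_middle"
      using that unfolding BC_middle_def by (cases z; simp only: mem_Collect_eq prod.case Un_iff; blast)+
    moreover have "b \<notin> BC_short \<and> b \<notin> BC_long" if "norm b = sqrt 2" for b :: "(real, 'n) vec"
      using that nS nL s2 by metis
    ultimately show "BC_mult k1 k2 k3 (?p z) = k3" "BC_mult k1 k2 k3 (?m z) = k3"
      using n2[OF that] by (simp_all only: BC_mult_def if_True if_False not_False_eq_True simp_thms)
  qed
  have mS: "BC_mult k1 k2 k3 (axis i 1 :: (real, 'n) vec) = k1" for i
    by (auto simp: BC_mult_def BC_short_def)
  have mL: "BC_mult k1 k2 k3 (2 *\<^sub>R axis i 1 :: (real, 'n) vec) = k2" for i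
    using nS[of "2 *\<^sub>R axis i 1"] by (auto simp: BC_mult_def BC_long_def)
  have iS: "inj (\<lambda>i. axis i 1 :: (real, 'n) vec)" by (auto simp: inj_def axis_eq_axis)
  have iL: "inj (\<lambda>i. 2 *\<^sub>R axis i 1 :: (real, 'n) vec)" by (auto simp: inj_def axis_eq_axis)
  have ip: "inj_on ?p ?T"
  proof (rule inj_onI, clarify)
    fix i j k l :: 'n
    assume h: "i < j" "k < l" and e: "axis i 1 + axis j (1::real) = axis k 1 + axis l 1"
    have e': "\<And>m. axis i 1 $ m + axis j (1::real) $ m = axis k 1 $ m + axis l 1 $ m"
      using e by (metis vector_add_component)
    have "i = k \<or> i = l" using e'[of i] h by (cases "i = k"; cases "i = l") (auto simp: axis_def split: if_split_asm)
    moreover have "j = k \<or> j = l" using e'[of j] h by (cases "j = k"; cases "j = l") (auto simp: axis_def split: if_split_asm)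
    ultimately show "i = k \<and> j = l" using h by auto
  qed
  have im: "inj_on ?m ?T"
  proof (rule inj_onI, clarify)
    fix i j k l :: 'n
    assume h: "i < j" "k < l" and e: "axis i 1 - axis j (1::real) = axis k 1 - axis l 1"
    have e': "\<And>m. axis i 1 $ m - axis j (1::real) $ m = axis k 1 $ m - axis l 1 $ m"
      using e by (metis vector_minus_component)
    have "i = k" using e'[of i] h by (cases "i = k"; cases "i = l") (auto simp: axis_def split: if_split_asm)
    moreover have "j = l" using e'[of j] h by (cases "j = k"; cases "j = l") (auto simp: axis_def split: if_split_asm)
    ultimately show "i = k \<and> j = l" by simp
  qed
  have dpm: "?p ` ?T \<inter> ?m ` ?T = {}"
  proof -
    have "(\<Sum>i\<in>UNIV. a $ i) = 2" if "a \<in> ?p ` ?T" for a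
      using that by (auto simp: sum.distrib axis_def)
    moreover have "(\<Sum>i\<in>UNIV. a $ i) = 0" if "a \<in> ?m ` ?T" for a
      using that by (auto simp: sum_subtractf axis_def)
    ultimately show ?thesis by (metis disjoint_iff zero_neq_numeral)
  qed
  have dSL: "?S \<inter> ?L = {}" 
  proof -
    have "norm a = 1" if "a \<in> ?S" for a using that by auto
    moreover have "norm a = 2" if "a \<in> ?L" for a using that by auto
    ultimately show ?thesis by (metis disjoint_iff one_eq_numeral_iff semiring_norm(85))
  qed
  have d: "(?S \<union> ?L) \<inter> (?p ` ?T \<union> ?m ` ?T) = {}"
  proof -
    have "norm a = 1 \<or> norm a = 2" if "a \<in> ?S \<union> ?L" for a using that by auto
    moreover have "norm a = sqrt 2" if "a \<in> ?p ` ?T \<union> ?m ` ?T" for a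
      using that n2 by blast
    ultimately show ?thesis using s2 by (metis disjoint_iff)
  qed
  have B: "BC_pos = (?S \<union> ?L) \<union> (?p ` ?T \<union> ?m ` ?T)"
    unfolding BC_pos_def by (auto simp: image_iff)
  have "(\<Sum>a\<in>BC_pos. BC_mult k1 k2 k3 a *\<^sub>R a) =
     (\<Sum>i\<in>UNIV. k1 *\<^sub>R axis i 1) + (\<Sum>i\<in>UNIV. k2 *\<^sub>R (2 *\<^sub>R axis i 1))
     + ((\<Sum>z\<in>?T. k3 *\<^sub>R ?p z) + (\<Sum>z\<in>?T. k3 *\<^sub>R ?m z))"
    unfolding B
    by (subst sum.union_disjoint[OF _ _ d], simp, simp, subst sum.union_disjoint[OF _ _ dSL], simp, simp,
        subst sum.union_disjoint[OF _ _ dpm], simp, simp,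
        simp only: sum.reindex[OF iS] sum.reindex[OF iL] sum.reindex[OF ip] sum.reindex[OF im] o_def mS mL mp cong: sum.cong)
  also have "(\<Sum>z\<in>?T. k3 *\<^sub>R ?p z) + (\<Sum>z\<in>?T. k3 *\<^sub>R ?m z) = (\<Sum>z\<in>?T. (2 * k3) *\<^sub>R axis (fst z) 1)"
    unfolding sum.distrib[symmetric] by (rule sum.cong) (auto simp: algebra_simps scaleR_2[symmetric])
  also have "?T = Sigma UNIV (\<lambda>i. {j. i < j})" by auto
  also have "(\<Sum>z\<in>\<dots>. (2 * k3) *\<^sub>R axis (fst z) 1) = (\<Sum>i\<in>UNIV. (2 * k3 * real (card {j. i < j})) *\<^sub>R (axis i 1 :: (real, 'n) vec))"
    by (subst sum.Sigma[symmetric, where g = "\<lambda>i j. (2 * k3) *\<^sub>R axis i 1", simplified case_prod_unfold]) (simp_all only: finite_class.finite_code ball_UNIV simp_thms sum_constant_scaleR scaleR_scaleR mult.commute mult.left_commute finite)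
  finally show ?thesis
    unfolding rho_def rho_BC_def by (simp add: sum.distrib[symmetric] algebra_simps)
qed

end

theory Submission
  imports Defs "HOL-Complex_Analysis.Cauchy_Integral_Formula"
begin

text \<open>
  The Cherednik kernel is defined as a unique solution, so the proof has to supply existence and uniqueness
  of the kernels of types A and BC, estimates that are uniform in the multiplicity, and the limit itself.

  \<^bold>\<open>The Euler equation.\<close> In the direction \<open>\<xi> = x\<close> the eigenvalue equation for the kernel \<open>f\<close> becomes
  \<open>\<partial>\<^sub>x f(x) = \<langle>\<lambda> + \<rho>(k), x\<rangle> f(x) - \<Sum> k\<^sub>a \<psi>(\<langle>a, x\<rangle>) (f(x) - f(s\<^sub>a x))\<close> with \<open>\<psi>(u) = u / (1 - e\<^sup>-\<^sup>u) > 0\<close> (\<open>kernel_euler\<close>).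
  Where \<open>|f|\<close> is maximal on a sphere about the origin, the reflection terms have a favourable sign.
  The resulting maximum principle (\<open>euler_bound\<close>) bounds solutions, also of the equation with a source term,
  by constants that do not depend on \<open>k\<close>. It yields uniqueness (\<open>cherednik_kernel_unique\<close>) and a Lipschitz
  estimate in the spectral parameter that is uniform in \<open>k\<close> (\<open>kernel_lipschitz\<close>).

  \<^bold>\<open>Existence.\<close> The Euler equation is solved by successive approximation in holomorphic functions on a tube
  around a real ball (\<open>euler_solution\<close>). The failures \<open>g\<^sub>j = (D\<^sub>j - \<lambda>\<^sub>j) f\<close> of the remaining eigenvalue equations
  satisfy \<open>\<Sum> x\<^sub>j g\<^sub>j = 0\<close> and, since Cherednik operators commute, \<open>(D\<^sub>i - \<lambda>\<^sub>i) g\<^sub>j = (D\<^sub>j - \<lambda>\<^sub>j) g\<^sub>i\<close>. Contracting with \<open>x\<close> gives an Euler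
  equation for the vector \<open>(g\<^sub>j)\<close>, which vanishes by the maximum principle (\<open>defect_zero\<close>). Commutativity is
  reduced to subsystems of rank two, where it is an identity for the function \<open>1 / (1 - e\<^sup>-\<^sup>t)\<close>
  (\<open>commuting_A\<close>, \<open>commuting_BC\<close>). Holomorphic functions on the tube have power series, so the
  solution is real analytic (\<open>cherednik_kernel_exists\<close>).

  \<^bold>\<open>The limit.\<close> Let \<open>g(x)\<close> be the claimed limit. It is even in each variable, so the short and long roots do not
  act on it, and the Euler equation of type A makes the remaining terms a combination of functions \<open>u\<^sub>i\<close>
  that are odd in \<open>x\<^sub>i\<close>. Subtracting \<open>(1 / k\<^sub>1) \<Sum> u\<^sub>i\<close> compensates them through the short roots; the result
  solves the Euler equation of type BC up to an error of order \<open>(1 + k\<^sub>2) / k\<^sub>1\<close>, which tends to \<open>0\<close>, and the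
  maximum principle turns this into convergence (\<open>convergence_rate\<close>). The uniform Lipschitz estimate makes
  the convergence locally uniform in \<open>\<lambda>\<close>. The product formula for the limit holds because the Cherednik
  operator of type A in the direction \<open>(1, \<dots>, 1)\<close> is the derivative (\<open>G_A_translate\<close>).
\<close>

section \<open>Parameter integrals of holomorphic functions\<close>

lemma contour_integral_linepath_eq:
  "contour_integral (linepath a b) f = integral {0..1} (\<lambda>s. f (linepath a b s) * (b - a))"
  by (simp add: contour_integral_integral)

text \<open>Morera's theorem: by Fubini the integral over a triangle may be taken inside the parameter
  integral, where it vanishes by Cauchy's theorem.\<close>

lemma holomorphic_param_integral:
  fixes H :: "real \<Rightarrow> complex \<Rightarrow> complex"
  assumes U: "open U" and cont: "continuous_on ({0..1} \<times> U) (\<lambda>(t, z). H t z)"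
    and hol: "\<And>t. t \<in> {0..1} \<Longrightarrow> H t holomorphic_on U"
  shows "(\<lambda>z. integral {0..1} (\<lambda>t. H t z)) holomorphic_on U"
proof -
  have contU: "continuous_on U (\<lambda>z. integral {0..1} (\<lambda>t. H t z))"
  proof -
    have "continuous_on (U \<times> cbox 0 1) ((\<lambda>(t, z). H t z) \<circ> prod.swap)"
      by (rule continuous_on_compose, intro continuous_intros) (rule continuous_on_subset[OF cont], auto)
    then have "continuous_on (U \<times> cbox 0 1) (\<lambda>(z, t). H t z)"
      by (rule continuous_on_eq) auto
    from integral_continuous_on_param[OF this] show ?thesis by simp
  qed
  have "(\<lambda>z. integral {0..1} (\<lambda>t. H t z)) analytic_on U"
  proof (rule Morera_triangle[OF contU U], intro impI)
    fix a b c assume sub: "convex hull {a, b, c} \<subseteq> U"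
    have swap: "contour_integral (linepath p q) (\<lambda>z. integral {0..1} (\<lambda>t. H t z)) =
        integral {0..1} (\<lambda>t. contour_integral (linepath p q) (H t))"
      "(\<lambda>t. contour_integral (linepath p q) (H t)) integrable_on {0..1}"
      if pq: "closed_segment p q \<subseteq> U" for p q
    proof -
      have inU: "linepath p q s \<in> U" if "s \<in> {0..1}" for s
        using pq that path_image_linepath[of p q] unfolding path_image_def by blast
      have c1: "continuous_on (cbox (0, 0) (1, 1)) (\<lambda>(s, t). H t (linepath p q s) * (q - p))"
      proof -
        have "continuous_on (cbox (0, 0) (1, 1)) ((\<lambda>(t, z). H t z) \<circ> (\<lambda>(s::real, t). (t, linepath p q s)))"
        proof (rule continuous_on_compose)
          show "continuous_on (cbox (0, 0) (1, 1)) (\<lambda>(s::real, t::real). (t, linepath p q s))"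
            unfolding linepath_def case_prod_unfold by (intro continuous_intros)
          show "continuous_on ((\<lambda>(s, t). (t, linepath p q s)) ` cbox (0, 0) (1, 1)) (\<lambda>(t, z). H t z)"
            by (rule continuous_on_subset[OF cont]) (use inU in \<open>auto simp: cbox_Pair_eq\<close>)
        qed
        then have "continuous_on (cbox (0, 0) (1, 1)) (\<lambda>x. ((\<lambda>(t, z). H t z) \<circ> (\<lambda>(s::real, t). (t, linepath p q s))) x * (q - p))"
          by (rule continuous_on_mult_right)
        then show ?thesis by (rule continuous_on_eq) auto
      qed
      have "contour_integral (linepath p q) (\<lambda>z. integral {0..1} (\<lambda>t. H t z)) =
          integral {0..1} (\<lambda>s. integral {0..1} (\<lambda>t. H t (linepath p q s) * (q - p)))"
        by (simp add: contour_integral_linepath_eq)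
      also have "\<dots> = integral {0..1} (\<lambda>t. integral {0..1} (\<lambda>s. H t (linepath p q s) * (q - p)))"
        using integral_swap_continuous[OF c1] by simp
      finally show "contour_integral (linepath p q) (\<lambda>z. integral {0..1} (\<lambda>t. H t z)) =
        integral {0..1} (\<lambda>t. contour_integral (linepath p q) (H t))"
        by (simp add: contour_integral_linepath_eq)
      have "continuous_on (cbox 0 1 \<times> cbox 0 1) (\<lambda>(s, t). H t (linepath p q s) * (q - p))"
        using c1 by (simp add: cbox_Pair_eq)
      then have "continuous_on (cbox 0 1 \<times> cbox 0 1) ((\<lambda>(s, t). H t (linepath p q s) * (q - p)) \<circ> prod.swap)"
        by (intro continuous_on_compose continuous_intros) (simp add: product_swap)
      then have "continuous_on (cbox 0 1 \<times> cbox 0 1) (\<lambda>(t, s). H t (linepath p q s) * (q - p))"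
        by (rule continuous_on_eq) auto
      from integral_continuous_on_param[OF this]
      have "continuous_on {0..1} (\<lambda>t. contour_integral (linepath p q) (H t))"
        by (simp add: contour_integral_linepath_eq)
      then show "(\<lambda>t. contour_integral (linepath p q) (H t)) integrable_on {0..1}"
        using integrable_continuous_interval by blast
    qed
    have seg: "closed_segment a b \<subseteq> U" "closed_segment b c \<subseteq> U" "closed_segment c a \<subseteq> U"
      unfolding segment_convex_hull by (rule order_trans[OF hull_mono sub]; blast)+
    have zero: "contour_integral (linepath a b) (H t) + contour_integral (linepath b c) (H t)
        + contour_integral (linepath c a) (H t) = 0" if t: "t \<in> {0..1}" for t
    proof -
      have "H t holomorphic_on (convex hull {a, b, c})" by (rule holomorphic_on_subset[OF hol[OF t] sub])
      then have "(H t has_contour_integral 0) (linepath a b +++ linepath b c +++ linepath c a)"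
        by (rule Cauchy_theorem_triangle)
      moreover have "H t contour_integrable_on linepath p q" if "closed_segment p q \<subseteq> U" for p q
        by (rule contour_integrable_continuous_linepath)
           (meson holomorphic_on_imp_continuous_on holomorphic_on_subset hol t that)
      then have "H t contour_integrable_on linepath a b" "H t contour_integrable_on linepath b c"
        "H t contour_integrable_on linepath c a"
        using seg by blast+
      moreover have "contour_integral (linepath a b +++ linepath b c +++ linepath c a) (H t) = 0"
        by (rule contour_integral_unique) fact
      ultimately show ?thesis by (simp add: add.assoc)
    qed
    show "contour_integral (linepath a b) (\<lambda>z. integral {0..1} (\<lambda>t. H t z)) +
       contour_integral (linepath b c) (\<lambda>z. integral {0..1} (\<lambda>t. H t z)) +
       contour_integral (linepath c a) (\<lambda>z. integral {0..1} (\<lambda>t. H t z)) = 0"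
    proof -
      have "integral {0..1} (\<lambda>t. contour_integral (linepath a b) (H t) + contour_integral (linepath b c) (H t)
        + contour_integral (linepath c a) (H t)) = integral {0..1} (\<lambda>t::real. 0)"
        by (rule integral_cong) (use zero in auto)
      then show ?thesis
        using swap seg by (simp add: integral_add integrable_add)
    qed
  qed
  then show ?thesis by (rule analytic_imp_holomorphic)
qed

section \<open>Holomorphic functions of several complex variables\<close>

definition cline :: "complex ^ 'n \<Rightarrow> complex ^ 'n \<Rightarrow> complex \<Rightarrow> complex ^ 'n"
  where "cline z v c = (\<chi> i. z $ i + c * v $ i)"

text \<open>Holomorphy in several variables is taken in the sense of Gateaux, with continuity added: every
  property of one complex variable then applies on each complex line, and products, affine substitutions,
  parameter integrals and uniform limits stay in the class. Frechet differentiability and power series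
  are consequences (\<open>gholo_has_derivative\<close>, \<open>gholo_imp_power_series\<close>).\<close>

definition gholo :: "(complex ^ 'n \<Rightarrow> complex) \<Rightarrow> (complex ^ 'n) set \<Rightarrow> bool"
  where "gholo F S \<longleftrightarrow> continuous_on S F \<and>
    (\<forall>z v. (\<lambda>c. F (cline z v c)) holomorphic_on {c. cline z v c \<in> S})"

lemma cline_nth [simp]: "cline z v c $ i = z $ i + c * v $ i"
  by (simp add: cline_def)

lemma cline_0 [simp]: "cline z v 0 = z" by (simp add: vec_eq_iff)

lemma continuous_on_cline [continuous_intros]:
  assumes "continuous_on T f" "continuous_on T g" "continuous_on T h"
  shows "continuous_on T (\<lambda>t. cline (f t) (g t) (h t))"
  unfolding cline_def using assms by (intro continuous_intros)

lemma open_cline_preimage: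
  assumes "open S" shows "open {c. cline z v c \<in> S}"
proof -
  have "continuous_on UNIV (\<lambda>c. cline z v c)" by (intro continuous_intros)
  then show ?thesis using open_vimage[OF assms] by (simp add: vimage_def)
qed

lemma gholo_continuous: "gholo F S \<Longrightarrow> continuous_on S F" by (simp add: gholo_def)

lemma gholo_slice: "gholo F S \<Longrightarrow> (\<And>c. c \<in> D \<Longrightarrow> cline z v c \<in> S) \<Longrightarrow> (\<lambda>c. F (cline z v c)) holomorphic_on D"
  unfolding gholo_def by (rule holomorphic_on_subset[of _ "{c. cline z v c \<in> S}"]) auto

lemma gholo_subset:
  assumes "gholo F S" "T \<subseteq> S" shows "gholo F T"
  unfolding gholo_def
proof (intro conjI allI)
  show "continuous_on T F" using assms gholo_continuous continuous_on_subset by blast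
  show "(\<lambda>c. F (cline z v c)) holomorphic_on {c. cline z v c \<in> T}" for z v
    by (rule gholo_slice[OF assms(1)]) (use assms(2) in auto)
qed

lemma gholo_cong: "(\<And>z. z \<in> S \<Longrightarrow> F z = G z) \<Longrightarrow> gholo F S \<longleftrightarrow> gholo G S"
  unfolding gholo_def by (intro conj_cong continuous_on_cong all_cong1 holomorphic_cong) auto

lemma gholo_const [simp]: "gholo (\<lambda>_. c) S" by (simp add: gholo_def)

lemma gholo_nth: "gholo (\<lambda>z. z $ i) S" by (auto simp: gholo_def intro!: continuous_intros holomorphic_intros)

lemma gholo_add: "gholo F S \<Longrightarrow> gholo G S \<Longrightarrow> gholo (\<lambda>z. F z + G z) S"
  by (auto simp: gholo_def intro!: continuous_intros holomorphic_intros)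

lemma gholo_diff: "gholo F S \<Longrightarrow> gholo G S \<Longrightarrow> gholo (\<lambda>z. F z - G z) S"
  by (auto simp: gholo_def intro!: continuous_intros holomorphic_intros)

lemma gholo_mult: "gholo F S \<Longrightarrow> gholo G S \<Longrightarrow> gholo (\<lambda>z. F z * G z) S"
  by (auto simp: gholo_def intro!: continuous_intros holomorphic_intros)

lemma gholo_sum: "(\<And>i. i \<in> I \<Longrightarrow> gholo (F i) S) \<Longrightarrow> gholo (\<lambda>z. \<Sum>i\<in>I. F i z) S"
  by (auto simp: gholo_def intro!: continuous_intros holomorphic_intros)

lemmas gholo_intros = gholo_const gholo_nth gholo_add gholo_diff gholo_mult gholo_sum

lemma gholo_compose_holomorphic:
  assumes "gholo F S" "\<phi> holomorphic_on U" "\<And>z. z \<in> S \<Longrightarrow> F z \<in> U"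
  shows "gholo (\<lambda>z. \<phi> (F z)) S"
  unfolding gholo_def
proof (intro conjI allI)
  show "continuous_on S (\<lambda>z. \<phi> (F z))"
    using assms by (auto intro!: continuous_on_compose2[OF holomorphic_on_imp_continuous_on[OF assms(2)]] dest: gholo_continuous)
  fix z v
  have "(\<phi> \<circ> (\<lambda>c. F (cline z v c))) holomorphic_on {c. cline z v c \<in> S}"
    by (rule holomorphic_on_compose_gen[OF _ assms(2)]) (use assms in \<open>auto simp: gholo_def\<close>)
  then show "(\<lambda>c. \<phi> (F (cline z v c))) holomorphic_on {c. cline z v c \<in> S}" by (simp add: o_def)
qed

lemma gholo_compose_affine:
  assumes F: "gholo F T" and L: "continuous_on S L" "\<And>z. z \<in> S \<Longrightarrow> L z \<in> T"
    and aff: "\<And>z v c. L (cline z v c) = cline (L z) (M v) c"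
  shows "gholo (\<lambda>z. F (L z)) S"
  unfolding gholo_def
proof (intro conjI allI)
  show "continuous_on S (\<lambda>z. F (L z))"
    using gholo_continuous[OF F] L by (auto intro: continuous_on_compose2)
  fix z v
  show "(\<lambda>c. F (L (cline z v c))) holomorphic_on {c. cline z v c \<in> S}"
    unfolding aff by (rule gholo_slice[OF F]) (use L(2) aff in force)
qed

lemma gholo_param_integral:
  assumes S: "open S" and cont: "continuous_on ({0..1} \<times> S) (\<lambda>(t, z). H t z)"
    and hol: "\<And>t. t \<in> {0..1} \<Longrightarrow> gholo (H t) S"
  shows "gholo (\<lambda>z. integral {0..1::real} (\<lambda>t. H t z)) S"
  unfolding gholo_def
proof (intro conjI allI)
  have "continuous_on (S \<times> cbox 0 1) ((\<lambda>(t, z). H t z) \<circ> prod.swap)"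
    by (rule continuous_on_compose, intro continuous_intros) (rule continuous_on_subset[OF cont], auto)
  then have "continuous_on (S \<times> cbox 0 1) (\<lambda>(z, t). H t z)"
    by (rule continuous_on_eq) auto
  from integral_continuous_on_param[OF this]
  show "continuous_on S (\<lambda>z. integral {0..1::real} (\<lambda>t. H t z))" by simp
  fix z v
  let ?U = "{c. cline z v c \<in> S}"
  show "(\<lambda>c. integral {0..1} (\<lambda>t. H t (cline z v c))) holomorphic_on ?U"
  proof (rule holomorphic_param_integral)
    show "open ?U" by (rule open_cline_preimage[OF S])
    have "continuous_on ({0..1} \<times> ?U) ((\<lambda>(t, z). H t z) \<circ> (\<lambda>(t, c). (t, cline z v c)))"
      by (rule continuous_on_compose, unfold case_prod_unfold, intro continuous_intros)
         (rule continuous_on_subset[OF cont[unfolded case_prod_unfold]], auto)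
    then show "continuous_on ({0..1} \<times> ?U) (\<lambda>(t, c). H t (cline z v c))"
      by (rule continuous_on_eq) auto
  qed (use hol in \<open>auto simp: gholo_def\<close>)
qed

lemma gholo_local:
  assumes "\<And>z. z \<in> S \<Longrightarrow> \<exists>T. open T \<and> z \<in> T \<and> gholo F T"
  shows "gholo F S"
  unfolding gholo_def
proof (intro conjI allI)
  show "continuous_on S F"
    unfolding continuous_on_eq_continuous_within
  proof
    fix z assume "z \<in> S"
    then obtain T where T: "open T" "z \<in> T" "gholo F T" using assms by blast
    then have "continuous (at z) F" using gholo_continuous continuous_on_eq_continuous_at by blast
    then show "continuous (at z within S) F" using continuous_at_imp_continuous_at_within by blast
  qed
  fix z v
  show "(\<lambda>c. F (cline z v c)) holomorphic_on {c. cline z v c \<in> S}"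
    unfolding holomorphic_on_def
  proof
    fix c assume "c \<in> {c. cline z v c \<in> S}"
    then obtain T where T: "open T" "cline z v c \<in> T" "gholo F T" using assms by blast
    have "(\<lambda>c. F (cline z v c)) holomorphic_on {c. cline z v c \<in> T}" using T by (simp add: gholo_def)
    then have "(\<lambda>c. F (cline z v c)) field_differentiable at c"
      using T open_cline_preimage[OF T(1)] by (intro holomorphic_on_imp_differentiable_at) auto
    then show "(\<lambda>c. F (cline z v c)) field_differentiable at c within {c. cline z v c \<in> S}"
      by (rule field_differentiable_at_within)
  qed
qed

lemma gholo_uniform_limit:
  assumes S: "open S" and hol: "\<And>n::nat. gholo (F n) S" and lim: "uniform_limit S F G sequentially"
  shows "gholo G S"
  unfolding gholo_def
proof (intro conjI allI)
  show "continuous_on S G"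
    by (rule uniform_limit_theorem[OF always_eventually lim]) (simp_all add: gholo_continuous[OF hol])
  fix z v
  let ?U = "{c. cline z v c \<in> S}"
  show "(\<lambda>c. G (cline z v c)) holomorphic_on ?U"
    unfolding holomorphic_on_def
  proof
    fix c assume c: "c \<in> ?U"
    obtain r where r: "r > 0" "cball c r \<subseteq> ?U"
      using open_cline_preimage[OF S] c open_contains_cball by blast
    have ul: "uniform_limit (cball c r) (\<lambda>n c. F n (cline z v c)) (\<lambda>c. G (cline z v c)) sequentially"
      unfolding uniform_limit_iff
    proof (intro allI impI)
      fix e :: real assume "e > 0"
      then have "\<forall>\<^sub>F n in sequentially. \<forall>w\<in>S. dist (F n w) (G w) < e" using lim by (simp add: uniform_limit_iff)
      then show "\<forall>\<^sub>F n in sequentially. \<forall>w\<in>cball c r. dist (F n (cline z v w)) (G (cline z v w)) < e"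
        by eventually_elim (use r in auto)
    qed
    have "(\<lambda>c. G (cline z v c)) holomorphic_on ball c r"
    proof (rule holomorphic_uniform_limit[OF _ ul])
      have h: "(\<lambda>c. F n (cline z v c)) holomorphic_on cball c r" for n
        by (rule gholo_slice[OF hol]) (use r in auto)
      show "\<forall>\<^sub>F n in sequentially. continuous_on (cball c r) (\<lambda>c. F n (cline z v c)) \<and> (\<lambda>c. F n (cline z v c)) holomorphic_on ball c r"
        by (intro always_eventually allI conjI holomorphic_on_imp_continuous_on[OF h] holomorphic_on_subset[OF h]) auto
    qed auto
    then have "(\<lambda>c. G (cline z v c)) field_differentiable at c"
      using r by (intro holomorphic_on_imp_differentiable_at) auto
    then show "(\<lambda>c. G (cline z v c)) field_differentiable at c within ?U"
      by (rule field_differentiable_at_within)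
  qed
qed

section \<open>Directional derivatives\<close>

definition cis1 :: "real \<Rightarrow> complex" where "cis1 t = exp (2 * of_real pi * \<i> * of_real t)"

lemma norm_cis1 [simp]: "norm (cis1 t) = 1" by (simp add: cis1_def)
lemma cis1_nz [simp]: "cis1 t \<noteq> 0" by (simp add: cis1_def)
lemma continuous_on_cis1 [continuous_intros]: "continuous_on T f \<Longrightarrow> continuous_on T (\<lambda>t. cis1 (f t))"
  unfolding cis1_def by (intro continuous_intros)

text \<open>The Cauchy formula for Taylor coefficients, as an average over the circle. In this form directional
  derivatives and power series coefficients are parameter integrals, to which
  \<open>gholo_param_integral\<close> applies.\<close>

lemma Cauchy_mean:
  assumes hol: "f holomorphic_on cball 0 r" and r: "r > 0"
  shows "(deriv ^^ k) f 0 / fact k = integral {0..1} (\<lambda>t. f (of_real r * cis1 t) / (of_real r * cis1 t) ^ k)"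
proof -
  have "(deriv ^^ k) f 0 = fact k / (2 * of_real pi * \<i>) * contour_integral (circlepath 0 r) (\<lambda>u. f u / (u - 0) ^ Suc k)"
    using Cauchy_higher_derivative_integral_circlepath(2)[OF holomorphic_on_imp_continuous_on[OF hol]
        holomorphic_on_subset[OF hol ball_subset_cball], of 0 k] r by simp
  also have "contour_integral (circlepath 0 r) (\<lambda>u. f u / (u - 0) ^ Suc k) =
      integral {0..1} (\<lambda>t. (2 * of_real pi * \<i>) * (f (of_real r * cis1 t) / (of_real r * cis1 t) ^ k))"
    unfolding contour_integral_integral
  proof (rule integral_cong)
    fix t :: real assume "t \<in> {0..1}"
    have c: "circlepath 0 r t = of_real r * cis1 t" by (simp add: circlepath cis1_def)
    have d: "vector_derivative (circlepath 0 r) (at t) = 2 * of_real pi * \<i> * (of_real r * cis1 t)"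
      by (simp add: vector_derivative_circlepath cis1_def)
    show "f (circlepath 0 r t) / (circlepath 0 r t - 0) ^ Suc k * vector_derivative (circlepath 0 r) (at t) =
         2 * of_real pi * \<i> * (f (of_real r * cis1 t) / (of_real r * cis1 t) ^ k)"
      unfolding c d using r by (simp add: field_simps)
  qed
  also have "\<dots> = 2 * of_real pi * \<i> * integral {0..1} (\<lambda>t. f (of_real r * cis1 t) / (of_real r * cis1 t) ^ k)"
    by (rule integral_mult_right)
  finally show ?thesis by (simp add: field_simps)
qed

text \<open>Cauchy's inequalities bound the terms of the Taylor series from the second on by a geometric series
  of ratio \<open>1 / 2\<close>.\<close>

lemma Cauchy_remainder:
  assumes hol: "f holomorphic_on cball 0 r" and r: "r > 0" and c: "norm c \<le> r / 2"
    and B: "\<And>c. norm c \<le> r \<Longrightarrow> norm (f c) \<le> B"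
  shows "norm (f c - f 0 - c * deriv f 0) \<le> 2 * B * (norm c)\<^sup>2 / r\<^sup>2"
proof -
  let ?a = "\<lambda>n. (deriv ^^ n) f 0 / fact n * c ^ n"
  have B0: "B \<ge> 0" using B[of 0] r norm_ge_zero[of "f 0"] by (simp, linarith)
  have "(\<lambda>n. (deriv ^^ n) f 0 / fact n * (c - 0) ^ n) sums f c"
    by (rule holomorphic_power_series[of _ _ r]) (use hol r c in \<open>auto intro: holomorphic_on_subset\<close>)
  then have s: "?a sums f c" by simp
  have bound: "norm (?a (n + 2)) \<le> B * (norm c / r)\<^sup>2 * (1 / 2) ^ n" for n
  proof -
    have "norm ((deriv ^^ (n+2)) f 0) \<le> fact (n+2) * B / r ^ (n+2)"
      by (rule Cauchy_inequality)
         (use hol r B in \<open>auto intro: holomorphic_on_subset holomorphic_on_imp_continuous_on\<close>)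
    then have "norm ((deriv ^^ (n+2)) f 0) / fact (n+2) \<le> fact (n+2) * B / r ^ (n+2) / fact (n+2)"
      by (rule divide_right_mono) (rule fact_ge_zero)
    also have "\<dots> = B / r ^ (n+2)" using fact_nonzero[of "n+2", where 'a = real] by (simp del: fact_Suc)
    finally have "norm ((deriv ^^ (n+2)) f 0) / fact (n+2) * norm c ^ (n+2) \<le> B / r ^ (n+2) * norm c ^ (n+2)"
      by (rule mult_right_mono) simp
    then have "norm (?a (n+2)) \<le> B / r ^ (n+2) * norm c ^ (n+2)"
      unfolding norm_mult norm_divide norm_power norm_fact .
    also have "\<dots> = B * (norm c / r)\<^sup>2 * (norm c / r) ^ n"
      using r by (simp add: power_divide power_add power2_eq_square)
    also have "\<dots> \<le> B * (norm c / r)\<^sup>2 * (1 / 2) ^ n"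
      using B0 r c by (intro mult_left_mono power_mono) (auto simp: field_simps)
    finally show ?thesis .
  qed
  have geo: "(\<lambda>n. B * (norm c / r)\<^sup>2 * (1 / 2) ^ n) sums (B * (norm c / r)\<^sup>2 * 2)"
    using sums_mult[OF geometric_sums[of "1/2::real"], of "B * (norm c / r)\<^sup>2"] by simp
  have "(\<lambda>n. ?a (n + 2)) sums (f c - (\<Sum>n<2. ?a n))"
    using sums_iff_shift[of ?a 2] s by simp
  moreover have "(\<Sum>n<2. ?a n) = f 0 + c * deriv f 0" by (simp add: numeral_2_eq_2)
  ultimately have s2: "(\<lambda>n. ?a (n + 2)) sums (f c - f 0 - c * deriv f 0)" by (simp add: algebra_simps)
  have "norm (suminf (\<lambda>n. ?a (n + 2))) \<le> suminf (\<lambda>n. B * (norm c / r)\<^sup>2 * (1 / 2) ^ n)"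
    by (rule norm_suminf_le[OF bound]) (use geo in \<open>auto simp: sums_iff\<close>)
  then have "norm (f c - f 0 - c * deriv f 0) \<le> B * (norm c / r)\<^sup>2 * 2"
    unfolding sums_unique[OF s2, symmetric] sums_unique[OF geo, symmetric] .
  then show ?thesis by (simp add: power_divide mult_ac)
qed

lemma norm_cline_diff: "norm (cline z v c - z) = norm c * norm v"
  by (simp add: norm_vec_def norm_mult L2_set_right_distrib)

definition dderiv :: "(complex ^ 'n \<Rightarrow> complex) \<Rightarrow> complex ^ 'n \<Rightarrow> complex ^ 'n \<Rightarrow> complex"
  where "dderiv F v z = deriv (\<lambda>c. F (cline z v c)) 0"

lemma small_line:
  fixes v :: "complex ^ 'n"
  assumes "\<epsilon> > 0"
  obtains r where "r > 0" "r * norm v < \<epsilon>"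
proof
  show "\<epsilon> / (norm v + 1) > 0" using assms by (simp add: add_nonneg_pos)
  have "\<epsilon> / (norm v + 1) * norm v = \<epsilon> * (norm v / (norm v + 1))" by simp
  also have "\<dots> < \<epsilon>" using assms by (simp add: divide_less_eq add_nonneg_pos)
  finally show "\<epsilon> / (norm v + 1) * norm v < \<epsilon>" .
qed

lemma dderiv_integral:
  assumes F: "gholo F S" and r: "r > 0" and sub: "\<And>c. norm c \<le> r \<Longrightarrow> cline z v c \<in> S"
  shows "dderiv F v z = integral {0..1} (\<lambda>t. F (cline z v (of_real r * cis1 t)) / (of_real r * cis1 t))"
proof -
  have "(\<lambda>c. F (cline z v c)) holomorphic_on cball 0 r"
    by (rule gholo_slice[OF F]) (use sub in auto)
  from Cauchy_mean[OF this r, of 1] show ?thesis by (simp add: dderiv_def)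
qed

lemma cline_in_ball:
  fixes z0 :: "complex ^ 'n"
  assumes "dist z0 z < e1" "norm c * norm v \<le> e2"
  shows "dist z0 (cline z v c) < e1 + e2"
proof -
  have "dist z0 (cline z v c) \<le> dist z0 z + dist z (cline z v c)" by (rule dist_triangle)
  also have "dist z (cline z v c) \<le> e2" using assms(2) by (simp add: dist_norm norm_minus_commute[of z] norm_cline_diff)
  finally show ?thesis using assms(1) by linarith
qed

text \<open>Near a given point the directional derivative is an average of values of \<open>F\<close> on a circle of fixed
  radius, and such averages depend holomorphically on the centre.\<close>

lemma gholo_dderiv:
  assumes S: "open S" and F: "gholo F S"
  shows "gholo (dderiv F v) S"
proof (rule gholo_local)
  fix z0 assume "z0 \<in> S"
  then obtain \<epsilon> where e: "\<epsilon> > 0" "ball z0 \<epsilon> \<subseteq> S" using S openE by blast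
  obtain r where r: "r > 0" "r * norm v < \<epsilon> / 2" using small_line[of "\<epsilon>/2" v] e by auto
  have inS: "cline z v c \<in> S" if "z \<in> ball z0 (\<epsilon>/2)" "norm c \<le> r" for z c
  proof -
    have "norm c * norm v \<le> r * norm v" using that by (simp add: mult_right_mono)
    then have "dist z0 (cline z v c) < \<epsilon>/2 + \<epsilon>/2" using that r by (intro cline_in_ball) auto
    then show ?thesis using e by auto
  qed
  have "gholo (\<lambda>z. integral {0..1} (\<lambda>t. F (cline z v (of_real r * cis1 t)) / (of_real r * cis1 t))) (ball z0 (\<epsilon>/2))"
  proof (rule gholo_param_integral)
    show "continuous_on ({0..1} \<times> ball z0 (\<epsilon>/2)) (\<lambda>(t, z). F (cline z v (of_real r * cis1 t)) / (of_real r * cis1 t))"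
      unfolding case_prod_unfold
      by (intro continuous_intros continuous_on_compose2[OF gholo_continuous[OF F]])
         (use inS r in \<open>auto simp: norm_mult\<close>)
    fix t :: real assume "t \<in> {0..1}"
    have "gholo (\<lambda>z. F (cline z v (of_real r * cis1 t))) (ball z0 (\<epsilon>/2))"
    proof (rule gholo_compose_affine[OF F, where M = "\<lambda>v. v"])
      show "cline (cline z w c) v (complex_of_real r * cis1 t) = cline (cline z v (complex_of_real r * cis1 t)) w c" for z w c
        by (simp add: vec_eq_iff)
    qed (use inS r in \<open>auto simp: norm_mult intro!: continuous_intros\<close>)
    from gholo_mult[OF this gholo_const[of "1 / (complex_of_real r * cis1 t)"]]
    show "gholo (\<lambda>z. F (cline z v (of_real r * cis1 t)) / (of_real r * cis1 t)) (ball z0 (\<epsilon>/2))" by simp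
  qed simp
  then have "gholo (dderiv F v) (ball z0 (\<epsilon>/2))"
    by (subst gholo_cong[OF dderiv_integral[OF F r(1)]]) (use inS in auto)
  then show "\<exists>T. open T \<and> z0 \<in> T \<and> gholo (dderiv F v) T" using e by (intro exI[of _ "ball z0 (\<epsilon>/2)"]) auto
qed

text \<open>Both sides are the same double Cauchy integral, with the order of integration exchanged.\<close>

lemma dderiv_commute:
  assumes S: "open S" and F: "gholo F S" and z: "z \<in> S"
  shows "dderiv (dderiv F u) v z = dderiv (dderiv F v) u z"
proof -
  obtain \<epsilon> where e: "\<epsilon> > 0" "ball z \<epsilon> \<subseteq> S" using S z openE by blast
  obtain r1 where r1: "r1 > 0" "r1 * norm u < \<epsilon> / 2" using small_line[of "\<epsilon>/2" u] e by auto
  obtain r2 where r2: "r2 > 0" "r2 * norm v < \<epsilon> / 2" using small_line[of "\<epsilon>/2" v] e by auto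
  define r where "r = min r1 r2"
  have r: "r > 0" "r * norm u < \<epsilon>/2" "r * norm v < \<epsilon>/2"
    using r1 r2 mult_right_mono[OF min.cobounded1 norm_ge_zero, of r1 r2 u] mult_right_mono[OF min.cobounded2 norm_ge_zero, of r1 r2 v]
    by (auto simp: r_def intro: le_less_trans)
  have b: "cline w x c \<in> S" if "dist z w < \<epsilon>/2" "norm c \<le> r" "x = u \<or> x = v" for w x c
  proof -
    have "norm c * norm x \<le> r * norm x" using that by (simp add: mult_right_mono)
    then have "dist z (cline w x c) < \<epsilon>/2 + \<epsilon>/2" using that r by (intro cline_in_ball) auto
    then show ?thesis using e by auto
  qed
  have d: "dist z (cline z x c) < \<epsilon>/2" if "norm c \<le> r" "x = u \<or> x = v" for x c
  proof -
    have "dist z (cline z x c) = norm c * norm x" by (simp add: dist_norm norm_minus_commute[of z] norm_cline_diff)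
    also have "\<dots> \<le> r * norm x" using that by (simp add: mult_right_mono)
    finally show ?thesis using that r by auto
  qed
  let ?e = "\<lambda>t. complex_of_real r * cis1 t"
  have ne: "norm (?e t) \<le> r" for t using r by (simp add: norm_mult)
  have eq: "dderiv (dderiv F x) y z = integral {0..1} (\<lambda>s. integral {0..1} (\<lambda>t. F (cline (cline z y (?e s)) x (?e t)) / ?e t / ?e s))"
    if xy: "x = u \<or> x = v" "y = u \<or> y = v" for x y
  proof -
    have "dderiv (dderiv F x) y z = integral {0..1} (\<lambda>s. dderiv F x (cline z y (?e s)) / ?e s)"
      by (rule dderiv_integral[OF gholo_dderiv[OF S F] r(1)]) (use b xy e(1) in auto)
    also have "\<dots> = integral {0..1} (\<lambda>s. integral {0..1} (\<lambda>t. F (cline (cline z y (?e s)) x (?e t)) / ?e t / ?e s))"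
    proof (rule integral_cong)
      fix s :: real
      have "dderiv F x (cline z y (?e s)) = integral {0..1} (\<lambda>t. F (cline (cline z y (?e s)) x (?e t)) / ?e t)"
        by (rule dderiv_integral[OF F r(1)]) (use b d ne xy in auto)
      then show "dderiv F x (cline z y (?e s)) / ?e s = integral {0..1} (\<lambda>t. F (cline (cline z y (?e s)) x (?e t)) / ?e t / ?e s)"
        by (simp only: integral_divide)
    qed
    finally show ?thesis .
  qed
  have "continuous_on (cbox (0,0) (1,1)) (\<lambda>(s, t). F (cline (cline z v (?e s)) u (?e t)) / ?e t / ?e s)"
    unfolding case_prod_unfold
    by (intro continuous_intros continuous_on_compose2[OF gholo_continuous[OF F]])
       (use b d ne r in auto)
  from integral_swap_continuous[OF this]
  have "dderiv (dderiv F u) v z = integral {0..1} (\<lambda>t. integral {0..1} (\<lambda>s. F (cline (cline z v (?e s)) u (?e t)) / ?e t / ?e s))"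
    by (simp add: eq)
  also have "\<dots> = integral {0..1} (\<lambda>t. integral {0..1} (\<lambda>s. F (cline (cline z u (?e t)) v (?e s)) / ?e s / ?e t))"
  proof -
    have "F (cline (cline z v (?e s)) u (?e t)) / ?e t / ?e s = F (cline (cline z u (?e t)) v (?e s)) / ?e s / ?e t" for s t
    proof -
      have "cline (cline z v (?e s)) u (?e t) = cline (cline z u (?e t)) v (?e s)"
        by (simp add: vec_eq_iff)
      then show ?thesis by (simp add: field_simps)
    qed
    then show ?thesis by simp
  qed
  also have "\<dots> = dderiv (dderiv F v) u z" by (simp add: eq)
  finally show ?thesis .
qed

lemma slice_differentiable:
  assumes S: "open S" and F: "gholo F S" and z: "z \<in> S"
  shows "(\<lambda>c. F (cline z v c)) field_differentiable at 0"
  by (rule holomorphic_on_imp_differentiable_at[OF _ open_cline_preimage[OF S]])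
     (use F z in \<open>auto simp: gholo_def\<close>)

lemma dderiv_scale:
  assumes S: "open S" and F: "gholo F S" and z: "z \<in> S"
  shows "dderiv F (\<chi> i. a * v $ i) z = a * dderiv F v z"
proof -
  have "((\<lambda>c. F (cline z v c)) has_field_derivative dderiv F v z) (at (a * 0))"
    using slice_differentiable[OF assms] by (simp add: dderiv_def field_differentiable_derivI)
  moreover have "((\<lambda>c. a * c) has_field_derivative a) (at 0)" by (auto intro!: derivative_eq_intros)
  ultimately have "((\<lambda>c. F (cline z v (a * c))) has_field_derivative dderiv F v z * a) (at 0)"
    by (rule DERIV_chain2)
  moreover have "cline z v (a * c) = cline z (\<chi> i. a * v $ i) c" for c by (simp add: vec_eq_iff)
  ultimately show ?thesis by (simp add: dderiv_def DERIV_imp_deriv mult.commute)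
qed

lemma gholo_remainder:
  assumes F: "gholo F S" and e: "\<epsilon> > 0" and sub: "cball z0 \<epsilon> \<subseteq> S" and B: "\<And>z. z \<in> cball z0 \<epsilon> \<Longrightarrow> norm (F z) \<le> B"
    and z: "dist z0 z \<le> \<epsilon>/2" and h: "norm h \<le> \<epsilon>/4"
  shows "norm (F (z + h) - F z - dderiv F h z) \<le> 8 * B * (norm h)\<^sup>2 / \<epsilon>\<^sup>2"
proof (cases "h = 0")
  case True
  then have "(\<lambda>c. F (cline z h c)) = (\<lambda>c. F z)" by (auto simp: cline_def vec_lambda_eta)
  then show ?thesis using True by (simp add: dderiv_def)
next
  case False
  define r where "r = \<epsilon> / 2 / norm h"
  have r: "r > 0" "r / 2 \<ge> 1" using e h False by (auto simp: r_def field_simps)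
  have inb: "cline z h c \<in> cball z0 \<epsilon>" if "norm c \<le> r" for c
  proof -
    have "dist z0 (cline z h c) \<le> dist z0 z + norm c * norm h"
      using dist_triangle[of z0 "cline z h c" z] by (simp add: dist_norm[of z "cline _ _ _"] norm_minus_commute[of z] norm_cline_diff)
    also have "norm c * norm h \<le> r * norm h" using that by (simp add: mult_right_mono)
    also have "r * norm h = \<epsilon> / 2" using False by (simp add: r_def)
    finally show ?thesis using z by simp
  qed
  have "norm (F (cline z h 1) - F (cline z h 0) - 1 * deriv (\<lambda>c. F (cline z h c)) 0) \<le> 2 * B * (norm (1::complex))\<^sup>2 / r\<^sup>2"
    by (rule Cauchy_remainder[OF _ r(1)]) (use inb B sub r in \<open>auto intro!: gholo_slice[OF F]\<close>)
  moreover have "cline z h 1 = z + h" by (simp add: vec_eq_iff)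
  ultimately show ?thesis using False e by (simp add: dderiv_def r_def power_divide field_simps)
qed

lemma gholo_ball_bound:
  assumes S: "open S" and F: "gholo F S" and z: "z \<in> S"
  obtains \<epsilon> B where "\<epsilon> > 0" "cball z \<epsilon> \<subseteq> S" "B \<ge> 0" "\<forall>w\<in>cball z \<epsilon>. norm (F w) \<le> B"
proof -
  obtain \<epsilon> where e: "\<epsilon> > 0" "cball z \<epsilon> \<subseteq> S" using S z open_contains_cball by blast
  have "compact (F ` cball z \<epsilon>)"
    by (rule compact_continuous_image) (use e gholo_continuous[OF F] continuous_on_subset in auto)
  then obtain B where "B > 0" "\<forall>w\<in>cball z \<epsilon>. norm (F w) \<le> B"
    using compact_imp_bounded bounded_pos by (metis imageI)
  then show ?thesis using that[of \<epsilon> B] e by auto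
qed

text \<open>The increment along \<open>u + v\<close> is the increment along \<open>u\<close> followed by one along \<open>v\<close> from the moved
  point; the second has the directional derivative at the moved point as its main term, by
  \<open>gholo_remainder\<close>, and this derivative is continuous.\<close>

lemma dderiv_add:
  assumes S: "open S" and F: "gholo F S" and z: "z \<in> S"
  shows "dderiv F (u + v) z = dderiv F u z + dderiv F v z"
proof -
  obtain \<epsilon> B where e: "\<epsilon> > 0" "cball z \<epsilon> \<subseteq> S" and B: "B \<ge> 0" "\<forall>w\<in>cball z \<epsilon>. norm (F w) \<le> B"
    using gholo_ball_bound[OF assms] by blast
  have q: "((\<lambda>c. (F (cline z x c) - F z) / c) \<longlongrightarrow> dderiv F x z) (at 0)" for x
    using slice_differentiable[OF assms, of x] unfolding dderiv_def field_differentiable_derivI DERIV_deriv_iff_field_differentiable[symmetric] has_field_derivative_iff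
    by simp
  let ?w = "\<lambda>c. cline z u c"
  have wlim: "(?w \<longlongrightarrow> z) (at 0)"
  proof -
    have "continuous_on UNIV ?w" by (intro continuous_intros)
    then have "isCont ?w 0" by (simp add: continuous_on_eq_continuous_at)
    then show ?thesis by (simp add: isCont_def)
  qed
  have dl: "((\<lambda>c. dderiv F v (?w c)) \<longlongrightarrow> dderiv F v z) (at 0)"
  proof -
    have "isCont (dderiv F v) z"
      using gholo_continuous[OF gholo_dderiv[OF S F]] S z continuous_on_eq_continuous_at by blast
    then show ?thesis using wlim isCont_tendsto_compose by blast
  qed
  have rl: "((\<lambda>c. (F (cline (?w c) v c) - F (?w c)) / c - dderiv F v (?w c)) \<longlongrightarrow> 0) (at 0)"
  proof (rule Lim_null_comparison)
    have "\<forall>\<^sub>F c in at 0. dist (?w c) z < \<epsilon>/2" using tendstoD[OF wlim, of "\<epsilon>/2"] e by simp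
    moreover have "\<forall>\<^sub>F c::complex in at 0. norm c * norm v < \<epsilon>/4"
    proof -
      have "((\<lambda>c::complex. norm c * norm v) \<longlongrightarrow> norm (0::complex) * norm v) (at 0)" by (intro tendsto_intros)
      from order_tendstoD(2)[OF this, of "\<epsilon>/4"] e show ?thesis by simp
    qed
    moreover have "\<forall>\<^sub>F c::complex in at 0. c \<noteq> 0" by (simp add: eventually_at_filter)
    ultimately show "\<forall>\<^sub>F c in at 0. norm ((F (cline (?w c) v c) - F (?w c)) / c - dderiv F v (?w c)) \<le> 8 * B * norm c * (norm v)\<^sup>2 / \<epsilon>\<^sup>2"
    proof eventually_elim
      case (elim c)
      let ?h = "\<chi> i. c * v $ i"
      have nh: "norm ?h = norm c * norm v" using norm_cline_diff[of 0 v c] by (simp add: cline_def)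
      have "norm (F (?w c + ?h) - F (?w c) - dderiv F ?h (?w c)) \<le> 8 * B * (norm ?h)\<^sup>2 / \<epsilon>\<^sup>2"
        by (rule gholo_remainder[OF F e B(2)[rule_format]]) (use elim nh in \<open>auto simp: dist_commute\<close>)
      moreover have "dderiv F ?h (?w c) = c * dderiv F v (?w c)"
        by (rule dderiv_scale[OF S F]) (use elim e in \<open>auto simp: dist_commute subset_iff\<close>)
      moreover have "?w c + ?h = cline (?w c) v c" by (simp add: vec_eq_iff)
      ultimately have 1: "norm (F (cline (?w c) v c) - F (?w c) - c * dderiv F v (?w c)) \<le> 8 * B * (norm c * norm v)\<^sup>2 / \<epsilon>\<^sup>2"
        by (simp add: nh)
      have "norm ((F (cline (?w c) v c) - F (?w c)) / c - dderiv F v (?w c)) =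
         norm (F (cline (?w c) v c) - F (?w c) - c * dderiv F v (?w c)) / norm c"
        using elim(3) unfolding norm_divide[symmetric] by (simp add: field_simps)
      also have "\<dots> \<le> 8 * B * (norm c * norm v)\<^sup>2 / \<epsilon>\<^sup>2 / norm c" using 1 by (rule divide_right_mono) simp
      also have "\<dots> = 8 * B * norm c * (norm v)\<^sup>2 / \<epsilon>\<^sup>2" using elim(3) by (simp add: power2_eq_square field_simps)
      finally show ?case .
    qed
    have "((\<lambda>c::complex. 8 * B * norm c * (norm v)\<^sup>2 / \<epsilon>\<^sup>2) \<longlongrightarrow> 8 * B * norm (0::complex) * (norm v)\<^sup>2 / \<epsilon>\<^sup>2) (at 0)"
      using e by (intro tendsto_intros) auto
    then show "((\<lambda>c::complex. 8 * B * norm c * (norm v)\<^sup>2 / \<epsilon>\<^sup>2) \<longlongrightarrow> 0) (at 0)" by simp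
  qed
  have "((\<lambda>c. ((F (cline (?w c) v c) - F (?w c)) / c - dderiv F v (?w c)) + dderiv F v (?w c) + (F (?w c) - F z) / c)
      \<longlongrightarrow> 0 + dderiv F v z + dderiv F u z) (at 0)"
    by (intro tendsto_add rl dl q)
  moreover have "((F (cline (?w c) v c) - F (?w c)) / c - dderiv F v (?w c)) + dderiv F v (?w c) + (F (?w c) - F z) / c
      = (F (cline z (u + v) c) - F z) / c" for c
  proof -
    have "cline (?w c) v c = cline z (u + v) c" by (simp add: vec_eq_iff algebra_simps)
    then show ?thesis by (simp add: diff_divide_distrib)
  qed
  ultimately have "((\<lambda>c. (F (cline z (u + v) c) - F z) / c) \<longlongrightarrow> dderiv F v z + dderiv F u z) (at 0)" by simp
  from tendsto_unique[OF _ this q] show ?thesis by (simp add: add.commute)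
qed

lemma gholo_has_derivative:
  assumes S: "open S" and F: "gholo F S" and z: "z \<in> S"
  shows "(F has_derivative (\<lambda>h. dderiv F h z)) (at z)"
proof -
  obtain \<epsilon> B where e: "\<epsilon> > 0" "cball z \<epsilon> \<subseteq> S" and B: "B \<ge> 0" "\<forall>w\<in>cball z \<epsilon>. norm (F w) \<le> B"
    using gholo_ball_bound[OF assms] by blast
  have lin: "linear (\<lambda>h. dderiv F h z)"
  proof (rule linearI)
    show "dderiv F (r *\<^sub>R h) z = r *\<^sub>R dderiv F h z" for r h
      using dderiv_scale[OF assms, of "of_real r" h] by (simp add: scaleR_vec_def scaleR_conv_of_real)
  qed (rule dderiv_add[OF assms])
  show ?thesis
    unfolding has_derivative_at
  proof (intro conjI)
    show "bounded_linear (\<lambda>h. dderiv F h z)" using lin by (rule linear_conv_bounded_linear[THEN iffD1])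
    show "(\<lambda>h. norm (F (z + h) - F z - dderiv F h z) / norm h) \<midarrow>0\<rightarrow> 0"
    proof (rule Lim_null_comparison)
      have "\<forall>\<^sub>F h in at 0. norm h < \<epsilon>/4"
        unfolding eventually_at by (rule exI[of _ "\<epsilon>/4"]) (use e in auto)
      moreover have "\<forall>\<^sub>F h::complex^'a in at 0. h \<noteq> 0" by (simp add: eventually_at_filter)
      ultimately show "\<forall>\<^sub>F h in at 0. norm (norm (F (z + h) - F z - dderiv F h z) / norm h) \<le> 8 * B * norm h / \<epsilon>\<^sup>2"
      proof eventually_elim
        case (elim h)
        have "norm (F (z + h) - F z - dderiv F h z) \<le> 8 * B * (norm h)\<^sup>2 / \<epsilon>\<^sup>2"
          by (rule gholo_remainder[OF F e B(2)[rule_format]]) (use elim e in auto)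
        then have "norm (F (z + h) - F z - dderiv F h z) / norm h \<le> 8 * B * (norm h)\<^sup>2 / \<epsilon>\<^sup>2 / norm h"
          by (rule divide_right_mono) simp
        also have "\<dots> = 8 * B * norm h / \<epsilon>\<^sup>2" using elim(2) by (simp add: power2_eq_square)
        finally show ?case by simp
      qed
      have "((\<lambda>h::complex^'a. 8 * B * norm h / \<epsilon>\<^sup>2) \<longlongrightarrow> 8 * B * norm (0::complex^'a) / \<epsilon>\<^sup>2) (at 0)"
        using e by (intro tendsto_intros) auto
      then show "((\<lambda>h::complex^'a. 8 * B * norm h / \<epsilon>\<^sup>2) \<longlongrightarrow> 0) (at 0)" by simp
    qed
  qed
qed

lemma cvec_nth [simp]: "cvec x $ i = of_real (x $ i)" by (simp add: cvec_def)

lemma bounded_linear_cvec: "bounded_linear cvec"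
  by (rule linear_conv_bounded_linear[THEN iffD1], rule linearI) (auto simp: vec_eq_iff complex_eq_iff)

lemma gholo_real_has_derivative:
  assumes S: "open S" and F: "gholo F S" and x: "cvec x \<in> S"
  shows "((\<lambda>x. F (cvec x)) has_derivative (\<lambda>h. dderiv F (cvec h) (cvec x))) (at x)"
  by (rule has_derivative_compose[OF bounded_linear.has_derivative[OF bounded_linear_cvec has_derivative_ident]
      gholo_has_derivative[OF S F x], simplified])

section \<open>Power series and real analyticity\<close>

definition multi_idx :: "'n set \<Rightarrow> ('n \<Rightarrow> nat) set"
  where "multi_idx A = {m. \<forall>i. i \<notin> A \<longrightarrow> m i = 0}"

lemma multi_idx_empty: "multi_idx {} = {\<lambda>_. 0}"
  by (auto simp: multi_idx_def)

lemma multi_idx_UNIV: "multi_idx UNIV = UNIV"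
  by (simp add: multi_idx_def)

lemma multi_idx_insert_bij:
  assumes "i \<notin> A"
  shows "bij_betw (\<lambda>(k, m). m(i := k)) (UNIV \<times> multi_idx A) (multi_idx (insert i A))"
proof (rule bij_betwI[where g = "\<lambda>m. (m i, m(i := 0))"])
  show "(\<lambda>(k, m). m(i := k)) \<in> UNIV \<times> multi_idx A \<rightarrow> multi_idx (insert i A)"
    by (auto simp: multi_idx_def)
  show "(\<lambda>m. (m i, m(i := 0))) \<in> multi_idx (insert i A) \<rightarrow> UNIV \<times> multi_idx A"
    by (auto simp: multi_idx_def)
  show "(\<lambda>m. (m i, m(i := 0))) ((\<lambda>(k, m). m(i := k)) x) = x" if "x \<in> UNIV \<times> multi_idx A" for x
    using that assms by (auto simp: multi_idx_def fun_eq_iff)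
  show "(\<lambda>(k, m). m(i := k)) ((\<lambda>m. (m i, m(i := 0))) y) = y" for y by auto
qed

lemma geometric_summable_on:
  fixes q :: real assumes "0 \<le> q" "q < 1"
  shows "(\<lambda>k. q ^ k) summable_on UNIV"
  by (rule summable_nonneg_imp_summable_on) (use assms in auto)

lemma multi_geometric_summable:
  fixes q :: "'n \<Rightarrow> real"
  assumes "finite A" and q: "\<And>i. 0 \<le> q i" "\<And>i. q i < 1"
  shows "(\<lambda>m. \<Prod>i\<in>A. q i ^ m i) summable_on multi_idx A"
  using assms(1)
proof induction
  case empty
  then show ?case by (simp add: multi_idx_empty)
next
  case (insert i A)
  let ?g = "\<lambda>m. \<Prod>i\<in>A. q i ^ m i"
  have g0: "?g m \<ge> 0" for m by (intro prod_nonneg) (use q in auto)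
  have p: "(\<Prod>j\<in>A. q j ^ (m(i := k)) j) = ?g m" for m k
    by (rule prod.cong) (use insert in auto)
  have inner: "(\<lambda>m. q i ^ k * ?g m) summable_on multi_idx A" for k
    using insert.IH by (rule summable_on_cmult_right)
  have "(\<lambda>x. norm (case x of (k, m) \<Rightarrow> q i ^ k * ?g m)) summable_on (UNIV \<times> multi_idx A)"
    unfolding Infinite_Sum.abs_summable_on_Sigma_iff
  proof (intro conjI ballI)
    fix k
    show "(\<lambda>m. norm (case (k, m) of (k, m) \<Rightarrow> q i ^ k * ?g m)) summable_on multi_idx A"
      using inner g0 q by (simp add: abs_mult)
    have "(\<lambda>k. q i ^ k * infsum ?g (multi_idx A)) summable_on UNIV"
      by (rule summable_on_cmult_left[OF geometric_summable_on[OF q]])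
    moreover have "infsum (\<lambda>m. norm (case (k, m) of (k, m) \<Rightarrow> q i ^ k * ?g m)) (multi_idx A) = q i ^ k * infsum ?g (multi_idx A)" for k
    proof -
      have "infsum (\<lambda>m. norm (case (k, m) of (k, m) \<Rightarrow> q i ^ k * ?g m)) (multi_idx A) = infsum (\<lambda>m. q i ^ k * ?g m) (multi_idx A)"
        using g0 q by (intro infsum_cong) (simp add: abs_mult)
      also have "\<dots> = q i ^ k * infsum ?g (multi_idx A)" by (rule infsum_cmult_right) (use insert.IH in simp)
      finally show ?thesis .
    qed
    ultimately have "(\<lambda>k. infsum (\<lambda>m. norm (case (k, m) of (k, m) \<Rightarrow> q i ^ k * ?g m)) (multi_idx A)) summable_on UNIV"
      by simp
    moreover have "0 \<le> infsum (\<lambda>m. norm (case (k, m) of (k, m) \<Rightarrow> q i ^ k * ?g m)) (multi_idx A)" for k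
      by (rule infsum_nonneg) simp
    ultimately show "(\<lambda>k. norm (infsum (\<lambda>m. norm (case (k, m) of (k, m) \<Rightarrow> q i ^ k * ?g m)) (multi_idx A))) summable_on UNIV"
      by simp
  qed
  then have "(\<lambda>(k, m). q i ^ k * ?g m) summable_on (UNIV \<times> multi_idx A)" by (rule abs_summable_summable)
  also have "(\<lambda>(k, m). q i ^ k * ?g m) = (\<lambda>x. \<Prod>j\<in>insert i A. q j ^ ((\<lambda>(k, m). m(i := k)) x) j)"
    using insert(1,2) by (auto simp: fun_eq_iff p simp del: fun_upd_apply simp: fun_upd_same)
  finally show ?case
    by (rule iffD1[OF summable_on_reindex_bij_betw[OF multi_idx_insert_bij[OF insert(2)]]])
qed

text \<open>Osgood's lemma, by induction on the set \<open>A\<close> of coordinates that are free to move. Expanding in one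
  more coordinate \<open>i\<close> gives Taylor coefficients \<open>d k\<close> which are circle averages in the coordinate \<open>i\<close>;
  they are holomorphic in the other coordinates and bounded by \<open>M / r ^ k\<close>. The bound on the coefficients
  makes the iterated series absolutely summable, so that it can be rearranged into one multi-indexed sum.\<close>

lemma gholo_power_series_aux:
  fixes a :: "complex ^ 'n"
  assumes r: "r > 0" "r < R" and S: "S = {z. \<forall>i. norm (z $ i - a $ i) < R}"
    and "finite A" "gholo F S" "\<And>z. (\<forall>i. norm (z $ i - a $ i) \<le> r) \<Longrightarrow> norm (F z) \<le> M"
  shows "\<exists>c. (\<forall>m. norm (c m) \<le> M / r ^ (\<Sum>i\<in>A. m i)) \<and>
    (\<forall>z. (\<forall>i. norm (z $ i - a $ i) < r) \<longrightarrow> (\<forall>i. i \<notin> A \<longrightarrow> z $ i = a $ i) \<longrightarrow>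
      ((\<lambda>m. c m * (\<Prod>i\<in>A. (z $ i - a $ i) ^ m i)) has_sum F z) (multi_idx A))"
  using assms(4-6)
proof (induction A arbitrary: F M rule: finite_induct)
  case empty
  show ?case
  proof (intro exI conjI allI impI)
    show "norm (F a) \<le> M / r ^ (\<Sum>i\<in>{}. m i)" for m :: "'n \<Rightarrow> nat" using empty r by simp
    fix z assume "\<forall>i. norm (z $ i - a $ i) < r" "\<forall>i. i \<notin> {} \<longrightarrow> z $ i = a $ i"
    then have "z = a" by (simp add: vec_eq_iff)
    then show "((\<lambda>m. F a * (\<Prod>i\<in>{}. (z $ i - a $ i) ^ m i)) has_sum F z) (multi_idx {})"
      by (simp add: multi_idx_empty has_sum_finite_iff)
  qed
next
  case (insert i A)
  note F = \<open>gholo F S\<close> and MF = insert.prems(2)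
  have M0: "0 \<le> M" using MF[of a] r norm_ge_zero[of "F a"] by (simp, linarith)
  let ?e = "\<lambda>t. complex_of_real r * cis1 t"
  define L where "L = (\<lambda>t z. (\<chi> j. if j = i then a $ j + ?e t else z $ j) :: complex ^ 'n)"
  define a0 where "a0 = (\<lambda>z. (\<chi> j. if j = i then a $ j else z $ j) :: complex ^ 'n)"
  define d where "d = (\<lambda>k z. integral {0..1} (\<lambda>t. F (L t z) / ?e t ^ k))"
  have ne: "norm (?e t) = r" for t using r by (simp add: norm_mult)
  have ez: "?e t \<noteq> 0" for t using r by simp
  have LS: "L t z \<in> S" if "z \<in> S" for t z using that r ne[of t] by (auto simp: S L_def)
  have openS: "open S"
  proof -
    have "S = (\<Inter>i. {z. norm (z $ i - a $ i) < R})" by (auto simp: S)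
    moreover have "open {z. norm (z $ i - a $ i) < R}" for i
      by (intro open_Collect_less continuous_intros)
    ultimately show ?thesis by (auto intro: open_INT)
  qed
  have contL: "continuous_on X (\<lambda>x. L (f x) (g x))" if "continuous_on X f" "continuous_on X g" for X :: "'z::topological_space set" and f g
  proof -
    have "continuous_on X (\<lambda>x. if j = i then a $ j + ?e (f x) else g x $ j)" for j
      by (cases "j = i") (use that in \<open>auto intro!: continuous_intros\<close>)
    then show ?thesis unfolding L_def by (rule continuous_on_vec_lambda)
  qed
  have cont: "continuous_on ({0..1} \<times> S) (\<lambda>(t, z). F (L t z) / ?e t ^ k)" for k
    unfolding case_prod_unfold
    by (intro continuous_intros contL continuous_on_compose2[OF gholo_continuous[OF F]]) (use LS ez in auto)
  have hol: "gholo (d k) S" for k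
    unfolding d_def
  proof (rule gholo_param_integral[OF openS cont])
    fix t :: real
    have "gholo (\<lambda>z. F (L t z)) S"
      by (rule gholo_compose_affine[OF F contL[OF continuous_on_const continuous_on_id], where M = "\<lambda>v. \<chi> j. if j = i then 0 else v $ j"])
         (use LS in \<open>auto simp: L_def vec_eq_iff\<close>)
    from gholo_mult[OF this gholo_const[of "1 / ?e t ^ k"]]
    show "gholo (\<lambda>z. F (L t z) / ?e t ^ k) S" by simp
  qed
  have bnd: "norm (d k z) \<le> M / r ^ k" if z: "\<forall>i. norm (z $ i - a $ i) \<le> r" for k z
  proof -
    have zS: "z \<in> S" using z r by (auto simp: S intro: le_less_trans)
    have "norm (integral {0..1} (\<lambda>t. F (L t z) / ?e t ^ k)) \<le> (M / r ^ k) * (1 - 0)"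
    proof (rule integral_bound)
      show "continuous_on {0..1} (\<lambda>t. F (L t z) / ?e t ^ k)"
        by (intro continuous_intros contL continuous_on_compose2[OF gholo_continuous[OF F]]) (use LS zS ez in auto)
      show "norm (F (L t z) / ?e t ^ k) \<le> M / r ^ k" for t
        unfolding norm_divide norm_power ne
        by (intro divide_right_mono MF) (use z ne[of t] r in \<open>auto simp: L_def\<close>)
    qed simp
    then show ?thesis by (simp add: d_def)
  qed
  have "\<forall>k. \<exists>c. (\<forall>m. norm (c m) \<le> (M / r ^ k) / r ^ (\<Sum>i\<in>A. m i)) \<and>
    (\<forall>z. (\<forall>i. norm (z $ i - a $ i) < r) \<longrightarrow> (\<forall>i. i \<notin> A \<longrightarrow> z $ i = a $ i) \<longrightarrow>
      ((\<lambda>m. c m * (\<Prod>i\<in>A. (z $ i - a $ i) ^ m i)) has_sum d k z) (multi_idx A))"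
    by (intro allI insert.IH hol bnd) auto
  then obtain C where CC: "\<forall>k. (\<forall>m. norm (C k m) \<le> (M / r ^ k) / r ^ (\<Sum>i\<in>A. m i)) \<and>
    (\<forall>z. (\<forall>i. norm (z $ i - a $ i) < r) \<longrightarrow> (\<forall>i. i \<notin> A \<longrightarrow> z $ i = a $ i) \<longrightarrow>
      ((\<lambda>m. C k m * (\<Prod>i\<in>A. (z $ i - a $ i) ^ m i)) has_sum d k z) (multi_idx A))"
    by (rule choice[THEN exE])
  have C: "norm (C k m) \<le> (M / r ^ k) / r ^ (\<Sum>i\<in>A. m i)" for k m
    by (rule CC[THEN spec, THEN conjunct1, THEN spec])
  have Csum: "((\<lambda>m. C k m * (\<Prod>i\<in>A. (z $ i - a $ i) ^ m i)) has_sum d k z) (multi_idx A)"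
    if "\<forall>i. norm (z $ i - a $ i) < r" "\<forall>i. i \<notin> A \<longrightarrow> z $ i = a $ i" for k z
    by (rule CC[THEN spec, THEN conjunct2, THEN spec, THEN mp, THEN mp, OF that])
  define c where "c = (\<lambda>m. C (m i) (m(i := 0)))"
  have cb: "norm (c m) \<le> M / r ^ (\<Sum>i\<in>insert i A. m i)" for m
  proof -
    have "(\<Sum>j\<in>A. (m(i := 0)) j) = (\<Sum>j\<in>A. m j)" by (rule sum.cong) (use insert in auto)
    then show ?thesis using C[of "m i" "m(i := 0)"] insert(1,2) by (simp add: c_def power_add)
  qed
  show ?case
  proof (intro exI[of _ c] conjI allI impI cb)
    fix z assume z: "\<forall>i. norm (z $ i - a $ i) < r" and zA: "\<forall>j. j \<notin> insert i A \<longrightarrow> z $ j = a $ j"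
    define q where "q = (\<lambda>j. norm (z $ j - a $ j) / r)"
    have q: "0 \<le> q j" "q j < 1" for j using z r by (auto simp: q_def)
    let ?G = "\<lambda>m. c m * (\<Prod>j\<in>insert i A. (z $ j - a $ j) ^ m j)"
    have Gs: "?G summable_on multi_idx (insert i A)"
    proof (rule abs_summable_summable, rule Infinite_Sum.abs_summable_on_comparison_test')
      show "(\<lambda>m. M * (\<Prod>j\<in>insert i A. q j ^ m j)) summable_on multi_idx (insert i A)"
        by (intro summable_on_cmult_right multi_geometric_summable) (use insert q in auto)
      fix m
      have "norm (?G m) \<le> M / r ^ (\<Sum>i\<in>insert i A. m i) * (\<Prod>j\<in>insert i A. norm (z $ j - a $ j) ^ m j)"
        unfolding norm_mult prod_norm[symmetric] norm_power by (intro mult_right_mono cb prod_nonneg) auto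
      also have "\<dots> = M * (\<Prod>j\<in>insert i A. q j ^ m j)"
        by (simp only: q_def power_divide prod_dividef power_sum times_divide_eq_left times_divide_eq_right)
      finally show "norm (?G m) \<le> M * (\<Prod>j\<in>insert i A. q j ^ m j)" .
    qed
    have a0: "\<forall>j. norm (a0 z $ j - a $ j) < r" "\<forall>j. j \<notin> A \<longrightarrow> a0 z $ j = a $ j"
      using z zA r by (auto simp: a0_def)
    define f where "f = (\<lambda>w. F (cline (a0 z) (axis i 1) w))"
    have inS: "cline (a0 z) (axis i 1) w \<in> S" if "norm w \<le> r" for w
      unfolding S
    proof clarify
      fix j show "norm (cline (a0 z) (axis i 1) w $ j - a $ j) < R"
        using a0(1)[rule_format, of j] that r by (cases "j = i") (auto simp: axis_def a0_def)
    qed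
    have fhol: "f holomorphic_on cball 0 r"
      unfolding f_def by (rule gholo_slice[OF F]) (use inS in auto)
    have coef: "(deriv ^^ k) f 0 / fact k = d k (a0 z)" for k
    proof -
      have "cline (a0 z) (axis i 1) (?e t) = L t (a0 z)" for t
        by (auto simp: vec_eq_iff L_def a0_def axis_def)
      then show ?thesis unfolding Cauchy_mean[OF fhol r(1)] by (simp add: d_def f_def)
    qed
    have "(\<lambda>k. (deriv ^^ k) f 0 / fact k * (z $ i - a $ i - 0) ^ k) sums f (z $ i - a $ i)"
      by (rule holomorphic_power_series[of _ _ r]) (use fhol z in \<open>auto intro: holomorphic_on_subset\<close>)
    moreover have "f (z $ i - a $ i) = F z"
    proof -
      have "cline (a0 z) (axis i 1) (z $ i - a $ i) = z" by (auto simp: vec_eq_iff a0_def axis_def)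
      then show ?thesis by (simp add: f_def)
    qed
    ultimately have sm: "(\<lambda>k. d k (a0 z) * (z $ i - a $ i) ^ k) sums F z" by (simp add: coef)
    have outer: "((\<lambda>k. d k (a0 z) * (z $ i - a $ i) ^ k) has_sum F z) UNIV"
    proof (rule norm_summable_imp_has_sum[OF _ sm], rule summable_comparison_test'[where N = 0])
      show "summable (\<lambda>k. M * q i ^ k)" using q[of i] by (intro summable_mult summable_geometric) auto
      fix k
      have "norm (d k (a0 z) * (z $ i - a $ i) ^ k) \<le> M / r ^ k * norm (z $ i - a $ i) ^ k"
        unfolding norm_mult norm_power by (intro mult_right_mono bnd) (use a0 in \<open>auto simp: less_imp_le\<close>)
      then show "norm (norm (d k (a0 z) * (z $ i - a $ i) ^ k)) \<le> M * q i ^ k" by (simp add: q_def power_divide)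
    qed
    let ?h = "\<lambda>(k, m). m(i := k)"
    have "((\<lambda>x. ?G (?h x)) has_sum F z) (UNIV \<times> multi_idx A)"
    proof (rule has_sum_SigmaI[OF _ outer])
      show "(\<lambda>x. ?G (?h x)) summable_on UNIV \<times> multi_idx A"
        by (rule iffD2[OF summable_on_reindex_bij_betw[OF multi_idx_insert_bij[OF insert(2)], of ?G] Gs])
      fix k
      have "((\<lambda>m. C k m * (\<Prod>j\<in>A. (a0 z $ j - a $ j) ^ m j) * (z $ i - a $ i) ^ k) has_sum d k (a0 z) * (z $ i - a $ i) ^ k) (multi_idx A)"
        by (rule has_sum_cmult_left[OF Csum[OF a0]])
      moreover have "C k m * (\<Prod>j\<in>A. (a0 z $ j - a $ j) ^ m j) * (z $ i - a $ i) ^ k = ?G (?h (k, m))" if "m \<in> multi_idx A" for m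
      proof -
        have 1: "(\<Prod>j\<in>A. (a0 z $ j - a $ j) ^ m j) = (\<Prod>j\<in>A. (z $ j - a $ j) ^ (m(i := k)) j)"
          by (rule prod.cong) (use insert(2) in \<open>auto simp: a0_def\<close>)
        have 2: "m(i := 0) = m" using that insert(2) by (auto simp: multi_idx_def)
        show ?thesis using insert(1,2) by (simp add: 1 2 c_def)
      qed
      ultimately show "((\<lambda>m. ?G (?h (k, m))) has_sum d k (a0 z) * (z $ i - a $ i) ^ k) (multi_idx A)"
        by (rule iffD1[OF has_sum_cong, rotated]) simp
    qed
    then show "(?G has_sum F z) (multi_idx (insert i A))"
      by (rule iffD1[OF has_sum_reindex_bij_betw[OF multi_idx_insert_bij[OF insert(2)], of ?G]])
  qed
qed

lemma gholo_imp_power_series: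
  fixes F :: "complex ^ 'n \<Rightarrow> complex"
  assumes S: "open S" and F: "gholo F S" and a: "a \<in> S"
  shows "\<exists>c r. r > 0 \<and> (\<forall>z. (\<forall>i. norm (z $ i - a $ i) < r) \<longrightarrow>
      ((\<lambda>m. c m * (\<Prod>i\<in>UNIV. (z $ i - a $ i) ^ m i)) has_sum F z) UNIV)"
proof -
  obtain \<epsilon> B where e: "\<epsilon> > 0" "cball a \<epsilon> \<subseteq> S" and B: "B \<ge> 0" "\<forall>w\<in>cball a \<epsilon>. norm (F w) \<le> B"
    using gholo_ball_bound[OF assms] by blast
  define R where "R = \<epsilon> / real CARD('n)"
  have R: "R > 0" using e by (simp add: R_def)
  have sub: "z \<in> cball a \<epsilon>" if "\<forall>i. norm (z $ i - a $ i) \<le> R" for z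
  proof -
    have "dist a z \<le> (\<Sum>i\<in>UNIV. norm ((a - z) $ i))" unfolding dist_norm norm_vec_def by (rule L2_set_le_sum) simp
    also have "\<dots> \<le> (\<Sum>i\<in>(UNIV::'n set). R)" by (rule sum_mono) (use that in \<open>simp add: norm_minus_commute\<close>)
    also have "\<dots> = \<epsilon>" by (simp add: R_def)
    finally show ?thesis by simp
  qed
  let ?S = "{z. \<forall>i. norm (z $ i - a $ i) < R}"
  have "gholo F ?S" by (rule gholo_subset[OF F]) (use sub e in \<open>auto simp: subset_iff less_imp_le\<close>)
  then have "\<exists>c. (\<forall>m. norm (c m) \<le> B / (R/2) ^ (\<Sum>i\<in>UNIV. m i)) \<and>
    (\<forall>z. (\<forall>i. norm (z $ i - a $ i) < R/2) \<longrightarrow> (\<forall>i. i \<notin> UNIV \<longrightarrow> z $ i = a $ i) \<longrightarrow>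
      ((\<lambda>m. c m * (\<Prod>i\<in>UNIV. (z $ i - a $ i) ^ m i)) has_sum F z) (multi_idx UNIV))"
  proof (intro gholo_power_series_aux[where R = R and S = ?S])
    show "norm (F z) \<le> B" if "\<forall>i. norm (z $ i - a $ i) \<le> R / 2" for z
      using B(2) sub[of z] that R by (smt (verit) field_sum_of_halves)
  qed (use R in auto)
  then obtain c where "\<forall>z. (\<forall>i. norm (z $ i - a $ i) < R/2) \<longrightarrow>
      ((\<lambda>m. c m * (\<Prod>i\<in>UNIV. (z $ i - a $ i) ^ m i)) has_sum F z) UNIV"
    unfolding multi_idx_UNIV by auto
  with R show ?thesis by (intro exI[of _ c] exI[of _ "R/2"] conjI) simp_all
qed

lemma gholo_imp_real_analytic_at:
  fixes F :: "complex ^ 'n \<Rightarrow> complex"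
  assumes S: "open S" and F: "gholo F S" and a: "cvec a \<in> S"
  shows "\<exists>c r. r > 0 \<and> (\<forall>x. (\<forall>i. \<bar>x $ i - a $ i\<bar> < r) \<longrightarrow>
       ((\<lambda>m. c m * of_real (\<Prod>i\<in>UNIV. (x $ i - a $ i) ^ m i)) has_sum F (cvec x)) UNIV)"
proof -
  obtain c r where r: "r > 0" and c: "\<forall>z. (\<forall>i. norm (z $ i - cvec a $ i) < r) \<longrightarrow>
      ((\<lambda>m. c m * (\<Prod>i\<in>UNIV. (z $ i - cvec a $ i) ^ m i)) has_sum F z) UNIV"
    using gholo_imp_power_series[OF assms] by (elim exE conjE) (rule that)
  have "((\<lambda>m. c m * of_real (\<Prod>i\<in>UNIV. (x $ i - a $ i) ^ m i)) has_sum F (cvec x)) UNIV"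
    if "\<forall>i. \<bar>x $ i - a $ i\<bar> < r" for x
  proof -
    have "norm (cvec x $ i - cvec a $ i) = \<bar>x $ i - a $ i\<bar>" for i
      by (simp flip: of_real_diff)
    with c[rule_format, of "cvec x"] that show ?thesis by simp
  qed
  with r show ?thesis by (intro exI[of _ c] exI[of _ r] conjI allI impI)
qed

text \<open>The power series converges absolutely at the point \<open>a + (\<rho>, \<dots>, \<rho>)\<close>. This controls all terms of
  degree at least two at once: for small \<open>h\<close> their sum is at most a multiple of the square of the norm of \<open>h\<close>.\<close>

lemma real_analytic_differentiable:
  fixes f :: "real ^ 'n \<Rightarrow> complex"
  assumes "real_analytic f"
  shows "f differentiable (at a)"
proof -
  have "\<exists>c. \<exists>r>0. \<forall>x. (\<forall>i. \<bar>x $ i - a $ i\<bar> < r) \<longrightarrow>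
       ((\<lambda>m. c m * of_real (\<Prod>i\<in>UNIV. (x $ i - a $ i) ^ m i)) has_sum f x) UNIV"
    by (rule spec[OF assms[unfolded real_analytic_def]])
  then obtain c r where r: "r > 0" and c': "\<forall>x. (\<forall>i. \<bar>x $ i - a $ i\<bar> < r) \<longrightarrow>
       ((\<lambda>m. c m * of_real (\<Prod>i\<in>UNIV. (x $ i - a $ i) ^ m i)) has_sum f x) UNIV"
    by (elim exE conjE) (rule that)
  note c = c'[THEN spec, THEN mp]
  define \<rho> where "\<rho> = r / 2"
  have \<rho>: "\<rho> > 0" "\<rho> < r" using r by (auto simp: \<rho>_def)
  let ?u = "\<lambda>i. (\<lambda>j. if j = i then 1 else 0) :: 'n \<Rightarrow> nat"
  let ?B = "insert (\<lambda>_. 0) (range ?u)"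
  have "((\<lambda>m. c m * of_real (\<Prod>i\<in>UNIV. ((a + vec \<rho>) $ i - a $ i) ^ m i)) has_sum f (a + vec \<rho>)) UNIV"
    by (rule c) (use \<rho> in auto)
  then have "(\<lambda>m. c m * of_real (\<rho> ^ (\<Sum>i\<in>UNIV. m i))) summable_on UNIV"
    by (auto simp: summable_on_def power_sum)
  then have "(\<lambda>m. norm (c m * of_real (\<rho> ^ (\<Sum>i\<in>UNIV. m i)))) summable_on UNIV"
    by (simp only: summable_on_iff_abs_summable_on_complex)
  then have sm: "(\<lambda>m. norm (c m) * \<rho> ^ (\<Sum>i\<in>UNIV. m i)) summable_on UNIV"
    using \<rho> by (simp add: norm_mult norm_power)
  define S where "S = infsum (\<lambda>m. norm (c m) * \<rho> ^ (\<Sum>i\<in>UNIV. m i)) (UNIV - ?B)"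
  have smB: "(\<lambda>m. norm (c m) * \<rho> ^ (\<Sum>i\<in>UNIV. m i)) summable_on (UNIV - ?B)"
    by (rule summable_on_subset_banach[OF sm]) simp
  define D where "D = (\<lambda>h::real^'n. \<Sum>i\<in>UNIV. c (?u i) * of_real (h $ i))"
  have inju: "inj ?u" by (rule injI) (metis zero_neq_one)
  have n0: "(\<lambda>_. 0) \<notin> range ?u"
  proof
    assume "(\<lambda>_. 0) \<in> range ?u"
    then obtain i where "(\<lambda>_. 0) = ?u i" by blast
    from fun_cong[OF this, of i] show False by simp
  qed
  have rem: "norm (f (a + h) - f a - D h) \<le> S * (norm h / \<rho>)\<^sup>2" if h: "norm h \<le> \<rho>" for h
  proof -
    define t where "t = norm h / \<rho>"
    have t: "0 \<le> t" "t \<le> 1" "norm h = t * \<rho>" using h \<rho> by (auto simp: t_def)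
    have hi: "\<bar>h $ i\<bar> \<le> t * \<rho>" for i using component_le_norm_cart[of h i] t by simp
    let ?g = "\<lambda>m. c m * of_real (\<Prod>i\<in>UNIV. (h $ i) ^ m i)"
    have "((\<lambda>m. c m * of_real (\<Prod>i\<in>UNIV. ((a + h) $ i - a $ i) ^ m i)) has_sum f (a + h)) UNIV"
      by (rule c) (use component_le_norm_cart[of h] h \<rho> in \<open>auto intro: le_less_trans\<close>)
    then have 1: "(?g has_sum f (a + h)) UNIV" by simp
    have 2: "(?g has_sum (\<Sum>m\<in>?B. ?g m)) ?B" by (rule has_sum_finite) simp
    have 3: "(\<Sum>m\<in>?B. ?g m) = c (\<lambda>_. 0) + D h"
    proof -
      have "(\<Prod>j\<in>UNIV. h $ j ^ ?u i j) = h $ i" for i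
      proof -
        have "(\<Prod>j\<in>UNIV. h $ j ^ ?u i j) = (\<Prod>j\<in>UNIV. if j = i then h $ j else 1)"
          by (rule prod.cong) auto
        then show ?thesis by simp
      qed
      then show ?thesis using n0 by (simp add: sum.reindex[OF inju] D_def del: of_real_prod)
    qed
    have 4: "f a = c (\<lambda>_. 0)"
    proof -
      have "((\<lambda>m. c m * of_real (\<Prod>i\<in>UNIV. (a $ i - a $ i) ^ m i)) has_sum f a) UNIV"
        by (rule c) (use r in auto)
      moreover have "((\<lambda>m. c m * of_real (\<Prod>i\<in>UNIV. (a $ i - a $ i) ^ m i)) has_sum c (\<lambda>_. 0)) UNIV"
      proof (rule has_sum_finite_neutralI[where B = "{\<lambda>_. 0}"])
        fix m :: "'n \<Rightarrow> nat" assume "m \<in> UNIV - {\<lambda>_. 0}"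
        then obtain i where "m i \<noteq> 0" by auto
        then have "(\<Prod>i\<in>UNIV. (a $ i - a $ i) ^ m i) = 0" by (intro prod_zero) (auto intro: exI[of _ i])
        then show "c m * of_real (\<Prod>i\<in>UNIV. (a $ i - a $ i) ^ m i) = 0" by simp
      qed auto
      ultimately show ?thesis by (rule has_sum_unique)
    qed
    have "(?g has_sum (f (a + h) - (c (\<lambda>_. 0) + D h))) (UNIV - ?B)"
      using has_sum_Diff[OF 1 2 subset_UNIV] unfolding 3 .
    then have 5: "infsum ?g (UNIV - ?B) = f (a + h) - f a - D h" by (simp add: infsumI 4)
    have "norm (infsum ?g (UNIV - ?B)) \<le> infsum (\<lambda>m. t\<^sup>2 * (norm (c m) * \<rho> ^ (\<Sum>i\<in>UNIV. m i))) (UNIV - ?B)"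
    proof (rule norm_infsum_le)
      show "(?g has_sum infsum ?g (UNIV - ?B)) (UNIV - ?B)"
        using \<open>(?g has_sum (f (a + h) - (c (\<lambda>_. 0) + D h))) (UNIV - ?B)\<close> by (simp add: infsumI)
      show "((\<lambda>m. t\<^sup>2 * (norm (c m) * \<rho> ^ (\<Sum>i\<in>UNIV. m i))) has_sum infsum (\<lambda>m. t\<^sup>2 * (norm (c m) * \<rho> ^ (\<Sum>i\<in>UNIV. m i))) (UNIV - ?B)) (UNIV - ?B)"
        by (rule has_sum_infsum, rule summable_on_cmult_right, rule smB)
      fix m assume m: "m \<in> UNIV - ?B"
      have s2: "(\<Sum>i\<in>UNIV. m i) \<ge> 2"
      proof (rule ccontr)
        assume "\<not> ?thesis"
        then consider "(\<Sum>i\<in>UNIV. m i) = 0" | "(\<Sum>i\<in>UNIV. m i) = Suc 0" by linarith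
        then show False
        proof cases
          case 1
          then have "m = (\<lambda>_. 0)" by auto
          then show ?thesis using m by simp
        next
          case 2
          then obtain i where "m i = Suc 0" "\<forall>j. i \<noteq> j \<longrightarrow> m j = 0"
            by (auto simp: sum_eq_Suc0_iff)
          then have "m = ?u i" by (auto simp: fun_eq_iff)
          then show ?thesis using m by blast
        qed
      qed
      have "norm (?g m) = norm (c m) * (\<Prod>i\<in>UNIV. \<bar>h $ i\<bar> ^ m i)"
        by (simp add: norm_mult norm_power flip: prod_norm)
      also have "\<dots> \<le> norm (c m) * (\<Prod>i\<in>UNIV. (t * \<rho>) ^ m i)"
        by (intro mult_left_mono prod_mono) (auto intro!: power_mono hi)
      also have "\<dots> = t ^ (\<Sum>i\<in>UNIV. m i) * (norm (c m) * \<rho> ^ (\<Sum>i\<in>UNIV. m i))"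
        by (simp add: power_sum power_mult_distrib prod.distrib)
      also have "\<dots> \<le> t\<^sup>2 * (norm (c m) * \<rho> ^ (\<Sum>i\<in>UNIV. m i))"
        using t \<rho> s2 by (intro mult_right_mono power_decreasing) auto
      finally show "norm (?g m) \<le> t\<^sup>2 * (norm (c m) * \<rho> ^ (\<Sum>i\<in>UNIV. m i))" .
    qed
    also have "\<dots> = t\<^sup>2 * S" unfolding S_def by (rule infsum_cmult_right) (use smB in simp)
    finally show ?thesis using 5 by (simp add: t_def mult.commute)
  qed
  have "(f has_derivative D) (at a)"
    unfolding has_derivative_at
  proof (intro conjI)
    show "bounded_linear D"
    proof (rule linear_conv_bounded_linear[THEN iffD1], rule linearI)
      show "D (x + y) = D x + D y" for x y by (simp add: D_def sum.distrib algebra_simps)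
      show "D (s *\<^sub>R x) = s *\<^sub>R D x" for s x
      proof -
        have "D (s *\<^sub>R x) = (\<Sum>i\<in>UNIV. s *\<^sub>R (c (?u i) * of_real (x $ i)))"
          unfolding D_def by (rule sum.cong) (simp_all add: scaleR_conv_of_real[of s "_ :: complex"])
        then show ?thesis by (simp add: D_def scaleR_sum_right)
      qed
    qed
    show "(\<lambda>h. norm (f (a + h) - f a - D h) / norm h) \<midarrow>0\<rightarrow> 0"
    proof (rule Lim_null_comparison)
      have "\<forall>\<^sub>F h in at (0::real^'n). norm h < \<rho>"
        unfolding eventually_at by (rule exI[of _ \<rho>]) (use \<rho> in auto)
      moreover have "\<forall>\<^sub>F h::real^'n in at 0. h \<noteq> 0" by (simp add: eventually_at_filter)
      ultimately show "\<forall>\<^sub>F h in at 0. norm (norm (f (a + h) - f a - D h) / norm h) \<le> S * norm h / \<rho>\<^sup>2"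
      proof eventually_elim
        case (elim h)
        have "norm (f (a + h) - f a - D h) / norm h \<le> S * (norm h / \<rho>)\<^sup>2 / norm h"
          by (rule divide_right_mono[OF rem]) (use elim in auto)
        also have "\<dots> = S * norm h / \<rho>\<^sup>2" using elim(2) by (simp add: power2_eq_square)
        finally show ?case by simp
      qed
      have "((\<lambda>h::real^'n. S * norm h / \<rho>\<^sup>2) \<longlongrightarrow> S * norm (0::real^'n) / \<rho>\<^sup>2) (at 0)"
        using \<rho> by (intro tendsto_intros) auto
      then show "((\<lambda>h::real^'n. S * norm h / \<rho>\<^sup>2) \<longlongrightarrow> 0) (at 0)" by simp
    qed
  qed
  then show ?thesis unfolding differentiable_def by blast
qed

section \<open>A maximum principle for the radial derivative\<close>

text \<open>Maximise \<open>exp (- 2 (L + 1) |x|) |f x|\<^sup>2\<close> over the ball. A maximum point \<open>x\<^sub>0 \<noteq> 0\<close> also maximises \<open>|f|\<close> on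
  its own sphere, so \<open>key\<close> applies there, and the derivative along the ray, taken from inside, is not negative.
  Together they give \<open>(L + 1) |f x\<^sub>0|\<^sup>2 \<le> (L |f x\<^sub>0| + \<epsilon>) |f x\<^sub>0|\<close>, that is \<open>|f x\<^sub>0| \<le> \<epsilon>\<close>.\<close>

lemma radial_maximum_principle:
  fixes f :: "'a::euclidean_space \<Rightarrow> 'b::real_inner"
  assumes der: "\<And>x. norm x \<le> R \<Longrightarrow> (f has_derivative f' x) (at x)"
    and L: "L \<ge> 0" and eps: "\<epsilon> \<ge> 0"
    and key: "\<And>x. norm x \<le> R \<Longrightarrow> x \<noteq> 0 \<Longrightarrow> (\<And>y. norm y = norm x \<Longrightarrow> norm (f y) \<le> norm (f x)) \<Longrightarrow>
      inner (f x) (f' x x) \<le> (L * norm (f x) + \<epsilon>) * norm x * norm (f x)"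
    and x: "norm x \<le> R"
  shows "norm (f x) \<le> exp ((L + 1) * norm x) * max (norm (f 0)) \<epsilon>"
proof -
  define C where "C = L + 1"
  define g where "g = (\<lambda>x. exp (- (2 * C * norm x)) * (norm (f x))\<^sup>2)"
  have contf: "continuous_on (cball 0 R) f"
    by (intro continuous_at_imp_continuous_on ballI has_derivative_continuous[OF der]) auto
  have "continuous_on (cball 0 R) g" unfolding g_def by (intro continuous_intros contf)
  moreover have "cball (0::'a) R \<noteq> {}" using order_trans[OF norm_ge_zero x] by simp
  ultimately obtain x0 where x0: "norm x0 \<le> R" and mx: "\<And>y. norm y \<le> R \<Longrightarrow> g y \<le> g x0"
    using continuous_attains_sup[OF compact_cball, of 0 R g] by auto
  let ?M = "max (norm (f 0)) \<epsilon>"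
  have g0: "g x0 \<le> ?M\<^sup>2"
  proof (cases "x0 = 0")
    case True
    then show ?thesis using eps by (simp add: g_def power_mono)
  next
    case False
    have sph: "norm (f y) \<le> norm (f x0)" if "norm y = norm x0" for y
    proof -
      have "g y \<le> g x0" using mx that x0 by simp
      then have "(norm (f y))\<^sup>2 \<le> (norm (f x0))\<^sup>2" by (simp add: g_def that)
      then show ?thesis by (simp add: power2_le_iff_abs_le)
    qed
    \<comment> \<open>the function to be maximised, along the ray through \<open>x\<^sub>0\<close>, differentiated at \<open>s = 1\<close>\<close>
    define h where "h = (\<lambda>s. exp (- (2 * C * s * norm x0)) * inner (f (s *\<^sub>R x0)) (f (s *\<^sub>R x0)))"
    have d1: "((\<lambda>s. f (s *\<^sub>R x0)) has_derivative (\<lambda>t. f' x0 (t *\<^sub>R x0))) (at 1)"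
    proof -
      have a: "((\<lambda>s::real. s *\<^sub>R x0) has_derivative (\<lambda>t. t *\<^sub>R x0)) (at 1)" by (auto intro!: derivative_eq_intros)
      have "(f has_derivative f' x0) (at (1 *\<^sub>R x0))" using der[OF x0] by simp
      from has_derivative_compose[OF a this] show ?thesis .
    qed
    have lin: "f' x0 (t *\<^sub>R x0) = t *\<^sub>R f' x0 x0" for t
      using der[OF x0] by (simp add: has_derivative_def bounded_linear.linear linear_scale)
    have d2: "((\<lambda>s. f (s *\<^sub>R x0)) has_vector_derivative f' x0 x0) (at 1)"
      using d1 unfolding has_vector_derivative_def lin .
    have dh: "(h has_real_derivative
       exp (- (2 * C * norm x0)) * (2 * inner (f x0) (f' x0 x0) - 2 * C * norm x0 * (norm (f x0))\<^sup>2)) (at 1)"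
    proof -
      have i: "((\<lambda>s. inner (f (s *\<^sub>R x0)) (f (s *\<^sub>R x0))) has_derivative (\<lambda>t. t * (2 * inner (f x0) (f' x0 x0)))) (at 1)"
        by (rule has_derivative_eq_rhs[OF has_derivative_inner[OF d1 d1]]) (simp add: lin inner_commute algebra_simps)
      then have i': "((\<lambda>s. inner (f (s *\<^sub>R x0)) (f (s *\<^sub>R x0))) has_real_derivative (2 * inner (f x0) (f' x0 x0))) (at 1)"
        unfolding has_field_derivative_def by (rule has_derivative_eq_rhs) (simp add: fun_eq_iff)
      have e: "((\<lambda>s. exp (- (2 * C * s * norm x0))) has_real_derivative (exp (- (2 * C * norm x0)) * (- (2 * C * norm x0)))) (at 1)"
        by (auto intro!: derivative_eq_intros)
      show ?thesis unfolding h_def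
        by (rule DERIV_cong[OF DERIV_mult[OF e i']]) (simp add: power2_norm_eq_inner algebra_simps)
    qed
    have "\<not> exp (- (2 * C * norm x0)) * (2 * inner (f x0) (f' x0 x0) - 2 * C * norm x0 * (norm (f x0))\<^sup>2) < 0"
    proof
      assume "exp (- (2 * C * norm x0)) * (2 * inner (f x0) (f' x0 x0) - 2 * C * norm x0 * (norm (f x0))\<^sup>2) < 0"
      from DERIV_neg_dec_left[OF dh this] obtain d where d: "d > 0" "\<And>t. 0 < t \<Longrightarrow> t < d \<Longrightarrow> h 1 < h (1 - t)" by auto
      define t where "t = min (d/2) 1"
      have t: "0 < t" "t < d" "t \<le> 1" using d by (auto simp: t_def)
      have hg: "h s = g (s *\<^sub>R x0)" if "s \<ge> 0" for s
        using that by (simp add: h_def g_def power2_norm_eq_inner mult.assoc)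
      have "norm ((1 - t) *\<^sub>R x0) \<le> 1 * norm x0" unfolding norm_scaleR using t by (intro mult_right_mono) auto
      then have "g ((1 - t) *\<^sub>R x0) \<le> g x0" using mx x0 by simp
      then show False using d(2)[OF t(1,2)] hg[of 1] hg[of "1 - t"] t by simp
    qed
    then have "2 * inner (f x0) (f' x0 x0) - 2 * C * norm x0 * (norm (f x0))\<^sup>2 \<ge> 0"
      by (smt (verit) exp_gt_zero mult_pos_neg)
    then have "C * norm x0 * (norm (f x0))\<^sup>2 \<le> (L * norm (f x0) + \<epsilon>) * norm x0 * norm (f x0)"
      using key[OF x0 False sph] by simp
    then have "norm x0 * (norm (f x0) * norm (f x0)) \<le> norm x0 * (\<epsilon> * norm (f x0))"
      by (simp add: C_def algebra_simps power2_eq_square)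
    then have "norm (f x0) * norm (f x0) \<le> \<epsilon> * norm (f x0)" using False by simp
    then have "norm (f x0) \<le> \<epsilon>"
      using eps by (cases "norm (f x0) = 0") auto
    then have "(norm (f x0))\<^sup>2 \<le> ?M\<^sup>2" by (intro power_mono) auto
    moreover have "g x0 \<le> 1 * (norm (f x0))\<^sup>2"
      unfolding g_def using L by (intro mult_right_mono) (auto simp: C_def)
    ultimately show ?thesis by simp
  qed
  have "g x \<le> ?M\<^sup>2" using mx[OF x] g0 by simp
  then have "(norm (f x))\<^sup>2 \<le> exp (2 * C * norm x) * ?M\<^sup>2"
    by (simp add: g_def exp_minus field_simps)
  also have "\<dots> = (exp (C * norm x) * ?M)\<^sup>2"
    by (simp add: power_mult_distrib exp_double[symmetric] mult.assoc)
  finally have "norm (f x) \<le> exp (C * norm x) * ?M"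
    using eps by (intro power2_le_imp_le[of "norm (f x)"]) (auto intro: mult_nonneg_nonneg simp: le_max_iff_disj)
  then show ?thesis by (simp add: C_def)
qed

section \<open>The Euler equation and uniqueness of Cherednik kernels\<close>

text \<open>The function \<open>u / (1 - e\<^sup>-\<^sup>u)\<close>, continued to \<open>u = 0\<close>. It is the coefficient of a root in the
  Cherednik operator in the radial direction, and everything below rests on its positivity.\<close>

definition rpsi :: "real \<Rightarrow> real" where "rpsi u = (if u = 0 then 1 else u / (1 - exp (- u)))"

lemma rpsi_pos: "rpsi u > 0"
proof (cases u "0::real" rule: linorder_cases)
  case less
  then have "1 - exp (- u) < 0" by simp
  then show ?thesis using less by (simp add: rpsi_def divide_neg_neg)
qed (simp_all add: rpsi_def)

lemma norm_refl_root [simp]: "norm (refl_root a x) = norm x"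
proof (cases "a = 0")
  case False
  then have "inner (refl_root a x) (refl_root a x) = inner x x"
    by (simp add: refl_root_def inner_diff_left inner_diff_right inner_commute field_simps)
  then show ?thesis by (simp add: norm_eq_sqrt_inner)
qed (simp add: refl_root_def)

lemma norm_bilin_le: "norm (bilin l x) \<le> norm l * norm x"
proof -
  have "norm (bilin l x) \<le> (\<Sum>i\<in>UNIV. \<bar>norm (l $ i)\<bar> * \<bar>norm (x $ i)\<bar>)"
    unfolding bilin_def by (rule order_trans[OF norm_sum]) (simp add: norm_mult)
  also have "\<dots> \<le> L2_set (\<lambda>i. norm (l $ i)) UNIV * L2_set (\<lambda>i. norm (x $ i)) UNIV" by (rule L2_set_mult_ineq)
  finally show ?thesis by (simp add: norm_vec_def)
qed

text \<open>Where \<open>|f|\<close> is maximal on a sphere, \<open>f x - f (s\<^sub>a x)\<close> has a nonnegative inner product with \<open>f x\<close>,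
  because \<open>s\<^sub>a\<close> preserves the sphere. As the coefficients \<open>k\<^sub>a \<psi>(\<langle>a, x\<rangle>)\<close> are not negative, the reflection
  terms only help in the maximum principle. Hence the bound does not involve the multiplicity at all.\<close>

lemma euler_bound:
  fixes f :: "real ^ 'n \<Rightarrow> complex"
  assumes der: "\<And>x. norm x \<le> R \<Longrightarrow> (f has_derivative f' x) (at x)"
    and eq: "\<And>x. norm x \<le> R \<Longrightarrow> x \<noteq> 0 \<Longrightarrow> f' x x = b x * f x + s x
        - (\<Sum>a\<in>P. of_real (k a * rpsi (a \<bullet> x)) * (f x - f (refl_root a x)))"
    and k: "\<And>a. a \<in> P \<Longrightarrow> k a \<ge> 0"
    and L: "L \<ge> 0" and eps: "\<epsilon> \<ge> 0"
    and b: "\<And>x. norm x \<le> R \<Longrightarrow> norm (b x) \<le> L * norm x"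
    and s: "\<And>x. norm x \<le> R \<Longrightarrow> norm (s x) \<le> \<epsilon> * norm x"
    and x: "norm x \<le> R"
  shows "norm (f x) \<le> exp ((L + 1) * norm x) * max (norm (f 0)) \<epsilon>"
proof (rule radial_maximum_principle[OF der L eps _ x])
  fix x assume x: "norm x \<le> R" "x \<noteq> 0" and mx: "\<And>y. norm y = norm x \<Longrightarrow> norm (f y) \<le> norm (f x)"
  have refl: "inner (f x) (of_real (k a * rpsi (a \<bullet> x)) * (f x - f (refl_root a x))) \<ge> 0" if a: "a \<in> P" for a
  proof -
    have "inner (f x) (f (refl_root a x)) \<le> norm (f x) * norm (f (refl_root a x))" by (rule norm_cauchy_schwarz)
    also have "\<dots> \<le> norm (f x) * norm (f x)" by (intro mult_left_mono mx) auto
    finally have "inner (f x) (f x - f (refl_root a x)) \<ge> 0"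
      by (simp add: inner_diff_right power2_norm_eq_inner[symmetric] power2_eq_square)
    moreover have "k a * rpsi (a \<bullet> x) \<ge> 0" using k[OF a] rpsi_pos[of "a \<bullet> x"] by simp
    ultimately show ?thesis unfolding scaleR_conv_of_real[symmetric] inner_scaleR_right by simp
  qed
  have "inner (f x) (f' x x) \<le> inner (f x) (b x * f x + s x)"
    unfolding eq[OF x] inner_diff_right inner_sum_right using sum_nonneg[of P, OF refl] by simp
  also have "\<dots> \<le> norm (f x) * norm (b x * f x + s x)" by (rule norm_cauchy_schwarz)
  also have "norm (b x * f x + s x) \<le> (L * norm x) * norm (f x) + \<epsilon> * norm x"
    by (rule order_trans[OF norm_triangle_ineq], unfold norm_mult) (intro add_mono mult_right_mono b s x norm_ge_zero)
  finally have "inner (f x) (f' x x) \<le> norm (f x) * ((L * norm x) * norm (f x) + \<epsilon> * norm x)"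
    by (simp add: mult_left_mono)
  then show "inner (f x) (f' x x) \<le> (L * norm (f x) + \<epsilon>) * norm x * norm (f x)" by (simp add: algebra_simps)
qed

text \<open>In the direction \<open>\<xi> = x\<close> the eigenvalue equation becomes the Euler equation: the factor \<open>\<langle>a, x\<rangle>\<close>
  absorbs the pole of \<open>1 / (1 - e\<^sup>-\<^sup>a)\<close>, and only values of \<open>f\<close> and its radial derivative occur.\<close>

lemma kernel_euler:
  fixes f :: "real ^ 'n \<Rightarrow> complex"
  assumes f: "is_cherednik_kernel P k l f"
  shows "(f has_derivative frechet_derivative f (at x)) (at x)"
    and "frechet_derivative f (at x) x = (bilin l x + of_real (rho P k \<bullet> x)) * f x
        - (\<Sum>a\<in>P. of_real (k a * rpsi (a \<bullet> x)) * (f x - f (refl_root a x)))"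
proof -
  show "(f has_derivative frechet_derivative f (at x)) (at x)"
    using f by (simp add: is_cherednik_kernel_def real_analytic_differentiable frechet_derivative_works[symmetric])
  have d: "of_real (k a * (a \<bullet> x)) * diff_quot a f x = of_real (k a * rpsi (a \<bullet> x)) * (f x - f (refl_root a x))" for a
  proof (cases "a \<bullet> x = 0")
    case True then show ?thesis by (simp add: refl_root_def)
  next
    case False then show ?thesis by (simp add: diff_quot_def rpsi_def)
  qed
  have "cherednik_op P k x f x = bilin l x * f x" using f by (simp add: is_cherednik_kernel_def)
  then show "frechet_derivative f (at x) x = (bilin l x + of_real (rho P k \<bullet> x)) * f x
        - (\<Sum>a\<in>P. of_real (k a * rpsi (a \<bullet> x)) * (f x - f (refl_root a x)))"
    unfolding cherednik_op_def d by (simp add: algebra_simps)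
qed

lemma bilin_add_left: "bilin (l + m) x = bilin l x + bilin m x"
  by (simp add: bilin_def algebra_simps sum.distrib)
lemma bilin_diff_left: "bilin (l - m) x = bilin l x - bilin m x"
  by (simp add: bilin_def algebra_simps sum_subtractf)
lemma bilin_minus_left: "bilin (- l) x = - bilin l x"
  by (simp add: bilin_def sum_negf)
lemma bilin_cvec: "bilin (cvec r) x = of_real (r \<bullet> x)"
  by (simp add: bilin_def inner_vec_def)

text \<open>The difference of two kernels solves the homogeneous Euler equation and vanishes at the origin.\<close>

lemma cherednik_kernel_unique:
  fixes f g :: "real ^ 'n \<Rightarrow> complex"
  assumes k: "\<And>a. a \<in> P \<Longrightarrow> k a \<ge> 0"
    and f: "is_cherednik_kernel P k l f" and g: "is_cherednik_kernel P k l g"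
  shows "f = g"
proof
  fix x
  let ?m = "l + cvec (rho P k)"
  have "norm (f x - g x) \<le> exp ((norm ?m + 1) * norm x) * max (norm (f 0 - g 0)) 0"
  proof (rule euler_bound[where R = "norm x" and s = "\<lambda>_. 0" and b = "bilin ?m" and k = k and P = P
        and f' = "\<lambda>x h. frechet_derivative f (at x) h - frechet_derivative g (at x) h"])
    show "((\<lambda>x. f x - g x) has_derivative (\<lambda>h. frechet_derivative f (at x) h - frechet_derivative g (at x) h)) (at x)" for x
      by (intro has_derivative_diff kernel_euler(1)[OF f] kernel_euler(1)[OF g])
    show "frechet_derivative f (at x) x - frechet_derivative g (at x) x = bilin ?m x * (f x - g x) + 0 -
         (\<Sum>a\<in>P. of_real (k a * rpsi (a \<bullet> x)) * (f x - g x - (f (refl_root a x) - g (refl_root a x))))" for x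
      unfolding kernel_euler(2)[OF f] kernel_euler(2)[OF g]
      by (simp add: bilin_add_left bilin_cvec algebra_simps sum_subtractf sum.distrib)
  qed (use k norm_bilin_le in auto)
  moreover have "f 0 = 1" "g 0 = 1" using f g by (simp_all add: is_cherednik_kernel_def)
  ultimately show "f x = g x" by simp
qed

lemma cherednik_kernel_eqI:
  assumes "\<And>a. a \<in> P \<Longrightarrow> k a \<ge> 0" "is_cherednik_kernel P k l f"
  shows "cherednik_kernel P k l = f"
  unfolding cherednik_kernel_def using assms cherednik_kernel_unique by (blast intro!: the_equality)

section \<open>Tubes around real balls\<close>

text \<open>The holomorphic continuation of \<open>rpsi\<close> to a strip.\<close>

definition cpsi :: "complex \<Rightarrow> complex" where "cpsi u = (if u = 0 then 1 else u / (1 - exp (- u)))"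

lemma cpsi_of_real: "cpsi (of_real x) = of_real (rpsi x)"
  by (simp add: cpsi_def rpsi_def flip: exp_of_real)

lemma exp_minus_eq_1_strip:
  assumes "\<bar>Im u\<bar> < 2 * pi" "1 - exp (- u) = 0" shows "u = 0"
proof -
  have "exp (- u) = 1" using assms by simp
  then obtain n :: int where n: "Re u = 0" "- Im u = of_int (2 * n) * pi" by (auto simp: exp_eq_1)
  have "\<bar>of_int (2 * n) * pi\<bar> < 2 * pi" using n(2) assms(1) by (metis abs_minus_cancel)
  then have "\<bar>real_of_int n\<bar> < 1" by (simp add: abs_mult)
  then have "n = 0" by linarith
  then show ?thesis using n by (simp add: complex_eq_iff)
qed

lemma holomorphic_cpsi: "cpsi holomorphic_on {u. \<bar>Im u\<bar> < 2 * pi}"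
proof -
  let ?S = "{u. \<bar>Im u\<bar> < 2 * pi}"
  have opn: "open ?S" by (intro open_Collect_less continuous_intros)
  have "(\<lambda>u. u / (1 - exp (- u))) holomorphic_on (?S - {0})"
    by (intro holomorphic_intros) (use exp_minus_eq_1_strip in auto)
  then have h: "cpsi holomorphic_on (?S - {0})"
    by (rule holomorphic_transform) (simp add: cpsi_def)
  have c0: "isCont cpsi 0"
  proof -
    have "((\<lambda>u::complex. 1 - exp (- u)) has_field_derivative 1) (at 0)" by (auto intro!: derivative_eq_intros)
    then have "((\<lambda>u::complex. (1 - exp (- u)) / u) \<longlongrightarrow> 1) (at 0)"
      unfolding has_field_derivative_iff by simp
    from tendsto_inverse[OF this] have "((\<lambda>u::complex. u / (1 - exp (- u))) \<longlongrightarrow> 1) (at 0)"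
      by (simp add: inverse_eq_divide)
    moreover have "\<forall>\<^sub>F u in at 0. u / (1 - exp (- u)) = cpsi u"
      by (simp add: eventually_at_filter cpsi_def)
    ultimately have "(cpsi \<longlongrightarrow> 1) (at 0)" by (rule Lim_transform_eventually)
    then show ?thesis by (simp add: isCont_def cpsi_def)
  qed
  have "continuous_on ?S cpsi"
  proof (rule continuous_at_imp_continuous_on, rule ballI)
    fix u assume u: "u \<in> ?S"
    show "isCont cpsi u"
    proof (cases "u = 0")
      case False
      have "open (?S - {0})" using opn by (simp add: open_delete)
      then show ?thesis using holomorphic_on_imp_continuous_on[OF h] u False
        by (simp add: continuous_on_eq_continuous_at)
    qed (use c0 in simp)
  qed
  then show ?thesis by (rule no_isolated_singularity[OF _ h opn]) simp
qed

text \<open>The second bound says that the complex coefficient differs from a positive real number only by a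
  multiple of the imaginary part; it replaces positivity on the complex tube.\<close>

lemma cpsi_compact_bounds:
  obtains B L where "B \<ge> 0" "L \<ge> 0" "\<And>u. \<bar>Re u\<bar> \<le> A \<Longrightarrow> \<bar>Im u\<bar> \<le> 1 \<Longrightarrow> norm (cpsi u) \<le> B"
    "\<And>u. \<bar>Re u\<bar> \<le> A \<Longrightarrow> \<bar>Im u\<bar> \<le> 1 \<Longrightarrow> norm (cpsi u - of_real (rpsi (Re u))) \<le> L * \<bar>Im u\<bar>"
proof -
  let ?S = "{u. \<bar>Im u\<bar> < 2 * pi}"
  define C where "C = cbox (Complex (- A) (- 1)) (Complex A 1)"
  have Cm: "u \<in> C \<longleftrightarrow> \<bar>Re u\<bar> \<le> A \<and> \<bar>Im u\<bar> \<le> 1" for u by (auto simp: C_def in_cbox_complex_iff)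
  have CS: "C \<subseteq> ?S" using pi_gt3 by (auto simp: Cm)
  have opn: "open ?S" by (intro open_Collect_less continuous_intros)
  have cC: "compact C" "convex C" by (auto simp: C_def)
  have bdd: "\<exists>B\<ge>0. \<forall>u\<in>C. norm (h u) \<le> B" if "h holomorphic_on ?S" for h
  proof -
    have "compact (h ` C)"
      by (rule compact_continuous_image[OF _ cC(1)])
         (meson CS holomorphic_on_imp_continuous_on holomorphic_on_subset that)
    then obtain B where "B > 0" "\<forall>x\<in>h ` C. norm x \<le> B" using compact_imp_bounded bounded_pos by metis
    then show ?thesis by (intro exI[of _ B]) auto
  qed
  obtain B where B: "B \<ge> 0" "\<And>u. u \<in> C \<Longrightarrow> norm (cpsi u) \<le> B" using bdd[OF holomorphic_cpsi] by blast
  obtain L where L: "L \<ge> 0" "\<And>u. u \<in> C \<Longrightarrow> norm (deriv cpsi u) \<le> L"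
    using bdd[OF holomorphic_deriv[OF holomorphic_cpsi opn]] by blast
  have lip: "norm (cpsi u - of_real (rpsi (Re u))) \<le> L * \<bar>Im u\<bar>" if u: "\<bar>Re u\<bar> \<le> A" "\<bar>Im u\<bar> \<le> 1" for u
  proof -
    have "norm (cpsi u - cpsi (of_real (Re u))) \<le> L * norm (u - of_real (Re u))"
    proof (rule field_differentiable_bound[OF cC(2)])
      show "(cpsi has_field_derivative deriv cpsi z) (at z within C)" if "z \<in> C" for z
        using holomorphic_derivI[OF holomorphic_cpsi opn] CS that by (metis has_field_derivative_at_within subsetD)
    qed (use L u in \<open>auto simp: Cm\<close>)
    moreover have "u - of_real (Re u) = \<i> * of_real (Im u)" by (simp add: complex_eq_iff)
    ultimately show ?thesis by (simp add: cpsi_of_real norm_mult)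
  qed
  show ?thesis by (rule that[OF B(1) L(1)]) (use B(2) lip in \<open>auto simp: Cm\<close>)
qed

definition reV :: "complex ^ 'n \<Rightarrow> real ^ 'n" where "reV z = (\<chi> i. Re (z $ i))"
definition imV :: "complex ^ 'n \<Rightarrow> real ^ 'n" where "imV z = (\<chi> i. Im (z $ i))"
definition crefl :: "real ^ 'n \<Rightarrow> complex ^ 'n \<Rightarrow> complex ^ 'n"
  where "crefl a z = (\<chi> i. z $ i - 2 * bilin z a / of_real (a \<bullet> a) * of_real (a $ i))"
definition cbil :: "complex ^ 'n \<Rightarrow> complex ^ 'n \<Rightarrow> complex"
  where "cbil l z = (\<Sum>i\<in>UNIV. l $ i * z $ i)"
definition tube :: "real \<Rightarrow> real \<Rightarrow> (complex ^ 'n) set"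
  where "tube R \<delta> = {z. norm (reV z) < R \<and> norm (imV z) < \<delta>}"

lemma reV_nth [simp]: "reV z $ i = Re (z $ i)" by (simp add: reV_def)
lemma imV_nth [simp]: "imV z $ i = Im (z $ i)" by (simp add: imV_def)

lemma reV_cvec [simp]: "reV (cvec x) = x" by (simp add: vec_eq_iff)
lemma imV_cvec [simp]: "imV (cvec x) = 0" by (simp add: vec_eq_iff)

lemma norm_complex_vec: "(norm z)\<^sup>2 = (norm (reV z))\<^sup>2 + (norm (imV z))\<^sup>2"
  by (simp add: norm_vec_def L2_set_def real_sqrt_pow2 sum_nonneg add_nonneg_nonneg cmod_power2 sum.distrib)

lemma Re_bilin: "Re (bilin z a) = reV z \<bullet> a"
  by (simp add: bilin_def inner_vec_def)
lemma Im_bilin: "Im (bilin z a) = imV z \<bullet> a"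
  by (simp add: bilin_def inner_vec_def)

lemma reV_crefl: "reV (crefl a z) = refl_root a (reV z)"
proof -
  have "Re (2 * bilin z a / of_real (a \<bullet> a) * of_real (a $ i)) = 2 * (a \<bullet> reV z) / (a \<bullet> a) * a $ i" for i
    using Re_bilin[of z a] by (simp add: inner_commute Re_divide_of_real)
  then show ?thesis by (simp add: vec_eq_iff crefl_def refl_root_def)
qed

lemma imV_crefl: "imV (crefl a z) = refl_root a (imV z)"
proof -
  have "Im (2 * bilin z a / of_real (a \<bullet> a) * of_real (a $ i)) = 2 * (a \<bullet> imV z) / (a \<bullet> a) * a $ i" for i
    using Im_bilin[of z a] by (simp add: inner_commute Im_divide_of_real)
  then show ?thesis by (simp add: vec_eq_iff crefl_def refl_root_def)
qed

lemma norm_crefl [simp]: "norm (crefl a z) = norm z"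
proof -
  have "(norm (crefl a z))\<^sup>2 = (norm z)\<^sup>2" unfolding norm_complex_vec by (simp add: reV_crefl imV_crefl)
  then show ?thesis by (simp add: power2_eq_iff_nonneg)
qed

lemma crefl_tube [simp]: "crefl a z \<in> tube R \<delta> \<longleftrightarrow> z \<in> tube R \<delta>"
  by (simp add: tube_def reV_crefl imV_crefl)

lemma bilin_cvec_left [simp]: "bilin (cvec x) a = of_real (a \<bullet> x)"
  by (simp add: bilin_cvec inner_commute)

lemma crefl_cvec: "crefl a (cvec x) = cvec (refl_root a x)"
  by (simp add: vec_eq_iff crefl_def refl_root_def)

lemma bilin_cline: "bilin (cline z v c) a = bilin z a + c * bilin v a"
  by (simp add: bilin_def sum.distrib sum_distrib_left algebra_simps)

lemma crefl_cline: "crefl a (cline z v c) = cline (crefl a z) (crefl a v) c"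
  by (simp add: vec_eq_iff crefl_def bilin_cline algebra_simps add_divide_distrib)

lemma continuous_on_bilin [continuous_intros]: "continuous_on X f \<Longrightarrow> continuous_on X (\<lambda>x. bilin (f x) a)"
  unfolding bilin_def by (intro continuous_intros)

lemma continuous_on_crefl [continuous_intros]:
  assumes "continuous_on X f" shows "continuous_on X (\<lambda>x. crefl a (f x))"
proof -
  have eq: "2 * bilin z a / of_real (a \<bullet> a) * of_real (a $ i) = bilin z a * (2 * of_real (a $ i) / of_real (a \<bullet> a))" for z i by simp
  show ?thesis unfolding crefl_def eq using assms by (intro continuous_intros)
qed

lemma continuous_on_reV: "continuous_on X reV" unfolding reV_def by (intro continuous_intros)
lemma continuous_on_imV: "continuous_on X imV" unfolding imV_def by (intro continuous_intros)

lemma open_tube: "open (tube R \<delta>)"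
  unfolding tube_def by (intro open_Collect_conj open_Collect_less continuous_intros continuous_on_reV continuous_on_imV)

lemma tube_scale:
  assumes "z \<in> tube R \<delta>" "0 \<le> t" "t \<le> 1" shows "t *\<^sub>R z \<in> tube R \<delta>"
proof -
  have "reV (t *\<^sub>R z) = t *\<^sub>R reV z" "imV (t *\<^sub>R z) = t *\<^sub>R imV z" by (simp_all add: vec_eq_iff)
  moreover have "t * norm (reV z) \<le> norm (reV z)" "t * norm (imV z) \<le> norm (imV z)"
    using assms by (simp_all add: mult_left_le_one_le)
  ultimately show ?thesis using assms by (auto simp: tube_def)
qed

lemma tube_norm_le:
  assumes "z \<in> tube R \<delta>" shows "norm z \<le> R + \<delta>"
proof -
  have "(norm z)\<^sup>2 \<le> (norm (reV z) + norm (imV z))\<^sup>2" unfolding norm_complex_vec by (simp add: power2_sum)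
  then have "norm z \<le> norm (reV z) + norm (imV z)" by (rule power2_le_imp_le) simp
  then show ?thesis using assms by (simp add: tube_def)
qed

lemma gholo_bilin: "gholo (\<lambda>z. bilin z a) S"
  unfolding bilin_def by (intro gholo_intros)
lemma gholo_cbil: "gholo (\<lambda>z. cbil l z) S"
  unfolding cbil_def by (intro gholo_intros)

lemma cbil_cvec [simp]: "cbil l (cvec x) = bilin l x" by (simp add: cbil_def bilin_def)

lemma norm_cbil_le: "norm (cbil l z) \<le> norm l * norm z"
proof -
  have "norm (cbil l z) \<le> (\<Sum>i\<in>UNIV. \<bar>norm (l $ i)\<bar> * \<bar>norm (z $ i)\<bar>)"
    unfolding cbil_def by (rule order_trans[OF norm_sum]) (simp add: norm_mult)
  also have "\<dots> \<le> L2_set (\<lambda>i. norm (l $ i)) UNIV * L2_set (\<lambda>i. norm (z $ i)) UNIV" by (rule L2_set_mult_ineq)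
  finally show ?thesis by (simp add: norm_vec_def)
qed

section \<open>Solving the Euler equation\<close>

text \<open>With the radial derivative \<open>E\<close>, the Euler equation reads \<open>(E + N) f = euler_rhs P k l N f\<close>. The shift \<open>N\<close>
  is at our disposal.\<close>

definition euler_rhs :: "(real ^ 'n) set \<Rightarrow> (real ^ 'n \<Rightarrow> real) \<Rightarrow> complex ^ 'n \<Rightarrow> nat \<Rightarrow>
    (complex ^ 'n \<Rightarrow> complex) \<Rightarrow> complex ^ 'n \<Rightarrow> complex"
  where "euler_rhs P k l N f z = (of_nat N + cbil l z) * f z
    - (\<Sum>a\<in>P. of_real (k a) * cpsi (bilin z a) * (f z - f (crefl a z)))"

lemma euler_rhs_diff: "euler_rhs P k l N f z - euler_rhs P k l N g z = euler_rhs P k l N (\<lambda>z. f z - g z) z"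
  by (simp add: euler_rhs_def algebra_simps sum_subtractf sum.distrib)

lemma tube_root:
  assumes z: "z \<in> tube R \<delta>" and a: "norm a * \<delta> \<le> 1"
  shows "\<bar>Re (bilin z a)\<bar> \<le> R * norm a" "\<bar>Im (bilin z a)\<bar> \<le> 1" "\<bar>Im (bilin z a)\<bar> \<le> norm a * norm z"
proof -
  have "\<bar>reV z \<bullet> a\<bar> \<le> norm (reV z) * norm a" by (rule Cauchy_Schwarz_ineq2)
  also have "\<dots> \<le> R * norm a" using z by (intro mult_right_mono) (auto simp: tube_def)
  finally show "\<bar>Re (bilin z a)\<bar> \<le> R * norm a" by (simp add: Re_bilin)
  have i: "\<bar>imV z \<bullet> a\<bar> \<le> norm (imV z) * norm a" by (rule Cauchy_Schwarz_ineq2)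
  also have "\<dots> \<le> \<delta> * norm a" using z by (intro mult_right_mono) (auto simp: tube_def)
  finally show "\<bar>Im (bilin z a)\<bar> \<le> 1" using a by (simp add: Im_bilin mult.commute)
  have "(norm (imV z))\<^sup>2 \<le> (norm z)\<^sup>2" by (simp add: norm_complex_vec)
  then have "norm (imV z) \<le> norm z" by (rule power2_le_imp_le) simp
  with i show "\<bar>Im (bilin z a)\<bar> \<le> norm a * norm z"
    by (smt (verit) Im_bilin mult.commute mult_left_mono norm_ge_zero)
qed

lemma gholo_cpsi_bilin:
  assumes "norm a * \<delta> \<le> 1"
  shows "gholo (\<lambda>z. cpsi (bilin z a)) (tube R \<delta>)"
  by (rule gholo_compose_holomorphic[OF gholo_bilin holomorphic_cpsi])
     (use tube_root[OF _ assms] pi_gt3 in fastforce)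

lemma gholo_crefl:
  assumes "gholo f (tube R \<delta>)" shows "gholo (\<lambda>z. f (crefl a z)) (tube R \<delta>)"
  by (rule gholo_compose_affine[OF assms, where M = "crefl a"]) (auto simp: crefl_cline intro!: continuous_intros)

lemma gholo_euler_rhs:
  assumes "\<And>a. a \<in> P \<Longrightarrow> norm a * \<delta> \<le> 1" "gholo f (tube R \<delta>)"
  shows "gholo (euler_rhs P k l N f) (tube R \<delta>)"
  unfolding euler_rhs_def
  by (intro gholo_intros gholo_cbil assms(2) gholo_cpsi_bilin assms(1) gholo_crefl)

text \<open>Let \<open>q\<close> be the sum of the coefficients \<open>k\<^sub>a \<psi>(Re \<langle>a, z\<rangle>)\<close>. If \<open>N\<close> exceeds \<open>q\<close>, then \<open>f z\<close> enters with the
  nonnegative coefficient \<open>N + 1 - q\<close> and the reflected values with total weight \<open>q\<close>, so that the operator has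
  norm \<open>N + 1\<close>, up to an error of order \<open>|z|\<close>. Without the shift the weights would add up to \<open>2 q\<close>.\<close>

lemma euler_rhs_bound:
  fixes P :: "(real ^ 'n) set"
  assumes P: "finite P" and k: "\<And>a. a \<in> P \<Longrightarrow> k a \<ge> 0" and \<delta>: "\<And>a. a \<in> P \<Longrightarrow> norm a * \<delta> \<le> 1" and R: "R > 0"
  shows "\<exists>N c. c \<ge> 0 \<and> (\<forall>z\<in>tube R \<delta>. \<forall>d m. norm (d z) \<le> m \<longrightarrow> (\<forall>a\<in>P. norm (d (crefl a z)) \<le> m) \<longrightarrow>
    norm (euler_rhs P k l (Suc N) d z) \<le> (real (Suc N) + c * norm z) * m)"
proof -
  define A where "A = R * (\<Sum>a\<in>P. norm a)"
  obtain B L where BL: "B \<ge> 0" "L \<ge> 0" "\<And>u. \<bar>Re u\<bar> \<le> A \<Longrightarrow> \<bar>Im u\<bar> \<le> 1 \<Longrightarrow> norm (cpsi u) \<le> B"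
    "\<And>u. \<bar>Re u\<bar> \<le> A \<Longrightarrow> \<bar>Im u\<bar> \<le> 1 \<Longrightarrow> norm (cpsi u - of_real (rpsi (Re u))) \<le> L * \<bar>Im u\<bar>"
    by (rule cpsi_compact_bounds[of A]) (rule that; blast)
  have aA: "R * norm a \<le> A" if "a \<in> P" for a
    unfolding A_def using R that P by (intro mult_left_mono member_le_sum) auto
  \<comment> \<open>\<open>N\<close> dominates the sum \<open>q\<close> on the whole tube\<close>
  obtain N :: nat where N: "(\<Sum>a\<in>P. k a * B) \<le> real N" using real_arch_simple by blast
  define c where "c = norm l + 2 * (\<Sum>a\<in>P. k a * L * norm a)"
  have "norm (euler_rhs P k l (Suc N) d z) \<le> (real (Suc N) + c * norm z) * m"
    if z: "z \<in> tube R \<delta>" and d: "norm (d z) \<le> m" "\<And>a. a \<in> P \<Longrightarrow> norm (d (crefl a z)) \<le> m" for z d m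
  proof -
    have m0: "m \<ge> 0" using d(1) norm_ge_zero order_trans by blast
    let ?c = "\<lambda>a. cpsi (bilin z a)" and ?r = "\<lambda>a. rpsi (Re (bilin z a))"
    have diff: "norm (?c a - of_real (?r a)) \<le> L * norm a * norm z" and rB: "?r a \<le> B" if a: "a \<in> P" for a
    proof -
      note t = tube_root[OF z \<delta>[OF a]]
      have re: "\<bar>Re (bilin z a)\<bar> \<le> A" using t(1) aA[OF a] by linarith
      have "norm (?c a - of_real (?r a)) \<le> L * \<bar>Im (bilin z a)\<bar>" using BL(4) re t(2) by blast
      also have "\<dots> \<le> L * (norm a * norm z)" using t(3) BL(2) by (rule mult_left_mono)
      finally show "norm (?c a - of_real (?r a)) \<le> L * norm a * norm z" by (simp add: mult.assoc)
      have "norm (cpsi (of_real (Re (bilin z a)))) \<le> B" by (rule BL(3)) (use re in auto)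
      then show "?r a \<le> B" by (simp add: cpsi_of_real)
    qed
    let ?q = "\<Sum>a\<in>P. k a * ?r a" and ?E = "\<Sum>a\<in>P. k a * L * norm a"
    have q: "0 \<le> ?q" "?q \<le> real N"
    proof -
      show "0 \<le> ?q" using k rpsi_pos by (intro sum_nonneg mult_nonneg_nonneg) (auto simp: less_imp_le)
      have "?q \<le> (\<Sum>a\<in>P. k a * B)" by (intro sum_mono mult_left_mono rB k)
      then show "?q \<le> real N" using N by simp
    qed
    have dq: "norm ((\<Sum>a\<in>P. of_real (k a) * ?c a) - of_real ?q) \<le> ?E * norm z"
    proof -
      have "(\<Sum>a\<in>P. of_real (k a) * ?c a) - of_real ?q = (\<Sum>a\<in>P. of_real (k a) * (?c a - of_real (?r a)))"
        by (simp add: sum_subtractf algebra_simps)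
      also have "norm \<dots> \<le> (\<Sum>a\<in>P. k a * (L * norm a * norm z))"
        by (rule sum_norm_le) (use k diff in \<open>auto simp: norm_mult intro!: mult_left_mono\<close>)
      also have "\<dots> = ?E * norm z" by (simp only: sum_distrib_right mult.assoc)
      finally show ?thesis .
    qed
    have 1: "norm ((of_nat (Suc N) - (\<Sum>a\<in>P. of_real (k a) * ?c a)) * d z) \<le> (real (Suc N) - ?q + ?E * norm z) * m"
    proof -
      have "of_nat (Suc N) - (\<Sum>a\<in>P. of_real (k a) * ?c a) =
         complex_of_real (real (Suc N) - ?q) - ((\<Sum>a\<in>P. of_real (k a) * ?c a) - of_real ?q)" by simp
      also have "norm \<dots> \<le> norm (complex_of_real (real (Suc N) - ?q)) + ?E * norm z"
        using dq by (rule order_trans[OF norm_triangle_ineq4 add_left_mono])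
      also have "norm (complex_of_real (real (Suc N) - ?q)) = real (Suc N) - ?q"
        using q by (subst norm_of_real) simp
      finally have h: "norm (of_nat (Suc N) - (\<Sum>a\<in>P. of_real (k a) * ?c a)) \<le> real (Suc N) - ?q + ?E * norm z" .
      show ?thesis unfolding norm_mult by (rule mult_mono[OF h d(1)]) (use order_trans[OF norm_ge_zero h] in auto)
    qed
    have 2: "norm (cbil l z * d z) \<le> norm l * norm z * m"
      unfolding norm_mult by (rule mult_mono[OF norm_cbil_le d(1)]) auto
    have 3: "norm (\<Sum>a\<in>P. of_real (k a) * ?c a * d (crefl a z)) \<le> (?q + ?E * norm z) * m"
    proof -
      have "norm (of_real (k a) * ?c a * d (crefl a z)) \<le> k a * (?r a + L * norm a * norm z) * m" if a: "a \<in> P" for a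
      proof -
        have "norm (?c a) \<le> norm (of_real (?r a) :: complex) + norm (?c a - of_real (?r a))"
          by (metis add.commute norm_triangle_sub)
        also have "norm (of_real (?r a) :: complex) = ?r a" using rpsi_pos[of "Re (bilin z a)"] by simp
        finally have "norm (?c a) \<le> ?r a + L * norm a * norm z" using diff[OF a] by simp
        then have le: "k a * norm (?c a) \<le> k a * (?r a + L * norm a * norm z)" using k[OF a] by (rule mult_left_mono)
        have "0 \<le> k a * norm (?c a)" using k[OF a] by simp
        from order_trans[OF this le] have "k a * norm (?c a) * norm (d (crefl a z)) \<le> k a * (?r a + L * norm a * norm z) * m"
          by (rule mult_mono[OF le d(2)[OF a] _ norm_ge_zero])
        then show ?thesis using k[OF a] by (simp add: norm_mult)
      qed
      then have "norm (\<Sum>a\<in>P. of_real (k a) * ?c a * d (crefl a z)) \<le> (\<Sum>a\<in>P. k a * (?r a + L * norm a * norm z) * m)"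
        by (rule sum_norm_le)
      also have "\<dots> = (\<Sum>a\<in>P. k a * ?r a * m + k a * L * norm a * norm z * m)"
        by (rule sum.cong) (simp_all only: distrib_left distrib_right mult.assoc)
      also have "\<dots> = (?q + ?E * norm z) * m"
        by (simp only: sum.distrib distrib_right sum_distrib_right)
      finally show ?thesis .
    qed
    have "euler_rhs P k l (Suc N) d z = (of_nat (Suc N) - (\<Sum>a\<in>P. of_real (k a) * ?c a)) * d z + cbil l z * d z
        + (\<Sum>a\<in>P. of_real (k a) * ?c a * d (crefl a z))"
    proof -
      have "(\<Sum>a\<in>P. of_real (k a) * ?c a * (d z - d (crefl a z))) =
          (\<Sum>a\<in>P. of_real (k a) * ?c a) * d z - (\<Sum>a\<in>P. of_real (k a) * ?c a * d (crefl a z))"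
        by (simp only: right_diff_distrib sum_subtractf sum_distrib_right)
      then show ?thesis unfolding euler_rhs_def by (simp only: left_diff_distrib distrib_right) simp
    qed
    then have "norm (euler_rhs P k l (Suc N) d z) \<le> (real (Suc N) - ?q + ?E * norm z) * m + norm l * norm z * m + (?q + ?E * norm z) * m"
      using order_trans[OF norm_triangle_ineq add_mono[OF order_trans[OF norm_triangle_ineq add_mono[OF 1 2]] 3]] by simp
    also have "\<dots> = (real (Suc N) + c * norm z) * m" by (simp add: c_def algebra_simps)
    finally show ?thesis .
  qed
  moreover have "c \<ge> 0" unfolding c_def using k BL(2) by (intro add_nonneg_nonneg mult_nonneg_nonneg sum_nonneg) auto
  ultimately show ?thesis by blast
qed

text \<open>The inverse of \<open>E + N + 1\<close> on functions regular at the origin, applied to the right-hand side: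
  the derivative of \<open>t ^ (N + 1) * f (t z)\<close> in \<open>t\<close> is \<open>t ^ N * ((E + N + 1) f) (t z)\<close>.\<close>

definition euler_step :: "(real ^ 'n) set \<Rightarrow> (real ^ 'n \<Rightarrow> real) \<Rightarrow> complex ^ 'n \<Rightarrow> nat \<Rightarrow>
    (complex ^ 'n \<Rightarrow> complex) \<Rightarrow> complex ^ 'n \<Rightarrow> complex"
  where "euler_step P k l N f z = integral {0..1} (\<lambda>t. of_real t ^ N * euler_rhs P k l (Suc N) f (t *\<^sub>R z))"

lemma continuous_on_ray:
  assumes "gholo g (tube R \<delta>)" "z \<in> tube R \<delta>"
  shows "continuous_on {0..1} (\<lambda>t. g (t *\<^sub>R z))"
  by (rule continuous_on_compose2[OF gholo_continuous[OF assms(1)]])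
     (auto intro!: continuous_intros tube_scale assms(2))

lemma gholo_euler_step:
  assumes \<delta>: "\<And>a. a \<in> P \<Longrightarrow> norm a * \<delta> \<le> 1" and f: "gholo f (tube R \<delta>)"
  shows "gholo (euler_step P k l N f) (tube R \<delta>)"
  unfolding euler_step_def
proof (rule gholo_param_integral[OF open_tube])
  let ?W = "euler_rhs P k l (Suc N) f"
  have W: "gholo ?W (tube R \<delta>)" by (rule gholo_euler_rhs[OF \<delta> f])
  show "continuous_on ({0..1} \<times> tube R \<delta>) (\<lambda>(t, z). of_real t ^ N * ?W (t *\<^sub>R z))"
    unfolding case_prod_unfold
    by (intro continuous_intros continuous_on_compose2[OF gholo_continuous[OF W]])
       (auto intro: tube_scale)
  fix t :: real assume t: "t \<in> {0..1}"
  have "gholo (\<lambda>z. ?W (t *\<^sub>R z)) (tube R \<delta>)"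
    by (rule gholo_compose_affine[OF W, where M = "\<lambda>v. t *\<^sub>R v"])
       (use t tube_scale in \<open>auto simp: vec_eq_iff algebra_simps intro!: continuous_intros\<close>)
  then show "gholo (\<lambda>z. of_real t ^ N * ?W (t *\<^sub>R z)) (tube R \<delta>)"
    by (intro gholo_mult gholo_const)
qed

text \<open>Successive approximation for \<open>f = euler_step P k l N f\<close>, starting from the constant function \<open>1\<close>. All iterates
  have the value \<open>1\<close> at the origin, so their differences vanish there to first order. In the weight
  \<open>|z| exp (C |z|)\<close> the step contracts by \<open>\<theta> = (N + 1) / (N + 2)\<close>: the factor \<open>|z|\<close> improves the integral of
  \<open>(N + 1) t ^ N\<close> to that of \<open>(N + 1) t ^ (N + 1)\<close>, and the exponential absorbs the error of order \<open>|z|\<close> in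
  \<open>euler_rhs_bound\<close>. The limit is uniform on the tube, hence holomorphic.\<close>

lemma euler_solution:
  fixes P :: "(real ^ 'n) set" and l :: "complex ^ 'n"
  assumes P: "finite P" and k: "\<And>a. a \<in> P \<Longrightarrow> k a \<ge> 0" and \<delta>: "\<And>a. a \<in> P \<Longrightarrow> norm a * \<delta> \<le> 1" and d0: "\<delta> > 0" and R: "R > 0"
  shows "\<exists>G. gholo G (tube R \<delta>) \<and> G 0 = 1 \<and> (\<forall>z\<in>tube R \<delta>. dderiv G z z = cbil l z * G z
    - (\<Sum>a\<in>P. of_real (k a) * cpsi (bilin z a) * (G z - G (crefl a z))))"
proof -
  let ?T = "tube R \<delta> :: (complex ^ 'n) set"
  have "\<exists>N c. c \<ge> 0 \<and> (\<forall>z\<in>?T. \<forall>d m. norm (d z) \<le> m \<longrightarrow> (\<forall>a\<in>P. norm (d (crefl a z)) \<le> m) \<longrightarrow>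
    norm (euler_rhs P k l (Suc N) d z) \<le> (real (Suc N) + c * norm z) * m)"
    by (rule euler_rhs_bound[OF P k \<delta> R])
  then obtain N c where c: "c \<ge> 0" and bound': "\<forall>z\<in>?T. \<forall>d m. norm (d z) \<le> m \<longrightarrow> (\<forall>a\<in>P. norm (d (crefl a z)) \<le> m) \<longrightarrow>
    norm (euler_rhs P k l (Suc N) d z) \<le> (real (Suc N) + c * norm z) * m"
    by (elim exE conjE) (rule that)
  have bound: "norm (euler_rhs P k l (Suc N) d z) \<le> (real (Suc N) + c * norm z) * m"
    if "z \<in> ?T" "norm (d z) \<le> m" "\<And>a. a \<in> P \<Longrightarrow> norm (d (crefl a z)) \<le> m" for z d m
    using bound' that by blast
  let ?W = "euler_rhs P k l (Suc N)" and ?S = "euler_step P k l N"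
  have z0: "0 \<in> ?T" using R d0 by (simp add: tube_def reV_def imV_def zero_vec_def[symmetric])
  have Wint: "(\<lambda>t. of_real t ^ N * ?W f (t *\<^sub>R z)) integrable_on {0..1}" if "gholo f ?T" "z \<in> ?T" for f z
    by (intro integrable_continuous_interval continuous_intros continuous_on_ray[OF gholo_euler_rhs[OF \<delta> that(1)] that(2)])
  have Sdiff: "?S f z - ?S g z = ?S (\<lambda>z. f z - g z) z" if "gholo f ?T" "gholo g ?T" "z \<in> ?T" for f g z
    unfolding euler_step_def integral_diff[OF Wint[OF that(1,3)] Wint[OF that(2,3)], symmetric]
    by (intro integral_cong) (simp add: right_diff_distrib[symmetric] euler_rhs_diff)
  define \<theta> where "\<theta> = real (Suc N) / real (Suc (Suc N))"
  have th: "0 < \<theta>" "\<theta> < 1" "\<theta> * real (Suc (Suc N)) = real (Suc N)" by (simp_all add: \<theta>_def)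
  define C where "C = c / \<theta>"
  have C: "C \<ge> 0" "\<theta> * C = c" using th c by (simp_all add: C_def)
  \<comment> \<open>the contraction estimate in the weight \<open>|z| exp (C |z|)\<close>\<close>
  have contr: "norm (?S d z) \<le> \<theta> * D * (norm z * exp (C * norm z))"
    if d: "gholo d ?T" "\<And>z. z \<in> ?T \<Longrightarrow> norm (d z) \<le> D * (norm z * exp (C * norm z))" and z: "z \<in> ?T" and D: "D \<ge> 0" for d z D
  proof -
    let ?r = "norm z"
    let ?\<Phi> = "\<lambda>t. \<theta> * D * ?r * (t ^ Suc (Suc N) * exp (C * t * ?r))"
    let ?\<phi> = "\<lambda>t. \<theta> * D * ?r * (real (Suc (Suc N)) * t ^ Suc N * exp (C * t * ?r) + t ^ Suc (Suc N) * (exp (C * t * ?r) * (C * ?r)))"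
    have FTC: "(?\<phi> has_integral (?\<Phi> 1 - ?\<Phi> 0)) {0..1}"
    proof (rule fundamental_theorem_of_calculus)
      fix t :: real
      have "(?\<Phi> has_real_derivative ?\<phi> t) (at t)"
        by (rule derivative_eq_intros refl | simp)+
      then show "(?\<Phi> has_vector_derivative ?\<phi> t) (at t within {0..1})"
        by (simp add: has_real_derivative_iff_has_vector_derivative has_vector_derivative_at_within)
    qed simp
    have "norm (?S d z) \<le> integral {0..1} ?\<phi>"
      unfolding euler_step_def
    proof (rule Henstock_Kurzweil_Integration.integral_norm_bound_integral[OF Wint[OF d(1) z]])
      show "?\<phi> integrable_on {0..1}" using FTC by blast
      fix t :: real assume t: "t \<in> {0..1}"
      then have tz: "t *\<^sub>R z \<in> ?T" using z tube_scale by auto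
      let ?m = "D * (t * ?r * exp (C * (t * ?r)))"
      have "norm (?W d (t *\<^sub>R z)) \<le> (real (Suc N) + c * norm (t *\<^sub>R z)) * ?m"
      proof (rule bound[OF tz])
        show "norm (d (t *\<^sub>R z)) \<le> ?m" using d(2)[OF tz] t by simp
        show "norm (d (crefl a (t *\<^sub>R z))) \<le> ?m" for a
          using d(2)[of "crefl a (t *\<^sub>R z)"] tz t by simp
      qed
      then have "t ^ N * norm (?W d (t *\<^sub>R z)) \<le> t ^ N * ((real (Suc N) + c * (t * ?r)) * ?m)"
        using t by (intro mult_left_mono) auto
      also have "\<dots> = ?\<phi> t"
        unfolding C(2)[symmetric] th(3)[symmetric] by (simp add: algebra_simps)
      finally show "norm (of_real t ^ N * ?W d (t *\<^sub>R z)) \<le> ?\<phi> t" using t by (simp add: norm_mult norm_power)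
    qed
    also have "\<dots> = ?\<Phi> 1 - ?\<Phi> 0" using FTC by (rule integral_unique)
    finally show ?thesis by (simp add: mult_ac)
  qed
  define fs where "fs = rec_nat (\<lambda>_. 1) (\<lambda>_. ?S)"
  have fs0: "fs 0 = (\<lambda>_. 1)" and fsS: "fs (Suc j) = ?S (fs j)" for j by (simp_all add: fs_def)
  have hol: "gholo (fs j) ?T" for j
    by (induction j) (auto simp: fs0 fsS intro: gholo_euler_step[OF \<delta>])
  define D where "D = norm l"
  have D0: "D \<ge> 0" by (simp add: D_def)
  have est: "norm (fs (Suc j) z - fs j z) \<le> \<theta> ^ j * D * (norm z * exp (C * norm z))" if "z \<in> ?T" for j z
    using that
  proof (induction j arbitrary: z)
    case 0
    have "?S (\<lambda>_. 1) z - 1 = integral {0..1} (\<lambda>t. of_real t ^ N * (of_real t * cbil l z))"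
    proof -
      have i1: "((\<lambda>t. complex_of_real t ^ N * of_nat (Suc N)) has_integral 1) {0..1}"
      proof -
        have "((\<lambda>t. complex_of_real t ^ N * of_nat (Suc N)) has_integral (complex_of_real 1 ^ Suc N - complex_of_real 0 ^ Suc N)) {0..1}"
          by (rule fundamental_theorem_of_calculus)
             (auto simp del: of_real_power power_Suc of_nat_Suc intro!: derivative_eq_intros has_vector_derivative_real_field)
        then show ?thesis by simp
      qed
      have i2: "(\<lambda>t. complex_of_real t ^ N * (of_real t * cbil l z)) integrable_on {0..1}"
        by (intro integrable_continuous_interval continuous_intros)
      have "cbil l (t *\<^sub>R z) = of_real t * cbil l z" for t
        by (simp add: cbil_def sum_distrib_left scaleR_conv_of_real[of t "_ :: complex"] mult_ac)
      then have "?S (\<lambda>_. 1) z = integral {0..1} (\<lambda>t. complex_of_real t ^ N * of_nat (Suc N) + complex_of_real t ^ N * (of_real t * cbil l z))"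
        by (simp add: euler_step_def euler_rhs_def distrib_left)
      also have "\<dots> = 1 + integral {0..1} (\<lambda>t. complex_of_real t ^ N * (of_real t * cbil l z))"
        by (rule integral_unique[OF has_integral_add[OF i1 integrable_integral[OF i2]]])
      finally show ?thesis by simp
    qed
    also have "norm \<dots> \<le> (D * norm z) * (1 - 0)"
    proof (rule integral_bound)
      show "continuous_on {0..1} (\<lambda>t. complex_of_real t ^ N * (of_real t * cbil l z))" by (intro continuous_intros)
      fix t :: real assume t: "t \<in> {0..1}"
      have "norm (complex_of_real t ^ N * (of_real t * cbil l z)) = t ^ Suc N * norm (cbil l z)"
        using t by (simp add: norm_mult norm_power)
      also have "\<dots> \<le> 1 * (D * norm z)"
        unfolding D_def using t by (intro mult_mono norm_cbil_le power_le_one) auto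
      finally show "norm (complex_of_real t ^ N * (of_real t * cbil l z)) \<le> D * norm z" by simp
    qed simp
    also have "\<dots> \<le> D * (norm z * exp (C * norm z))"
      using D0 C by (auto intro!: mult_left_mono simp: mult_le_cancel_left1)
    finally show ?case by (simp add: fs0 fsS)
  next
    case (Suc j)
    have "norm (?S (\<lambda>z. fs (Suc j) z - fs j z) z) \<le> \<theta> * (\<theta> ^ j * D) * (norm z * exp (C * norm z))"
      by (rule contr[OF gholo_diff[OF hol hol]]) (use Suc th D0 in auto)
    moreover have "fs (Suc (Suc j)) z - fs (Suc j) z = ?S (\<lambda>z. fs (Suc j) z - fs j z) z"
      using Sdiff[OF hol[of "Suc j"] hol[of j] Suc.prems] fsS[of "Suc j"] fsS[of j] by metis
    ultimately show ?case by (simp add: mult_ac)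
  qed
  define B where "B = D * ((R + \<delta>) * exp (C * (R + \<delta>)))"
  have weight: "D * (norm z * exp (C * norm z)) \<le> B" if "z \<in> ?T" for z
    unfolding B_def using tube_norm_le[OF that] D0 C
    by (intro mult_left_mono mult_mono) (auto intro: order_trans[OF norm_ge_zero] mult_left_mono)
  have "uniform_limit ?T (\<lambda>n z. \<Sum>j<n. fs (Suc j) z - fs j z) (\<lambda>z. \<Sum>j. fs (Suc j) z - fs j z) sequentially"
  proof (rule Weierstrass_m_test)
    show "norm (fs (Suc j) z - fs j z) \<le> \<theta> ^ j * B" if "z \<in> ?T" for j z
    proof -
      have "\<theta> ^ j * (D * (norm z * exp (C * norm z))) \<le> \<theta> ^ j * B"
        by (rule mult_left_mono[OF weight[OF that]]) (use th in simp)
      then show ?thesis using est[OF that, of j] by (simp only: mult.assoc)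
    qed
    show "summable (\<lambda>j. \<theta> ^ j * B)" using th by (intro summable_mult2 summable_geometric) auto
  qed
  moreover have "(\<Sum>j<n. fs (Suc j) z - fs j z) = fs n z - 1" for n z
    by (subst sum_lessThan_telescope) (simp add: fs0)
  ultimately have ul0: "uniform_limit ?T (\<lambda>n z. fs n z - 1) (\<lambda>z. \<Sum>j. fs (Suc j) z - fs j z) sequentially" by simp
  define G where "G = (\<lambda>z. 1 + (\<Sum>j. fs (Suc j) z - fs j z))"
  have "uniform_limit ?T (\<lambda>n z. 1 + (fs n z - 1)) G sequentially"
    unfolding G_def by (intro uniform_limit_add uniform_limit_const ul0)
  then have ul: "uniform_limit ?T fs G sequentially" by simp
  have Gh: "gholo G ?T" by (rule gholo_uniform_limit[OF open_tube hol ul])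
  have lim: "(\<lambda>j. fs j z) \<longlonglongrightarrow> G z" if "z \<in> ?T" for z using tendsto_uniform_limitI[OF ul that] .
  have G0: "G 0 = 1"
  proof -
    have "fs j 0 = 1" for j
    proof (induction j)
      case (Suc j)
      then show ?case using est[OF z0, of j] by simp
    qed (simp add: fs0)
    then show ?thesis using lim[OF z0] by (simp add: LIMSEQ_const_iff)
  qed
  have fixp: "G z = ?S G z" if z: "z \<in> ?T" for z
  proof -
    let ?K = "real (Suc N) + c * (R + \<delta>)"
    have K: "?K > 0" using c R d0 by (intro add_pos_nonneg) auto
    have "(\<lambda>j. ?S (fs j) z) \<longlonglongrightarrow> ?S G z"
      unfolding tendsto_iff
    proof (intro allI impI)
      fix e :: real assume e: "e > 0"
      have "\<forall>\<^sub>F j in sequentially. \<forall>w\<in>?T. dist (fs j w) (G w) < e / (2 * ?K)"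
        using ul e K by (simp add: uniform_limit_iff)
      then show "\<forall>\<^sub>F j in sequentially. dist (?S (fs j) z) (?S G z) < e"
      proof eventually_elim
        case (elim j)
        let ?d = "\<lambda>z. fs j z - G z"
        have "norm (integral {0..1} (\<lambda>t. of_real t ^ N * ?W ?d (t *\<^sub>R z))) \<le> (?K * (e / (2 * ?K))) * (1 - 0)"
        proof (rule integral_bound)
          show "continuous_on {0..1} (\<lambda>t. of_real t ^ N * ?W ?d (t *\<^sub>R z))"
            by (intro continuous_intros continuous_on_ray[OF gholo_euler_rhs[OF \<delta> gholo_diff[OF hol Gh]] z])
          fix t :: real assume t: "t \<in> {0..1}"
          then have tz: "t *\<^sub>R z \<in> ?T" using z tube_scale by auto
          have "norm (?W ?d (t *\<^sub>R z)) \<le> (real (Suc N) + c * norm (t *\<^sub>R z)) * (e / (2 * ?K))"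
          proof (rule bound[OF tz])
            show "norm (fs j (t *\<^sub>R z) - G (t *\<^sub>R z)) \<le> e / (2 * ?K)"
              using elim tz by (force simp: dist_norm)
            show "norm (fs j (crefl a (t *\<^sub>R z)) - G (crefl a (t *\<^sub>R z))) \<le> e / (2 * ?K)" for a
              using elim[rule_format, of "crefl a (t *\<^sub>R z)"] tz by (simp add: dist_norm)
          qed
          also have "\<dots> \<le> ?K * (e / (2 * ?K))"
            using tube_norm_le[OF tz] c e K by (intro mult_right_mono add_left_mono mult_left_mono) auto
          finally have "t ^ N * norm (?W ?d (t *\<^sub>R z)) \<le> 1 * (?K * (e / (2 * ?K)))"
            using t e K by (intro mult_mono power_le_one) auto
          then show "norm (of_real t ^ N * ?W ?d (t *\<^sub>R z)) \<le> ?K * (e / (2 * ?K))"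
            using t by (simp add: norm_mult norm_power)
        qed simp
        also have "\<dots> < e"
        proof -
          have "K * (e / (2 * K)) = e / 2" if "K > 0" for K :: real using that by simp
          from this[OF K] show ?thesis using e by (simp only:) simp
        qed
        finally have "norm (?S ?d z) < e" by (simp only: euler_step_def)
        then show ?case by (simp only: dist_norm Sdiff[OF hol Gh z])
      qed
    qed
    moreover have "(\<lambda>j. ?S (fs j) z) \<longlonglongrightarrow> G z" using LIMSEQ_Suc[OF lim[OF z]] by (simp add: fsS)
    ultimately show ?thesis by (rule LIMSEQ_unique[symmetric])
  qed
  have ode: "dderiv G z z = ?W G z - of_nat (Suc N) * G z" if z: "z \<in> ?T" for z
  proof -
    \<comment> \<open>extend slightly beyond \<open>z\<close> on its ray\<close>
    have "\<exists>s1>1. s1 *\<^sub>R z \<in> ?T"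
    proof -
      have "continuous_on UNIV (\<lambda>s::real. s *\<^sub>R z)" by (intro continuous_intros)
      then have "open ((\<lambda>s::real. s *\<^sub>R z) -` ?T)" by (rule open_vimage[OF open_tube])
      moreover have "1 \<in> (\<lambda>s::real. s *\<^sub>R z) -` ?T" using z by simp
      ultimately obtain e where "e > 0" "ball 1 e \<subseteq> (\<lambda>s::real. s *\<^sub>R z) -` ?T" using openE by blast
      then show ?thesis by (intro exI[of _ "1 + e / 2"]) (auto simp: subset_iff dist_real_def)
    qed
    then obtain s1 where s1: "s1 > 1" "s1 *\<^sub>R z \<in> ?T" by blast
    have inT: "s *\<^sub>R z \<in> ?T" if "0 \<le> s" "s \<le> s1" for s
      using tube_scale[OF s1(2), of "s / s1"] that s1 by simp
    define f where "f = (\<lambda>\<tau>. complex_of_real \<tau> ^ N * ?W G (\<tau> *\<^sub>R z))"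
    have contf: "continuous_on {0..s1} f"
      unfolding f_def
      by (intro continuous_intros continuous_on_compose2[OF gholo_continuous[OF gholo_euler_rhs[OF \<delta> Gh]]])
         (use inT in auto)
    have J: "integral {0..s} f = of_real s ^ Suc N * G (s *\<^sub>R z)" if s: "0 \<le> s" "s \<le> s1" for s
    proof -
      have "((\<lambda>t. s *\<^sub>R f (s * t)) has_integral (integral {s * 0..s * 1} f)) {0..1}"
      proof (rule has_integral_substitution[where c = 0 and d = s1])
        show "(*) s ` {0..1} \<subseteq> {0..s1}" using s by (auto intro: order_trans[OF mult_left_le])
        show "((*) s has_real_derivative s) (at x within {0..1})" for x by (auto intro!: derivative_eq_intros)
      qed (use s contf in auto)
      then have "((\<lambda>t. s *\<^sub>R f (s * t)) has_integral (integral {0..s} f)) {0..1}" by simp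
      then have "integral {0..s} f = integral {0..1} (\<lambda>t. s *\<^sub>R f (s * t))" by (rule integral_unique[symmetric])
      also have "\<dots> = integral {0..1} (\<lambda>t. of_real s ^ Suc N * (of_real t ^ N * ?W G (t *\<^sub>R s *\<^sub>R z)))"
        by (rule integral_cong) (simp add: f_def scaleR_conv_of_real[of s "_ :: complex"] power_mult_distrib mult_ac)
      also have "\<dots> = of_real s ^ Suc N * ?S G (s *\<^sub>R z)"
        by (simp add: euler_step_def)
      finally show ?thesis using fixp[OF inT[OF s]] by simp
    qed
    have "((\<lambda>s. integral {0..s} f) has_vector_derivative f 1) (at 1 within {0..s1})"
      by (rule integral_has_vector_derivative[OF contf]) (use s1 in auto)
    then have "((\<lambda>s. of_real s ^ Suc N * G (s *\<^sub>R z)) has_vector_derivative f 1) (at 1 within {0..s1})"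
      by (rule has_vector_derivative_transform[rotated 2]) (use J s1 in auto)
    moreover have "at (1::real) within {0..s1} = at 1" by (rule at_within_interior) (use s1 in auto)
    ultimately have v1: "((\<lambda>s. of_real s ^ Suc N * G (s *\<^sub>R z)) has_vector_derivative f 1) (at 1)" by simp
    have dG: "(G has_derivative (\<lambda>h. dderiv G h z)) (at (1 *\<^sub>R z))"
      using gholo_has_derivative[OF open_tube Gh z] by simp
    have "((\<lambda>s::real. s *\<^sub>R z) has_derivative (\<lambda>t. t *\<^sub>R z)) (at 1)" by (auto intro!: derivative_eq_intros)
    from has_derivative_compose[OF this dG]
    have "((\<lambda>s. G (s *\<^sub>R z)) has_derivative (\<lambda>t. dderiv G (t *\<^sub>R z) z)) (at 1)" .
    moreover have "dderiv G (t *\<^sub>R z) z = t *\<^sub>R dderiv G z z" for t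
      by (rule linear_scale[OF bounded_linear.linear[OF has_derivative_bounded_linear[OF gholo_has_derivative[OF open_tube Gh z]]]])
    ultimately have v2: "((\<lambda>s. G (s *\<^sub>R z)) has_vector_derivative dderiv G z z) (at 1)"
      by (simp add: has_vector_derivative_def)
    have v3: "((\<lambda>s. complex_of_real s ^ Suc N) has_vector_derivative of_nat (Suc N)) (at 1)"
      by (rule has_vector_derivative_eq_rhs, rule has_vector_derivative_real_field)
         (auto simp del: power_Suc intro!: derivative_eq_intros)
    have "((\<lambda>s. of_real s ^ Suc N * G (s *\<^sub>R z)) has_vector_derivative
       (of_real 1 ^ Suc N * dderiv G z z + of_nat (Suc N) * G (1 *\<^sub>R z))) (at 1)"
      by (rule has_vector_derivative_mult[OF v3 v2])
    from vector_derivative_unique_at[OF this v1]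
    have "dderiv G z z + of_nat (Suc N) * G z = ?W G z" by (simp add: f_def)
    then show ?thesis by (simp add: algebra_simps)
  qed
  show ?thesis
  proof (intro exI[of _ G] conjI ballI Gh G0)
    fix z assume "z \<in> ?T"
    from ode[OF this] show "dderiv G z z = cbil l z * G z - (\<Sum>a\<in>P. of_real (k a) * cpsi (bilin z a) * (G z - G (crefl a z)))"
      by (simp add: euler_rhs_def algebra_simps)
  qed
qed

section \<open>Difference quotients along roots\<close>

text \<open>The difference quotient \<open>(1 - s\<^sub>a) f / (1 - e\<^sup>-\<^sup>a)\<close> off the hyperplane \<open>a\<^sup>\<bottom>\<close>.\<close>

definition Del :: "real ^ 'n \<Rightarrow> (real ^ 'n \<Rightarrow> complex) \<Rightarrow> real ^ 'n \<Rightarrow> complex"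
  where "Del a f x = (f x - f (refl_root a x)) / of_real (1 - exp (- (a \<bullet> x)))"

text \<open>The holomorphic extension of \<open>Del a G\<close> across the hyperplane: \<open>G z - G (s\<^sub>a z)\<close> is the integral of the
  derivative along the segment from \<open>s\<^sub>a z\<close> to \<open>z\<close>, a multiple of \<open>a\<close> of length proportional to \<open>\<langle>a, z\<rangle>\<close>.\<close>

definition cDel :: "real ^ 'n \<Rightarrow> (complex ^ 'n \<Rightarrow> complex) \<Rightarrow> complex ^ 'n \<Rightarrow> complex"
  where "cDel a G z = cpsi (bilin z a) * (of_real (2 / (a \<bullet> a)) *
    integral {0..1} (\<lambda>t. dderiv G (cvec a) ((1 - t) *\<^sub>R z + t *\<^sub>R crefl a z)))"

lemma dderiv_unique:
  assumes "open S" "gholo F S" "z \<in> S" "(F has_derivative F') (at z)"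
  shows "dderiv F v z = F' v"
  using has_derivative_unique[OF gholo_has_derivative[OF assms(1-3)] assms(4)] by (rule fun_cong)

lemma linear_dderiv:
  assumes "open S" "gholo F S" "z \<in> S" shows "linear (\<lambda>v. dderiv F v z)"
  by (rule bounded_linear.linear[OF has_derivative_bounded_linear[OF gholo_has_derivative[OF assms]]])

lemma dderiv_cvec_expand:
  fixes F :: "complex ^ 'n \<Rightarrow> complex"
  assumes "open S" "gholo F S" "z \<in> S"
  shows "dderiv F (cvec v) z = (\<Sum>i\<in>UNIV. of_real (v $ i) * dderiv F (axis i 1) z)"
proof -
  have e: "cvec v = (\<Sum>i\<in>UNIV. (v $ i) *\<^sub>R axis i 1)"
    by (simp add: vec_eq_iff axis_def if_distrib[where f = "\<lambda>x. _ *\<^sub>R x"] scaleR_conv_of_real[of _ "1::complex"] cong: if_cong)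
  show ?thesis
    unfolding e linear_sum[OF linear_dderiv[OF assms]] linear_scale[OF linear_dderiv[OF assms]]
    by (simp add: scaleR_conv_of_real)
qed

lemma tube_segment:
  assumes z: "z \<in> tube R \<delta>" and t: "0 \<le> t" "t \<le> 1"
  shows "(1 - t) *\<^sub>R z + t *\<^sub>R crefl a z \<in> tube R \<delta>"
proof -
  have "norm ((1 - t) *\<^sub>R x + t *\<^sub>R refl_root a x) \<le> norm x" for x
  proof -
    have "norm ((1 - t) *\<^sub>R x + t *\<^sub>R refl_root a x) \<le> norm ((1 - t) *\<^sub>R x) + norm (t *\<^sub>R refl_root a x)" by (rule norm_triangle_ineq)
    also have "\<dots> = norm x" unfolding norm_scaleR norm_refl_root using t by (simp add: algebra_simps)
    finally show ?thesis .
  qed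
  moreover have "reV ((1 - t) *\<^sub>R z + t *\<^sub>R crefl a z) = (1 - t) *\<^sub>R reV z + t *\<^sub>R refl_root a (reV z)"
    unfolding reV_crefl[symmetric] by (simp add: vec_eq_iff)
  moreover have "imV ((1 - t) *\<^sub>R z + t *\<^sub>R crefl a z) = (1 - t) *\<^sub>R imV z + t *\<^sub>R refl_root a (imV z)"
    unfolding imV_crefl[symmetric] by (simp add: vec_eq_iff)
  ultimately show ?thesis using z by (auto simp: tube_def intro: le_less_trans)
qed

lemma gholo_cDel:
  assumes \<delta>: "norm a * \<delta> \<le> 1" and G: "gholo G (tube R \<delta>)"
  shows "gholo (cDel a G) (tube R \<delta>)"
  unfolding cDel_def
proof (intro gholo_mult gholo_const gholo_cpsi_bilin[OF \<delta>] gholo_param_integral open_tube)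
  have D: "gholo (dderiv G (cvec a)) (tube R \<delta>)" by (rule gholo_dderiv[OF open_tube G])
  show "continuous_on ({0..1} \<times> tube R \<delta>) (\<lambda>(t, z). dderiv G (cvec a) ((1 - t) *\<^sub>R z + t *\<^sub>R crefl a z))"
    unfolding case_prod_unfold
    by (intro continuous_intros continuous_on_compose2[OF gholo_continuous[OF D]])
       (auto intro: tube_segment)
  fix t :: real assume t: "t \<in> {0..1}"
  show "gholo (\<lambda>z. dderiv G (cvec a) ((1 - t) *\<^sub>R z + t *\<^sub>R crefl a z)) (tube R \<delta>)"
  proof (rule gholo_compose_affine[OF D, where M = "\<lambda>v. (1 - t) *\<^sub>R v + t *\<^sub>R crefl a v"])
    show "(1 - t) *\<^sub>R cline z v c + t *\<^sub>R crefl a (cline z v c) =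
       cline ((1 - t) *\<^sub>R z + t *\<^sub>R crefl a z) ((1 - t) *\<^sub>R v + t *\<^sub>R crefl a v) c" for z v c
      by (simp add: vec_eq_iff crefl_cline algebra_simps)
  qed (use t in \<open>auto intro: tube_segment intro!: continuous_intros\<close>)
qed

lemma cDel_eq:
  assumes G: "gholo G (tube R \<delta>)" and z: "z \<in> tube R \<delta>" and a: "a \<noteq> 0"
  shows "bilin z a * cDel a G z = cpsi (bilin z a) * (G z - G (crefl a z))"
proof -
  let ?u = "bilin z a"
  let ?p = "\<lambda>t. (1 - t) *\<^sub>R z + t *\<^sub>R crefl a z"
  let ?w = "2 * ?u / of_real (a \<bullet> a)"
  have p: "?p t = z - t *\<^sub>R (\<chi> i. ?w * cvec a $ i)" for t
    by (simp add: vec_eq_iff crefl_def algebra_simps)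
  have "((\<lambda>t. - (?w * dderiv G (cvec a) (?p t))) has_integral (G (?p 1) - G (?p 0))) {0..1}"
  proof (rule fundamental_theorem_of_calculus)
    fix t :: real assume t: "t \<in> {0..1}"
    then have pt: "?p t \<in> tube R \<delta>" using tube_segment[OF z] by auto
    have "(?p has_derivative (\<lambda>h. h *\<^sub>R (- (\<chi> i. ?w * cvec a $ i)))) (at t)"
      unfolding p by (auto intro!: derivative_eq_intros)
    from has_derivative_compose[OF this gholo_has_derivative[OF open_tube G pt]]
    have "((\<lambda>t. G (?p t)) has_derivative (\<lambda>h. dderiv G (h *\<^sub>R (- (\<chi> i. ?w * cvec a $ i))) (?p t))) (at t)" .
    moreover have "dderiv G (h *\<^sub>R (- (\<chi> i. ?w * cvec a $ i))) (?p t) = h *\<^sub>R (- (?w * dderiv G (cvec a) (?p t)))" for h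
    proof -
      have "dderiv G (\<chi> i. ?w * cvec a $ i) (?p t) = ?w * dderiv G (cvec a) (?p t)"
        by (rule dderiv_scale[OF open_tube G pt])
      then show ?thesis
        by (simp only: linear_scale[OF linear_dderiv[OF open_tube G pt]] linear_neg[OF linear_dderiv[OF open_tube G pt]])
    qed
    ultimately have "((\<lambda>t. G (?p t)) has_vector_derivative - (?w * dderiv G (cvec a) (?p t))) (at t)"
      by (simp add: has_vector_derivative_def)
    then show "((\<lambda>t. G (?p t)) has_vector_derivative - (?w * dderiv G (cvec a) (?p t))) (at t within {0..1})"
      by (rule has_vector_derivative_at_within)
  qed simp
  then have "integral {0..1} (\<lambda>t. - (?w * dderiv G (cvec a) (?p t))) = G (?p 1) - G (?p 0)"
    by (rule integral_unique)
  also have "\<dots> = G (crefl a z) - G z" by simp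
  finally have "integral {0..1} (\<lambda>t. - (?w * dderiv G (cvec a) (?p t))) = G (crefl a z) - G z" .
  moreover have "integral {0..1} (\<lambda>t. - (?w * dderiv G (cvec a) (?p t))) = - (?w * integral {0..1} (\<lambda>t. dderiv G (cvec a) (?p t)))"
    by (simp only: integral_neg integral_mult_right)
  ultimately have "- (?w * integral {0..1} (\<lambda>t. dderiv G (cvec a) (?p t))) = G (crefl a z) - G z"
    by (simp only:)
  moreover have "u = B - A" if "- u = A - B" for u A B :: complex using that by (metis minus_diff_eq minus_minus)
  ultimately have e: "?w * integral {0..1} (\<lambda>t. dderiv G (cvec a) (?p t)) = G z - G (crefl a z)"
    by blast
  show ?thesis unfolding e[symmetric] cDel_def by (simp add: mult_ac)
qed

lemma cDel_regular:
  assumes G: "gholo G (tube R \<delta>)" and z: "z \<in> tube R \<delta>" and a: "a \<noteq> 0" and u: "bilin z a \<noteq> 0"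
  shows "cDel a G z = (G z - G (crefl a z)) / (1 - exp (- bilin z a))"
proof -
  have "bilin z a * cDel a G z = bilin z a * ((G z - G (crefl a z)) / (1 - exp (- bilin z a)))"
    using cDel_eq[OF G z a] u by (simp add: cpsi_def)
  then show ?thesis by (rule iffD1[OF mult_left_cancel[OF u]])
qed

lemma regular_dense:
  fixes P :: "(real ^ 'n) set"
  assumes P: "finite P" "\<And>a. a \<in> P \<Longrightarrow> a \<noteq> 0" and U: "open U" "U \<noteq> {}"
  shows "\<exists>x\<in>U. \<forall>a\<in>P. a \<bullet> x \<noteq> 0"
proof (rule ccontr)
  assume "\<not> ?thesis"
  then have "U \<subseteq> (\<Union>a\<in>P. {x. a \<bullet> x = 0})" by auto
  moreover have "negligible (\<Union>a\<in>P. {x. a \<bullet> x = 0})"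
  proof (rule negligible_Union)
    show "finite ((\<lambda>a. {x. a \<bullet> x = 0}) ` P)" using P by simp
    show "negligible t" if "t \<in> (\<lambda>a. {x. a \<bullet> x = 0}) ` P" for t
    proof -
      obtain a where "a \<in> P" "t = {x. a \<bullet> x = 0}" using \<open>t \<in> _\<close> by blast
      then show ?thesis using negligible_hyperplane[of a 0] P(2) by simp
    qed
  qed
  ultimately have "negligible U" using negligible_subset by blast
  then show False using open_not_negligible U by blast
qed

text \<open>On the hyperplane the limit in the definition of \<open>diff_quot\<close> exists because \<open>cDel\<close> is continuous.\<close>

lemma diff_quot_eq:
  fixes f :: "real ^ 'n \<Rightarrow> complex"
  assumes G: "gholo G (tube R \<delta>)" and \<delta>: "norm a * \<delta> \<le> 1" "\<delta> > 0" and a: "a \<noteq> 0"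
    and f: "\<And>y. norm y < R \<Longrightarrow> f y = G (cvec y)" and x: "norm x < R"
  shows "diff_quot a f x = cDel a G (cvec x)"
proof -
  have inT: "cvec y \<in> tube R \<delta>" if "norm y < R" for y using that \<delta> by (simp add: tube_def)
  define q where "q = (\<lambda>y. (f y - f (refl_root a y)) / of_real (1 - exp (- (a \<bullet> y))))"
  have reg: "q y = cDel a G (cvec y)" if "norm y < R" "a \<bullet> y \<noteq> 0" for y
    using cDel_regular[OF G inT[OF that(1)] a] that
    by (simp add: q_def f crefl_cvec exp_of_real[symmetric])
  show ?thesis
  proof (cases "a \<bullet> x = 0")
    case False
    then show ?thesis using reg[OF x] by (simp add: diff_quot_def q_def)
  next
    case True
    let ?S = "{y. a \<bullet> y \<noteq> 0}"
    have "isCont (\<lambda>y. cDel a G (cvec y)) x"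
    proof -
      have "isCont (cDel a G) (cvec x)"
        using gholo_continuous[OF gholo_cDel[OF \<delta>(1) G]] inT[OF x] open_tube continuous_on_eq_continuous_at by blast
      moreover have "isCont cvec x" using bounded_linear_cvec by (rule linear_continuous_at)
      ultimately show ?thesis by (rule isCont_o2[rotated])
    qed
    then have "((\<lambda>y. cDel a G (cvec y)) \<longlongrightarrow> cDel a G (cvec x)) (at x within ?S)"
      unfolding isCont_def by (rule tendsto_within_subset) simp
    moreover have "\<forall>\<^sub>F y in at x within ?S. cDel a G (cvec y) = q y"
    proof -
      have "\<forall>\<^sub>F y in at x within ?S. y \<in> ?S" by (simp add: eventually_at_filter)
      moreover have "\<forall>\<^sub>F y in at x within ?S. norm (y - x) < R - norm x"
        unfolding eventually_at by (rule exI[of _ "R - norm x"]) (use x in \<open>auto simp: dist_norm\<close>)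
      ultimately show ?thesis
      proof eventually_elim
        case (elim y)
        then have "norm y < R" using norm_triangle_sub[of y x] by linarith
        then show ?case using reg elim by auto
      qed
    qed
    ultimately have lim: "(q \<longlongrightarrow> cDel a G (cvec x)) (at x within ?S)" by (rule Lim_transform_eventually)
    have "at x within ?S \<noteq> bot"
    proof -
      have "x islimpt ?S"
        unfolding islimpt_approachable
      proof (intro allI impI)
        fix e :: real assume e: "e > 0"
        let ?y = "x + (e / (2 * norm a)) *\<^sub>R a"
        have "a \<bullet> ?y \<noteq> 0" using True a e by (simp add: inner_add_right)
        moreover have "?y \<noteq> x" using a e by simp
        moreover have "dist ?y x < e" using a e by (simp add: dist_norm)
        ultimately show "\<exists>x'\<in>?S. x' \<noteq> x \<and> dist x' x < e" by blast
      qed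
      then show ?thesis by (simp add: trivial_limit_within)
    qed
    then have "Lim (at x within ?S) q = cDel a G (cvec x)" using lim by (rule tendsto_Lim)
    then show ?thesis using True by (simp add: diff_quot_def q_def)
  qed
qed

section \<open>The eigenvalue equations follow from the Euler equation\<close>

text \<open>What the existence proof needs from a root system. The assumption \<open>comm\<close> is the part of
  \<open>[D\<^sub>i, D\<^sub>j] = 0\<close> that contains no derivatives, for \<open>D\<^sub>i\<close> the Cherednik operator of the \<open>i\<close>-th basis vector; it is
  asked only at regular points.\<close>

locale commuting_roots =
  fixes P :: "(real ^ 'n) set" and k :: "real ^ 'n \<Rightarrow> real"
  assumes finP: "finite P" and nz: "a \<in> P \<Longrightarrow> a \<noteq> 0" and k0: "a \<in> P \<Longrightarrow> k a \<ge> 0"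
    and regular_refl: "(\<And>c. c \<in> P \<Longrightarrow> c \<bullet> x \<noteq> 0) \<Longrightarrow> a \<in> P \<Longrightarrow> b \<in> P \<Longrightarrow> b \<bullet> refl_root a x \<noteq> 0"
    and comm: "(\<And>a. a \<in> P \<Longrightarrow> a \<bullet> x \<noteq> 0) \<Longrightarrow>
      (\<Sum>a\<in>P. \<Sum>b\<in>P. of_real (k a * k b * (a $ i * b $ j - a $ j * b $ i)) * Del a (Del b f) x) = 0"
begin

text \<open>The failure of the eigenvalue equation \<open>D\<^sub>j G = l\<^sub>j G\<close>. The vector \<open>\<rho>(k)\<close> is absorbed into \<open>l\<close>.\<close>

definition defect :: "complex ^ 'n \<Rightarrow> (complex ^ 'n \<Rightarrow> complex) \<Rightarrow> 'n \<Rightarrow> complex ^ 'n \<Rightarrow> complex"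
  where "defect l G j z = dderiv G (axis j 1) z + (\<Sum>a\<in>P. of_real (k a * a $ j) * cDel a G z) - l $ j * G z"

end

locale euler_extension = commuting_roots P k for P :: "(real ^ 'n) set" and k +
  fixes l :: "complex ^ 'n" and G R \<delta>
  assumes \<delta>: "a \<in> P \<Longrightarrow> norm a * \<delta> \<le> 1" "\<delta> > 0"
    and G: "gholo G (tube R \<delta>)"
    and euler: "z \<in> tube R \<delta> \<Longrightarrow> dderiv G z z = cbil l z * G z
    - (\<Sum>a\<in>P. of_real (k a) * cpsi (bilin z a) * (G z - G (crefl a z)))"
begin

abbreviation "T \<equiv> tube R \<delta>"

lemma inT: "norm x < R \<Longrightarrow> cvec x \<in> T" using \<delta> by (simp add: tube_def)

lemma gholo_defect: "gholo (defect l G j) T"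
  unfolding defect_def by (intro gholo_intros gholo_dderiv[OF open_tube] gholo_cDel \<delta>(1) G)

lemma dderiv_defect:
  assumes z: "z \<in> T"
  shows "dderiv (defect l G j) v z = dderiv (dderiv G (axis j 1)) v z
    + (\<Sum>a\<in>P. of_real (k a * a $ j) * dderiv (cDel a G) v z) - l $ j * dderiv G v z"
proof (rule dderiv_unique[OF open_tube gholo_defect z])
  show "(defect l G j has_derivative (\<lambda>v. dderiv (dderiv G (axis j 1)) v z
    + (\<Sum>a\<in>P. of_real (k a * a $ j) * dderiv (cDel a G) v z) - l $ j * dderiv G v z)) (at z)"
    unfolding defect_def
    by (intro has_derivative_diff has_derivative_add has_derivative_sum has_derivative_mult_right
       gholo_has_derivative[OF open_tube _ z] gholo_dderiv[OF open_tube] gholo_cDel \<delta>(1) G)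
qed

text \<open>This is the Euler equation, which is the eigenvalue equation in the radial direction.\<close>

lemma radial_defect:
  assumes x: "norm x < R"
  shows "(\<Sum>i\<in>UNIV. of_real (x $ i) * defect l G i (cvec x)) = 0"
proof -
  note z = inT[OF x]
  have "(\<Sum>i\<in>UNIV. of_real (x $ i) * defect l G i (cvec x)) =
      (\<Sum>i\<in>UNIV. of_real (x $ i) * dderiv G (axis i 1) (cvec x))
      + (\<Sum>i\<in>UNIV. \<Sum>a\<in>P. of_real (k a) * (of_real (x $ i) * of_real (a $ i)) * cDel a G (cvec x)) - bilin l x * G (cvec x)"
  proof -
    have "of_real (x $ i) * defect l G i (cvec x) = of_real (x $ i) * dderiv G (axis i 1) (cvec x)
      + (\<Sum>a\<in>P. of_real (k a) * (of_real (x $ i) * of_real (a $ i)) * cDel a G (cvec x)) - l $ i * of_real (x $ i) * G (cvec x)" for i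
    proof -
      have "of_real (x $ i) * (\<Sum>a\<in>P. of_real (k a * a $ i) * cDel a G (cvec x)) =
         (\<Sum>a\<in>P. of_real (k a) * (of_real (x $ i) * of_real (a $ i)) * cDel a G (cvec x))"
        unfolding sum_distrib_left by (rule sum.cong) (simp_all add: mult_ac)
      then show ?thesis unfolding defect_def by (simp only: distrib_left right_diff_distrib) (simp add: mult_ac)
    qed
    then show ?thesis by (simp only: bilin_def sum.distrib sum_subtractf sum_distrib_right)
  qed
  also have "(\<Sum>i\<in>UNIV. \<Sum>a\<in>P. of_real (k a) * (of_real (x $ i) * of_real (a $ i)) * cDel a G (cvec x))
      = (\<Sum>a\<in>P. of_real (k a) * (of_real (a \<bullet> x) * cDel a G (cvec x)))"
  proof -
    have "(\<Sum>i\<in>UNIV. of_real (k a) * (of_real (x $ i) * of_real (a $ i)) * cDel a G (cvec x)) =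
       of_real (k a) * (of_real (a \<bullet> x) * cDel a G (cvec x))" for a
    proof -
      have "complex_of_real (a \<bullet> x) = (\<Sum>i\<in>UNIV. of_real (x $ i) * of_real (a $ i))"
        by (simp add: inner_vec_def mult.commute)
      then show ?thesis by (simp only: sum_distrib_left sum_distrib_right mult.assoc)
    qed
    then show ?thesis by (subst sum.swap) simp
  qed
  also have "\<dots> = (\<Sum>a\<in>P. of_real (k a) * cpsi (bilin (cvec x) a) * (G (cvec x) - G (crefl a (cvec x))))"
    by (rule sum.cong) (use cDel_eq[OF G z] nz in auto)
  also have "(\<Sum>i\<in>UNIV. of_real (x $ i) * dderiv G (axis i 1) (cvec x)) = dderiv G (cvec x) (cvec x)"
    by (rule dderiv_cvec_expand[OF open_tube G z, symmetric])
  finally show ?thesis using euler[OF z] by simp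
qed

text \<open>Along a direction orthogonal to \<open>a\<close> the factor \<open>1 / (1 - e\<^sup>-\<^sup>a)\<close> is constant, and \<open>s\<^sub>a\<close> fixes the direction.\<close>

lemma dderiv_cDel_tangent:
  assumes z: "z \<in> T" and a: "a \<in> P" and u: "bilin z a \<noteq> 0" and v: "v \<bullet> a = 0"
  shows "dderiv (cDel a G) (cvec v) z = (dderiv G (cvec v) z - dderiv G (cvec v) (crefl a z)) / (1 - exp (- bilin z a))"
proof -
  have az: "crefl a z \<in> T" using z by simp
  have ev: "\<forall>\<^sub>F c in nhds 0. cDel a G (cline z (cvec v) c) =
      (G (cline z (cvec v) c) - G (cline (crefl a z) (cvec v) c)) / (1 - exp (- bilin z a))"
  proof -
    have "\<forall>\<^sub>F c in nhds 0. c \<in> {c. cline z (cvec v) c \<in> T}"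
      using open_cline_preimage[OF open_tube] z by (intro eventually_nhds_in_open) auto
    then show ?thesis
    proof eventually_elim
      case (elim c)
      have va: "bilin (cvec v) a = 0" using v by (simp add: inner_commute)
      then have "crefl a (cvec v) = cvec v" by (simp add: crefl_def vec_eq_iff)
      then show ?case
        using cDel_regular[OF G _ nz[OF a], of "cline z (cvec v) c"] elim u va
        by (simp add: bilin_cline crefl_cline)
    qed
  qed
  have d: "((\<lambda>c. G (cline w (cvec v) c)) has_field_derivative dderiv G (cvec v) w) (at 0)" if "w \<in> T" for w
    using slice_differentiable[OF open_tube G that, of "cvec v"] by (simp add: dderiv_def field_differentiable_derivI)
  have "((\<lambda>c. (G (cline z (cvec v) c) - G (cline (crefl a z) (cvec v) c)) / (1 - exp (- bilin z a))) has_field_derivative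
      (dderiv G (cvec v) z - dderiv G (cvec v) (crefl a z)) / (1 - exp (- bilin z a))) (at 0)"
    by (intro DERIV_cdivide DERIV_diff d z az)
  then have "((\<lambda>c. cDel a G (cline z (cvec v) c)) has_field_derivative
      (dderiv G (cvec v) z - dderiv G (cvec v) (crefl a z)) / (1 - exp (- bilin z a))) (at 0)"
    using DERIV_cong_ev[OF refl ev refl] by blast
  then show ?thesis unfolding dderiv_def[of "cDel a G"] by (rule DERIV_imp_deriv)
qed

text \<open>The identity \<open>(D\<^sub>i - l\<^sub>i) (D\<^sub>j - l\<^sub>j) G = (D\<^sub>j - l\<^sub>j) (D\<^sub>i - l\<^sub>i) G\<close>. Second derivatives of \<open>G\<close> are symmetric; the terms
  with one derivative involve only the direction \<open>a\<^sub>j e\<^sub>i - a\<^sub>i e\<^sub>j\<close>, which is orthogonal to \<open>a\<close>, so that the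
  derivative passes through the difference quotient; the rest is \<open>comm\<close>.\<close>

lemma curl_defect:
  assumes x: "norm x < R" and reg: "\<And>a. a \<in> P \<Longrightarrow> a \<bullet> x \<noteq> 0"
  shows "dderiv (defect l G j) (axis i 1) (cvec x) - dderiv (defect l G i) (axis j 1) (cvec x)
    + (\<Sum>a\<in>P. of_real (k a) / of_real (1 - exp (- (a \<bullet> x))) *
        (of_real (a $ i) * (defect l G j (cvec x) - defect l G j (cvec (refl_root a x)))
       - of_real (a $ j) * (defect l G i (cvec x) - defect l G i (cvec (refl_root a x)))))
    - l $ i * defect l G j (cvec x) + l $ j * defect l G i (cvec x) = 0"
proof -
  let ?z = "cvec x" and ?s = "\<lambda>a. cvec (refl_root a x)"
  let ?f = "\<lambda>x. G (cvec x)"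
  let ?ph = "\<lambda>a. 1 / complex_of_real (1 - exp (- (a \<bullet> x)))"
  note z = inT[OF x]
  have zs: "?s a \<in> T" for a using x by (intro inT) simp
  have u: "bilin ?z a \<noteq> 0" if "a \<in> P" for a using reg[OF that] by simp
  define d where "d = (\<lambda>i. dderiv G (axis i 1) ?z)"
  define ds where "ds = (\<lambda>a i. dderiv G (axis i 1) (?s a))"
  define D where "D = (\<lambda>a. cDel a G ?z)"
  define Ds where "Ds = (\<lambda>b a. cDel a G (?s b))"
  define F where "F = G ?z"
  define Fs where "Fs = (\<lambda>a. G (?s a))"
  define w where "w = (\<lambda>a. (of_real (a $ j) * d i - of_real (a $ i) * d j) - (of_real (a $ j) * ds a i - of_real (a $ i) * ds a j))"
  have DD: "D a = ?ph a * (F - Fs a)" if "a \<in> P" for a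
    using cDel_regular[OF G z nz[OF that] u[OF that]] by (simp add: D_def F_def Fs_def crefl_cvec exp_of_real[symmetric])
  have Dr: "Del b ?f y = cDel b G (cvec y)" if "b \<in> P" "norm y < R" "b \<bullet> y \<noteq> 0" for b y
    using cDel_regular[OF G inT[OF that(2)] nz[OF that(1)]] that by (simp add: Del_def crefl_cvec exp_of_real[symmetric])
  have DelDel: "Del a (Del b ?f) x = ?ph a * (D b - Ds a b)" if "a \<in> P" "b \<in> P" for a b
    using Dr[OF that(2) x reg[OF that(2)]] Dr[OF that(2), of "refl_root a x"] regular_refl[OF reg that] x
    by (simp add: Del_def[of a] D_def Ds_def)
  have tang: "of_real (a $ j) * dderiv (cDel a G) (axis i 1) ?z - of_real (a $ i) * dderiv (cDel a G) (axis j 1) ?z = ?ph a * w a"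
    if a: "a \<in> P" for a
  proof -
    let ?v = "a $ j *\<^sub>R axis i 1 - a $ i *\<^sub>R axis j 1 :: real ^ 'n"
    have cv: "cvec ?v = a $ j *\<^sub>R axis i 1 - a $ i *\<^sub>R axis j 1"
      by (simp add: vec_eq_iff axis_def scaleR_conv_of_real[of _ "1::complex"])
    have ex: "dderiv H (cvec ?v) y = of_real (a $ j) * dderiv H (axis i 1) y - of_real (a $ i) * dderiv H (axis j 1) y"
      if "gholo H T" "y \<in> T" for H y
      unfolding cv linear_diff[OF linear_dderiv[OF open_tube that]] linear_scale[OF linear_dderiv[OF open_tube that]]
      by (simp only: scaleR_conv_of_real)
    have "?v \<bullet> a = 0" by (simp add: inner_diff_left inner_axis' )
    from dderiv_cDel_tangent[OF z a u[OF a] this]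
    show ?thesis
      unfolding ex[OF gholo_cDel[OF \<delta>(1)[OF a] G] z] ex[OF G z] ex[OF G zs] crefl_cvec bilin_cvec_left
      unfolding w_def d_def ds_def by (simp add: exp_of_real[symmetric])
  qed
  have defx: "defect l G j ?z = d j + (\<Sum>b\<in>P. of_real (k b * b $ j) * D b) - l $ j * F" for j
    by (simp add: defect_def d_def D_def F_def)
  have defs: "defect l G j (?s a) = ds a j + (\<Sum>b\<in>P. of_real (k b * b $ j) * Ds a b) - l $ j * Fs a" for a j
    by (simp add: defect_def ds_def Ds_def Fs_def)
  have sym: "dderiv (dderiv G (axis j 1)) (axis i 1) ?z = dderiv (dderiv G (axis i 1)) (axis j 1) ?z"
    by (rule dderiv_commute[OF open_tube G z])
  have c1: "dderiv (defect l G j) (axis i 1) ?z - dderiv (defect l G i) (axis j 1) ?z =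
      (\<Sum>a\<in>P. of_real (k a) * (?ph a * w a)) - l $ j * d i + l $ i * d j"
  proof -
    have "(\<Sum>a\<in>P. of_real (k a * a $ j) * dderiv (cDel a G) (axis i 1) ?z) - (\<Sum>a\<in>P. of_real (k a * a $ i) * dderiv (cDel a G) (axis j 1) ?z)
       = (\<Sum>a\<in>P. of_real (k a) * (of_real (a $ j) * dderiv (cDel a G) (axis i 1) ?z - of_real (a $ i) * dderiv (cDel a G) (axis j 1) ?z))"
      by (simp add: sum_subtractf right_diff_distrib mult.assoc)
    also have "\<dots> = (\<Sum>a\<in>P. of_real (k a) * (?ph a * w a))" by (rule sum.cong) (simp_all only: tang)
    finally show ?thesis unfolding dderiv_defect[OF z] sym by (simp add: d_def)
  qed
  let ?C = "\<lambda>a. \<Sum>b\<in>P. of_real (k b * (a $ i * b $ j - a $ j * b $ i)) * (D b - Ds a b)"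
  have c2: "of_real (a $ i) * (defect l G j ?z - defect l G j (?s a)) - of_real (a $ j) * (defect l G i ?z - defect l G i (?s a))
     = - w a + ?C a - (of_real (a $ i) * l $ j - of_real (a $ j) * l $ i) * (F - Fs a)" for a
    unfolding defx defs w_def
    by (simp add: sum_distrib_left sum_subtractf sum.distrib algebra_simps)
  have c3: "(\<Sum>a\<in>P. of_real (k a) * ?ph a * ?C a) = 0"
  proof -
    have "(\<Sum>a\<in>P. of_real (k a) * ?ph a * ?C a) =
      (\<Sum>a\<in>P. \<Sum>b\<in>P. of_real (k a * k b * (a $ i * b $ j - a $ j * b $ i)) * Del a (Del b ?f) x)"
      by (intro sum.cong refl) (simp add: sum_distrib_left DelDel mult_ac)
    also have "\<dots> = 0" by (rule comm[OF reg])
    finally show ?thesis .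
  qed
  have c4: "(\<Sum>a\<in>P. of_real (k a) / of_real (1 - exp (- (a \<bullet> x))) *
        (of_real (a $ i) * (defect l G j ?z - defect l G j (?s a)) - of_real (a $ j) * (defect l G i ?z - defect l G i (?s a))))
     = - (\<Sum>a\<in>P. of_real (k a) * (?ph a * w a)) - (\<Sum>a\<in>P. of_real (k a) * (of_real (a $ i) * l $ j - of_real (a $ j) * l $ i) * D a)"
  proof -
    have "(\<Sum>a\<in>P. of_real (k a) / of_real (1 - exp (- (a \<bullet> x))) *
        (of_real (a $ i) * (defect l G j ?z - defect l G j (?s a)) - of_real (a $ j) * (defect l G i ?z - defect l G i (?s a))))
      = (\<Sum>a\<in>P. - (of_real (k a) * (?ph a * w a)) + of_real (k a) * ?ph a * ?C a
          - of_real (k a) * (of_real (a $ i) * l $ j - of_real (a $ j) * l $ i) * D a)"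
    proof (rule sum.cong)
      fix a assume a: "a \<in> P"
      have g: "K / p * (- W + C - m * X) = - (K * (1 / p * W)) + K * (1 / p) * C - K * m * (1 / p * X)" for K p W C m X :: complex
        by (cases "p = 0") (auto simp: field_simps)
      show "of_real (k a) / of_real (1 - exp (- (a \<bullet> x))) *
        (of_real (a $ i) * (defect l G j ?z - defect l G j (?s a)) - of_real (a $ j) * (defect l G i ?z - defect l G i (?s a)))
        = - (of_real (k a) * (?ph a * w a)) + of_real (k a) * ?ph a * ?C a
          - of_real (k a) * (of_real (a $ i) * l $ j - of_real (a $ j) * l $ i) * D a"
        unfolding c2 DD[OF a] by (rule g)
    qed simp
    also have "\<dots> = - (\<Sum>a\<in>P. of_real (k a) * (?ph a * w a)) + (\<Sum>a\<in>P. of_real (k a) * ?ph a * ?C a)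
       - (\<Sum>a\<in>P. of_real (k a) * (of_real (a $ i) * l $ j - of_real (a $ j) * l $ i) * D a)"
      by (simp only: sum.distrib sum_subtractf sum_negf)
    finally show ?thesis unfolding c3 by simp
  qed
  have c5: "(\<Sum>a\<in>P. of_real (k a) * (of_real (a $ i) * l $ j - of_real (a $ j) * l $ i) * D a) =
     l $ j * (\<Sum>b\<in>P. of_real (k b * b $ i) * D b) - l $ i * (\<Sum>b\<in>P. of_real (k b * b $ j) * D b)"
    by (simp add: sum_distrib_left sum_subtractf algebra_simps)
  show ?thesis unfolding c1 c4 c5 unfolding defx by (simp add: algebra_simps)
qed

end

lemma cvec_axis [simp]: "cvec (axis i 1) = axis i 1"
  by (simp add: vec_eq_iff axis_def)

lemma has_derivative_vec_lambda:
  fixes f :: "'i::finite \<Rightarrow> 'a::real_normed_vector \<Rightarrow> 'b::euclidean_space"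
  assumes "\<And>j. (f j has_derivative f' j) (at x)"
  shows "((\<lambda>x. \<chi> j. f j x) has_derivative (\<lambda>h. \<chi> j. f' j h)) (at x)"
proof (rule iffD2[OF has_derivative_componentwise_within], rule ballI)
  fix b :: "'b ^ 'i" assume "b \<in> Basis"
  then obtain j u where b: "b = axis j u" by (auto simp: Basis_vec_def)
  have "((\<lambda>x. inner (f j x) u) has_derivative (\<lambda>h. inner (f' j h) u)) (at x)"
    by (rule has_derivative_inner_left[OF assms])
  then show "((\<lambda>x. inner (\<chi> j. f j x) b) has_derivative (\<lambda>h. inner (\<chi> j. f' j h) b)) (at x)"
    unfolding b inner_axis by simp
qed

context euler_extension
begin

definition defect_vec :: "real ^ 'n \<Rightarrow> complex ^ 'n" where "defect_vec x = (\<chi> j. defect l G j (cvec x))"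

lemma defect_vec_nth [simp]: "defect_vec x $ j = defect l G j (cvec x)" by (simp add: defect_vec_def)

lemma defect_real_derivative:
  assumes "norm x < R"
  shows "((\<lambda>x. defect l G j (cvec x)) has_derivative (\<lambda>h. dderiv (defect l G j) (cvec h) (cvec x))) (at x)"
  by (rule gholo_real_has_derivative[OF open_tube gholo_defect inT[OF assms]])

lemma radial_defect_derivative:
  assumes x: "norm x < R"
  shows "defect l G j (cvec x) + (\<Sum>i\<in>UNIV. of_real (x $ i) * dderiv (defect l G i) (axis j 1) (cvec x)) = 0"
proof -
  let ?F = "\<lambda>x. \<Sum>i\<in>UNIV. complex_of_real (x $ i) * defect l G i (cvec x)"
  have nth: "((\<lambda>x. complex_of_real (x $ i)) has_derivative (\<lambda>h. of_real (h $ i))) (at x)" for i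
    by (rule bounded_linear_imp_has_derivative)
       (rule bounded_linear_compose[OF bounded_linear_of_real bounded_linear_vec_nth])
  have "(?F has_derivative (\<lambda>h. \<Sum>i\<in>UNIV. of_real (x $ i) * dderiv (defect l G i) (cvec h) (cvec x)
      + of_real (h $ i) * defect l G i (cvec x))) (at x)"
    by (intro has_derivative_sum has_derivative_mult nth defect_real_derivative x)
  moreover have "(?F has_derivative (\<lambda>h. 0)) (at x)"
  proof (rule has_derivative_transform_within_open[of "\<lambda>_. 0" _ _ _ "ball 0 R"])
    show "0 = ?F y" if "y \<in> ball 0 R" for y using radial_defect[of y] that by simp
  qed (use x in auto)
  ultimately have "(\<lambda>h. \<Sum>i\<in>UNIV. of_real (x $ i) * dderiv (defect l G i) (cvec h) (cvec x)
      + of_real (h $ i) * defect l G i (cvec x)) = (\<lambda>h. 0)" by (rule has_derivative_unique)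
  from fun_cong[OF this, of "axis j 1"]
  have "(\<Sum>i\<in>UNIV. of_real (x $ i) * dderiv (defect l G i) (axis j 1) (cvec x))
      + (\<Sum>i\<in>UNIV. of_real (axis j (1::real) $ i) * defect l G i (cvec x)) = 0"
    by (simp only: sum.distrib cvec_axis)
  moreover have "(\<Sum>i\<in>UNIV. complex_of_real (axis j 1 $ i) * g i) = g j" for g
  proof -
    have "complex_of_real (axis j 1 $ i) * g i = (if i = j then g i else 0)" for i by (simp add: axis_def)
    then show ?thesis by simp
  qed
  ultimately show ?thesis by (simp add: add.commute)
qed

text \<open>Contract \<open>curl_defect\<close> with \<open>x\<close> and eliminate the radial component of the defect by \<open>radial_defect\<close> at
  \<open>x\<close> and at \<open>s\<^sub>a x\<close>. The reflection terms combine into the natural action of \<open>s\<^sub>a\<close> on vector fields.\<close>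

lemma defect_euler_regular:
  assumes x: "norm x < R" and reg: "\<And>a. a \<in> P \<Longrightarrow> a \<bullet> x \<noteq> 0"
  shows "(\<Sum>i\<in>UNIV. of_real (x $ i) * dderiv (defect l G j) (axis i 1) (cvec x)) + defect l G j (cvec x)
    - bilin l x * defect l G j (cvec x)
    + (\<Sum>a\<in>P. of_real (k a) * cpsi (bilin (cvec x) a) *
        (defect l G j (cvec x) - crefl a (defect_vec (refl_root a x)) $ j)) = 0"
proof -
  define g where "g = (\<lambda>j. defect l G j (cvec x))"
  define gs where "gs = (\<lambda>a j. defect l G j (cvec (refl_root a x)))"
  define e where "e = (\<lambda>i j. dderiv (defect l G j) (axis i 1) (cvec x))"
  define K where "K = (\<lambda>a. complex_of_real (k a) / of_real (1 - exp (- (a \<bullet> x))))"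
  let ?x = "\<lambda>i. complex_of_real (x $ i)" and ?a = "\<lambda>a i. complex_of_real (a $ i)"
  have B: "e i j - e j i + (\<Sum>a\<in>P. K a * (?a a i * (g j - gs a j) - ?a a j * (g i - gs a i))) - l $ i * g j + l $ j * g i = 0" for i
    using curl_defect[OF x reg, of j i] unfolding e_def g_def gs_def K_def by simp
  have rad: "(\<Sum>i\<in>UNIV. ?x i * g i) = 0" using radial_defect[OF x] by (simp add: g_def)
  have dif: "(\<Sum>i\<in>UNIV. ?x i * e j i) = - g j" using radial_defect_derivative[OF x, of j] by (simp add: e_def g_def add_eq_0_iff)
  have rads: "(\<Sum>i\<in>UNIV. ?x i * gs a i) = 2 * of_real (a \<bullet> x) / of_real (a \<bullet> a) * bilin (defect_vec (refl_root a x)) a" for a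
  proof -
    have "(\<Sum>i\<in>UNIV. complex_of_real (refl_root a x $ i) * gs a i) = 0"
      using radial_defect[of "refl_root a x"] x by (simp add: gs_def)
    moreover have "complex_of_real (refl_root a x $ i) * gs a i = ?x i * gs a i - 2 * of_real (a \<bullet> x) / of_real (a \<bullet> a) * (gs a i * ?a a i)" for i
      by (simp add: refl_root_def algebra_simps)
    ultimately have "(\<Sum>i\<in>UNIV. ?x i * gs a i) - 2 * of_real (a \<bullet> x) / of_real (a \<bullet> a) * (\<Sum>i\<in>UNIV. gs a i * ?a a i) = 0"
      by (simp only: sum_subtractf sum_distrib_left)
    then show ?thesis by (simp add: bilin_def gs_def)
  qed
  have "0 = (\<Sum>i\<in>UNIV. ?x i * (e i j - e j i + (\<Sum>a\<in>P. K a * (?a a i * (g j - gs a j) - ?a a j * (g i - gs a i))) - l $ i * g j + l $ j * g i))"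
    unfolding B by simp
  also have "\<dots> = (\<Sum>i\<in>UNIV. ?x i * e i j) - (\<Sum>i\<in>UNIV. ?x i * e j i)
     + (\<Sum>i\<in>UNIV. \<Sum>a\<in>P. K a * (?a a i * ?x i * (g j - gs a j) - ?a a j * (?x i * g i - ?x i * gs a i)))
     - (\<Sum>i\<in>UNIV. l $ i * ?x i * g j) + (\<Sum>i\<in>UNIV. l $ j * (?x i * g i))"
  proof -
    have "?x i * (e i j - e j i + (\<Sum>a\<in>P. K a * (?a a i * (g j - gs a j) - ?a a j * (g i - gs a i))) - l $ i * g j + l $ j * g i)
      = ?x i * e i j - ?x i * e j i + (\<Sum>a\<in>P. K a * (?a a i * ?x i * (g j - gs a j) - ?a a j * (?x i * g i - ?x i * gs a i)))
       - l $ i * ?x i * g j + l $ j * (?x i * g i)" for i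
    proof -
      have "?x i * (\<Sum>a\<in>P. K a * (?a a i * (g j - gs a j) - ?a a j * (g i - gs a i))) =
         (\<Sum>a\<in>P. K a * (?a a i * ?x i * (g j - gs a j) - ?a a j * (?x i * g i - ?x i * gs a i)))"
        unfolding sum_distrib_left by (rule sum.cong) (simp_all add: algebra_simps)
      then show ?thesis by (simp only: distrib_left right_diff_distrib) (simp add: mult_ac)
    qed
    then show ?thesis by (simp only: sum.distrib sum_subtractf)
  qed
  also have "(\<Sum>i\<in>UNIV. \<Sum>a\<in>P. K a * (?a a i * ?x i * (g j - gs a j) - ?a a j * (?x i * g i - ?x i * gs a i)))
     = (\<Sum>a\<in>P. of_real (k a) * cpsi (bilin (cvec x) a) * (g j - crefl a (defect_vec (refl_root a x)) $ j))"
  proof (subst sum.swap, rule sum.cong)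
    fix a assume a: "a \<in> P"
    let ?b = "bilin (defect_vec (refl_root a x)) a"
    have ax: "(\<Sum>i\<in>UNIV. ?a a i * ?x i) = of_real (a \<bullet> x)" by (simp add: inner_vec_def)
    have "(\<Sum>i\<in>UNIV. K a * (?a a i * ?x i * (g j - gs a j) - ?a a j * (?x i * g i - ?x i * gs a i)))
      = K a * ((\<Sum>i\<in>UNIV. ?a a i * ?x i) * (g j - gs a j) - ?a a j * ((\<Sum>i\<in>UNIV. ?x i * g i) - (\<Sum>i\<in>UNIV. ?x i * gs a i)))"
      by (simp only: sum_distrib_left sum_distrib_right sum_subtractf right_diff_distrib)
    also have "\<dots> = K a * of_real (a \<bullet> x) * (g j - (gs a j - 2 * ?b / of_real (a \<bullet> a) * ?a a j))"
      unfolding ax rad rads by (simp add: algebra_simps)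
    also have "K a * of_real (a \<bullet> x) = of_real (k a) * cpsi (bilin (cvec x) a)"
      using reg[OF a] by (simp add: K_def cpsi_of_real rpsi_def)
    also have "gs a j - 2 * ?b / of_real (a \<bullet> a) * ?a a j = crefl a (defect_vec (refl_root a x)) $ j"
      by (simp add: crefl_def gs_def)
    finally show "(\<Sum>i\<in>UNIV. K a * (?a a i * ?x i * (g j - gs a j) - ?a a j * (?x i * g i - ?x i * gs a i)))
      = of_real (k a) * cpsi (bilin (cvec x) a) * (g j - crefl a (defect_vec (refl_root a x)) $ j)" .
  qed simp
  also have "(\<Sum>i\<in>UNIV. l $ i * ?x i * g j) = bilin l x * g j" by (simp add: bilin_def sum_distrib_right)
  also have "(\<Sum>i\<in>UNIV. l $ j * (?x i * g i)) = 0" using rad by (simp flip: sum_distrib_left)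
  finally show ?thesis unfolding dif by (simp add: e_def g_def algebra_simps)
qed

lemma continuous_gholo_cvec: "gholo H T \<Longrightarrow> continuous_on (ball 0 R) (\<lambda>x. H (cvec x))"
  by (rule continuous_on_compose2[OF gholo_continuous])
     (use inT bounded_linear_cvec in \<open>auto intro: linear_continuous_on\<close>)

text \<open>The left-hand side is continuous, and regular points are dense.\<close>

lemma defect_euler:
  assumes x: "norm x < R"
  shows "(\<Sum>i\<in>UNIV. of_real (x $ i) * dderiv (defect l G j) (axis i 1) (cvec x)) + defect l G j (cvec x)
    - bilin l x * defect l G j (cvec x)
    + (\<Sum>a\<in>P. of_real (k a) * cpsi (bilin (cvec x) a) *
        (defect l G j (cvec x) - crefl a (defect_vec (refl_root a x)) $ j)) = 0" (is "?\<Phi> x = 0")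
proof (rule ccontr)
  assume nonzero: "?\<Phi> x \<noteq> 0"
  have refl: "crefl a (defect_vec (refl_root a y)) $ j = defect l G j (crefl a (cvec y))
    - 2 * (\<Sum>i\<in>UNIV. defect l G i (crefl a (cvec y)) * of_real (a $ i)) / of_real (a \<bullet> a) * of_real (a $ j)" for a y
    by (simp add: crefl_def[of a "defect_vec _"] bilin_def crefl_cvec)
  have gD: "gholo (\<lambda>z. defect l G i (crefl a z)) T" for a i by (rule gholo_crefl[OF gholo_defect])
  have "gholo (\<lambda>z. (\<Sum>i\<in>UNIV. z $ i * dderiv (defect l G j) (axis i 1) z) + defect l G j z
    - cbil l z * defect l G j z
    + (\<Sum>a\<in>P. of_real (k a) * cpsi (bilin z a) *
        (defect l G j z - (defect l G j (crefl a z)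
    - 2 * (\<Sum>i\<in>UNIV. defect l G i (crefl a z) * of_real (a $ i)) * of_real (inverse (a \<bullet> a)) * of_real (a $ j))))) T"
    by (intro gholo_intros gholo_dderiv[OF open_tube] gholo_defect gholo_cbil gholo_cpsi_bilin \<delta>(1) gD)
  then have cont: "continuous_on (ball 0 R) ?\<Phi>"
    unfolding refl by (rule continuous_on_eq[OF continuous_gholo_cvec]) (simp add: divide_inverse)
  have "open (ball 0 R \<inter> ?\<Phi> -` (- {0}))"
    by (rule continuous_open_preimage[OF cont]) auto
  moreover have "x \<in> ball 0 R \<inter> ?\<Phi> -` (- {0})" using x nonzero by simp
  ultimately obtain y where "y \<in> ball 0 R \<inter> ?\<Phi> -` (- {0})" "\<forall>a\<in>P. a \<bullet> y \<noteq> 0"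
    using regular_dense[OF finP nz, of "ball 0 R \<inter> ?\<Phi> -` (- {0})"] by blast
  then show False using defect_euler_regular[of y j] by auto
qed

lemma inner_crefl_nonneg:
  assumes "norm (w :: complex ^ 'n) \<le> norm v" shows "inner v (v - crefl a w) \<ge> 0"
proof -
  have "inner v (crefl a w) \<le> norm v * norm (crefl a w)" by (rule norm_cauchy_schwarz)
  also have "\<dots> \<le> norm v * norm v" using assms by (intro mult_left_mono) auto
  finally show ?thesis by (simp add: inner_diff_right power2_norm_eq_inner[symmetric] power2_eq_square)
qed

lemma defect_vec_derivative_radial:
  assumes x: "norm x < R"
  shows "(\<chi> j. dderiv (defect l G j) (cvec x) (cvec x)) =
    (\<chi> j. bilin l x * defect_vec x $ j) - defect_vec x - (\<Sum>a\<in>P. (k a * rpsi (a \<bullet> x)) *\<^sub>R (defect_vec x - crefl a (defect_vec (refl_root a x))))"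
  using defect_euler[OF x] 
  by (simp add: vec_eq_iff dderiv_cvec_expand[OF open_tube gholo_defect inT[OF x]] cpsi_of_real
      scaleR_conv_of_real[of _ "_ :: complex"] algebra_simps add_eq_0_iff)

text \<open>The vector of defects solves a homogeneous Euler equation in which \<open>s\<^sub>a\<close> acts on values by an isometry, so
  the maximum principle works as in the scalar case. The additional term \<open>- g\<close> makes the vector vanish at the
  origin: there the equation says that \<open>g\<close> is minus a combination of terms with nonnegative inner product
  with \<open>g\<close>.\<close>

lemma defect_zero:
  assumes x: "norm x < R"
  shows "defect l G j (cvec x) = 0"
proof -
  define r where "r = norm x"
  have sumpos: "(\<Sum>a\<in>P. (k a * rpsi (a \<bullet> y)) * inner (defect_vec y) (defect_vec y - crefl a (defect_vec (refl_root a y)))) \<ge> 0"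
    if "\<And>w. norm w = norm y \<Longrightarrow> norm (defect_vec w) \<le> norm (defect_vec y)" for y
    by (intro sum_nonneg mult_nonneg_nonneg k0 inner_crefl_nonneg) (use that rpsi_pos in \<open>auto simp: less_imp_le\<close>)
  have "defect_vec 0 = 0"
  proof -
    have R: "norm (0::real^'n) < R" using x norm_ge_zero[of x] by (simp, linarith)
    have c0: "cvec (0 :: real ^ 'n) = 0" by (simp add: vec_eq_iff)
    have d0: "dderiv (defect l G j) 0 0 = 0" for j
    proof -
      have "(0 :: complex ^ 'n) \<in> T" using inT[OF R] by (simp only: c0)
      from linear_0[OF linear_dderiv[OF open_tube gholo_defect this]] show ?thesis .
    qed
    have "(0 :: complex ^ 'n) = (\<chi> j. bilin l 0 * defect_vec 0 $ j) - defect_vec 0 - (\<Sum>a\<in>P. (k a * rpsi (a \<bullet> 0)) *\<^sub>R (defect_vec 0 - crefl a (defect_vec (refl_root a 0))))"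
      using defect_vec_derivative_radial[OF R] by (simp only: c0 d0) (simp add: vec_eq_iff)
    then have "defect_vec 0 = - (\<Sum>a\<in>P. (k a * rpsi (a \<bullet> 0)) *\<^sub>R (defect_vec 0 - crefl a (defect_vec (refl_root a 0))))"
      by (simp add: bilin_def vec_eq_iff algebra_simps eq_neg_iff_add_eq_0)
    from arg_cong[OF this, of "inner (defect_vec 0)"]
    have "inner (defect_vec 0) (defect_vec 0) = - (\<Sum>a\<in>P. (k a * rpsi (a \<bullet> 0)) * inner (defect_vec 0) (defect_vec 0 - crefl a (defect_vec (refl_root a 0))))"
      by (simp only: inner_minus_right inner_scaleR_right inner_sum_right)
    then have "inner (defect_vec 0) (defect_vec 0) \<le> 0" using sumpos[of 0] by simp
    then have "\<not> inner (defect_vec 0) (defect_vec 0) > 0" by (rule leD)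
    then show ?thesis unfolding inner_gt_zero_iff by (rule notnotD)
  qed
  moreover have "norm (defect_vec x) \<le> exp ((norm l + 1) * norm x) * max (norm (defect_vec 0)) 0"
  proof (rule radial_maximum_principle[where R = r and f' = "\<lambda>x h. \<chi> j. dderiv (defect l G j) (cvec h) (cvec x)"])
    show "(defect_vec has_derivative (\<lambda>h. \<chi> j. dderiv (defect l G j) (cvec h) (cvec y))) (at y)" if "norm y \<le> r" for y
      unfolding defect_vec_def[abs_def] by (rule has_derivative_vec_lambda[OF defect_real_derivative]) (use that x in \<open>simp add: r_def\<close>)
    fix y assume y: "norm y \<le> r" "y \<noteq> 0" and mx: "\<And>w. norm w = norm y \<Longrightarrow> norm (defect_vec w) \<le> norm (defect_vec y)"
    have yR: "norm y < R" using y x by (simp add: r_def)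
    have "inner (defect_vec y) (\<chi> j. dderiv (defect l G j) (cvec y) (cvec y)) =
      inner (defect_vec y) (\<chi> j. bilin l y * defect_vec y $ j) - inner (defect_vec y) (defect_vec y)
      - (\<Sum>a\<in>P. (k a * rpsi (a \<bullet> y)) * inner (defect_vec y) (defect_vec y - crefl a (defect_vec (refl_root a y))))"
      unfolding defect_vec_derivative_radial[OF yR] by (simp add: inner_diff_right inner_sum_right)
    also have "\<dots> \<le> inner (defect_vec y) (\<chi> j. bilin l y * defect_vec y $ j)" using sumpos[OF mx] inner_ge_zero[of "defect_vec y"] by linarith
    also have "\<dots> \<le> norm (defect_vec y) * norm (\<chi> j. bilin l y * defect_vec y $ j)" by (rule norm_cauchy_schwarz)
    also have "norm (\<chi> j. bilin l y * defect_vec y $ j) = norm (bilin l y) * norm (defect_vec y)"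
      using norm_cline_diff[of 0 "defect_vec y" "bilin l y"] by (simp add: cline_def)
    also have "norm (defect_vec y) * (norm (bilin l y) * norm (defect_vec y)) \<le> norm (defect_vec y) * ((norm l * norm y) * norm (defect_vec y))"
      by (intro mult_left_mono mult_right_mono norm_bilin_le) auto
    finally show "inner (defect_vec y) (\<chi> j. dderiv (defect l G j) (cvec y) (cvec y)) \<le> (norm l * norm (defect_vec y) + 0) * norm y * norm (defect_vec y)"
      by (simp add: mult_ac)
  qed (auto simp: r_def)
  ultimately have "defect_vec x = 0" by simp
  then show ?thesis by (metis defect_vec_nth zero_index)
qed

end

section \<open>Existence of Cherednik kernels\<close>

context commuting_roots
begin

text \<open>The solutions of the Euler equation on tubes over growing balls agree on their real points, by
  \<open>euler_bound\<close>, and glue to an entire real analytic function. Its defects vanish, so it satisfies all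
  eigenvalue equations.\<close>

theorem cherednik_kernel_exists:
  "\<exists>f. is_cherednik_kernel P k m f \<and> (\<forall>v. continuous_on UNIV (\<lambda>x. frechet_derivative f (at x) v))"
proof -
  define l where "l = m + cvec (rho P k)"
  \<comment> \<open>small enough for \<open>\<langle>a, z\<rangle>\<close> to stay in the strip where \<open>cpsi\<close> is holomorphic, for all roots and on all tubes of width \<open>\<delta>\<close>\<close>
  define \<delta> where "\<delta> = 1 / (1 + (\<Sum>a\<in>P. norm a))"
  have sp: "(\<Sum>a\<in>P. norm a) \<ge> 0" by (intro sum_nonneg) auto
  have d0: "\<delta> > 0" using sp by (simp add: \<delta>_def)
  have \<delta>: "norm a * \<delta> \<le> 1" if "a \<in> P" for a
  proof -
    have "norm a \<le> (\<Sum>a\<in>P. norm a)" by (rule member_le_sum[OF that _ finP]) auto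
    then show ?thesis using sp by (simp add: \<delta>_def divide_le_eq)
  qed
  have "\<forall>R\<in>{0<..}. \<exists>G. gholo G (tube R \<delta>) \<and> G 0 = 1 \<and> (\<forall>z\<in>tube R \<delta>. dderiv G z z = cbil l z * G z
    - (\<Sum>a\<in>P. of_real (k a) * cpsi (bilin z a) * (G z - G (crefl a z))))"
  proof
    fix R :: real assume "R \<in> {0<..}"
    then have "R > 0" by simp
    show "\<exists>G. gholo G (tube R \<delta>) \<and> G 0 = 1 \<and> (\<forall>z\<in>tube R \<delta>. dderiv G z z = cbil l z * G z
      - (\<Sum>a\<in>P. of_real (k a) * cpsi (bilin z a) * (G z - G (crefl a z))))"
      by (rule euler_solution[OF finP k0 \<delta> d0 \<open>R > 0\<close>])
  qed
  then obtain H where H': "\<forall>R\<in>{0<..}. gholo (H R) (tube R \<delta>) \<and> H R 0 = 1 \<and> (\<forall>z\<in>tube R \<delta>. dderiv (H R) z z = cbil l z * H R z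
    - (\<Sum>a\<in>P. of_real (k a) * cpsi (bilin z a) * (H R z - H R (crefl a z))))"
    by (rule bchoice[THEN exE])
  have H: "gholo (H R) (tube R \<delta>)" "H R 0 = 1" "z \<in> tube R \<delta> \<Longrightarrow> dderiv (H R) z z = cbil l z * H R z
    - (\<Sum>a\<in>P. of_real (k a) * cpsi (bilin z a) * (H R z - H R (crefl a z)))" if "R > 0" for R z
  proof -
    have "R \<in> {0<..}" using that by simp
    note h = H'[THEN bspec, OF this]
    show "gholo (H R) (tube R \<delta>)" by (rule h[THEN conjunct1])
    show "H R 0 = 1" by (rule h[THEN conjunct2, THEN conjunct1])
    show "dderiv (H R) z z = cbil l z * H R z
      - (\<Sum>a\<in>P. of_real (k a) * cpsi (bilin z a) * (H R z - H R (crefl a z)))" if "z \<in> tube R \<delta>"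
      by (rule h[THEN conjunct2, THEN conjunct2, THEN bspec, OF that])
  qed
  have inT: "cvec x \<in> tube R \<delta>" if "norm x < R" for x :: "real ^ 'n" and R using that d0 by (simp add: tube_def)
  have H_eq: "H R (cvec x) = H S (cvec x)" if "norm x < R" "norm x < S" for R S and x :: "real ^ 'n"
  proof -
    have RS: "R > 0" "S > 0" using that norm_ge_zero[of x] by linarith+
    have "norm (H R (cvec x) - H S (cvec x)) \<le> exp ((norm l + 1) * norm x) * max (norm (H R (cvec 0) - H S (cvec 0))) 0"
    proof (rule euler_bound[where R = "norm x" and s = "\<lambda>_. 0" and b = "bilin l" and k = k and P = P
        and f = "\<lambda>x. H R (cvec x) - H S (cvec x)"
        and f' = "\<lambda>x h. dderiv (H R) (cvec h) (cvec x) - dderiv (H S) (cvec h) (cvec x)"])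
      fix y :: "real ^ 'n" assume y: "norm y \<le> norm x"
      then have yR: "cvec y \<in> tube R \<delta>" "cvec y \<in> tube S \<delta>" using that by (auto intro!: inT)
      show "((\<lambda>x. H R (cvec x) - H S (cvec x)) has_derivative
          (\<lambda>h. dderiv (H R) (cvec h) (cvec y) - dderiv (H S) (cvec h) (cvec y))) (at y)"
        by (intro has_derivative_diff gholo_real_has_derivative[OF open_tube H(1)] RS yR)
      show "dderiv (H R) (cvec y) (cvec y) - dderiv (H S) (cvec y) (cvec y) = bilin l y * (H R (cvec y) - H S (cvec y)) + 0 -
         (\<Sum>a\<in>P. of_real (k a * rpsi (a \<bullet> y)) * (H R (cvec y) - H S (cvec y) - (H R (cvec (refl_root a y)) - H S (cvec (refl_root a y)))))"
      proof -
        have "(\<Sum>a\<in>P. of_real (k a * rpsi (a \<bullet> y)) * (H R (cvec y) - H S (cvec y) - (H R (cvec (refl_root a y)) - H S (cvec (refl_root a y)))))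
          = (\<Sum>a\<in>P. of_real (k a) * cpsi (bilin (cvec y) a) * (H R (cvec y) - H R (crefl a (cvec y))))
          - (\<Sum>a\<in>P. of_real (k a) * cpsi (bilin (cvec y) a) * (H S (cvec y) - H S (crefl a (cvec y))))"
          unfolding sum_subtractf[symmetric]
          by (rule sum.cong) (simp_all add: cpsi_of_real crefl_cvec algebra_simps)
        then show ?thesis
          unfolding H(3)[OF RS(1) yR(1)] H(3)[OF RS(2) yR(2)] cbil_cvec by (simp only: right_diff_distrib) simp
      qed
    qed (use k0 norm_bilin_le in auto)
    moreover have "cvec (0::real^'n) = 0" by (simp add: vec_eq_iff)
    ultimately show ?thesis using H(2)[OF RS(1)] H(2)[OF RS(2)] by simp
  qed
  \<comment> \<open>any radius exceeding \<open>norm x\<close> gives the same value\<close>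
  define f where "f = (\<lambda>x :: real ^ 'n. H (norm x + 1) (cvec x))"
  have fH: "f y = H R (cvec y)" if "norm y < R" for y :: "real ^ 'n" and R unfolding f_def by (rule H_eq) (use that in auto)
  have ev: "\<forall>\<^sub>F y in nhds x. f y = H (norm x + 1) (cvec y)" for x :: "real ^ 'n"
  proof -
    have "\<forall>\<^sub>F y in nhds x. y \<in> ball x 1" by (intro eventually_nhds_in_open) auto
    then show ?thesis
    proof eventually_elim
      case (elim y)
      then have "norm y < norm x + 1" using norm_triangle_sub[of y x] by (simp add: dist_norm norm_minus_commute)
      then show ?case by (rule fH)
    qed
  qed
  have Rp: "norm (x::real^'n) + 1 > 0" for x using norm_ge_zero[of x] by linarith
  have fder: "(f has_derivative (\<lambda>h. dderiv (H R) (cvec h) (cvec x))) (at x)" if "norm x < R" for x R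
  proof (rule has_derivative_transform_within_open[of "\<lambda>y. H R (cvec y)" _ _ _ "ball 0 R"])
    show "((\<lambda>y. H R (cvec y)) has_derivative (\<lambda>h. dderiv (H R) (cvec h) (cvec x))) (at x)"
      by (rule gholo_real_has_derivative[OF open_tube H(1) inT[OF that]]) (use that norm_ge_zero[of x] in linarith)
    show "H R (cvec y) = f y" if "y \<in> ball 0 R" for y using fH[of y R] that by simp
  qed (use that in auto)
  have fd: "frechet_derivative f (at x) h = dderiv (H R) (cvec h) (cvec x)" if "norm x < R" for x R h
    using fun_cong[OF frechet_derivative_at[OF fder[OF that]], of h] by simp
  have an: "real_analytic f"
    unfolding real_analytic_def
  proof
    fix x :: "real ^ 'n"
    have "\<exists>c r. r > 0 \<and> (\<forall>y. (\<forall>i. \<bar>y $ i - x $ i\<bar> < r) \<longrightarrow>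
       ((\<lambda>m. c m * of_real (\<Prod>i\<in>UNIV. (y $ i - x $ i) ^ m i)) has_sum H (norm x + 1) (cvec y)) UNIV)"
      by (rule gholo_imp_real_analytic_at[OF open_tube H(1)[OF Rp] inT]) simp
    then obtain c r where r: "r > 0" and c: "\<forall>y. (\<forall>i. \<bar>y $ i - x $ i\<bar> < r) \<longrightarrow>
       ((\<lambda>m. c m * of_real (\<Prod>i\<in>UNIV. (y $ i - x $ i) ^ m i)) has_sum H (norm x + 1) (cvec y)) UNIV"
      by (elim exE conjE) (rule that)
    \<comment> \<open>the box of this size lies in the ball of radius \<open>1\<close>, where \<open>f\<close> agrees with the chosen local solution\<close>
    define r' where "r' = min r (1 / real CARD('n))"
    have r': "r' > 0" using r by (simp add: r'_def)
    have "((\<lambda>m. c m * of_real (\<Prod>i\<in>UNIV. (y $ i - x $ i) ^ m i)) has_sum f y) UNIV" if y: "\<forall>i. \<bar>y $ i - x $ i\<bar> < r'" for y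
    proof -
      have "norm (y - x) \<le> (\<Sum>i\<in>UNIV. \<bar>(y - x) $ i\<bar>)" by (rule norm_le_l1_cart)
      also have "\<dots> < (\<Sum>i\<in>(UNIV::'n set). 1 / real CARD('n))"
        by (rule sum_strict_mono) (use y in \<open>auto simp: r'_def\<close>)
      also have "\<dots> = 1" by simp
      finally have "norm y < norm x + 1" using norm_triangle_sub[of y x] by linarith
      from fH[OF this] show ?thesis using c[rule_format, of y] y by (simp add: r'_def)
    qed
    with r' show "\<exists>c. \<exists>r>0. \<forall>y. (\<forall>i. \<bar>y $ i - x $ i\<bar> < r) \<longrightarrow>
       ((\<lambda>m. c m * of_real (\<Prod>i\<in>UNIV. (y $ i - x $ i) ^ m i)) has_sum f y) UNIV"
      by (intro exI[of _ c] exI[of _ r'] conjI allI impI)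
  qed
  have ker: "is_cherednik_kernel P k m f"
    unfolding is_cherednik_kernel_def
  proof (intro conjI allI an)
    have "cvec (0::real^'n) = 0" by (simp add: vec_eq_iff)
    then show "f 0 = 1" using H(2)[of 1] by (simp add: f_def)
    fix \<xi> x :: "real ^ 'n"
    let ?R = "norm x + 1"
    interpret E: euler_extension P k l "H ?R" ?R \<delta>
      by unfold_locales (fact \<delta> | rule d0 | rule H(1)[OF Rp] | rule H(3)[OF Rp], assumption)+
    have x: "norm x < ?R" by simp
    have dq: "diff_quot a f x = cDel a (H ?R) (cvec x)" if "a \<in> P" for a
      by (rule diff_quot_eq[OF H(1)[OF Rp] \<delta>[OF that] d0 nz[OF that] _ x]) (rule fH)
    have z: "dderiv (H ?R) (axis j 1) (cvec x) = l $ j * H ?R (cvec x) - (\<Sum>a\<in>P. of_real (k a * a $ j) * cDel a (H ?R) (cvec x))" for j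
      using E.defect_zero[OF x, of j] by (simp add: defect_def algebra_simps)
    have "frechet_derivative f (at x) \<xi> = (\<Sum>j\<in>UNIV. of_real (\<xi> $ j) * (l $ j * H ?R (cvec x) - (\<Sum>a\<in>P. of_real (k a * a $ j) * cDel a (H ?R) (cvec x))))"
      unfolding fd[OF x] dderiv_cvec_expand[OF open_tube H(1)[OF Rp] inT[OF x]] z ..
    also have "\<dots> = bilin l \<xi> * f x - (\<Sum>a\<in>P. of_real (k a * (a \<bullet> \<xi>)) * diff_quot a f x)"
    proof -
      have "(\<Sum>j\<in>UNIV. of_real (\<xi> $ j) * (\<Sum>a\<in>P. of_real (k a * a $ j) * cDel a (H ?R) (cvec x)))
        = (\<Sum>a\<in>P. \<Sum>j\<in>UNIV. of_real (\<xi> $ j) * (of_real (k a * a $ j) * cDel a (H ?R) (cvec x)))"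
        unfolding sum_distrib_left by (rule sum.swap)
      also have "\<dots> = (\<Sum>a\<in>P. of_real (k a * (a \<bullet> \<xi>)) * diff_quot a f x)"
      proof (rule sum.cong)
        fix a assume "a \<in> P"
        have "of_real (k a * (a \<bullet> \<xi>)) = (\<Sum>j\<in>UNIV. complex_of_real (\<xi> $ j) * of_real (k a * a $ j))"
          by (simp add: inner_vec_def sum_distrib_left mult_ac)
        then show "(\<Sum>j\<in>UNIV. of_real (\<xi> $ j) * (of_real (k a * a $ j) * cDel a (H ?R) (cvec x))) = of_real (k a * (a \<bullet> \<xi>)) * diff_quot a f x"
          by (simp only: dq[OF \<open>a \<in> P\<close>] sum_distrib_right mult.assoc)
      qed simp
      finally have s: "(\<Sum>j\<in>UNIV. of_real (\<xi> $ j) * (\<Sum>a\<in>P. of_real (k a * a $ j) * cDel a (H ?R) (cvec x)))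
        = (\<Sum>a\<in>P. of_real (k a * (a \<bullet> \<xi>)) * diff_quot a f x)" .
      have "(\<Sum>j\<in>UNIV. of_real (\<xi> $ j) * (l $ j * H ?R (cvec x))) = bilin l \<xi> * f x"
        unfolding bilin_def f_def sum_distrib_right by (rule sum.cong) (simp_all add: mult_ac)
      then show ?thesis unfolding right_diff_distrib sum_subtractf s by simp
    qed
    finally show "cherednik_op P k \<xi> f x = bilin m \<xi> * f x"
      unfolding cherednik_op_def by (simp add: l_def bilin_add_left bilin_cvec algebra_simps inner_commute)
  qed
  have "continuous_on UNIV (\<lambda>x. frechet_derivative f (at x) v)" for v
    unfolding continuous_on_eq_continuous_at[OF open_UNIV]
  proof
    fix x :: "real ^ 'n"
    let ?R = "norm x + 1"
    have "continuous_on (ball 0 ?R) (\<lambda>y. dderiv (H ?R) (cvec v) (cvec y))"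
      by (rule continuous_on_compose2[OF gholo_continuous[OF gholo_dderiv[OF open_tube H(1)[OF Rp]]]])
         (use inT bounded_linear_cvec in \<open>auto intro: linear_continuous_on\<close>)
    then have "continuous_on (ball 0 ?R) (\<lambda>y. frechet_derivative f (at y) v)"
      by (rule continuous_on_eq) (simp add: fd[where R = ?R])
    then show "isCont (\<lambda>y. frechet_derivative f (at y) v) x"
      by (simp add: continuous_on_eq_continuous_at)
  qed
  then show ?thesis using ker by blast
qed

end

section \<open>Commutators of difference quotients in rank two\<close>

definition ph :: "real \<Rightarrow> complex" where "ph t = of_real (1 / (1 - exp (- t)))"

lemma ph_minus: "t \<noteq> 0 \<Longrightarrow> ph (- t) = 1 - ph t"
proof -
  assume "t \<noteq> 0"
  then have "1 / (1 - exp t) = 1 - 1 / (1 - exp (- t))" by (simp add: exp_minus field_simps)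
  then show ?thesis by (simp only: ph_def minus_minus of_real_diff of_real_1)
qed

lemma ph_add:
  assumes "s \<noteq> 0" "t \<noteq> 0" "s + t \<noteq> 0"
  shows "ph s * ph t = ph (s + t) * (ph s + ph t - 1)"
proof -
  define A B where "A = exp (- s)" "B = exp (- t)"
  have "A \<noteq> 1" "B \<noteq> 1" "A * B \<noteq> 1" using assms by (auto simp: A_B_def simp flip: exp_add)
  then have "1 - A \<noteq> 0" "1 - B \<noteq> 0" "1 - A * B \<noteq> 0" by auto
  then have "1 / (1 - A) * (1 / (1 - B)) = 1 / (1 - A * B) * (1 / (1 - A) + 1 / (1 - B) - 1)"
    by (simp add: divide_simps) (simp add: algebra_simps)
  moreover have "exp (- (s + t)) = A * B" by (simp add: A_B_def flip: exp_add)
  ultimately have "1 / (1 - exp (- s)) * (1 / (1 - exp (- t))) = 1 / (1 - exp (- (s + t))) * (1 / (1 - exp (- s)) + 1 / (1 - exp (- t)) - 1)"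
    by (simp add: A_B_def)
  from arg_cong[OF this, of complex_of_real] show ?thesis by (simp only: ph_def of_real_mult of_real_add of_real_diff of_real_1)
qed

lemma Del_ph: "Del a f x = ph (a \<bullet> x) * (f x - f (refl_root a x))"
  by (simp add: Del_def ph_def)

definition Del_comm :: "real ^ 'n \<Rightarrow> real ^ 'n \<Rightarrow> (real ^ 'n \<Rightarrow> complex) \<Rightarrow> real ^ 'n \<Rightarrow> complex"
  where "Del_comm a b f x = Del a (Del b f) x - Del b (Del a f) x"

lemma Del_comm_swap: "Del_comm b a f x = - Del_comm a b f x" by (simp add: Del_comm_def)

lemma inner_refl_root: "b \<bullet> refl_root a x = b \<bullet> x - 2 * (a \<bullet> x) / (a \<bullet> a) * (a \<bullet> b)"
  by (simp add: refl_root_def inner_diff_right inner_commute)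

lemma Del_comm_expand:
  "Del_comm a b f x = ph (a \<bullet> x) * (ph (b \<bullet> x) * (f x - f (refl_root b x))
      - ph (b \<bullet> refl_root a x) * (f (refl_root a x) - f (refl_root b (refl_root a x))))
    - ph (b \<bullet> x) * (ph (a \<bullet> x) * (f x - f (refl_root a x))
      - ph (a \<bullet> refl_root b x) * (f (refl_root b x) - f (refl_root a (refl_root b x))))"
  by (simp add: Del_comm_def Del_ph)

lemma Del_comm_orthogonal:
  assumes "a \<bullet> b = 0"
  shows "Del_comm a b f x = 0"
proof -
  have ba: "b \<bullet> a = 0" using assms by (simp add: inner_commute)
  have "refl_root b (refl_root a x) = refl_root a (refl_root b x)"
    using assms ba by (simp add: refl_root_def inner_diff_right algebra_simps)
  then show ?thesis using assms ba by (simp add: Del_comm_expand inner_refl_root algebra_simps)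
qed

lemma refl_root_norm2: "a \<bullet> a = 2 \<Longrightarrow> refl_root a y = y - (a \<bullet> y) *\<^sub>R a"
  by (simp add: refl_root_def)

lemma refl_root_norm1: "a \<bullet> a = 1 \<Longrightarrow> refl_root a y = y - (2 * (a \<bullet> y)) *\<^sub>R a"
  by (simp add: refl_root_def)

text \<open>For a subsystem of type \<open>A\<^sub>2\<close>: the values of \<open>f\<close> at the six points of the orbit have coefficients that
  vanish by the addition formula \<open>ph_add\<close>.\<close>

lemma Del_comm_A2:
  fixes a b :: "real ^ 'n"
  assumes n: "a \<bullet> a = 2" "b \<bullet> b = 2" "a \<bullet> b = - 1"
    and reg: "a \<bullet> x \<noteq> 0" "b \<bullet> x \<noteq> 0" "(a + b) \<bullet> x \<noteq> 0"
  shows "Del_comm a b f x + Del_comm a (a + b) f x + Del_comm (a + b) b f x = 0"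
proof -
  let ?g = "a + b"
  have ba: "b \<bullet> a = - 1" using n by (simp add: inner_commute)
  have ip: "?g \<bullet> ?g = 2" "a \<bullet> ?g = 1" "?g \<bullet> a = 1" "b \<bullet> ?g = 1" "?g \<bullet> b = 1"
    using n ba by (simp_all add: inner_add_left inner_add_right)
  let ?sa = "refl_root a x" and ?sb = "refl_root b x" and ?sg = "refl_root ?g x"
  have gx: "?g \<bullet> x = a \<bullet> x + b \<bullet> x" by (simp add: inner_add_left)
  have v: "b \<bullet> ?sa = a \<bullet> x + b \<bullet> x" "?g \<bullet> ?sa = b \<bullet> x" "a \<bullet> ?sb = a \<bullet> x + b \<bullet> x" "?g \<bullet> ?sb = a \<bullet> x"
    "a \<bullet> ?sg = - (b \<bullet> x)" "b \<bullet> ?sg = - (a \<bullet> x)"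
    using n ba ip by (simp_all add: inner_refl_root gx field_simps)
  have w: "refl_root ?g ?sa = refl_root a ?sb" "refl_root a ?sg = refl_root b ?sa"
    "refl_root b ?sg = refl_root a ?sb" "refl_root ?g ?sb = refl_root b ?sa"
    unfolding refl_root_norm2[OF n(1)] refl_root_norm2[OF n(2)] refl_root_norm2[OF ip(1)]
    by (simp_all add: n ba ip gx inner_add_left inner_add_right inner_diff_right algebra_simps)
  have rel: "ph (a \<bullet> x) * ph (b \<bullet> x) = ph (a \<bullet> x + b \<bullet> x) * (ph (a \<bullet> x) + ph (b \<bullet> x) - 1)"
    by (rule ph_add) (use reg gx in auto)
  show ?thesis
    unfolding Del_comm_expand v w gx ph_minus[OF reg(1)] ph_minus[OF reg(2)]
    using rel by algebra
qed

lemma refl_root_scale: "c \<noteq> 0 \<Longrightarrow> refl_root (c *\<^sub>R a) x = refl_root a x"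
  by (simp add: refl_root_def power2_eq_square)

text \<open>The analogue for two short (\<open>c = 1\<close>) or long (\<open>c = 2\<close>) roots and the two middle roots of a subsystem of
  type \<open>BC\<^sub>2\<close>. The functions \<open>ph U\<close> and \<open>ph (2 U)\<close> are related to those of the middle roots by different
  addition formulas, hence the two cases.\<close>

lemma Del_comm_BC2:
  fixes u v :: "real ^ 'n"
  assumes n: "u \<bullet> u = 1" "v \<bullet> v = 1" "u \<bullet> v = 0"
    and reg: "u \<bullet> x \<noteq> 0" "v \<bullet> x \<noteq> 0" "(u + v) \<bullet> x \<noteq> 0" "(u - v) \<bullet> x \<noteq> 0"
    and c: "c = 1 \<or> c = 2"
  shows "Del_comm (c *\<^sub>R u) (u - v) f x + Del_comm (c *\<^sub>R v) (u - v) f x + Del_comm (c *\<^sub>R v) (u + v) f x - Del_comm (c *\<^sub>R u) (u + v) f x = 0"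
proof -
  let ?D = "u - v" and ?Q = "u + v"
  let ?U = "u \<bullet> x" and ?V = "v \<bullet> x"
  have c0: "c \<noteq> 0" using c by auto
  have vu: "v \<bullet> u = 0" using n by (simp add: inner_commute)
  have ip: "?D \<bullet> ?D = 2" "?Q \<bullet> ?Q = 2" "?D \<bullet> u = 1" "u \<bullet> ?D = 1" "?D \<bullet> v = - 1" "v \<bullet> ?D = - 1"
    "?Q \<bullet> u = 1" "u \<bullet> ?Q = 1" "?Q \<bullet> v = 1" "v \<bullet> ?Q = 1"
    using n vu by (simp_all add: inner_add_left inner_add_right inner_diff_left inner_diff_right)
  let ?su = "refl_root u x" and ?sv = "refl_root v x" and ?sD = "refl_root ?D x" and ?sQ = "refl_root ?Q x"
  have DQ: "?D \<bullet> x = ?U - ?V" "?Q \<bullet> x = ?U + ?V" by (simp_all add: inner_add_left inner_diff_left)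
  have i: "u \<bullet> ?sD = ?V" "v \<bullet> ?sD = ?U" "u \<bullet> ?sQ = - ?V" "v \<bullet> ?sQ = - ?U"
    "?D \<bullet> ?su = - (?U + ?V)" "?Q \<bullet> ?su = - (?U - ?V)" "?D \<bullet> ?sv = ?U + ?V" "?Q \<bullet> ?sv = ?U - ?V"
    using n vu ip by (simp_all add: inner_refl_root DQ field_simps)
  have w: "refl_root ?D ?sv = refl_root u ?sD" "refl_root v ?sD = refl_root ?D ?su"
    "refl_root ?Q ?sv = refl_root ?D ?su" "refl_root v ?sQ = refl_root u ?sD"
    "refl_root ?Q ?su = refl_root u ?sD" "refl_root u ?sQ = refl_root ?D ?su"
    unfolding refl_root_norm1[OF n(1)] refl_root_norm1[OF n(2)] refl_root_norm2[OF ip(1)] refl_root_norm2[OF ip(2)]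
    by (simp_all add: vec_eq_iff n vu ip DQ inner_add_left inner_add_right inner_diff_left inner_diff_right algebra_simps)
  define \<alpha> \<beta> m q where "\<alpha> = ph (c * ?U)" "\<beta> = ph (c * ?V)" "m = ph (?U - ?V)" "q = ph (?U + ?V)"
  have cU: "ph (c * - ?U) = 1 - \<alpha>" "ph (c * - ?V) = 1 - \<beta>"
    using ph_minus[of "c * ?U"] ph_minus[of "c * ?V"] c0 reg by (simp_all add: \<alpha>_\<beta>_m_q_def)
  have mq: "ph (- (?U - ?V)) = 1 - m" "ph (- (?U + ?V)) = 1 - q"
    using ph_minus[of "?U - ?V"] ph_minus[of "?U + ?V"] reg DQ by (simp_all add: \<alpha>_\<beta>_m_q_def)
  have sc: "c *\<^sub>R u \<bullet> y = c * (u \<bullet> y)" "c *\<^sub>R v \<bullet> y = c * (v \<bullet> y)" for y by simp_all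
  have E: "Del_comm (c *\<^sub>R u) (u - v) f x + Del_comm (c *\<^sub>R v) (u - v) f x + Del_comm (c *\<^sub>R v) (u + v) f x - Del_comm (c *\<^sub>R u) (u + v) f x
    = (\<alpha> * (m * (f x - f ?sD) - (1 - q) * (f ?su - f (refl_root ?D ?su))) - m * (\<alpha> * (f x - f ?su) - \<beta> * (f ?sD - f (refl_root u ?sD))))
    + (\<beta> * (m * (f x - f ?sD) - q * (f ?sv - f (refl_root u ?sD))) - m * (\<beta> * (f x - f ?sv) - \<alpha> * (f ?sD - f (refl_root ?D ?su))))
    + (\<beta> * (q * (f x - f ?sQ) - m * (f ?sv - f (refl_root ?D ?su))) - q * (\<beta> * (f x - f ?sv) - (1 - \<alpha>) * (f ?sQ - f (refl_root u ?sD))))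
    - (\<alpha> * (q * (f x - f ?sQ) - (1 - m) * (f ?su - f (refl_root u ?sD))) - q * (\<alpha> * (f x - f ?su) - (1 - \<beta>) * (f ?sQ - f (refl_root ?D ?su))))"
    unfolding Del_comm_expand refl_root_scale[OF c0] sc DQ i w cU mq
    by (simp only: \<alpha>_\<beta>_m_q_def[symmetric])
  from c show ?thesis
  proof
    assume c: "c = 1"
    have r1: "\<alpha> * \<beta> = q * (\<alpha> + \<beta> - 1)"
      using ph_add[of ?U ?V] reg DQ c by (simp add: \<alpha>_\<beta>_m_q_def)
    have r2: "m * \<beta> = \<alpha> * (m + \<beta> - 1)"
      using ph_add[of "?U - ?V" ?V] reg DQ c by (simp add: \<alpha>_\<beta>_m_q_def)
    show ?thesis unfolding E using r1 r2 by algebra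
  next
    assume c: "c = 2"
    have r1: "m * q = \<alpha> * (m + q - 1)"
      using ph_add[of "?U - ?V" "?U + ?V"] reg DQ c by (simp add: \<alpha>_\<beta>_m_q_def)
    have r2: "q * (1 - m) = \<beta> * (q + (1 - m) - 1)"
      using ph_add[of "?U + ?V" "- (?U - ?V)"] reg DQ c by (simp add: \<alpha>_\<beta>_m_q_def mq[unfolded \<alpha>_\<beta>_m_q_def, simplified] mq)
    show ?thesis unfolding E using r1 r2 by algebra
  qed
qed

section \<open>The positive roots of types A and BC\<close>

lemma axis_inner [simp]: "axis i 1 \<bullet> (x :: real ^ 'n) = x $ i"
  by (simp add: inner_axis')

lemma refl_root_short:
  assumes "c \<noteq> 0"
  shows "refl_root (c *\<^sub>R axis i 1) x = (\<chi> p. if p = i then - x $ i else x $ p)"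
proof -
  have "refl_root (axis i 1) x = x - (2 * x $ i) *\<^sub>R axis i 1"
    by (subst refl_root_norm1) (simp_all add: inner_axis_axis)
  then show ?thesis unfolding refl_root_scale[OF assms] by (simp add: vec_eq_iff axis_def)
qed

lemma refl_root_minus:
  assumes "i \<noteq> j"
  shows "refl_root (axis i 1 - axis j 1) x = (\<chi> p. if p = i then x $ j else if p = j then x $ i else x $ p)"
proof -
  have "refl_root (axis i 1 - axis j 1) x = x - (x $ i - x $ j) *\<^sub>R (axis i 1 - axis j 1)"
    using assms by (subst refl_root_norm2)
      (simp_all add: inner_diff_left inner_diff_right inner_add_left inner_add_right inner_axis_axis)
  then show ?thesis using assms by (auto simp: vec_eq_iff axis_def)
qed

lemma refl_root_plus:
  assumes "i \<noteq> j"
  shows "refl_root (axis i 1 + axis j 1) x = (\<chi> p. if p = i then - x $ j else if p = j then - x $ i else x $ p)"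
proof -
  have "refl_root (axis i 1 + axis j 1) x = x - (x $ i + x $ j) *\<^sub>R (axis i 1 + axis j 1)"
    using assms by (subst refl_root_norm2)
      (simp_all add: inner_diff_left inner_diff_right inner_add_left inner_add_right inner_axis_axis)
  then show ?thesis using assms by (auto simp: vec_eq_iff axis_def)
qed

definition ppairs :: "('n::linorder \<times> 'n) set" where "ppairs = {(i, j). i < j}"

text \<open>Summing over all pairs a function that lives on the pairs containing \<open>i\<close>.\<close>

lemma sum_ppairs_index:
  fixes F :: "'n::{finite,linorder} \<Rightarrow> 'n \<Rightarrow> 'b::comm_monoid_add"
  assumes "\<And>p q. p < q \<Longrightarrow> p \<noteq> i \<Longrightarrow> q \<noteq> i \<Longrightarrow> F p q = 0"
  shows "(\<Sum>(p, q)\<in>ppairs. F p q) = (\<Sum>p\<in>UNIV - {i}. F (min i p) (max i p))"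
proof -
  let ?m = "\<lambda>p. (min i p, max i p)"
  have inj: "inj_on ?m (UNIV - {i})" by (auto simp: inj_on_def min_def max_def split: if_splits)
  have "(\<Sum>(p, q)\<in>ppairs. F p q) = (\<Sum>(p, q)\<in>?m ` (UNIV - {i}). F p q)"
  proof (rule sum.mono_neutral_right)
    show "?m ` (UNIV - {i}) \<subseteq> ppairs" by (auto simp: ppairs_def min_def max_def)
    have "z \<in> ?m ` (UNIV - {i})" if "z \<in> ppairs" "fst z = i \<or> snd z = i" for z
    proof -
      have "z = (fst z, snd z)" "fst z < snd z" "fst z = i \<or> snd z = i" using that by (auto simp: ppairs_def)
      then obtain p q where z: "z = (p, q)" "p < q" "p = i \<or> q = i" by blast
      then have "z = ?m (if p = i then q else p)" "(if p = i then q else p) \<in> UNIV - {i}" by auto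
      then show ?thesis by blast
    qed
    then show "\<forall>z\<in>ppairs - ?m ` (UNIV - {i}). (case z of (p, q) \<Rightarrow> F p q) = 0"
      using assms by (fastforce simp: ppairs_def)
  qed simp
  also have "\<dots> = (\<Sum>p\<in>UNIV - {i}. F (min i p) (max i p))"
    by (simp add: sum.reindex[OF inj])
  finally show ?thesis .
qed

lemma sum_A_pos:
  fixes g :: "real ^ ('n::{finite,linorder}) \<Rightarrow> 'b::comm_monoid_add"
  shows "(\<Sum>a\<in>A_pos. g a) = (\<Sum>(i, j)\<in>ppairs. g (axis j 1 - axis i 1))"
proof -
  let ?m = "\<lambda>(i, j). axis j 1 - axis i 1 :: (real, 'n) vec"
  have inj: "inj_on ?m ppairs"
  proof (rule inj_onI, clarify)
    fix i j p q :: 'n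
    assume h: "(i, j) \<in> ppairs" "(p, q) \<in> ppairs" and e: "axis j 1 - axis i (1::real) = axis q 1 - axis p 1"
    have e': "\<And>m. axis j 1 $ m - axis i (1::real) $ m = axis q 1 $ m - axis p 1 $ m"
      using e by (metis vector_minus_component)
    have "i = p" using e'[of i] h by (cases "i = p"; cases "i = q") (auto simp: axis_def ppairs_def split: if_split_asm)
    moreover have "j = q" using e'[of j] h by (cases "j = q"; cases "j = p") (auto simp: axis_def ppairs_def split: if_split_asm)
    ultimately show "i = p \<and> j = q" by simp
  qed
  have A: "A_pos = ?m ` ppairs" by (auto simp: A_pos_def ppairs_def)
  have "(\<Sum>a\<in>A_pos. g a) = (\<Sum>z\<in>ppairs. g (?m z))"
    unfolding A by (subst sum.reindex[OF inj]) (simp add: o_def)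
  also have "\<dots> = (\<Sum>(i, j)\<in>ppairs. g (axis j 1 - axis i 1))"
    by (rule sum.cong) auto
  finally show ?thesis .
qed

lemma sum_BC_pos:
  fixes g :: "real ^ ('n::{finite,linorder}) \<Rightarrow> 'b::comm_monoid_add"
  shows "(\<Sum>a\<in>BC_pos. g a) = (\<Sum>i\<in>UNIV. g (axis i 1)) + (\<Sum>i\<in>UNIV. g (2 *\<^sub>R axis i 1))
    + ((\<Sum>(i, j)\<in>ppairs. g (axis i 1 + axis j 1)) + (\<Sum>(i, j)\<in>ppairs. g (axis i 1 - axis j 1)))"
proof -
  let ?S = "range (\<lambda>i. axis i 1) :: (real, 'n) vec set" and ?L = "range (\<lambda>i. 2 *\<^sub>R axis i 1) :: (real, 'n) vec set"
  let ?p = "\<lambda>(i, j). axis i 1 + axis j 1 :: (real, 'n) vec" and ?m = "\<lambda>(i, j). axis i 1 - axis j 1 :: (real, 'n) vec"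
  let ?s = "\<lambda>a :: (real, 'n) vec. \<Sum>i\<in>UNIV. a $ i"
  have iS: "inj (\<lambda>i. axis i 1 :: (real, 'n) vec)" by (auto simp: inj_def axis_eq_axis)
  have iL: "inj (\<lambda>i. 2 *\<^sub>R axis i 1 :: (real, 'n) vec)" by (auto simp: inj_def axis_eq_axis)
  have ip: "inj_on ?p ppairs"
  proof (rule inj_onI, clarify)
    fix i j p q :: 'n
    assume h: "(i, j) \<in> ppairs" "(p, q) \<in> ppairs" and e: "axis i 1 + axis j (1::real) = axis p 1 + axis q 1"
    have e': "\<And>m. axis i 1 $ m + axis j (1::real) $ m = axis p 1 $ m + axis q 1 $ m"
      using e by (metis vector_add_component)
    have "i = p \<or> i = q" using e'[of i] h by (cases "i = p"; cases "i = q") (auto simp: axis_def ppairs_def split: if_split_asm)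
    moreover have "j = p \<or> j = q" using e'[of j] h by (cases "j = q"; cases "j = p") (auto simp: axis_def ppairs_def split: if_split_asm)
    ultimately show "i = p \<and> j = q" using h by (auto simp: ppairs_def)
  qed
  have im: "inj_on ?m ppairs"
  proof (rule inj_onI, clarify)
    fix i j p q :: 'n
    assume h: "(i, j) \<in> ppairs" "(p, q) \<in> ppairs" and e: "axis i 1 - axis j (1::real) = axis p 1 - axis q 1"
    have e': "\<And>m. axis i 1 $ m - axis j (1::real) $ m = axis p 1 $ m - axis q 1 $ m"
      using e by (metis vector_minus_component)
    have "i = p" using e'[of i] h by (cases "i = p"; cases "i = q") (auto simp: axis_def ppairs_def split: if_split_asm)
    moreover have "j = q" using e'[of j] h by (cases "j = q"; cases "j = p") (auto simp: axis_def ppairs_def split: if_split_asm)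
    ultimately show "i = p \<and> j = q" by simp
  qed
  have nS: "norm a = 1" if "a \<in> ?S" for a using that by auto
  have nL: "norm a = 2" if "a \<in> ?L" for a using that by auto
  have n2: "norm a = sqrt 2" if "a \<in> ?p ` ppairs \<union> ?m ` ppairs" for a
    using that by (auto simp: ppairs_def norm_eq_sqrt_inner inner_add_left inner_diff_left inner_add_right inner_diff_right inner_axis_axis)
  have s2: "sqrt 2 \<noteq> 1" "sqrt 2 \<noteq> (2::real)" using real_sqrt_less_iff[of 2 4] by auto
  have d1: "?S \<inter> ?L = {}" using nS nL by (metis disjoint_iff one_eq_numeral_iff semiring_norm(85))
  have d2: "(?S \<union> ?L) \<inter> (?p ` ppairs \<union> ?m ` ppairs) = {}"
  proof (rule equals0I)
    fix a assume a: "a \<in> (?S \<union> ?L) \<inter> (?p ` ppairs \<union> ?m ` ppairs)"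
    then have "norm a = 1 \<or> norm a = 2" using nS nL by blast
    moreover have "norm a = sqrt 2" by (rule n2) (use a in blast)
    ultimately show False using s2 by simp
  qed
  have d3: "?p ` ppairs \<inter> ?m ` ppairs = {}"
  proof -
    have "?s a = 2" if "a \<in> ?p ` ppairs" for a using that by (auto simp: sum.distrib axis_def)
    moreover have "?s a = 0" if "a \<in> ?m ` ppairs" for a using that by (auto simp: sum_subtractf axis_def)
    ultimately show ?thesis by (metis disjoint_iff zero_neq_numeral)
  qed
  have B: "BC_pos = (?S \<union> ?L) \<union> (?p ` ppairs \<union> ?m ` ppairs)"
    unfolding BC_pos_def ppairs_def by (auto simp: image_iff)
  have rp: "sum g (?p ` ppairs) = (\<Sum>(i, j)\<in>ppairs. g (axis i 1 + axis j 1))"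
    by (subst sum.reindex[OF ip]) (rule sum.cong, auto)
  have rm: "sum g (?m ` ppairs) = (\<Sum>(i, j)\<in>ppairs. g (axis i 1 - axis j 1))"
    by (subst sum.reindex[OF im]) (rule sum.cong, auto)
  show ?thesis
    unfolding B
    by (subst sum.union_disjoint[OF _ _ d2], simp, simp, subst sum.union_disjoint[OF _ _ d1], simp, simp,
        subst sum.union_disjoint[OF _ _ d3], simp, simp,
        simp only: sum.reindex[OF iS] sum.reindex[OF iL] o_def rp rm)
qed

lemma BC_mult_values:
  fixes i j :: "'n::{finite,linorder}"
  shows "BC_mult k1 k2 k3 (axis i 1 :: (real, 'n) vec) = k1"
    "BC_mult k1 k2 k3 (2 *\<^sub>R axis i 1 :: (real, 'n) vec) = k2"
    "i < j \<Longrightarrow> BC_mult k1 k2 k3 (axis i 1 + axis j 1 :: (real, 'n) vec) = k3"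
    "i < j \<Longrightarrow> BC_mult k1 k2 k3 (axis i 1 - axis j 1 :: (real, 'n) vec) = k3"
proof -
  have nS: "norm a = 1" if "a \<in> BC_short" for a :: "(real, 'n) vec" using that by (auto simp: BC_short_def)
  have nL: "norm a = 2" if "a \<in> BC_long" for a :: "(real, 'n) vec" using that by (auto simp: BC_long_def)
  have s2: "sqrt 2 \<noteq> 1" "sqrt 2 \<noteq> (2::real)" using real_sqrt_less_iff[of 2 4] by auto
  have n2: "norm (axis i 1 + axis j 1 :: (real, 'n) vec) = sqrt 2" "norm (axis i 1 - axis j 1 :: (real, 'n) vec) = sqrt 2" if "i < j"
    using that by (auto simp: norm_eq_sqrt_inner inner_add_left inner_diff_left inner_add_right inner_diff_right inner_axis_axis)
  have not: "b \<notin> BC_short \<and> b \<notin> BC_long" if "norm b = sqrt 2" for b :: "(real, 'n) vec"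
    using that nS nL s2 by metis
  show "BC_mult k1 k2 k3 (axis i 1 :: (real, 'n) vec) = k1" by (auto simp: BC_mult_def BC_short_def)
  show "BC_mult k1 k2 k3 (2 *\<^sub>R axis i 1 :: (real, 'n) vec) = k2"
    using nS[of "2 *\<^sub>R axis i 1"] by (auto simp: BC_mult_def BC_long_def)
  assume ij: "i < j"
  have middle_part: "axis i 1 + axis j 1 \<in> (BC_middle :: (real, 'n) vec set)" "axis i 1 - axis j 1 \<in> (BC_middle :: (real, 'n) vec set)"
    using ij unfolding BC_middle_def by (simp_all only: mem_Collect_eq Un_iff; blast)+
  show "BC_mult k1 k2 k3 (axis i 1 + axis j 1 :: (real, 'n) vec) = k3" "BC_mult k1 k2 k3 (axis i 1 - axis j 1 :: (real, 'n) vec) = k3"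
    using n2[OF ij] not middle_part by (simp_all only: BC_mult_def if_True if_False not_False_eq_True simp_thms)
qed

section \<open>Commuting Cherednik operators of types A and BC\<close>

text \<open>Roots with disjoint index sets are orthogonal and do not contribute to the commutator of \<open>D\<^sub>i\<close> and \<open>D\<^sub>j\<close>. What
  remains is the pair \<open>{i, j}\<close> itself and, for each third index \<open>r\<close>, three products of roots.\<close>

lemma double_index_sum:
  fixes b :: "'n::finite \<Rightarrow> 'n \<Rightarrow> complex"
  assumes ij: "i \<noteq> j" and z: "\<And>p q. p \<noteq> i \<Longrightarrow> q \<noteq> j \<Longrightarrow> p \<noteq> j \<Longrightarrow> q \<noteq> i \<Longrightarrow> p \<noteq> q \<Longrightarrow> b p q = 0"
  shows "(\<Sum>p\<in>UNIV - {i}. \<Sum>q\<in>UNIV - {j}. b p q) = b j i + (\<Sum>r\<in>UNIV - {i, j}. b r r + b j r + b r i)"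
proof -
  let ?U = "UNIV - {i, j}"
  have U: "UNIV - {i} = insert j ?U" "UNIV - {j} = insert i ?U" using ij by auto
  have inner: "(\<Sum>q\<in>UNIV - {j}. b p q) = b p i + b p p" if "p \<in> ?U" for p
  proof -
    have "(\<Sum>q\<in>?U. b p q) = (\<Sum>q\<in>{p}. b p q)"
      by (rule sum.mono_neutral_right) (use that z in auto)
    then show ?thesis unfolding U(2) by simp
  qed
  have "(\<Sum>p\<in>UNIV - {i}. \<Sum>q\<in>UNIV - {j}. b p q) = (\<Sum>q\<in>UNIV - {j}. b j q) + (\<Sum>p\<in>?U. \<Sum>q\<in>UNIV - {j}. b p q)"
    unfolding U(1) by simp
  also have "(\<Sum>p\<in>?U. \<Sum>q\<in>UNIV - {j}. b p q) = (\<Sum>p\<in>?U. b p i + b p p)" by (rule sum.cong) (use inner in auto)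
  also have "(\<Sum>q\<in>UNIV - {j}. b j q) = b j i + (\<Sum>q\<in>?U. b j q)" unfolding U(2) by simp
  finally show ?thesis by (simp add: sum.distrib algebra_simps)
qed

lemma commutator_sum:
  fixes k :: "real ^ 'n \<Rightarrow> real"
  shows "(\<Sum>a\<in>P. \<Sum>b\<in>P. of_real (k a * k b * (a $ i * b $ j - a $ j * b $ i)) * Del a (Del b f) x)
    = (\<Sum>a\<in>P. of_real (k a * a $ i) * (\<Sum>b\<in>P. of_real (k b * b $ j) * Del_comm a b f x))"
proof -
  have "(\<Sum>a\<in>P. \<Sum>b\<in>P. of_real (k a * k b * (a $ i * b $ j - a $ j * b $ i)) * Del a (Del b f) x)
    = (\<Sum>a\<in>P. \<Sum>b\<in>P. of_real (k a * k b * (a $ i * b $ j)) * Del a (Del b f) x)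
    - (\<Sum>a\<in>P. \<Sum>b\<in>P. of_real (k a * k b * (a $ j * b $ i)) * Del a (Del b f) x)"
    by (simp add: sum_subtractf algebra_simps)
  also have "(\<Sum>a\<in>P. \<Sum>b\<in>P. of_real (k a * k b * (a $ j * b $ i)) * Del a (Del b f) x)
    = (\<Sum>a\<in>P. \<Sum>b\<in>P. of_real (k a * k b * (a $ i * b $ j)) * Del b (Del a f) x)"
    by (subst sum.swap) (simp add: mult_ac)
  also have "(\<Sum>a\<in>P. \<Sum>b\<in>P. of_real (k a * k b * (a $ i * b $ j)) * Del a (Del b f) x)
     - (\<Sum>a\<in>P. \<Sum>b\<in>P. of_real (k a * k b * (a $ i * b $ j)) * Del b (Del a f) x)
     = (\<Sum>a\<in>P. \<Sum>b\<in>P. of_real (k a * a $ i) * (of_real (k b * b $ j) * Del_comm a b f x))"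
    unfolding sum_subtractf[symmetric] by (intro sum.cong refl) (simp add: Del_comm_def algebra_simps)
  finally show ?thesis by (simp only: sum_distrib_left)
qed

definition order_sign :: "'n::linorder \<Rightarrow> 'n \<Rightarrow> complex" where "order_sign i p = (if i < p then 1 else - 1)"
text \<open>The positive root of type BC that is \<open>e\<^sub>i - e\<^sub>p\<close> up to sign; \<open>order_sign i p\<close> is the sign. They make the sums
  over roots containing a given index uniform in the order of the indices.\<close>

definition min_max_root :: "'n::{finite,linorder} \<Rightarrow> 'n \<Rightarrow> (real, 'n) vec" where "min_max_root i p = axis (min i p) 1 - axis (max i p) 1"

lemma min_max_root_commute: "min_max_root i p = min_max_root p i" by (simp add: min_max_root_def min.commute max.commute)

lemma min_max_root_less: "i < p \<Longrightarrow> min_max_root i p = axis i 1 - axis p 1" by (simp add: min_max_root_def)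

text \<open>The relation \<open>Del_comm_A2\<close> in a form that is symmetric in the three indices.\<close>

lemma triple_sum_zero:
  fixes D :: "'n::linorder \<Rightarrow> 'n \<Rightarrow> real ^ 'm"
  assumes sym: "\<And>p q. D p q = D q p"
    and A2: "\<And>p q r. p < q \<Longrightarrow> q < r \<Longrightarrow> Del_comm (D p q) (D q r) f x + Del_comm (D p q) (D p r) f x + Del_comm (D p r) (D q r) f x = 0"
    and d: "i \<noteq> j" "i \<noteq> r" "j \<noteq> r"
  shows "order_sign i r * order_sign j r * Del_comm (D i r) (D j r) f x + order_sign i j * order_sign j r * Del_comm (D i j) (D j r) f x
    + order_sign i r * order_sign j i * Del_comm (D i r) (D j i) f x = 0"
proof -
  define X where "X = Del_comm (D i j) (D j r) f x"
  define Y where "Y = Del_comm (D i j) (D i r) f x"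
  define Z where "Z = Del_comm (D i r) (D j r) f x"
  have sw: "Del_comm (D j r) (D i j) f x = - X" "Del_comm (D i r) (D i j) f x = - Y" "Del_comm (D j r) (D i r) f x = - Z"
    by (simp_all add: X_def Y_def Z_def Del_comm_swap[of "D i j"] Del_comm_swap[of "D i r" "D j r"])
  have dji: "D j i = D i j" "D r i = D i r" "D r j = D j r" by (simp_all add: sym)
  have goal: "order_sign i r * order_sign j r * Z + order_sign i j * order_sign j r * X - order_sign i r * order_sign j i * Y = 0"
  proof -
    consider "i < j" "j < r" | "i < r" "r < j" | "j < i" "i < r" | "j < r" "r < i" | "r < i" "i < j" | "r < j" "j < i"
      using d by (metis linorder_less_linear)
    then show ?thesis
    proof cases
      case 1
      then have o: "i < r" "\<not> j < i" by auto
      from A2[OF 1] show ?thesis using 1 o by (simp add: order_sign_def X_def Y_def Z_def algebra_simps)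
    next
      case 2
      then have o: "i < j" "\<not> j < i" "\<not> j < r" by auto
      from A2[OF 2] have "Z - Y + X = 0" unfolding dji sw by (simp add: X_def Y_def Z_def algebra_simps)
      then show ?thesis using 2 o by (simp add: order_sign_def algebra_simps)
    next
      case 3
      then have o: "j < r" "\<not> i < j" by auto
      from A2[OF 3] have "Y + X - Z = 0" unfolding dji sw by (simp add: X_def Y_def Z_def algebra_simps)
      then show ?thesis using 3 o by (simp add: order_sign_def algebra_simps)
    next
      case 4
      then have o: "j < i" "\<not> i < j" "\<not> i < r" by auto
      from A2[OF 4] have "- Z - X + Y = 0" unfolding dji sw by (simp add: X_def Y_def Z_def algebra_simps)
      then show ?thesis using 4 o by (simp add: order_sign_def algebra_simps)
    next
      case 5
      then have o: "r < j" "\<not> j < r" "\<not> i < r" "\<not> j < i" by auto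
      from A2[OF 5] have "- Y + Z + - X = 0" unfolding dji sw by (simp add: X_def Y_def Z_def algebra_simps)
      then show ?thesis using 5 o by (simp add: order_sign_def algebra_simps)
    next
      case 6
      then have o: "r < i" "\<not> i < r" "\<not> j < r" "\<not> i < j" by auto
      from A2[OF 6] have "- X + - Z + Del_comm (D i r) (D i j) f x = 0" unfolding dji sw .
      then have "Z + X + Y = 0" unfolding sw by algebra
      then show ?thesis using 6 o by (simp add: order_sign_def)
    qed
  qed
  then show ?thesis by (simp add: dji(1) sw Z_def[symmetric] X_def[symmetric])
qed

lemma axis_index: "axis i (1::real) $ j = (if i = j then 1 else 0)"
  by (auto simp: axis_def)

lemma weighted_sum_A:
  fixes h :: "(real, 'n::{finite,linorder}) vec \<Rightarrow> complex"
  shows "(\<Sum>a\<in>A_pos. of_real (k3 * a $ i) * h a) = (\<Sum>p\<in>UNIV - {i}. of_real k3 * (- order_sign i p * h (- min_max_root i p)))"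
proof -
  have "(\<Sum>a\<in>A_pos. of_real (k3 * a $ i) * h a) =
     (\<Sum>(p, q)\<in>ppairs. of_real (k3 * (axis q 1 - axis p 1) $ i) * h (axis q 1 - axis p 1))"
    by (rule sum_A_pos)
  also have "\<dots> = (\<Sum>p\<in>UNIV - {i}. of_real (k3 * (axis (max i p) 1 - axis (min i p) 1) $ i) * h (axis (max i p) 1 - axis (min i p) 1))"
    by (rule sum_ppairs_index) (simp add: axis_index)
  also have "\<dots> = (\<Sum>p\<in>UNIV - {i}. of_real k3 * (- order_sign i p * h (- min_max_root i p)))"
    by (rule sum.cong) (auto simp: order_sign_def min_max_root_def axis_index min_def max_def)
  finally show ?thesis .
qed

lemma weighted_sum_BC:
  fixes h :: "(real, 'n::{finite,linorder}) vec \<Rightarrow> complex"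
  shows "(\<Sum>a\<in>BC_pos. of_real (BC_mult k1 k2 k3 a * a $ i) * h a) =
    of_real k1 * h (axis i 1) + of_real (2 * k2) * h (2 *\<^sub>R axis i 1)
    + (\<Sum>p\<in>UNIV - {i}. of_real k3 * (order_sign i p * h (min_max_root i p) + h (axis i 1 + axis p 1)))"
proof -
  let ?g = "\<lambda>a :: (real, 'n) vec. of_real (BC_mult k1 k2 k3 a * a $ i) * h a"
  have 1: "(\<Sum>j\<in>UNIV. ?g (axis j 1)) = of_real k1 * h (axis i 1)"
  proof -
    have "?g (axis j 1) = (if j = i then of_real k1 * h (axis i 1) else 0)" for j
      by (simp add: BC_mult_values axis_index)
    then show ?thesis by simp
  qed
  have 2: "(\<Sum>j\<in>UNIV. ?g (2 *\<^sub>R axis j 1)) = of_real (2 * k2) * h (2 *\<^sub>R axis i 1)"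
  proof -
    have "?g (2 *\<^sub>R axis j 1) = (if j = i then of_real (2 * k2) * h (2 *\<^sub>R axis i 1) else 0)" for j
      by (simp add: BC_mult_values axis_index)
    then show ?thesis by simp
  qed
  have 3: "(\<Sum>(p, q)\<in>ppairs. ?g (axis p 1 + axis q 1)) = (\<Sum>p\<in>UNIV - {i}. of_real k3 * h (axis i 1 + axis p 1))"
  proof -
    have "(\<Sum>(p, q)\<in>ppairs. ?g (axis p 1 + axis q 1)) = (\<Sum>(p, q)\<in>ppairs. of_real (k3 * (axis p 1 + axis q 1) $ i) * h (axis p 1 + axis q 1))"
      by (rule sum.cong) (auto simp: ppairs_def BC_mult_values)
    also have "\<dots> = (\<Sum>p\<in>UNIV - {i}. of_real (k3 * (axis (min i p) 1 + axis (max i p) 1) $ i) * h (axis (min i p) 1 + axis (max i p) 1))"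
      by (rule sum_ppairs_index) (simp add: axis_index)
    also have "\<dots> = (\<Sum>p\<in>UNIV - {i}. of_real k3 * h (axis i 1 + axis p 1))"
      by (rule sum.cong) (auto simp: axis_index min_def max_def add.commute)
    finally show ?thesis .
  qed
  have 4: "(\<Sum>(p, q)\<in>ppairs. ?g (axis p 1 - axis q 1)) = (\<Sum>p\<in>UNIV - {i}. of_real k3 * (order_sign i p * h (min_max_root i p)))"
  proof -
    have "(\<Sum>(p, q)\<in>ppairs. ?g (axis p 1 - axis q 1)) = (\<Sum>(p, q)\<in>ppairs. of_real (k3 * (axis p 1 - axis q 1) $ i) * h (axis p 1 - axis q 1))"
      by (rule sum.cong) (auto simp: ppairs_def BC_mult_values)
    also have "\<dots> = (\<Sum>p\<in>UNIV - {i}. of_real (k3 * (axis (min i p) 1 - axis (max i p) 1) $ i) * h (axis (min i p) 1 - axis (max i p) 1))"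
      by (rule sum_ppairs_index) (simp add: axis_index)
    also have "\<dots> = (\<Sum>p\<in>UNIV - {i}. of_real k3 * (order_sign i p * h (min_max_root i p)))"
      by (rule sum.cong) (auto simp: order_sign_def min_max_root_def axis_index min_def max_def)
    finally show ?thesis .
  qed
  show ?thesis unfolding sum_BC_pos 1 2 3 4 by (simp add: sum.distrib distrib_left)
qed

lemma Del_comm_self [simp]: "Del_comm a a f x = 0" by (simp add: Del_comm_def)

lemma min_max_root_inner: "min_max_root i p \<bullet> x = (if i < p then x $ i - x $ p else x $ p - x $ i)"
  by (auto simp: min_max_root_def inner_diff_left min_def max_def)

lemma min_max_root_norm: "i \<noteq> p \<Longrightarrow> min_max_root i p \<bullet> min_max_root i p = 2"
  unfolding min_max_root_inner by (auto simp: min_max_root_def axis_index min_def max_def)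

lemma min_max_root_chain: "p < q \<Longrightarrow> q < s \<Longrightarrow> min_max_root p q \<bullet> min_max_root q s = - 1"
  unfolding min_max_root_inner by (auto simp: min_max_root_less axis_index)

lemma finite_A_pos: "finite (A_pos :: (real, 'n::{finite,linorder}) vec set)"
proof -
  have "(A_pos :: (real, 'n) vec set) = (\<lambda>(i, j). axis j 1 - axis i 1) ` {(i, j). i < j}" by (auto simp: A_pos_def)
  then show ?thesis by (rule ssubst) (rule finite_imageI, simp)
qed

lemma finite_BC_pos: "finite (BC_pos :: (real, 'n::{finite,linorder}) vec set)"
proof -
  have "(BC_pos :: (real, 'n) vec set) \<subseteq> range (\<lambda>i. axis i 1) \<union> range (\<lambda>i. 2 *\<^sub>R axis i 1) \<union> range (\<lambda>(i, j). axis i 1 + axis j 1) \<union> range (\<lambda>(i, j). axis i 1 - axis j 1)"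
    unfolding BC_pos_def by auto
  then show ?thesis by (rule finite_subset) simp
qed

lemma axis_diff_nonzero: "i \<noteq> j \<Longrightarrow> axis i (1::real) - axis j 1 \<noteq> 0"
  by (metis axis_eq_axis eq_iff_diff_eq_0 zero_neq_one)

lemma axis_add_nonzero: "axis i (1::real) + axis j 1 \<noteq> 0"
proof
  assume "axis i (1::real) + axis j 1 = 0"
  then have "(axis i (1::real) + axis j 1) $ i = 0" by simp
  then show False by (auto simp: axis_index split: if_splits)
qed

lemma A_regular:
  fixes x :: "(real, 'n::{finite,linorder}) vec"
  shows "(\<forall>c\<in>A_pos. c \<bullet> x \<noteq> 0) \<longleftrightarrow> (\<forall>p q. p \<noteq> q \<longrightarrow> x $ p \<noteq> x $ q)"
proof
  assume h: "\<forall>c\<in>A_pos. c \<bullet> x \<noteq> 0"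
  have "x $ p \<noteq> x $ q" if "p < q" for p q
  proof -
    have "axis q 1 - axis p 1 \<in> (A_pos :: (real, 'n) vec set)" using that by (auto simp: A_pos_def)
    with h have "(axis q 1 - axis p 1) \<bullet> x \<noteq> 0" by blast
    then show ?thesis by (simp add: inner_diff_left)
  qed
  then show "\<forall>p q. p \<noteq> q \<longrightarrow> x $ p \<noteq> x $ q" by (metis linorder_neq_iff)
next
  assume "\<forall>p q. p \<noteq> q \<longrightarrow> x $ p \<noteq> x $ q"
  then show "\<forall>c\<in>A_pos. c \<bullet> x \<noteq> 0" by (force simp: A_pos_def inner_diff_left)
qed

lemma BC_regular:
  fixes x :: "(real, 'n::{finite,linorder}) vec"
  shows "(\<forall>c\<in>BC_pos. c \<bullet> x \<noteq> 0) \<longleftrightarrow> (\<forall>p. x $ p \<noteq> 0) \<and> (\<forall>p q. p \<noteq> q \<longrightarrow> x $ p \<noteq> x $ q \<and> x $ p \<noteq> - x $ q)"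
proof
  assume h: "\<forall>c\<in>BC_pos. c \<bullet> x \<noteq> 0"
  have 1: "x $ p \<noteq> 0" for p
  proof -
    have "axis p 1 \<in> (BC_pos :: (real, 'n) vec set)" unfolding BC_pos_def by blast
    with h have "axis p 1 \<bullet> x \<noteq> 0" by blast
    then show ?thesis by simp
  qed
  have 2: "x $ p \<noteq> x $ q \<and> x $ p \<noteq> - x $ q" if "p < q" for p q
  proof -
    have "axis p 1 - axis q 1 \<in> (BC_pos :: (real, 'n) vec set)" "axis p 1 + axis q 1 \<in> (BC_pos :: (real, 'n) vec set)"
      using that unfolding BC_pos_def by blast+
    with h have "(axis p 1 - axis q 1) \<bullet> x \<noteq> 0" "(axis p 1 + axis q 1) \<bullet> x \<noteq> 0" by blast+
    then show ?thesis by (auto simp: inner_diff_left inner_add_left)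
  qed
  have "x $ p \<noteq> x $ q \<and> x $ p \<noteq> - x $ q" if "p \<noteq> q" for p q
    using 2[of p q] 2[of q p] that by (cases p q rule: linorder_cases) auto
  with 1 show "(\<forall>p. x $ p \<noteq> 0) \<and> (\<forall>p q. p \<noteq> q \<longrightarrow> x $ p \<noteq> x $ q \<and> x $ p \<noteq> - x $ q)" by blast
next
  assume h: "(\<forall>p. x $ p \<noteq> 0) \<and> (\<forall>p q. p \<noteq> q \<longrightarrow> x $ p \<noteq> x $ q \<and> x $ p \<noteq> - x $ q)"
  show "\<forall>c\<in>BC_pos. c \<bullet> x \<noteq> 0"
  proof
    fix c assume "c \<in> (BC_pos :: (real, 'n) vec set)"
    then consider i where "c = axis i 1" | i where "c = 2 *\<^sub>R axis i 1" | i j where "c = axis i 1 + axis j 1" "i < j" | i j where "c = axis i 1 - axis j 1" "i < j"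
      unfolding BC_pos_def by blast
    then show "c \<bullet> x \<noteq> 0"
    proof cases
      case (3 i j)
      then have "x $ i \<noteq> - x $ j" using h by (metis less_irrefl)
      then show ?thesis using 3 by (simp add: inner_add_left add_eq_0_iff2)
    next
      case (4 i j)
      then have "x $ i \<noteq> x $ j" using h by (metis less_irrefl)
      then show ?thesis using 4 by (simp add: inner_diff_left)
    qed (use h in auto)
  qed
qed

lemma signed_permutation_regular:
  fixes x y :: "real ^ 'n"
  assumes reg: "\<And>p. x $ p \<noteq> 0" "\<And>p q. p \<noteq> q \<Longrightarrow> x $ p \<noteq> x $ q" "\<And>p q. p \<noteq> q \<Longrightarrow> x $ p \<noteq> - x $ q"
    and "inj \<pi>" and y: "\<forall>p. y $ p = x $ \<pi> p \<or> y $ p = - x $ \<pi> p"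
  shows "(\<forall>p. y $ p \<noteq> 0) \<and> (\<forall>p q. p \<noteq> q \<longrightarrow> y $ p \<noteq> y $ q \<and> y $ p \<noteq> - y $ q)"
proof (intro conjI allI impI)
  show "y $ p \<noteq> 0" for p using y[rule_format, of p] reg(1)[of "\<pi> p"] by auto
  fix p q :: 'n assume "p \<noteq> q"
  then have "\<pi> p \<noteq> \<pi> q" using \<open>inj \<pi>\<close> by (simp add: inj_eq)
  note r = reg(2)[OF this] reg(3)[OF this]
  show "y $ p \<noteq> y $ q" "y $ p \<noteq> - y $ q"
    using y[rule_format, of p] y[rule_format, of q] r by linarith+
qed

text \<open>By \<open>weighted_sum_A\<close> and \<open>double_index_sum\<close> the commutator is a sum over third indices \<open>r\<close>, and the three
  terms for each \<open>r\<close> cancel by the \<open>A\<^sub>2\<close> relation.\<close>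

lemma commuting_A:
  assumes k3: "0 \<le> k3"
  shows "commuting_roots (A_pos :: (real, 'n::{finite,linorder}) vec set) (\<lambda>_. k3)"
proof
  let ?P = "A_pos :: (real, 'n) vec set"
  show "finite ?P" by (rule finite_A_pos)
  show "a \<noteq> 0" if a: "a \<in> ?P" for a
  proof -
    obtain i j :: 'n where "a = axis j 1 - axis i 1" "i < j" using a unfolding A_pos_def by blast
    then show ?thesis using axis_diff_nonzero[of j i] by simp
  qed
  show "0 \<le> k3" by (rule k3)
  fix x :: "(real, 'n) vec"
  assume reg0: "\<And>c. c \<in> ?P \<Longrightarrow> c \<bullet> x \<noteq> 0"
  then have reg: "x $ p \<noteq> x $ q" if "p \<noteq> q" for p q using A_regular[of x] that by blast
  show "b \<bullet> refl_root a x \<noteq> 0" if a: "a \<in> ?P" and b: "b \<in> ?P" for a b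
  proof -
    obtain i j :: 'n where ij: "a = axis j 1 - axis i 1" "i < j" using a unfolding A_pos_def by blast
    have ji: "j \<noteq> i" using ij(2) by simp
    have "\<forall>p q. p \<noteq> q \<longrightarrow> refl_root a x $ p \<noteq> refl_root a x $ q"
      unfolding ij(1) refl_root_minus[OF ji] using reg by auto
    then show ?thesis using A_regular[of "refl_root a x"] b by blast
  qed
  fix i j :: 'n and f :: "(real, 'n) vec \<Rightarrow> complex"
  show "(\<Sum>a\<in>?P. \<Sum>b\<in>?P. of_real (k3 * k3 * (a $ i * b $ j - a $ j * b $ i)) * Del a (Del b f) x) = 0"
  proof (cases "i = j")
    case False
    let ?b = "\<lambda>p q. order_sign i p * order_sign j q * Del_comm (- min_max_root i p) (- min_max_root j q) f x"
    have "(\<Sum>a\<in>?P. \<Sum>b\<in>?P. of_real (k3 * k3 * (a $ i * b $ j - a $ j * b $ i)) * Del a (Del b f) x) =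
        (\<Sum>p\<in>UNIV - {i}. of_real k3 * (- order_sign i p * (\<Sum>q\<in>UNIV - {j}. of_real k3 * (- order_sign j q * Del_comm (- min_max_root i p) (- min_max_root j q) f x))))"
      unfolding commutator_sum[where k = "\<lambda>_. k3"] weighted_sum_A ..
    also have "\<dots> = of_real (k3 * k3) * (\<Sum>p\<in>UNIV - {i}. \<Sum>q\<in>UNIV - {j}. ?b p q)"
      by (simp add: sum_distrib_left mult_ac)
    also have "(\<Sum>p\<in>UNIV - {i}. \<Sum>q\<in>UNIV - {j}. ?b p q) = ?b j i + (\<Sum>r\<in>UNIV - {i, j}. ?b r r + ?b j r + ?b r i)"
    proof (rule double_index_sum[OF False])
      fix p q assume "p \<noteq> i" "q \<noteq> j" "p \<noteq> j" "q \<noteq> i" "p \<noteq> q"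
      then have "(- min_max_root i p) \<bullet> (- min_max_root j q) = 0" using False
        by (simp add: min_max_root_inner[of i p]) (auto simp: min_max_root_def axis_index min_def max_def)
      then show "?b p q = 0" by (simp add: Del_comm_orthogonal)
    qed
    also have "?b j i = 0" by (simp add: min_max_root_commute[of j i])
    also have "(\<Sum>r\<in>UNIV - {i, j}. ?b r r + ?b j r + ?b r i) = 0"
    proof (rule sum.neutral, rule ballI)
      fix r assume r: "r \<in> UNIV - {i, j}"
      show "?b r r + ?b j r + ?b r i = 0"
      proof (rule triple_sum_zero[where D = "\<lambda>p q. - min_max_root p q"])
        show "- min_max_root p q = - min_max_root q p" for p q :: 'n by (simp add: min_max_root_commute)
        fix p q s :: 'n assume pqs: "p < q" "q < s"
        have ps: "p < s" using pqs by simp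
        have e: "- min_max_root p s = - min_max_root p q + - min_max_root q s" using pqs ps by (simp add: min_max_root_less)
        have "Del_comm (- min_max_root p q) (- min_max_root q s) f x + Del_comm (- min_max_root p q) (- min_max_root p q + - min_max_root q s) f x + Del_comm (- min_max_root p q + - min_max_root q s) (- min_max_root q s) f x = 0"
        proof (rule Del_comm_A2)
          show "- min_max_root p q \<bullet> - min_max_root p q = 2" "- min_max_root q s \<bullet> - min_max_root q s = 2" "- min_max_root p q \<bullet> - min_max_root q s = - 1"
            using pqs by (simp_all add: min_max_root_norm min_max_root_chain)
          show "- min_max_root p q \<bullet> x \<noteq> 0" "- min_max_root q s \<bullet> x \<noteq> 0" "(- min_max_root p q + - min_max_root q s) \<bullet> x \<noteq> 0"
            unfolding e[symmetric] using pqs ps reg[of q p] reg[of s q] reg[of s p] by (simp_all add: min_max_root_inner)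
        qed
        then show "Del_comm (- min_max_root p q) (- min_max_root q s) f x + Del_comm (- min_max_root p q) (- min_max_root p s) f x + Del_comm (- min_max_root p s) (- min_max_root q s) f x = 0"
          unfolding e .
      qed (use r False in auto)
    qed
    finally show ?thesis by simp
  qed simp
qed

text \<open>The terms for a third index cancel by the relations of the four \<open>A\<^sub>2\<close> subsystems on three indices, and the
  terms on the indices \<open>i\<close> and \<open>j\<close> alone by the two \<open>BC\<^sub>2\<close> relations, for short and for long roots.\<close>

lemma commuting_BC:
  assumes k: "0 \<le> k1" "0 \<le> k2" "0 \<le> k3"
  shows "commuting_roots (BC_pos :: (real, 'n::{finite,linorder}) vec set) (BC_mult k1 k2 k3)"
proof
  let ?P = "BC_pos :: (real, 'n) vec set"
  let ?k = "BC_mult k1 k2 k3"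
  show "finite ?P" by (rule finite_BC_pos)
  show "a \<noteq> 0" if a: "a \<in> ?P" for a
  proof -
    consider i where "a = axis i 1" | i where "a = 2 *\<^sub>R axis i 1" | i j where "a = axis i 1 + axis j 1" | i j where "a = axis i 1 - axis j 1" "i \<noteq> j"
      using a unfolding BC_pos_def by blast
    then show ?thesis using axis_add_nonzero axis_diff_nonzero by cases (auto simp: axis_eq_0_iff)
  qed
  show "0 \<le> ?k a" for a using k by (simp add: BC_mult_def)
  fix x :: "(real, 'n) vec"
  assume reg0: "\<And>c. c \<in> ?P \<Longrightarrow> c \<bullet> x \<noteq> 0"
  then have reg: "x $ p \<noteq> 0" "p \<noteq> q \<Longrightarrow> x $ p \<noteq> x $ q" "p \<noteq> q \<Longrightarrow> x $ p \<noteq> - x $ q" for p q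
    using BC_regular[of x] by blast+
  show "b \<bullet> refl_root a x \<noteq> 0" if a: "a \<in> ?P" and b: "b \<in> ?P" for a b
  proof -
    consider i where "a = 1 *\<^sub>R axis i 1" | i where "a = 2 *\<^sub>R axis i 1" | i j where "a = axis i 1 + axis j 1" "i \<noteq> j" | i j where "a = axis i 1 - axis j 1" "i \<noteq> j"
      using a unfolding BC_pos_def by fastforce
    then have "\<exists>\<pi>. inj \<pi> \<and> (\<forall>p. refl_root a x $ p = x $ \<pi> p \<or> refl_root a x $ p = - x $ \<pi> p)"
    proof cases
      case (1 i)
      show ?thesis unfolding 1 refl_root_short[OF zero_neq_one[symmetric]] by (rule exI[of _ id]) simp
    next
      case (2 i)
      show ?thesis unfolding 2 refl_root_short[OF zero_neq_numeral[symmetric]] by (rule exI[of _ id]) simp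
    next
      case (3 i j)
      show ?thesis unfolding 3(1) refl_root_plus[OF 3(2)]
        by (rule exI[of _ "\<lambda>p. if p = i then j else if p = j then i else p"])
           (simp add: inj_def)
    next
      case (4 i j)
      show ?thesis unfolding 4(1) refl_root_minus[OF 4(2)]
        by (rule exI[of _ "\<lambda>p. if p = i then j else if p = j then i else p"])
           (simp add: inj_def)
    qed
    then obtain \<pi> where \<pi>: "inj \<pi>" "\<forall>p. refl_root a x $ p = x $ \<pi> p \<or> refl_root a x $ p = - x $ \<pi> p"
      by blast
    have "(\<forall>p. refl_root a x $ p \<noteq> 0) \<and> (\<forall>p q. p \<noteq> q \<longrightarrow> refl_root a x $ p \<noteq> refl_root a x $ q \<and> refl_root a x $ p \<noteq> - refl_root a x $ q)"
      by (rule signed_permutation_regular[where x = x, OF reg(1) reg(2) reg(3) \<pi>])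
    from bspec[OF iffD2[OF BC_regular this] b] show ?thesis .
  qed
  fix i j :: 'n and f :: "(real, 'n) vec \<Rightarrow> complex"
  show "(\<Sum>a\<in>?P. \<Sum>b\<in>?P. of_real (?k a * ?k b * (a $ i * b $ j - a $ j * b $ i)) * Del a (Del b f) x) = 0"
  proof (cases "i = j")
    case ij: False
    define B where "B = (\<lambda>a b. Del_comm a b f x)"
    have Bsw: "B b a = - B a b" for a b unfolding B_def by (rule Del_comm_swap)
    have Borth: "B a b = 0" if "a \<bullet> b = 0" for a b unfolding B_def by (rule Del_comm_orthogonal[OF that])
    let ?e = "\<lambda>i. axis i 1 :: (real, 'n) vec"
    let ?q = "\<lambda>i p. ?e i + ?e p"
    have A2: "B a b + B a (a + b) + B (a + b) b = 0"
      if "a \<bullet> a = 2" "b \<bullet> b = 2" "a \<bullet> b = - 1" "a \<bullet> x \<noteq> 0" "b \<bullet> x \<noteq> 0" "(a + b) \<bullet> x \<noteq> 0" for a b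
      unfolding B_def by (rule Del_comm_A2) (use that in auto)
    have rt2: "min_max_root p q \<bullet> min_max_root p q = 2" if "p \<noteq> q" for p q :: 'n
      by (rule min_max_root_norm[OF that])
    have qx: "?q p q \<bullet> x \<noteq> 0" if "p \<noteq> q" for p q using reg(3)[OF that] by (simp add: inner_add_left add_eq_0_iff2)
    have rx: "min_max_root p q \<bullet> x \<noteq> 0" if "p \<noteq> q" for p q using reg(2)[OF that] by (simp add: min_max_root_inner)
    have q2: "?q p q \<bullet> ?q p q = 2" if "p \<noteq> q" for p q
      using that by (simp add: inner_add_left axis_index)
    \<comment> \<open>the four subsystems of type \<open>A\<^sub>2\<close> through the indices \<open>p\<close>, \<open>q\<close>, \<open>r\<close>\<close>
    have F1: "order_sign p r * order_sign q r * B (min_max_root p r) (min_max_root q r) + order_sign p q * order_sign q r * B (min_max_root p q) (min_max_root q r)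
       + order_sign p r * order_sign q p * B (min_max_root p r) (min_max_root q p) = 0" if "p \<noteq> q" "p \<noteq> r" "q \<noteq> r" for p q r
      unfolding B_def
    proof (rule triple_sum_zero[where D = min_max_root])
      show "min_max_root p q = min_max_root q p" for p q :: 'n by (rule min_max_root_commute)
      fix p q s :: 'n assume pqs: "p < q" "q < s"
      have ps: "p < s" using pqs by simp
      have e: "min_max_root p s = min_max_root p q + min_max_root q s" using pqs ps by (simp add: min_max_root_less)
      have "B (min_max_root p q) (min_max_root q s) + B (min_max_root p q) (min_max_root p q + min_max_root q s) + B (min_max_root p q + min_max_root q s) (min_max_root q s) = 0"
      proof (rule A2)
        show "min_max_root p q \<bullet> min_max_root q s = - 1" by (rule min_max_root_chain[OF pqs])
        show "(min_max_root p q + min_max_root q s) \<bullet> x \<noteq> 0" unfolding e[symmetric] by (rule rx) (use ps in simp)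
      qed (use pqs in \<open>auto intro!: rt2 rx\<close>)
      then show "Del_comm (min_max_root p q) (min_max_root q s) f x + Del_comm (min_max_root p q) (min_max_root p s) f x + Del_comm (min_max_root p s) (min_max_root q s) f x = 0"
        unfolding e B_def .
    qed (use that in auto)
    have F2: "order_sign p r * B (min_max_root p r) (?q q r) + B (?q p q) (?q q r) + order_sign p r * B (min_max_root p r) (?q p q) = 0"
      if d: "p \<noteq> q" "p \<noteq> r" "q \<noteq> r" for p q r
    proof (cases "p < r")
      case True
      have e: "min_max_root p r + ?q q r = ?q p q" using True by (simp add: min_max_root_less algebra_simps)
      have "B (min_max_root p r) (?q q r) + B (min_max_root p r) (min_max_root p r + ?q q r) + B (min_max_root p r + ?q q r) (?q q r) = 0"
      proof (rule A2)
        show "min_max_root p r \<bullet> ?q q r = - 1" using True d by (simp add: min_max_root_inner axis_index)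
        show "(min_max_root p r + ?q q r) \<bullet> x \<noteq> 0" unfolding e by (rule qx[OF d(1)])
      qed (use d in \<open>auto intro!: rt2 rx qx q2\<close>)
      then show ?thesis unfolding e using True by (simp add: order_sign_def algebra_simps)
    next
      case False
      then have rp: "r < p" using d by simp
      have e: "min_max_root p r + ?q p q = ?q q r" using rp by (simp add: min_max_root_commute[of p r] min_max_root_less algebra_simps)
      have "B (min_max_root p r) (?q p q) + B (min_max_root p r) (min_max_root p r + ?q p q) + B (min_max_root p r + ?q p q) (?q p q) = 0"
      proof (rule A2)
        show "min_max_root p r \<bullet> ?q p q = - 1" using False d by (simp add: min_max_root_inner axis_index)
        show "(min_max_root p r + ?q p q) \<bullet> x \<noteq> 0" unfolding e by (rule qx[OF d(3)])
      qed (use d in \<open>auto intro!: rt2 rx qx q2\<close>)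
      then show ?thesis unfolding e using False by (simp add: order_sign_def Bsw[of "?q q r"] algebra_simps eq_neg_iff_add_eq_0 add_eq_0_iff)
    qed
    have F4: "B (?q p r) (?q q r) + order_sign p q * B (min_max_root p q) (?q q r) + order_sign q p * B (?q p r) (min_max_root q p) = 0"
      if d: "p \<noteq> q" "p \<noteq> r" "q \<noteq> r" for p q r
    proof -
      have qc: "?q p r = ?q r p" "?q q r = ?q r q" by (simp_all add: add.commute)
      have s: "order_sign q p = - order_sign p q" using d by (auto simp: order_sign_def)
      have "order_sign p q * B (min_max_root p q) (?q r q) + B (?q p r) (?q r q) + order_sign p q * B (min_max_root p q) (?q p r) = 0"
        by (rule F2) (use d in auto)
      then show ?thesis unfolding s min_max_root_commute[of q p] Bsw[of "?q p r" "min_max_root p q"] qc(2) by (simp add: algebra_simps)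
    qed
    let ?M = "\<lambda>i p a. order_sign i p * B a (min_max_root i p) + B a (?q i p)"
    let ?b = "\<lambda>p q. order_sign i p * ?M j q (min_max_root i p) + ?M j q (?q i p)"
    have short: "(\<Sum>q\<in>UNIV - {j}. of_real k3 * ?M j q (c *\<^sub>R ?e i)) = of_real k3 * ?M j i (c *\<^sub>R ?e i)" for c
    proof -
      have "(\<Sum>q\<in>UNIV - {j}. of_real k3 * ?M j q (c *\<^sub>R ?e i)) = (\<Sum>q\<in>{i}. of_real k3 * ?M j q (c *\<^sub>R ?e i))"
      proof (rule sum.mono_neutral_right)
        show "\<forall>q\<in>UNIV - {j} - {i}. of_real k3 * ?M j q (c *\<^sub>R ?e i) = 0"
        proof
          fix q assume q: "q \<in> UNIV - {j} - {i}"
          have "c *\<^sub>R ?e i \<bullet> min_max_root j q = 0" "c *\<^sub>R ?e i \<bullet> ?q j q = 0"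
            using q ij by (auto simp: min_max_root_def axis_index min_def max_def)
          then show "of_real k3 * ?M j q (c *\<^sub>R ?e i) = 0" by (simp add: Borth)
        qed
      qed (use ij in auto)
      then show ?thesis by simp
    qed
    have short': "(\<Sum>p\<in>UNIV - {i}. of_real k3 * (order_sign i p * B (min_max_root i p) (c *\<^sub>R ?e j) + B (?q i p) (c *\<^sub>R ?e j)))
       = of_real k3 * (order_sign i j * B (min_max_root i j) (c *\<^sub>R ?e j) + B (?q i j) (c *\<^sub>R ?e j))" for c
    proof -
      have "(\<Sum>p\<in>UNIV - {i}. of_real k3 * (order_sign i p * B (min_max_root i p) (c *\<^sub>R ?e j) + B (?q i p) (c *\<^sub>R ?e j)))
        = (\<Sum>p\<in>{j}. of_real k3 * (order_sign i p * B (min_max_root i p) (c *\<^sub>R ?e j) + B (?q i p) (c *\<^sub>R ?e j)))"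
      proof (rule sum.mono_neutral_right)
        show "\<forall>p\<in>UNIV - {i} - {j}. of_real k3 * (order_sign i p * B (min_max_root i p) (c *\<^sub>R ?e j) + B (?q i p) (c *\<^sub>R ?e j)) = 0"
        proof
          fix p assume p: "p \<in> UNIV - {i} - {j}"
          have "min_max_root i p \<bullet> c *\<^sub>R ?e j = 0" "?q i p \<bullet> c *\<^sub>R ?e j = 0"
            using p ij by (auto simp: min_max_root_inner inner_add_left axis_index)
          then show "of_real k3 * (order_sign i p * B (min_max_root i p) (c *\<^sub>R ?e j) + B (?q i p) (c *\<^sub>R ?e j)) = 0" by (simp add: Borth)
        qed
      qed (use ij in auto)
      then show ?thesis by simp
    qed
    have BC2: "?M j i (c *\<^sub>R ?e i) + (order_sign i j * B (min_max_root i j) (c *\<^sub>R ?e j) + B (?q i j) (c *\<^sub>R ?e j)) = 0" if c: "c = 1 \<or> c = 2" for c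
    proof -
      have main: "B (c *\<^sub>R ?e p) (?e p - ?e q) + B (c *\<^sub>R ?e q) (?e p - ?e q) + B (c *\<^sub>R ?e q) (?q p q) - B (c *\<^sub>R ?e p) (?q p q) = 0"
        if pq: "p \<noteq> q" for p q
        unfolding B_def
        by (rule Del_comm_BC2) (use pq c reg(1) reg(2,3)[OF pq] in \<open>auto simp: axis_index inner_add_left inner_diff_left add_eq_0_iff2\<close>)
      show ?thesis
      proof (cases "i < j")
        case True
        then have nl: "\<not> j < i" by simp
        have r: "min_max_root i j = ?e i - ?e j" "min_max_root j i = ?e i - ?e j" "?q j i = ?q i j" using True by (simp_all add: min_max_root_less min_max_root_commute[of j i] add.commute)
        show ?thesis unfolding r using main[OF ij] True nl
          by (simp add: order_sign_def Bsw[of _ "c *\<^sub>R ?e j"] algebra_simps add_eq_0_iff)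
      next
        case False
        then have ji: "j < i" using ij by simp
        have r: "min_max_root i j = ?e j - ?e i" "min_max_root j i = ?e j - ?e i" "?q i j = ?q j i" using ji by (simp_all add: min_max_root_less min_max_root_commute[of i j] add.commute)
        show ?thesis unfolding r using main[OF ij[symmetric]] False ji
          by (simp add: order_sign_def Bsw[of _ "c *\<^sub>R ?e j"] algebra_simps add_eq_0_iff)
      qed
    qed
    have ee: "B (c *\<^sub>R ?e i) (d *\<^sub>R ?e j) = 0" for c d by (rule Borth) (use ij in \<open>simp add: axis_index\<close>)
    have ee1: "B (?e i) (?e j) = 0" "B (2 *\<^sub>R ?e i) (?e j) = 0" "B (?e i) (2 *\<^sub>R ?e j) = 0" "B (2 *\<^sub>R ?e i) (2 *\<^sub>R ?e j) = 0"
      using ee[of 1 1] ee[of 2 1] ee[of 1 2] ee[of 2 2] by simp_all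
    have quad: "(\<Sum>p\<in>UNIV - {i}. \<Sum>q\<in>UNIV - {j}. ?b p q) = 0"
    proof -
      have "(\<Sum>p\<in>UNIV - {i}. \<Sum>q\<in>UNIV - {j}. ?b p q) = ?b j i + (\<Sum>r\<in>UNIV - {i, j}. ?b r r + ?b j r + ?b r i)"
      proof (rule double_index_sum[OF ij])
        fix p q assume d: "p \<noteq> i" "q \<noteq> j" "p \<noteq> j" "q \<noteq> i" "p \<noteq> q"
        have "min_max_root i p \<bullet> min_max_root j q = 0" "min_max_root i p \<bullet> ?q j q = 0" "?q i p \<bullet> min_max_root j q = 0" "?q i p \<bullet> ?q j q = 0"
          using d ij by (simp_all add: min_max_root_inner[of i p] inner_add_left) (auto simp: min_max_root_def axis_index min_def max_def)
        then show "?b p q = 0" by (simp add: Borth)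
      qed
      also have "?b j i = 0"
      proof -
        have o: "min_max_root i j \<bullet> ?q j i = 0" "min_max_root j i \<bullet> ?q i j = 0" using ij by (simp_all add: min_max_root_inner axis_index)
        have z: "B (min_max_root i j) (min_max_root j i) = 0" "B (min_max_root i j) (?q j i) = 0" "B (?q i j) (min_max_root j i) = 0" "B (?q i j) (?q j i) = 0"
        proof -
          show "B (min_max_root i j) (min_max_root j i) = 0" by (simp add: min_max_root_commute[of j i] B_def)
          show "B (min_max_root i j) (?q j i) = 0" by (rule Borth[OF o(1)])
          show "B (?q i j) (min_max_root j i) = 0" by (rule Borth) (use o(2) in \<open>simp only: inner_commute\<close>)
          show "B (?q i j) (?q j i) = 0" unfolding add.commute[of "?e i"] by (simp add: B_def)
        qed
        show ?thesis unfolding z by simp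
      qed
      also have "(\<Sum>r\<in>UNIV - {i, j}. ?b r r + ?b j r + ?b r i) = 0"
      proof (rule sum.neutral, rule ballI)
        fix r assume "r \<in> UNIV - {i, j}"
        then have r: "i \<noteq> r" "j \<noteq> r" by auto
        have f3: "order_sign j r * B (min_max_root j r) (?q i r) + B (?q j i) (?q i r) + order_sign j r * B (min_max_root j r) (?q j i) = 0"
          by (rule F2) (use r ij in auto)
        have "(order_sign i r * order_sign j r * B (min_max_root i r) (min_max_root j r) + order_sign i j * order_sign j r * B (min_max_root i j) (min_max_root j r) + order_sign i r * order_sign j i * B (min_max_root i r) (min_max_root j i))
          + (order_sign i r * B (min_max_root i r) (?q j r) + B (?q i j) (?q j r) + order_sign i r * B (min_max_root i r) (?q i j))
          - (order_sign j r * B (min_max_root j r) (?q i r) + B (?q j i) (?q i r) + order_sign j r * B (min_max_root j r) (?q j i))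
          + (B (?q i r) (?q j r) + order_sign i j * B (min_max_root i j) (?q j r) + order_sign j i * B (?q i r) (min_max_root j i)) = 0"
          unfolding F1[OF ij r] F2[OF ij r] f3 F4[OF ij r] by simp
        moreover have "?q j i = ?q i j" by (simp add: add.commute)
        ultimately show "?b r r + ?b j r + ?b r i = 0"
          unfolding Bsw[of "?q i r" "min_max_root j r", THEN sym, symmetric] Bsw[of "?q i j" "min_max_root j r"]
          by (simp add: Bsw[of "min_max_root j r" "?q i r"] Bsw[of "?q i j" "?q i r"] Bsw[of "min_max_root j r" "?q i j"] algebra_simps)
      qed
      finally show ?thesis by simp
    qed
    have "(\<Sum>a\<in>?P. \<Sum>b\<in>?P. of_real (?k a * ?k b * (a $ i * b $ j - a $ j * b $ i)) * Del a (Del b f) x) =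
      (\<Sum>a\<in>?P. of_real (?k a * a $ i) * (\<Sum>b\<in>?P. of_real (?k b * b $ j) * B a b))"
      unfolding commutator_sum B_def ..
    also have "\<dots> = of_real k1 * (of_real k3 * ?M j i (1 *\<^sub>R ?e i)) + of_real (2 * k2) * (of_real k3 * ?M j i (2 *\<^sub>R ?e i))
      + (\<Sum>p\<in>UNIV - {i}. of_real k3 * (order_sign i p * (of_real k1 * B (min_max_root i p) (?e j) + of_real (2 * k2) * B (min_max_root i p) (2 *\<^sub>R ?e j)
           + (\<Sum>q\<in>UNIV - {j}. of_real k3 * ?M j q (min_max_root i p)))
         + (of_real k1 * B (?q i p) (?e j) + of_real (2 * k2) * B (?q i p) (2 *\<^sub>R ?e j)
           + (\<Sum>q\<in>UNIV - {j}. of_real k3 * ?M j q (?q i p)))))"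
      unfolding weighted_sum_BC using short[of 1] short[of 2] by (simp add: ee1)
    also have "\<dots> = of_real k1 * (of_real k3 * ?M j i (1 *\<^sub>R ?e i)) + of_real (2 * k2) * (of_real k3 * ?M j i (2 *\<^sub>R ?e i))
      + (of_real k1 * (\<Sum>p\<in>UNIV - {i}. of_real k3 * (order_sign i p * B (min_max_root i p) (1 *\<^sub>R ?e j) + B (?q i p) (1 *\<^sub>R ?e j)))
       + of_real (2 * k2) * (\<Sum>p\<in>UNIV - {i}. of_real k3 * (order_sign i p * B (min_max_root i p) (2 *\<^sub>R ?e j) + B (?q i p) (2 *\<^sub>R ?e j)))
       + of_real (k3 * k3) * (\<Sum>p\<in>UNIV - {i}. \<Sum>q\<in>UNIV - {j}. ?b p q))"
    proof -
      have eq: "of_real k3 * (order_sign i p * (of_real k1 * B (min_max_root i p) (?e j) + of_real (2 * k2) * B (min_max_root i p) (2 *\<^sub>R ?e j)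
           + (\<Sum>q\<in>UNIV - {j}. of_real k3 * ?M j q (min_max_root i p)))
         + (of_real k1 * B (?q i p) (?e j) + of_real (2 * k2) * B (?q i p) (2 *\<^sub>R ?e j)
           + (\<Sum>q\<in>UNIV - {j}. of_real k3 * ?M j q (?q i p))))
       = of_real k1 * (of_real k3 * (order_sign i p * B (min_max_root i p) (1 *\<^sub>R ?e j) + B (?q i p) (1 *\<^sub>R ?e j)))
       + of_real (2 * k2) * (of_real k3 * (order_sign i p * B (min_max_root i p) (2 *\<^sub>R ?e j) + B (?q i p) (2 *\<^sub>R ?e j)))
       + of_real (k3 * k3) * (\<Sum>q\<in>UNIV - {j}. ?b p q)" for p
      proof -
        have "(\<Sum>q\<in>UNIV - {j}. ?b p q) = order_sign i p * (\<Sum>q\<in>UNIV - {j}. ?M j q (min_max_root i p)) + (\<Sum>q\<in>UNIV - {j}. ?M j q (?q i p))"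
          unfolding sum.distrib[of "\<lambda>q. order_sign i p * ?M j q (min_max_root i p)"] sum_distrib_left ..
        moreover have "(\<Sum>q\<in>UNIV - {j}. of_real k3 * ?M j q a) = of_real k3 * (\<Sum>q\<in>UNIV - {j}. ?M j q a)" for a
          by (rule sum_distrib_left[symmetric])
        moreover have "K3 * (s * (K1 * b1 + K2 * b2 + K3 * S1) + (K1 * c1 + K2 * c2 + K3 * S2)) =
            K1 * (K3 * (s * b1 + c1)) + K2 * (K3 * (s * b2 + c2)) + K3 * K3 * (s * S1 + S2)"
          for K1 K2 K3 s b1 b2 c1 c2 S1 S2 :: complex by (simp add: algebra_simps)
        ultimately show ?thesis by (simp only: scaleR_one of_real_mult)
      qed
      have sum3: "(\<Sum>p\<in>S. u * F p + v * H p + w * K p) = u * sum F S + v * sum H S + w * sum K S"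
        for u v w :: complex and F H K :: "'n \<Rightarrow> complex" and S by (simp add: sum.distrib sum_distrib_left)
      show ?thesis by (simp only: eq sum3)
    qed
    also have "\<dots> = of_real k1 * of_real k3 * (?M j i (1 *\<^sub>R ?e i) + (order_sign i j * B (min_max_root i j) (1 *\<^sub>R ?e j) + B (?q i j) (1 *\<^sub>R ?e j)))
      + of_real (2 * k2) * of_real k3 * (?M j i (2 *\<^sub>R ?e i) + (order_sign i j * B (min_max_root i j) (2 *\<^sub>R ?e j) + B (?q i j) (2 *\<^sub>R ?e j)))"
      unfolding short' quad by (simp only: distrib_left mult.assoc) (simp only: add_ac mult_zero_right add_0_right add_0_left)
    also have "\<dots> = 0" using BC2[of 1] BC2[of 2] by (simp only: mult_zero_right simp_thms add_0_left)
    finally show ?thesis .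
  qed simp
qed

section \<open>Bounds uniform in the multiplicity\<close>

text \<open>The bound depends on the spectral parameter shifted by \<open>\<rho>(k)\<close>, but not on \<open>k\<close> otherwise.\<close>

lemma kernel_norm_bound:
  fixes f :: "real ^ 'n \<Rightarrow> complex"
  assumes k: "\<And>a. a \<in> P \<Longrightarrow> k a \<ge> 0" and f: "is_cherednik_kernel P k m f"
  shows "norm (f x) \<le> exp ((norm (m + cvec (rho P k)) + 1) * norm x)"
proof -
  have "norm (f x) \<le> exp ((norm (m + cvec (rho P k)) + 1) * norm x) * max (norm (f 0)) 0"
  proof (rule euler_bound[where R = "norm x" and s = "\<lambda>_. 0" and b = "bilin (m + cvec (rho P k))" and k = k and P = P
        and f' = "\<lambda>x. frechet_derivative f (at x)"])
    show "(f has_derivative frechet_derivative f (at y)) (at y)" for y by (rule kernel_euler(1)[OF f])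
    show "frechet_derivative f (at y) y = bilin (m + cvec (rho P k)) y * f y + 0
      - (\<Sum>a\<in>P. of_real (k a * rpsi (a \<bullet> y)) * (f y - f (refl_root a y)))" for y
      unfolding kernel_euler(2)[OF f] by (simp add: bilin_add_left bilin_cvec inner_commute)
  qed (use k norm_bilin_le in auto)
  moreover have "f 0 = 1" using f by (simp add: is_cherednik_kernel_def)
  ultimately show ?thesis by simp
qed

text \<open>The difference of two kernels solves the Euler equation of the first with the source term
  \<open>\<langle>m - n, x\<rangle> g x\<close>, where \<open>g\<close> is the second. Both kernels have the value \<open>1\<close> at the origin.\<close>

lemma kernel_lipschitz:
  fixes f g :: "real ^ 'n \<Rightarrow> complex"
  assumes k: "\<And>a. a \<in> P \<Longrightarrow> k a \<ge> 0" and f: "is_cherednik_kernel P k m f" and g: "is_cherednik_kernel P k n g"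
    and c: "norm (m + cvec (rho P k)) \<le> C" "norm (n + cvec (rho P k)) \<le> C"
  shows "norm (f x - g x) \<le> exp (2 * (C + 1) * norm x) * norm (m - n)"
proof -
  let ?m = "m + cvec (rho P k)" and ?n = "n + cvec (rho P k)"
  define \<epsilon> where "\<epsilon> = norm (m - n) * exp ((C + 1) * norm x)"
  have C0: "C \<ge> 0" using c(1) norm_ge_zero order_trans by blast
  have "norm (f x - g x) \<le> exp ((C + 1) * norm x) * max (norm (f 0 - g 0)) \<epsilon>"
  proof (rule euler_bound[where R = "norm x" and s = "\<lambda>x. bilin (m - n) x * g x" and b = "bilin ?m" and k = k and P = P
        and f' = "\<lambda>x h. frechet_derivative f (at x) h - frechet_derivative g (at x) h"])
    show "((\<lambda>x. f x - g x) has_derivative (\<lambda>h. frechet_derivative f (at x) h - frechet_derivative g (at x) h)) (at x)" for x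
      by (intro has_derivative_diff kernel_euler(1)[OF f] kernel_euler(1)[OF g])
    show "frechet_derivative f (at x) x - frechet_derivative g (at x) x = bilin ?m x * (f x - g x) + bilin (m - n) x * g x -
         (\<Sum>a\<in>P. of_real (k a * rpsi (a \<bullet> x)) * (f x - g x - (f (refl_root a x) - g (refl_root a x))))" for x
      unfolding kernel_euler(2)[OF f] kernel_euler(2)[OF g]
      by (simp add: bilin_add_left bilin_diff_left bilin_cvec algebra_simps inner_commute sum_subtractf sum.distrib)
    fix y :: "real ^ 'n" assume y: "norm y \<le> norm x"
    show "norm (bilin ?m y) \<le> C * norm y"
      by (rule order_trans[OF norm_bilin_le mult_right_mono[OF c(1)]]) simp
    have "norm (g y) \<le> exp ((norm ?n + 1) * norm y)" by (rule kernel_norm_bound[OF k g])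
    also have "\<dots> \<le> exp ((C + 1) * norm x)"
      unfolding exp_le_cancel_iff using c(2) y C0 by (intro mult_mono) auto
    finally have "norm (bilin (m - n) y * g y) \<le> (norm (m - n) * norm y) * exp ((C + 1) * norm x)"
      unfolding norm_mult by (intro mult_mono norm_bilin_le) auto
    then show "norm (bilin (m - n) y * g y) \<le> \<epsilon> * norm y" by (simp add: \<epsilon>_def mult_ac)
  qed (use k C0 in \<open>auto simp: \<epsilon>_def\<close>)
  moreover have "f 0 = 1" "g 0 = 1" using f g by (simp_all add: is_cherednik_kernel_def)
  moreover have "exp ((C + 1) * norm x) * exp ((C + 1) * norm x) = exp (2 * (C + 1) * norm x)"
    by (simp flip: exp_add)
  ultimately show ?thesis by (simp add: \<epsilon>_def max_def mult_ac)
qed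

lemma G_A_kernel:
  fixes m :: "(complex, 'n::{finite,linorder}) vec"
  assumes "0 \<le> k3"
  shows "is_cherednik_kernel A_pos (\<lambda>_. k3) m (G_A k3 m)"
    and "continuous_on UNIV (\<lambda>x. frechet_derivative (G_A k3 m) (at x) v)"
proof -
  obtain f where f: "is_cherednik_kernel A_pos (\<lambda>_. k3) m f" "\<forall>v. continuous_on UNIV (\<lambda>x. frechet_derivative f (at x) v)"
    using commuting_roots.cherednik_kernel_exists[OF commuting_A[OF assms]] by blast
  have "G_A k3 m = f" unfolding G_A_def by (rule cherednik_kernel_eqI[OF _ f(1)]) (rule assms)
  then show "is_cherednik_kernel A_pos (\<lambda>_. k3) m (G_A k3 m)"
    "continuous_on UNIV (\<lambda>x. frechet_derivative (G_A k3 m) (at x) v)" using f by simp_all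
qed

lemma BC_mult_nonneg: "0 \<le> k1 \<Longrightarrow> 0 \<le> k2 \<Longrightarrow> 0 \<le> k3 \<Longrightarrow> 0 \<le> BC_mult k1 k2 k3 a"
  by (simp add: BC_mult_def)

lemma G_BC_kernel:
  fixes m :: "(complex, 'n::{finite,linorder}) vec"
  assumes "0 \<le> k1" "0 \<le> k2" "0 \<le> k3"
  shows "is_cherednik_kernel BC_pos (BC_mult k1 k2 k3) m (G_BC k1 k2 k3 m)"
proof -
  obtain f where f: "is_cherednik_kernel BC_pos (BC_mult k1 k2 k3) m f"
    using commuting_roots.cherednik_kernel_exists[OF commuting_BC[OF assms]] by blast
  have "G_BC k1 k2 k3 m = f" unfolding G_BC_def
    by (rule cherednik_kernel_eqI[OF _ f]) (rule BC_mult_nonneg[OF assms])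
  then show ?thesis using f by simp
qed

lemma G_A_derivative:
  fixes l :: "(complex, 'n::{finite,linorder}) vec"
  assumes "0 \<le> k3"
  defines "G \<equiv> G_A k3 (l - cvec (rho_A k3))"
  shows "frechet_derivative G (at y) v = bilin l v * G y
    - (\<Sum>(i, j)\<in>ppairs. of_real (k3 * (v $ j - v $ i)) * diff_quot (axis j 1 - axis i 1) G y)"
proof -
  have "cherednik_op A_pos (\<lambda>_. k3) v G y = bilin (l - cvec (rho_A k3)) v * G y"
    using G_A_kernel(1)[OF assms(1)] unfolding G_def is_cherednik_kernel_def by blast
  then have "frechet_derivative G (at y) v = bilin l v * G y - (\<Sum>a\<in>A_pos. of_real (k3 * (a \<bullet> v)) * diff_quot a G y)"
    unfolding cherednik_op_def rho_A_eq bilin_diff_left bilin_cvec inner_commute[of v "rho_A k3"] by (simp add: left_diff_distrib eq_diff_eq)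
  then show ?thesis unfolding sum_A_pos by (simp add: inner_diff_left)
qed

section \<open>The projection formula\<close>

text \<open>All roots of type A are orthogonal to \<open>(1, \<dots>, 1)\<close>, so in this direction the Cherednik operator is the
  derivative.\<close>

lemma G_A_translate:
  fixes l :: "(complex, 'n::{finite,linorder}) vec"
  assumes k3: "0 \<le> k3"
  defines "G \<equiv> G_A k3 (l - cvec (rho_A k3))"
  shows "G (y + t *\<^sub>R 1) = exp (of_real t * bilin l 1) * G y"
proof -
  have d: "(G has_derivative frechet_derivative G (at z)) (at z)" for z
    unfolding G_def by (rule kernel_euler(1)[OF G_A_kernel(1)[OF k3]])
  have one: "frechet_derivative G (at z) 1 = bilin l 1 * G z" for z
    unfolding G_def G_A_derivative[OF k3] by simp
  define F where "F = (\<lambda>t::real. exp (- (of_real t * bilin l 1)) * G (y + t *\<^sub>R 1))"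
  have "(F has_vector_derivative 0) (at t)" for t
  proof -
    have "((\<lambda>t::real. y + t *\<^sub>R 1) has_derivative (\<lambda>h. h *\<^sub>R 1)) (at t)" by (auto intro!: derivative_eq_intros)
    from has_derivative_compose[OF this d]
    have "((\<lambda>t. G (y + t *\<^sub>R 1)) has_derivative (\<lambda>h. frechet_derivative G (at (y + t *\<^sub>R 1)) (h *\<^sub>R 1))) (at t)" .
    moreover have "frechet_derivative G (at (y + t *\<^sub>R 1)) (h *\<^sub>R 1) = h *\<^sub>R (bilin l 1 * G (y + t *\<^sub>R 1))" for h
      unfolding linear_scale[OF bounded_linear.linear[OF has_derivative_bounded_linear[OF d]]] one ..
    ultimately have v: "((\<lambda>t. G (y + t *\<^sub>R 1)) has_vector_derivative (bilin l 1 * G (y + t *\<^sub>R 1))) (at t)"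
      by (simp add: has_vector_derivative_def)
    have e: "((\<lambda>t. exp (- (complex_of_real t * bilin l 1))) has_vector_derivative (exp (- (of_real t * bilin l 1)) * - bilin l 1)) (at t)"
      by (rule has_vector_derivative_eq_rhs, rule has_vector_derivative_real_field)
         (auto intro!: derivative_eq_intros)
    show ?thesis unfolding F_def
      by (rule has_vector_derivative_eq_rhs, rule has_vector_derivative_mult[OF e v]) simp
  qed
  then obtain c where c: "\<And>t. F t = c"
    using has_vector_derivative_zero_constant[of UNIV F] by auto
  have "F t = F 0" unfolding c ..
  then have "exp (- (of_real t * bilin l 1)) * G (y + t *\<^sub>R 1) = G y" by (simp add: F_def)
  then have "exp (of_real t * bilin l 1) * (exp (- (of_real t * bilin l 1)) * G (y + t *\<^sub>R 1)) = exp (of_real t * bilin l 1) * G y"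
    by simp
  then show ?thesis by (simp add: mult.assoc[symmetric] flip: exp_add)
qed

lemma A_roots_sum_zero:
  fixes w :: "(real, 'n::{finite,linorder}) vec"
  assumes "w \<in> span A_roots" shows "(\<Sum>i\<in>UNIV. w $ i) = 0"
proof -
  have "A_roots \<subseteq> {w :: (real, 'n) vec. (\<Sum>i\<in>UNIV. w $ i) = 0}"
    by (auto simp: A_roots_def A_pos_def sum_subtractf axis_index)
  moreover have "subspace {w :: (real, 'n) vec. (\<Sum>i\<in>UNIV. w $ i) = 0}"
    by (auto simp: subspace_def sum.distrib simp flip: sum_distrib_left)
  ultimately have "span A_roots \<subseteq> {w :: (real, 'n) vec. (\<Sum>i\<in>UNIV. w $ i) = 0}" by (rule span_minimal)
  then show ?thesis using assms by blast
qed

text \<open>A vector with coordinate sum \<open>0\<close> is the combination of the roots \<open>e\<^sub>i - e\<^sub>m\<close>, for a fixed index \<open>m\<close>, whose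
  coefficients are its coordinates.\<close>

lemma sum_zero_in_span_A_roots:
  fixes w :: "(real, 'n::{finite,linorder}) vec"
  assumes "(\<Sum>i\<in>UNIV. w $ i) = 0" shows "w \<in> span A_roots"
proof -
  obtain i0 :: 'n where True by blast
  have root: "axis i 1 - axis i0 1 \<in> span (A_roots :: (real, 'n) vec set)" for i
  proof (cases i i0 rule: linorder_cases)
    case less
    then have "axis i0 1 - axis i 1 \<in> (A_pos :: (real, 'n) vec set)" by (auto simp: A_pos_def)
    then have "- (axis i0 1 - axis i 1) \<in> (A_roots :: (real, 'n) vec set)" unfolding A_roots_def by blast
    then show ?thesis using span_base by fastforce
  next
    case equal
    then show ?thesis by (simp add: span_zero)
  next
    case greater
    then have "axis i 1 - axis i0 1 \<in> (A_pos :: (real, 'n) vec set)" by (auto simp: A_pos_def)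
    then show ?thesis unfolding A_roots_def by (auto intro: span_base)
  qed
  have "w = (\<Sum>i\<in>UNIV. w $ i *\<^sub>R (axis i 1 - axis i0 1))"
  proof -
    have "(\<Sum>i\<in>UNIV. w $ i *\<^sub>R (axis i 1 - axis i0 1)) $ p = w $ p - (\<Sum>i\<in>UNIV. w $ i) * axis i0 1 $ p" for p
    proof -
      have "w $ i * axis i 1 $ p = (if i = p then w $ p else 0)" for i by (simp add: axis_index)
      then show ?thesis by (simp add: right_diff_distrib sum_subtractf sum_distrib_right)
    qed
    then show ?thesis using assms by (simp add: vec_eq_iff)
  qed
  moreover have "(\<Sum>i\<in>UNIV. w $ i *\<^sub>R (axis i 1 - axis i0 1)) \<in> span (A_roots :: (real, 'n) vec set)"
    by (intro span_sum span_scale root)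
  ultimately show ?thesis by simp
qed

lemma orth_proj_A_roots:
  fixes v :: "(real, 'n::{finite,linorder}) vec"
  shows "orth_proj (span A_roots) v = v - ((\<Sum>i\<in>UNIV. v $ i) / CARD('n)) *\<^sub>R 1"
proof -
  define p where "p = v - ((\<Sum>i\<in>UNIV. v $ i) / CARD('n)) *\<^sub>R (1 :: (real, 'n) vec)"
  have pS: "p \<in> span A_roots"
    by (rule sum_zero_in_span_A_roots) (simp add: p_def sum_subtractf)
  have po: "(v - p) \<bullet> w = 0" if "w \<in> span A_roots" for w
  proof -
    have "(1 :: (real, 'n) vec) \<bullet> w = (\<Sum>i\<in>UNIV. w $ i)" by (simp add: inner_vec_def)
    then show ?thesis using A_roots_sum_zero[OF that] by (simp add: p_def)
  qed
  have uniq: "p' = p" if "p' \<in> span A_roots" "\<forall>w\<in>span A_roots. (v - p') \<bullet> w = 0" for p'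
  proof -
    have d: "p' - p \<in> span A_roots" using that(1) pS by (rule span_diff)
    have "(p' - p) \<bullet> (p' - p) = (v - p) \<bullet> (p' - p) - (v - p') \<bullet> (p' - p)" by (simp add: inner_diff_left)
    also have "\<dots> = 0" using po[OF d] that(2) d by simp
    finally show ?thesis by simp
  qed
  have "orth_proj (span A_roots) v = p"
    unfolding orth_proj_def
  proof (rule the_equality)
    show "p \<in> span A_roots \<and> (\<forall>w\<in>span A_roots. (v - p) \<bullet> w = 0)" using pS po by blast
  qed (use uniq in blast)
  then show ?thesis by (simp only: p_def)
qed

lemma G_A_projection:
  fixes l :: "(complex, 'n::{finite,linorder}) vec"
  assumes k3: "0 \<le> k3" and c: "\<And>i. c i > 0"
  shows "G_A k3 (l - cvec (rho_A k3)) (\<chi> i. ln (c i)) =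
    (\<Prod>i\<in>UNIV. of_real (c i) powr (bilin l 1 / of_nat CARD('n))) *
    G_A k3 (l - cvec (rho_A k3)) (orth_proj (span A_roots) (\<chi> i. ln (c i)))"
proof -
  let ?v = "(\<chi> i. ln (c i)) :: (real, 'n) vec"
  define m where "m = (\<Sum>i\<in>UNIV. ln (c i)) / CARD('n)"
  have "?v = orth_proj (span A_roots) ?v + m *\<^sub>R 1" unfolding orth_proj_A_roots by (simp add: m_def)
  then have "G_A k3 (l - cvec (rho_A k3)) ?v = exp (of_real m * bilin l 1) * G_A k3 (l - cvec (rho_A k3)) (orth_proj (span A_roots) ?v)"
    using G_A_translate[OF k3, of l "orth_proj (span A_roots) ?v" m] by simp
  moreover have "(\<Prod>i\<in>UNIV. of_real (c i) powr (bilin l 1 / of_nat CARD('n))) = exp (of_real m * bilin l 1)"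
  proof -
    have "of_real (c i) powr (bilin l 1 / of_nat CARD('n)) = exp (bilin l 1 / of_nat CARD('n) * of_real (ln (c i)))" for i
      using c[of i] by (simp add: powr_def Ln_of_real)
    then have "(\<Prod>i\<in>UNIV. of_real (c i) powr (bilin l 1 / of_nat CARD('n))) = exp (\<Sum>i\<in>UNIV. bilin l 1 / of_nat CARD('n) * of_real (ln (c i)))"
      by (simp add: exp_sum)
    also have "(\<Sum>i\<in>UNIV. bilin l 1 / of_nat CARD('n) * of_real (ln (c i))) = of_real m * bilin l 1"
      by (simp add: m_def sum_distrib_left sum_distrib_right sum_divide_distrib mult_ac)
    finally show ?thesis .
  qed
  ultimately show ?thesis by simp
qed

section \<open>Continuously differentiable functions\<close>

definition cont_diff :: "(real ^ 'n \<Rightarrow> complex) \<Rightarrow> bool"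
  where "cont_diff F \<longleftrightarrow> (\<forall>x. F differentiable (at x)) \<and> (\<forall>v. continuous_on UNIV (\<lambda>x. frechet_derivative F (at x) v))"

lemma cont_diff_has_derivative: "cont_diff F \<Longrightarrow> (F has_derivative frechet_derivative F (at x)) (at x)"
  by (simp add: cont_diff_def frechet_derivative_works)

lemma cont_diffI:
  assumes "\<And>x. (F has_derivative F' x) (at x)" "\<And>v. continuous_on UNIV (\<lambda>x. F' x v)"
  shows "cont_diff F"
proof -
  have "frechet_derivative F (at x) = F' x" for x using frechet_derivative_at[OF assms(1)] by simp
  then show ?thesis unfolding cont_diff_def differentiable_def using assms by auto
qed

lemma cont_diff_continuous: "cont_diff F \<Longrightarrow> continuous_on UNIV F"
  by (auto simp: cont_diff_def continuous_on_eq_continuous_at intro: differentiable_imp_continuous_within)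

lemma cont_diff_const [simp]: "cont_diff (\<lambda>_. c)"
  by (rule cont_diffI[where F' = "\<lambda>_ _. 0"]) auto

lemma cont_diff_add: "cont_diff F \<Longrightarrow> cont_diff H \<Longrightarrow> cont_diff (\<lambda>x. F x + H x)"
  by (rule cont_diffI[OF has_derivative_add[OF cont_diff_has_derivative cont_diff_has_derivative]]) (auto simp: cont_diff_def intro!: continuous_intros)

lemma cont_diff_diff: "cont_diff F \<Longrightarrow> cont_diff H \<Longrightarrow> cont_diff (\<lambda>x. F x - H x)"
  by (rule cont_diffI[OF has_derivative_diff[OF cont_diff_has_derivative cont_diff_has_derivative]]) (auto simp: cont_diff_def intro!: continuous_intros)

lemma cont_diff_mult:
  assumes "cont_diff F" "cont_diff H" shows "cont_diff (\<lambda>x. F x * H x)"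
  by (rule cont_diffI[OF has_derivative_mult[OF cont_diff_has_derivative[OF assms(1)] cont_diff_has_derivative[OF assms(2)]]])
     (use assms cont_diff_continuous[OF assms(1)] cont_diff_continuous[OF assms(2)] in \<open>auto simp: cont_diff_def intro!: continuous_intros\<close>)

lemma cont_diff_sum: "(\<And>i. i \<in> I \<Longrightarrow> cont_diff (F i)) \<Longrightarrow> cont_diff (\<lambda>x. \<Sum>i\<in>I. F i x)"
  by (induction I rule: infinite_finite_induct) (auto intro: cont_diff_add)

lemma cont_diff_compose_linear:
  assumes F: "cont_diff F" and L: "bounded_linear L" shows "cont_diff (\<lambda>x. F (L x))"
proof (rule cont_diffI)
  show "((\<lambda>x. F (L x)) has_derivative (\<lambda>h. frechet_derivative F (at (L x)) (L h))) (at x)" for x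
    by (rule has_derivative_compose[OF bounded_linear_imp_has_derivative[OF L] cont_diff_has_derivative[OF F]])
  show "continuous_on UNIV (\<lambda>x. frechet_derivative F (at (L x)) (L v))" for v
    by (rule continuous_on_compose2[of UNIV "\<lambda>x. frechet_derivative F (at x) (L v)"])
       (use F linear_continuous_on[OF L] in \<open>auto simp: cont_diff_def\<close>)
qed

text \<open>A continuously differentiable function that vanishes at the origin and its radial derivative are both
  of order \<open>|x|\<close> on balls, as \<open>euler_bound\<close> requires of a source term.\<close>

lemma cont_diff_bound:
  fixes F :: "real ^ 'n \<Rightarrow> complex"
  assumes F: "cont_diff F" "F 0 = 0"
  shows "\<exists>B\<ge>0. \<forall>x. norm x \<le> r \<longrightarrow> norm (F x) \<le> B * norm x \<and> norm (frechet_derivative F (at x) x) \<le> B * norm x"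
proof -
  have "\<exists>b. \<forall>x\<in>cball 0 r. norm (frechet_derivative F (at x) (axis i 1)) \<le> b" for i
  proof -
    have "compact ((\<lambda>x. frechet_derivative F (at x) (axis i 1)) ` cball 0 r)"
      by (rule compact_continuous_image) (use F in \<open>auto simp: cont_diff_def intro: continuous_on_subset\<close>)
    then have "bounded ((\<lambda>x. frechet_derivative F (at x) (axis i 1)) ` cball 0 r)" by (rule compact_imp_bounded)
    then show ?thesis by (auto simp: bounded_iff)
  qed
  then obtain b where b: "\<And>i x. x \<in> cball 0 r \<Longrightarrow> norm (frechet_derivative F (at x) (axis i 1)) \<le> b i" by metis
  define B where "B = (\<Sum>i\<in>UNIV. \<bar>b i\<bar>)"
  have B0: "B \<ge> 0" unfolding B_def by (intro sum_nonneg) auto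
  have D: "norm (frechet_derivative F (at x) h) \<le> B * norm h" if x: "x \<in> cball 0 r" for x h
  proof -
    have lin: "linear (frechet_derivative F (at x))"
      by (rule bounded_linear.linear[OF has_derivative_bounded_linear[OF cont_diff_has_derivative[OF F(1)]]])
    have h: "h = (\<Sum>i\<in>UNIV. h $ i *\<^sub>R axis i 1)"
      by (simp add: vec_eq_iff axis_index if_distrib[where f = "\<lambda>y. _ * y"] cong: if_cong)
    have "frechet_derivative F (at x) h = frechet_derivative F (at x) (\<Sum>i\<in>UNIV. h $ i *\<^sub>R axis i 1)"
      by (rule arg_cong[OF h])
    also have "\<dots> = (\<Sum>i\<in>UNIV. h $ i *\<^sub>R frechet_derivative F (at x) (axis i 1))"
      unfolding linear_sum[OF lin] linear_scale[OF lin] ..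
    also have "norm \<dots> \<le> (\<Sum>i\<in>UNIV. norm h * \<bar>b i\<bar>)"
    proof (rule sum_norm_le)
      fix i
      have "norm (frechet_derivative F (at x) (axis i 1)) \<le> \<bar>b i\<bar>" using b[OF x, of i] by linarith
      then show "norm (h $ i *\<^sub>R frechet_derivative F (at x) (axis i 1)) \<le> norm h * \<bar>b i\<bar>"
        unfolding norm_scaleR by (intro mult_mono) (auto simp: component_le_norm_cart)
    qed
    finally show ?thesis by (simp add: B_def sum_distrib_left mult.commute)
  qed
  have "norm (F x) \<le> B * norm x" if x: "norm x \<le> r" for x
  proof -
    have r0: "0 \<le> r" using order_trans[OF norm_ge_zero x] .
    have "norm (F x - F 0) \<le> B * norm (x - 0)"
    proof (rule differentiable_bound[of "cball 0 r"])
      show "(F has_derivative frechet_derivative F (at y)) (at y within cball 0 r)" for y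
        by (rule has_derivative_at_withinI[OF cont_diff_has_derivative[OF F(1)]])
      show "onorm (frechet_derivative F (at y)) \<le> B" if "y \<in> cball 0 r" for y
        by (rule onorm_bound[OF B0]) (use D[OF that] in simp)
    qed (use x r0 in auto)
    then show ?thesis by (simp add: F)
  qed
  then show ?thesis using B0 D by (intro exI[of _ B]) auto
qed

section \<open>The substitution \<open>y = log cosh\<^sup>2 (x / 2)\<close>\<close>

lemma log_cosh_derivative: "((\<lambda>t. ln ((cosh (t / 2))\<^sup>2)) has_real_derivative tanh (t / 2)) (at t)"
proof -
  have c: "cosh (t / 2) > 0" by (rule cosh_real_pos)
  have "((\<lambda>t. ln ((cosh (t / 2))\<^sup>2)) has_real_derivative (2 * cosh (t / 2) * (sinh (t / 2) * (1 / 2))) / (cosh (t / 2))\<^sup>2) (at t)"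
  proof -
    have "((\<lambda>t. (cosh (t / 2))\<^sup>2) has_real_derivative 2 * cosh (t / 2) * (sinh (t / 2) * (1 / 2))) (at t)"
      by (auto intro!: derivative_eq_intros)
    from DERIV_chain2[OF DERIV_ln_divide this] c show ?thesis by simp
  qed
  moreover have "(2 * cosh (t / 2) * (sinh (t / 2) * (1 / 2))) / (cosh (t / 2))\<^sup>2 = tanh (t / 2)"
    using c by (simp add: tanh_def power2_eq_square)
  ultimately show ?thesis by simp
qed

lemma vlog_cosh_nth: "vlog (cosh2_half x) $ i = ln ((cosh (x $ i / 2))\<^sup>2)"
  by (simp add: vlog_def cosh2_half_def)

lemma vlog_cosh_derivative:
  fixes x :: "real ^ 'n"
  shows "((\<lambda>x. vlog (cosh2_half x)) has_derivative (\<lambda>h. \<chi> i. tanh (x $ i / 2) * h $ i)) (at x)"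
proof -
  have "((\<lambda>x. ln ((cosh (x $ i / 2))\<^sup>2)) has_derivative (\<lambda>h. tanh (x $ i / 2) * h $ i)) (at x)" for i
  proof -
    have n: "((\<lambda>x :: real ^ 'n. x $ i) has_derivative (\<lambda>h. h $ i)) (at x)"
      by (rule bounded_linear_imp_has_derivative[OF bounded_linear_vec_nth])
    show ?thesis
      by (rule has_derivative_compose[OF n log_cosh_derivative[unfolded has_field_derivative_def]])
  qed
  from has_derivative_vec_lambda[OF this] show ?thesis by (simp add: vlog_def cosh2_half_def)
qed

lemma cont_diff_tanh_nth: "cont_diff (\<lambda>x :: real ^ 'n. of_real (tanh (x $ i / 2)))"
proof (rule cont_diffI)
  fix x :: "real ^ 'n"
  have n: "((\<lambda>x :: real ^ 'n. x $ i) has_derivative (\<lambda>h. h $ i)) (at x)"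
    by (rule bounded_linear_imp_has_derivative[OF bounded_linear_vec_nth])
  have "((\<lambda>t. tanh (t / 2)) has_real_derivative (1 - (tanh (x $ i / 2))\<^sup>2) / 2) (at (x $ i))"
    by (auto intro!: derivative_eq_intros)
  from has_derivative_compose[OF n this[unfolded has_field_derivative_def]]
  have "((\<lambda>x. tanh (x $ i / 2)) has_derivative (\<lambda>h. (1 - (tanh (x $ i / 2))\<^sup>2) / 2 * h $ i)) (at x)" .
  from has_derivative_of_real[OF this]
  show "((\<lambda>x. complex_of_real (tanh (x $ i / 2))) has_derivative (\<lambda>h. of_real ((1 - (tanh (x $ i / 2))\<^sup>2) / 2 * h $ i))) (at x)" .
next
  fix v :: "real ^ 'n"
  show "continuous_on UNIV (\<lambda>x :: real ^ 'n. complex_of_real ((1 - (tanh (x $ i / 2))\<^sup>2) / 2 * v $ i))"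
    by (intro continuous_intros) auto
qed

lemma bounded_linear_refl_root: "bounded_linear (refl_root a)"
  unfolding refl_root_def
  by (rule linear_conv_bounded_linear[THEN iffD1], rule linearI)
     (simp_all add: inner_add_right algebra_simps add_divide_distrib)

lemma rpsi_bound: "\<exists>M\<ge>0. \<forall>t. \<bar>t\<bar> \<le> A \<longrightarrow> rpsi t \<le> M"
proof -
  obtain B where B: "B \<ge> 0" "\<And>u. \<bar>Re u\<bar> \<le> A \<Longrightarrow> \<bar>Im u\<bar> \<le> 1 \<Longrightarrow> norm (cpsi u) \<le> B"
    by (rule cpsi_compact_bounds[of A]) (rule that; blast)
  have "rpsi t \<le> B" if "\<bar>t\<bar> \<le> A" for t
    using B(2)[of "of_real t"] that by (simp add: cpsi_of_real)
  then show ?thesis using B(1) by blast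
qed

text \<open>The half angle formula behind the choice of the correctors \<open>u i\<close> below: it turns the coefficient of a
  short root into \<open>t tanh (t / 2) + t\<close>.\<close>

lemma rpsi_tanh: "2 * rpsi t * tanh (t / 2) = t * tanh (t / 2) + t"
proof (cases "t = 0")
  case False
  define A where "A = exp (- t)"
  have A: "A > 0" "A \<noteq> 1" using False by (auto simp: A_def)
  have "tanh (t / 2) = (1 - A) / (1 + A)" by (simp add: tanh_real_altdef A_def)
  moreover have "rpsi t = t / (1 - A)" using False by (simp add: rpsi_def A_def)
  moreover have "1 - A \<noteq> 0" "1 + A \<noteq> 0" using A by auto
  moreover have "2 * (t / (1 - A)) * ((1 - A) / (1 + A)) = t * ((1 - A) / (1 + A)) + t" if "1 - A \<noteq> 0" "1 + A \<noteq> 0"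
    using that by (simp add: divide_simps; simp add: algebra_simps)
  ultimately show ?thesis by (simp only: not_False_eq_True simp_thms)
qed (simp add: rpsi_def)

lemma cosh_sq_exp: "(cosh (t / 2))\<^sup>2 = (exp t + 1)\<^sup>2 / (4 * exp (t :: real))"
proof -
  define a where "a = exp (t / 2)"
  have a: "a > 0" "exp t = a\<^sup>2" by (simp_all add: a_def exp_double[symmetric])
  have "cosh (t / 2) = (a + inverse a) / 2" by (simp add: cosh_field_def a_def exp_minus)
  also have "\<dots> = (a\<^sup>2 + 1) / (2 * a)" using a by (simp add: field_simps power2_eq_square)
  finally show ?thesis unfolding a(2) by (simp add: power_divide power_mult_distrib)
qed

text \<open>The roots \<open>e\<^sub>i \<plusminus> e\<^sub>j\<close> of type BC and, after the substitution \<open>y = log cosh\<^sup>2 (x / 2)\<close>, the root \<open>e\<^sub>j - e\<^sub>i\<close> of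
  type A act on an even function by the same difference \<open>g x - g (s x)\<close>. Their coefficients add up to a
  function of \<open>x\<^sub>i\<close> alone. With \<open>A = e\<^sup>s\<close> and \<open>B = e\<^sup>t\<close> this is an identity of rational functions in \<open>A\<close> and \<open>B\<close>,
  linear in \<open>s\<close> and \<open>t\<close>.\<close>

lemma BC_A_identity:
  fixes s t :: real
  defines "p \<equiv> (cosh (s / 2))\<^sup>2" and "q \<equiv> (cosh (t / 2))\<^sup>2"
  assumes ne: "s \<noteq> t" "s \<noteq> - t"
  shows "- (t * tanh (t / 2) - s * tanh (s / 2)) / (1 - p / q) + rpsi (s + t) + rpsi (s - t) = s * tanh (s / 2) + s"
proof -
  define A B where "A = exp s" "B = exp t"
  have pos: "A > 0" "B > 0" by (simp_all add: A_B_def)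
  have AB: "A * B \<noteq> 1" "A \<noteq> B"
    using ne by (auto simp: A_B_def simp flip: exp_add)
  have th: "tanh (s / 2) = (A - 1) / (A + 1)" "tanh (t / 2) = (B - 1) / (B + 1)"
  proof -
    have "tanh (r / 2) = (exp r - 1) / (exp r + 1)" for r :: real
    proof -
      have "1 - exp (- r) = (exp r - 1) / exp r" "1 + exp (- r) = (exp r + 1) / exp r"
        by (simp_all add: exp_minus diff_divide_distrib add_divide_distrib inverse_eq_divide)
      then show ?thesis by (simp add: tanh_real_altdef)
    qed
    then show "tanh (s / 2) = (A - 1) / (A + 1)" "tanh (t / 2) = (B - 1) / (B + 1)" by (simp_all only: A_B_def)
  qed
  have pq: "p = (A + 1)\<^sup>2 / (4 * A)" "q = (B + 1)\<^sup>2 / (4 * B)"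
    by (simp_all add: p_def q_def cosh_sq_exp A_B_def)
  have nz: "A + 1 \<noteq> 0" "B + 1 \<noteq> 0" "A \<noteq> 0" "B \<noteq> 0" "A * B - 1 \<noteq> 0" "B - A \<noteq> 0" using pos AB by auto
  have pq2: "1 / (1 - p / q) = (B + 1)\<^sup>2 * A / ((A * B - 1) * (B - A))"
  proof -
    have r: "p / q = (A + 1)\<^sup>2 * B / ((B + 1)\<^sup>2 * A)" unfolding pq using nz by (simp add: divide_simps)
    then have "1 - p / q = (A * B - 1) * (B - A) / ((B + 1)\<^sup>2 * A)"
      unfolding r using nz by (simp add: divide_simps) (simp add: algebra_simps power2_eq_square)
    then show ?thesis by simp
  qed
  have r1: "rpsi (s + t) = (s + t) * (A * B) / (A * B - 1)"
  proof -
    have e: "exp (- (s + t)) = 1 / (A * B)" unfolding exp_minus exp_add A_B_def inverse_eq_divide ..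
    have "1 - exp (- (s + t)) = (A * B - 1) / (A * B)" unfolding e using nz by (simp add: field_simps)
    moreover have "rpsi (s + t) = (s + t) / (1 - exp (- (s + t)))" using ne by (simp add: rpsi_def)
    ultimately show ?thesis by simp
  qed
  have r2: "rpsi (s - t) = - (s - t) * A / (B - A)"
  proof -
    have e: "exp (- (s - t)) = B / A" by (simp add: A_B_def exp_diff)
    have "1 - exp (- (s - t)) = - ((B - A) / A)" unfolding e using nz by (simp add: field_simps)
    moreover have "rpsi (s - t) = (s - t) / (1 - exp (- (s - t)))" using ne by (simp add: rpsi_def)
    ultimately have "rpsi (s - t) = - ((s - t) * A / (B - A))" by (simp only:) simp
    then show ?thesis by (simp only: minus_mult_left minus_divide_left)
  qed
  have "- (t * tanh (t / 2) - s * tanh (s / 2)) * (1 / (1 - p / q)) + rpsi (s + t) + rpsi (s - t) = s * tanh (s / 2) + s"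
    unfolding th pq2 r1 r2 using nz
    by (simp add: divide_simps) (simp add: algebra_simps power2_eq_square)
  then show ?thesis by simp
qed

text \<open>The contribution of the middle roots to the Euler equation of type BC, without the factor \<open>k\<^sub>3\<close>.\<close>

definition middle_part :: "((real, 'n::{finite,linorder}) vec \<Rightarrow> complex) \<Rightarrow> (real, 'n) vec \<Rightarrow> complex"
  where "middle_part f x = (\<Sum>(i, j)\<in>ppairs. of_real (rpsi (x $ i + x $ j)) * (f x - f (refl_root (axis i 1 + axis j 1) x))
    + of_real (rpsi (x $ i - x $ j)) * (f x - f (refl_root (axis i 1 - axis j 1) x)))"

lemma BC_euler_sum:
  fixes f :: "(real, 'n::{finite,linorder}) vec \<Rightarrow> complex"
  shows "(\<Sum>a\<in>BC_pos. of_real (BC_mult k1 k2 k3 a * rpsi (a \<bullet> x)) * (f x - f (refl_root a x))) =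
    (\<Sum>i\<in>UNIV. of_real (k1 * rpsi (x $ i) + k2 * rpsi (2 * x $ i)) * (f x - f (refl_root (axis i 1) x))) + of_real k3 * middle_part f x"
proof -
  let ?g = "\<lambda>a. of_real (BC_mult k1 k2 k3 a * rpsi (a \<bullet> x)) * (f x - f (refl_root a x))"
  have 3: "(\<Sum>(i, j)\<in>ppairs. ?g (axis i 1 + axis j 1)) + (\<Sum>(i, j)\<in>ppairs. ?g (axis i 1 - axis j 1)) = of_real k3 * middle_part f x"
    unfolding middle_part_def sum_distrib_left sum.distrib[symmetric]
    by (rule sum.cong) (auto simp: ppairs_def BC_mult_values inner_add_left inner_diff_left algebra_simps)
  have 1: "(\<Sum>i\<in>UNIV. ?g (axis i 1)) + (\<Sum>i\<in>UNIV. ?g (2 *\<^sub>R axis i 1)) =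
    (\<Sum>i\<in>UNIV. of_real (k1 * rpsi (x $ i) + k2 * rpsi (2 * x $ i)) * (f x - f (refl_root (axis i 1) x)))"
    unfolding sum.distrib[symmetric]
    by (rule sum.cong) (simp_all add: BC_mult_values refl_root_scale algebra_simps)
  show ?thesis unfolding sum_BC_pos 3 1 ..
qed

section \<open>Convergence for a fixed spectral parameter\<close>

text \<open>The claimed limit \<open>g\<close>, as a function of \<open>x\<close>, and the correctors \<open>u i\<close>.

  As \<open>g\<close> is even in each variable, the terms of order \<open>k\<^sub>1\<close> and \<open>k\<^sub>2\<close> in the Euler equation of type BC vanish
  on it. The terms of order one leave the residual \<open>\<Sum> 2 \<psi>(x\<^sub>i) u\<^sub>i\<close> (\<open>limit_identity\<close>), where \<open>u\<^sub>i\<close> is odd in \<open>x\<^sub>i\<close> and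
  even in the other variables (\<open>u_flip\<close>). On \<open>u\<^sub>i\<close> the short roots act as multiplication by
  \<open>2 k\<^sub>1 \<psi>(x\<^sub>i)\<close>, so the corrected function \<open>g - (1 / k\<^sub>1) \<Sum> u\<^sub>i\<close> has no residual of order one any more.\<close>

locale limit_setup =
  fixes k3 :: real and l :: "(complex, 'n::{finite,linorder}) vec"
  assumes k3: "0 \<le> k3"
begin

definition G where "G = G_A k3 (l - cvec (rho_A k3))"
definition g where "g x = G (vlog (cosh2_half x))"
definition u where "u i x = of_real (tanh (x $ i / 2)) *
  (l $ i * g x + of_real k3 * (\<Sum>j\<in>{i<..}. g x - g (refl_root (axis i 1 - axis j 1) x)))"

lemma G_kernel: "is_cherednik_kernel A_pos (\<lambda>_. k3) (l - cvec (rho_A k3)) G"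
  unfolding G_def by (rule G_A_kernel(1)[OF k3])

lemma g_even:
  assumes "\<And>p. \<bar>x $ p\<bar> = \<bar>y $ p\<bar>" shows "g x = g y"
proof -
  have "cosh (x $ p / 2) = cosh (y $ p / 2)" for p
  proof -
    have "x $ p = y $ p \<or> x $ p = - y $ p" using assms[of p] by linarith
    then show ?thesis by auto
  qed
  then have "cosh2_half x = cosh2_half y" by (simp add: cosh2_half_def vec_eq_iff)
  then show ?thesis by (simp add: g_def)
qed

lemma g_derivative:
  "(g has_derivative (\<lambda>h. frechet_derivative G (at (vlog (cosh2_half x))) (\<chi> i. tanh (x $ i / 2) * h $ i))) (at x)"
  unfolding g_def[abs_def]
  by (rule has_derivative_compose[OF vlog_cosh_derivative kernel_euler(1)[OF G_kernel]])

lemma cont_diff_g: "cont_diff g"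
proof (rule cont_diffI[OF g_derivative])
  fix v :: "(real, 'n) vec"
  have lin: "linear (frechet_derivative G (at y))" for y
    by (rule bounded_linear.linear[OF has_derivative_bounded_linear[OF kernel_euler(1)[OF G_kernel]]])
  have e: "frechet_derivative G (at y) w = (\<Sum>i\<in>UNIV. w $ i *\<^sub>R frechet_derivative G (at y) (axis i 1))" for y w
  proof -
    have w: "w = (\<Sum>i\<in>UNIV. w $ i *\<^sub>R axis i 1)"
      by (simp add: vec_eq_iff axis_index if_distrib[where f = "\<lambda>y. _ * y"] cong: if_cong)
    have "frechet_derivative G (at y) w = frechet_derivative G (at y) (\<Sum>i\<in>UNIV. w $ i *\<^sub>R axis i 1)"
      by (rule arg_cong[OF w])
    then show ?thesis by (simp only: linear_sum[OF lin] linear_scale[OF lin])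
  qed
  have cY: "continuous_on UNIV (\<lambda>x :: (real, 'n) vec. vlog (cosh2_half x))"
    by (intro continuous_at_imp_continuous_on ballI has_derivative_continuous[OF vlog_cosh_derivative])
  have cG: "continuous_on UNIV (\<lambda>x :: (real, 'n) vec. frechet_derivative G (at (vlog (cosh2_half x))) (axis i 1))" for i
    by (rule continuous_on_compose2[of UNIV "\<lambda>y. frechet_derivative G (at y) (axis i 1)"])
       (use G_A_kernel(2)[OF k3] cY in \<open>auto simp: G_def\<close>)
  show "continuous_on UNIV (\<lambda>x. frechet_derivative G (at (vlog (cosh2_half x))) (\<chi> i. tanh (x $ i / 2) * v $ i))"
    unfolding e[of _ "\<chi> i. _ i"] vec_lambda_beta by (intro continuous_intros cG) auto
qed

lemma cont_diff_u: "cont_diff (u i)"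
  unfolding u_def[abs_def]
  by (intro cont_diff_mult cont_diff_add cont_diff_sum cont_diff_diff cont_diff_const cont_diff_tanh_nth cont_diff_g cont_diff_compose_linear[OF cont_diff_g bounded_linear_refl_root])

lemma g_pair_singular: "x $ i = x $ j \<or> x $ i = - x $ j \<Longrightarrow> i \<noteq> j \<Longrightarrow> g (refl_root (axis i 1 - axis j 1) x) = g x"
  by (rule g_even) (auto simp: refl_root_minus)

lemma g_plus_minus: "i \<noteq> j \<Longrightarrow> g (refl_root (axis i 1 + axis j 1) x) = g (refl_root (axis i 1 - axis j 1) x)"
  by (rule g_even) (auto simp: refl_root_minus refl_root_plus)

text \<open>Where \<open>x\<^sub>i = \<plusminus> x\<^sub>j\<close>, the difference of \<open>g\<close> and the factor in front of the quotient both vanish; elsewhere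
  the quotient is an honest fraction and \<open>BC_A_identity\<close> applies.\<close>

lemma pair_identity:
  assumes ij: "i < j"
  shows "- of_real (x $ j * tanh (x $ j / 2) - x $ i * tanh (x $ i / 2)) * diff_quot (axis j 1 - axis i 1) G (vlog (cosh2_half x))
    + of_real (rpsi (x $ i + x $ j) + rpsi (x $ i - x $ j)) * (g x - g (refl_root (axis i 1 - axis j 1) x))
    = of_real (x $ i * tanh (x $ i / 2) + x $ i) * (g x - g (refl_root (axis i 1 - axis j 1) x))"
proof (cases "x $ i = x $ j \<or> x $ i = - x $ j")
  case True
  have "x $ j * tanh (x $ j / 2) = x $ i * tanh (x $ i / 2)" using True by auto
  then show ?thesis using g_pair_singular[OF True] ij by simp
next
  case False
  let ?y = "vlog (cosh2_half x)"
  let ?p = "(cosh (x $ i / 2))\<^sup>2" and ?q = "(cosh (x $ j / 2))\<^sup>2"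
  have pos: "?p > 0" "?q > 0" using cosh_real_pos by simp_all
  have ay: "(axis j 1 - axis i 1) \<bullet> ?y = ln ?q - ln ?p" by (simp add: inner_diff_left vlog_cosh_nth)
  have "cosh (x $ i / 2) \<noteq> cosh (x $ j / 2)"
  proof
    assume "cosh (x $ i / 2) = cosh (x $ j / 2)"
    then have "\<bar>x $ i / 2\<bar> = \<bar>x $ j / 2\<bar>"
      using cosh_real_nonneg_less_iff[of "\<bar>x $ i / 2\<bar>" "\<bar>x $ j / 2\<bar>"] cosh_real_nonneg_less_iff[of "\<bar>x $ j / 2\<bar>" "\<bar>x $ i / 2\<bar>"]
      by (simp add: cosh_real_abs) 
    then show False using False by (auto simp: abs_eq_iff)
  qed
  then have "?p \<noteq> ?q" using cosh_real_pos[of "x $ i / 2"] cosh_real_pos[of "x $ j / 2"]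
    by (simp add: power2_eq_iff_nonneg less_imp_le)
  then have ne: "ln ?q - ln ?p \<noteq> 0" using pos by simp
  have sw: "refl_root (axis j 1 - axis i 1) ?y = vlog (cosh2_half (refl_root (axis i 1 - axis j 1) x))"
    using ij by (subst refl_root_minus, simp) (subst refl_root_minus, auto simp: vec_eq_iff vlog_cosh_nth)
  have ex: "exp (- (ln ?q - ln ?p)) = ?p / ?q" using pos by (simp add: exp_diff)
  have dq: "diff_quot (axis j 1 - axis i 1) G ?y = (g x - g (refl_root (axis i 1 - axis j 1) x)) / of_real (1 - ?p / ?q)"
    using ne unfolding diff_quot_def Let_def ay sw ex g_def by simp
  have id: "- (x $ j * tanh (x $ j / 2) - x $ i * tanh (x $ i / 2)) / (1 - ?p / ?q) + rpsi (x $ i + x $ j) + rpsi (x $ i - x $ j)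
      = x $ i * tanh (x $ i / 2) + x $ i"
    by (rule BC_A_identity) (use False in auto)
  show ?thesis
    unfolding dq id[symmetric] by (simp add: algebra_simps diff_divide_distrib)
qed

text \<open>The Euler equation of type A in the direction \<open>(x\<^sub>i tanh (x\<^sub>i / 2))\<^sub>i\<close>, which the chain rule produces from
  the radial derivative of \<open>g\<close>, combined with \<open>pair_identity\<close> for each pair of indices.\<close>

lemma limit_identity:
  "frechet_derivative g (at x) x + bilin l x * g x + of_real k3 * middle_part g x = (\<Sum>i\<in>UNIV. of_real (2 * rpsi (x $ i)) * u i x)"
proof -
  let ?T = "\<lambda>i. tanh (x $ i / 2)"
  let ?y = "vlog (cosh2_half x)"
  let ?d = "\<lambda>i j. g x - g (refl_root (axis i 1 - axis j 1) x)"
  let ?q = "\<lambda>i j. diff_quot (axis j 1 - axis i 1) G ?y"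
  have "frechet_derivative g (at x) x = frechet_derivative G (at ?y) (\<chi> i. ?T i * x $ i)"
    using frechet_derivative_at[OF g_derivative[of x]] by metis
  also have "\<dots> = bilin l (\<chi> i. ?T i * x $ i) * g x - (\<Sum>(i, j)\<in>ppairs. of_real (k3 * (?T j * x $ j - ?T i * x $ i)) * ?q i j)"
    unfolding G_def g_def G_A_derivative[OF k3] by simp
  finally have E: "frechet_derivative g (at x) x = bilin l (\<chi> i. ?T i * x $ i) * g x
     - (\<Sum>(i, j)\<in>ppairs. of_real (k3 * (?T j * x $ j - ?T i * x $ i)) * ?q i j)" .
  have m: "middle_part g x = (\<Sum>(i, j)\<in>ppairs. of_real (rpsi (x $ i + x $ j) + rpsi (x $ i - x $ j)) * ?d i j)"
    unfolding middle_part_def by (rule sum.cong) (auto simp: ppairs_def g_plus_minus algebra_simps)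
  have "(\<Sum>i\<in>UNIV. of_real (2 * rpsi (x $ i)) * u i x) =
      (\<Sum>i\<in>UNIV. of_real (x $ i * ?T i + x $ i) * (l $ i * g x + of_real k3 * (\<Sum>j\<in>{i<..}. ?d i j)))"
  proof (rule sum.cong)
    fix i
    have "of_real (2 * rpsi (x $ i)) * u i x = of_real (2 * rpsi (x $ i) * ?T i) * (l $ i * g x + of_real k3 * (\<Sum>j\<in>{i<..}. ?d i j))"
      by (simp add: u_def mult.assoc)
    then show "of_real (2 * rpsi (x $ i)) * u i x = of_real (x $ i * ?T i + x $ i) * (l $ i * g x + of_real k3 * (\<Sum>j\<in>{i<..}. ?d i j))"
      unfolding rpsi_tanh .
  qed simp
  also have "\<dots> = (\<Sum>i\<in>UNIV. of_real (x $ i * ?T i + x $ i) * l $ i * g x)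
      + of_real k3 * (\<Sum>i\<in>UNIV. \<Sum>j\<in>{i<..}. of_real (x $ i * ?T i + x $ i) * ?d i j)"
    by (simp add: distrib_left sum.distrib sum_distrib_left mult_ac)
  also have "(\<Sum>i\<in>UNIV. \<Sum>j\<in>{i<..}. of_real (x $ i * ?T i + x $ i) * ?d i j) = (\<Sum>(i, j)\<in>ppairs. of_real (x $ i * ?T i + x $ i) * ?d i j)"
  proof -
    have "Sigma UNIV (\<lambda>i. {i<..}) = (ppairs :: ('n \<times> 'n) set)" by (auto simp: ppairs_def)
    then show ?thesis by (subst sum.Sigma) simp_all
  qed
  also have "\<dots> = (\<Sum>(i, j)\<in>ppairs. - of_real (x $ j * ?T j - x $ i * ?T i) * ?q i j + of_real (rpsi (x $ i + x $ j) + rpsi (x $ i - x $ j)) * ?d i j)"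
  proof (rule sum.cong[OF refl])
    fix z :: "'n \<times> 'n" assume "z \<in> ppairs"
    then obtain i j where z: "z = (i, j)" "i < j" by (auto simp: ppairs_def)
    show "(case z of (i, j) \<Rightarrow> of_real (x $ i * ?T i + x $ i) * ?d i j) =
      (case z of (i, j) \<Rightarrow> - of_real (x $ j * ?T j - x $ i * ?T i) * ?q i j + of_real (rpsi (x $ i + x $ j) + rpsi (x $ i - x $ j)) * ?d i j)"
      unfolding z(1) prod.case by (rule pair_identity[OF z(2), symmetric])
  qed
  also have "\<dots> = middle_part g x - (\<Sum>(i, j)\<in>ppairs. of_real (x $ j * ?T j - x $ i * ?T i) * ?q i j)"
    unfolding m sum_subtractf[symmetric] by (rule sum.cong) (auto simp: algebra_simps)
  also have "(\<Sum>i\<in>UNIV. of_real (x $ i * ?T i + x $ i) * l $ i * g x) = bilin l (\<chi> i. ?T i * x $ i) * g x + bilin l x * g x"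
    unfolding bilin_def sum_distrib_right sum.distrib[symmetric] by (rule sum.cong) (auto simp: algebra_simps)
  finally have R: "(\<Sum>i\<in>UNIV. of_real (2 * rpsi (x $ i)) * u i x) =
    bilin l (\<chi> i. ?T i * x $ i) * g x + bilin l x * g x
    + of_real k3 * (middle_part g x - (\<Sum>(i, j)\<in>ppairs. of_real (x $ j * ?T j - x $ i * ?T i) * ?q i j))" .
  have k: "(\<Sum>(i, j)\<in>ppairs. of_real (k3 * (?T j * x $ j - ?T i * x $ i)) * ?q i j) =
    of_real k3 * (\<Sum>(i, j)\<in>ppairs. of_real (x $ j * ?T j - x $ i * ?T i) * ?q i j)"
    unfolding sum_distrib_left by (rule sum.cong) (auto simp: mult_ac)
  show ?thesis unfolding R E k by (simp add: algebra_simps)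
qed

lemma u_flip: "u i (refl_root (axis p 1) x) = (if p = i then - u i x else u i x)"
proof -
  have fl: "refl_root (axis p 1) x = (\<chi> q. if q = p then - x $ p else x $ q)"
    using refl_root_short[of 1 p x] by simp
  have g1: "g (refl_root (axis p 1) x) = g x" by (rule g_even) (simp add: fl)
  have g2: "g (refl_root (axis i 1 - axis j 1) (refl_root (axis p 1) x)) = g (refl_root (axis i 1 - axis j 1) x)" if "i < j" for j
    by (rule g_even) (use that in \<open>auto simp: refl_root_minus fl\<close>)
  have s: "(\<Sum>j\<in>{i<..}. g x - g (refl_root (axis i 1 - axis j 1) (refl_root (axis p 1) x)))
     = (\<Sum>j\<in>{i<..}. g x - g (refl_root (axis i 1 - axis j 1) x))"
    by (rule sum.cong) (auto simp: g2)
  show ?thesis unfolding u_def g1 s by (auto simp: fl)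
qed

lemma g_flip: "g (refl_root (axis p 1) x) = g x"
  by (rule g_even) (use refl_root_short[of 1 p x] in simp)

text \<open>The function \<open>g - (1 / k\<^sub>1) \<Sum> u\<^sub>i\<close> solves the Euler equation of type BC up to an error of order
  \<open>(1 + k\<^sub>2) / k\<^sub>1\<close>: the terms of order one of the correctors are divided by \<open>k\<^sub>1\<close>, and the long roots contribute
  \<open>k\<^sub>2 / k\<^sub>1\<close>. By \<open>euler_bound\<close>, whose constants do not depend on the multiplicity, it is close to the kernel.\<close>

lemma convergence_rate:
  fixes x0 :: "(real, 'n) vec"
  shows "\<exists>C\<ge>0. \<forall>k1 k2. 0 < k1 \<longrightarrow> 0 \<le> k2 \<longrightarrow>
    norm (G_BC k1 k2 k3 (- l - cvec (rho_BC k1 k2 k3)) x0 - g x0) \<le> C * ((1 + k2) / k1)"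
proof -
  define r where "r = norm x0"
  have r0: "r \<ge> 0" by (simp add: r_def)
  have u0: "u i 0 = 0" for i by (simp add: u_def)
  have "\<forall>i. \<exists>b\<ge>0. \<forall>x. norm x \<le> r \<longrightarrow> norm (u i x) \<le> b * norm x \<and> norm (frechet_derivative (u i) (at x) x) \<le> b * norm x"
    by (intro allI cont_diff_bound cont_diff_u u0)
  then obtain b where b: "\<And>i. b i \<ge> 0" "\<And>i x. norm x \<le> r \<Longrightarrow> norm (u i x) \<le> b i * norm x"
    "\<And>i x. norm x \<le> r \<Longrightarrow> norm (frechet_derivative (u i) (at x) x) \<le> b i * norm x" by metis
  define B where "B = (\<Sum>i\<in>UNIV. b i)"
  have B0: "B \<ge> 0" unfolding B_def by (intro sum_nonneg b)
  have bB: "b i \<le> B" for i unfolding B_def by (rule member_le_sum) (use b in auto)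
  have ub: "norm (u i x) \<le> B * norm x" "norm (frechet_derivative (u i) (at x) x) \<le> B * norm x" if "norm x \<le> r" for i x
    using b(2,3)[OF that, of i] mult_right_mono[OF bB norm_ge_zero, of i x] by linarith+
  obtain M where M: "M \<ge> 0" "\<And>t. \<bar>t\<bar> \<le> 2 * r \<Longrightarrow> rpsi t \<le> M" using rpsi_bound by blast
  have comp: "\<bar>x $ i\<bar> \<le> r" if "norm x \<le> r" for x :: "(real, 'n) vec" and i
    using component_le_norm_cart[of x i] that by linarith
  have rp: "norm (complex_of_real (rpsi t)) \<le> M" if "\<bar>t\<bar> \<le> 2 * r" for t
    using M(2)[OF that] rpsi_pos[of t] by simp
  define N where "N = real (card (ppairs :: ('n \<times> 'n) set))"
  have midb: "norm (middle_part (u i) x) \<le> N * (4 * M * B * norm x)" if x: "norm x \<le> r" for i x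
  proof -
    have "norm (of_real (rpsi (x $ p + x $ q)) * (u i x - u i (refl_root (axis p 1 + axis q 1) x))
      + of_real (rpsi (x $ p - x $ q)) * (u i x - u i (refl_root (axis p 1 - axis q 1) x))) \<le> 4 * M * B * norm x" for p q
    proof -
      have d: "norm (u i x - u i (refl_root a x)) \<le> 2 * B * norm x" for a
        using norm_triangle_ineq4[of "u i x" "u i (refl_root a x)"] ub(1)[OF x, of i] ub(1)[of "refl_root a x" i] x by simp
      have "norm (of_real (rpsi t) * (u i x - u i (refl_root a x))) \<le> M * (2 * B * norm x)" if "\<bar>t\<bar> \<le> 2 * r" for t a
        unfolding norm_mult by (rule mult_mono[OF rp[OF that] d M(1) norm_ge_zero])
      note t = this
      have "\<bar>x $ p + x $ q\<bar> \<le> 2 * r" "\<bar>x $ p - x $ q\<bar> \<le> 2 * r" using comp[OF x, of p] comp[OF x, of q] by linarith+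
      then show ?thesis
        by (intro order_trans[OF norm_triangle_mono[OF t[of "x $ p + x $ q"] t[of "x $ p - x $ q"]]]) simp_all
    qed
    then have "norm (middle_part (u i) x) \<le> (\<Sum>z\<in>(ppairs :: ('n \<times> 'n) set). 4 * M * B * norm x)"
      unfolding middle_part_def by (intro sum_norm_le) (auto split: prod.split)
    then show ?thesis by (simp add: N_def)
  qed
  define C1 where "C1 = B + norm l * r * B + k3 * (N * (4 * M * B))"
  have C1: "C1 \<ge> 0" unfolding C1_def N_def using B0 r0 k3 M(1) by (intro add_nonneg_nonneg mult_nonneg_nonneg) auto
  define Ru where "Ru = (\<lambda>i x. frechet_derivative (u i) (at x) x + bilin l x * u i x + of_real k3 * middle_part (u i) x)"
  have Rub: "norm (Ru i x) \<le> C1 * norm x" if x: "norm x \<le> r" for i x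
  proof -
    have "norm (bilin l x * u i x) \<le> (norm l * r) * (B * norm x)"
      unfolding norm_mult
      by (rule mult_mono[OF order_trans[OF norm_bilin_le mult_left_mono[OF x norm_ge_zero]] ub(1)[OF x]]) (use r0 in auto)
    moreover have "norm (of_real k3 * middle_part (u i) x) \<le> k3 * (N * (4 * M * B * norm x))"
      unfolding norm_mult using k3 midb[OF x, of i] by (simp add: mult_left_mono)
    ultimately have "norm (Ru i x) \<le> B * norm x + (norm l * r) * (B * norm x) + k3 * (N * (4 * M * B * norm x))"
      unfolding Ru_def using ub(2)[OF x, of i] by (intro norm_triangle_mono)
    then show ?thesis by (simp add: C1_def algebra_simps)
  qed
  define n where "n = real CARD('n)"
  have n0: "n \<ge> 0" by (simp add: n_def)
  define C2 where "C2 = n * C1 + n * (2 * M * B)"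
  have C2: "C2 \<ge> 0" unfolding C2_def using n0 C1 M(1) B0 by (intro add_nonneg_nonneg mult_nonneg_nonneg) auto
  define C where "C = exp ((norm l + 1) * r) * C2 + n * (B * r)"
  have main: "norm (G_BC k1 k2 k3 (- l - cvec (rho_BC k1 k2 k3)) x0 - g x0) \<le> C * ((1 + k2) / k1)"
    if k1: "0 < k1" and k2: "0 \<le> k2" for k1 k2
  proof -
    define m where "m = - l - cvec (rho_BC k1 k2 k3)"
    define f where "f = G_BC k1 k2 k3 m"
    have f: "is_cherednik_kernel BC_pos (BC_mult k1 k2 k3) m f"
      unfolding f_def by (rule G_BC_kernel) (use k1 k2 k3 in auto)
    let ?c = "complex_of_real (1 / k1)"
    let ?BC = "\<lambda>F x. \<Sum>a\<in>BC_pos. of_real (BC_mult k1 k2 k3 a * rpsi (a \<bullet> x)) * (F x - F (refl_root a x))"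
    define d where "d = (\<lambda>x. f x - (g x - ?c * (\<Sum>i\<in>UNIV. u i x)))"
    define s where "s = (\<lambda>x. ?c * (\<Sum>i\<in>UNIV. Ru i x) + of_real (k2 / k1) * (\<Sum>i\<in>UNIV. of_real (2 * rpsi (2 * x $ i)) * u i x))"
    define \<epsilon> where "\<epsilon> = C2 * ((1 + k2) / k1)"
    have e0: "\<epsilon> \<ge> 0" unfolding \<epsilon>_def using C2 k1 k2 by simp
    have ff: "frechet_derivative f (at x) x = - bilin l x * f x - ?BC f x" for x
    proof -
      have "bilin m x + of_real (rho BC_pos (BC_mult k1 k2 k3) \<bullet> x) = - bilin l x"
        by (simp add: m_def rho_BC_eq bilin_diff_left bilin_minus_left bilin_cvec inner_commute)
      then show ?thesis unfolding kernel_euler(2)[OF f] by simp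
    qed
    have BCg: "?BC g x = of_real k3 * middle_part g x" for x
      unfolding BC_euler_sum by (simp add: g_flip)
    have BCu: "?BC (u i) x = of_real (2 * (k1 * rpsi (x $ i) + k2 * rpsi (2 * x $ i))) * u i x + of_real k3 * middle_part (u i) x" for i x
    proof -
      have "of_real (k1 * rpsi (x $ p) + k2 * rpsi (2 * x $ p)) * (u i x - u i (refl_root (axis p 1) x)) =
        (if p = i then of_real (2 * (k1 * rpsi (x $ i) + k2 * rpsi (2 * x $ i))) * u i x else 0)" for p
        by (simp add: u_flip algebra_simps)
      then show ?thesis unfolding BC_euler_sum by simp
    qed
    have BCd: "?BC d x = ?BC f x - ?BC g x + ?c * (\<Sum>i\<in>UNIV. ?BC (u i) x)" for x
    proof -
      have "(\<Sum>i\<in>UNIV. ?BC (u i) x) = (\<Sum>a\<in>BC_pos. of_real (BC_mult k1 k2 k3 a * rpsi (a \<bullet> x)) * (\<Sum>i\<in>UNIV. u i x - u i (refl_root a x)))"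
        by (subst sum.swap) (simp only: sum_distrib_left)
      then have "?BC f x - ?BC g x + ?c * (\<Sum>i\<in>UNIV. ?BC (u i) x) =
        (\<Sum>a\<in>BC_pos. of_real (BC_mult k1 k2 k3 a * rpsi (a \<bullet> x)) * (f x - f (refl_root a x))
          - of_real (BC_mult k1 k2 k3 a * rpsi (a \<bullet> x)) * (g x - g (refl_root a x))
          + ?c * (of_real (BC_mult k1 k2 k3 a * rpsi (a \<bullet> x)) * (\<Sum>i\<in>UNIV. u i x - u i (refl_root a x))))"
        by (simp only: sum.distrib sum_subtractf sum_distrib_left)
      also have "\<dots> = ?BC d x"
      proof (rule sum.cong)
        fix a
        have "w * (F - F') - w * (H - H') + c * (w * (U - U')) = w * (F - (H - c * U) - (F' - (H' - c * U')))"
          for w F F' H H' c U U' :: complex by (simp add: algebra_simps)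
        then show "of_real (BC_mult k1 k2 k3 a * rpsi (a \<bullet> x)) * (f x - f (refl_root a x))
          - of_real (BC_mult k1 k2 k3 a * rpsi (a \<bullet> x)) * (g x - g (refl_root a x))
          + ?c * (of_real (BC_mult k1 k2 k3 a * rpsi (a \<bullet> x)) * (\<Sum>i\<in>UNIV. u i x - u i (refl_root a x)))
          = of_real (BC_mult k1 k2 k3 a * rpsi (a \<bullet> x)) * (d x - d (refl_root a x))"
          unfolding d_def sum_subtractf .
      qed simp
      finally show ?thesis ..
    qed
    let ?d' = "\<lambda>x h. frechet_derivative f (at x) h - (frechet_derivative g (at x) h - ?c * (\<Sum>i\<in>UNIV. frechet_derivative (u i) (at x) h))"
    have "norm (d x0) \<le> exp ((norm l + 1) * norm x0) * max (norm (d 0)) \<epsilon>"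
    proof (rule euler_bound[where R = r and s = s and b = "\<lambda>x. - bilin l x" and k = "BC_mult k1 k2 k3" and P = BC_pos and f' = ?d'])
      show "(d has_derivative ?d' x) (at x)" for x
        unfolding d_def
        by (intro has_derivative_diff has_derivative_mult_right has_derivative_sum kernel_euler(1)[OF f] cont_diff_has_derivative cont_diff_g cont_diff_u)
      show "?d' x x = - bilin l x * d x + s x - ?BC d x" for x
      proof -
        define SD where "SD = (\<Sum>i\<in>UNIV. frechet_derivative (u i) (at x) x)"
        define SU where "SU = (\<Sum>i\<in>UNIV. u i x)"
        define SM where "SM = (\<Sum>i\<in>UNIV. middle_part (u i) x)"
        define S1 where "S1 = (\<Sum>i\<in>UNIV. of_real (2 * rpsi (x $ i)) * u i x)"
        define S2 where "S2 = (\<Sum>i\<in>UNIV. of_real (2 * rpsi (2 * x $ i)) * u i x)"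
        have R: "(\<Sum>i\<in>UNIV. Ru i x) = SD + bilin l x * SU + of_real k3 * SM"
          by (simp add: Ru_def SD_def SU_def SM_def sum.distrib sum_distrib_left)
        have BS: "(\<Sum>i\<in>UNIV. ?BC (u i) x) = of_real k1 * S1 + of_real k2 * S2 + of_real k3 * SM"
        proof -
          have "?BC (u i) x = of_real k1 * (of_real (2 * rpsi (x $ i)) * u i x) + of_real k2 * (of_real (2 * rpsi (2 * x $ i)) * u i x) + of_real k3 * middle_part (u i) x" for i
            unfolding BCu by (simp add: algebra_simps)
          then show ?thesis by (simp only: S1_def S2_def SM_def sum.distrib sum_distrib_left)
        qed
        have c: "?c * of_real k1 = 1" using k1 by (simp flip: of_real_mult)
        have c2: "complex_of_real (k2 / k1) = ?c * of_real k2" by simp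
        have gg: "frechet_derivative g (at x) x = S1 - bilin l x * g x - of_real k3 * middle_part g x"
          using limit_identity[of x] by (simp add: S1_def algebra_simps)
        have key: "- b * f - F - (S - b * g - k * m - c * D) - (- b * (f - (g - c * U)) + (c * (D + b * U + k * N) + c * q * T)
          - (F - k * m + c * (p * S + q * T + k * N))) = (c * p - 1) * S" for b f g F S k m c D U N p q T :: complex
          by (simp add: algebra_simps)
        have "?d' x x - (- bilin l x * d x + s x - ?BC d x) = (?c * of_real k1 - 1) * S1"
          unfolding BCd BCg BS unfolding s_def R d_def ff gg c2 SD_def[symmetric] SU_def[symmetric] S2_def[symmetric] by (rule key)
        then show ?thesis using c by simp
      qed
      show "norm (- bilin l x) \<le> norm l * norm x" for x by (simp add: norm_bilin_le)
      show "norm (s x) \<le> \<epsilon> * norm x" if x: "norm x \<le> r" for x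
      proof -
        have "norm (\<Sum>i\<in>UNIV. Ru i x) \<le> (\<Sum>i\<in>(UNIV :: 'n set). C1 * norm x)" by (intro sum_norm_le Rub x)
        then have s1: "norm (?c * (\<Sum>i\<in>UNIV. Ru i x)) \<le> (1 / k1) * (n * (C1 * norm x))"
          unfolding norm_mult n_def using k1 by (simp add: norm_divide divide_right_mono)
        have "norm (of_real (2 * rpsi (2 * x $ i)) * u i x) \<le> 2 * M * (B * norm x)" for i
        proof -
          have "\<bar>2 * x $ i\<bar> \<le> 2 * r" using comp[OF x, of i] by linarith
          then have "norm (complex_of_real (2 * rpsi (2 * x $ i))) \<le> 2 * M" using M(2) rpsi_pos[of "2 * x $ i"] by simp
          then show ?thesis unfolding norm_mult using ub(1)[OF x, of i] M(1) by (intro mult_mono) auto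
        qed
        then have "norm (\<Sum>i\<in>UNIV. of_real (2 * rpsi (2 * x $ i)) * u i x) \<le> (\<Sum>i\<in>(UNIV :: 'n set). 2 * M * (B * norm x))"
          by (rule sum_norm_le)
        then have "norm (\<Sum>i\<in>UNIV. of_real (2 * rpsi (2 * x $ i)) * u i x) \<le> n * (2 * M * (B * norm x))" by (simp add: n_def)
        then have s2: "norm (of_real (k2 / k1) * (\<Sum>i\<in>UNIV. of_real (2 * rpsi (2 * x $ i)) * u i x)) \<le> (k2 / k1) * (n * (2 * M * (B * norm x)))"
          unfolding norm_mult using k1 k2 by (intro mult_mono) (auto simp: norm_divide)
        have t1: "n * (C1 * norm x) \<le> C2 * norm x" "n * (2 * M * (B * norm x)) \<le> C2 * norm x"
          using n0 C1 M(1) B0 by (simp_all add: C2_def algebra_simps)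
        have "norm (s x) \<le> (1 / k1) * (C2 * norm x) + (k2 / k1) * (C2 * norm x)"
          unfolding s_def
          by (rule order_trans[OF norm_triangle_mono[OF s1 s2]]) (intro add_mono mult_left_mono t1; use k1 k2 in simp)
        then show ?thesis by (simp add: \<epsilon>_def add_divide_distrib algebra_simps)
      qed
      show "0 \<le> BC_mult k1 k2 k3 a" for a by (rule BC_mult_nonneg) (use k1 k2 k3 in auto)
    qed (use e0 r_def in auto)
    moreover have "d 0 = 0"
    proof -
      have "vlog (cosh2_half 0) = (0 :: (real, 'n) vec)" by (simp add: vec_eq_iff vlog_cosh_nth)
      then have "g 0 = 1" using G_kernel by (simp add: g_def is_cherednik_kernel_def)
      moreover have "f 0 = 1" using f by (simp add: is_cherednik_kernel_def)
      ultimately show ?thesis by (simp add: d_def u0)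
    qed
    ultimately have d: "norm (d x0) \<le> exp ((norm l + 1) * r) * \<epsilon>" using e0 by (simp add: r_def max_def)
    have "norm (\<Sum>i\<in>UNIV. u i x0) \<le> (\<Sum>i\<in>(UNIV :: 'n set). B * r)"
      by (rule sum_norm_le) (use ub(1)[of x0] in \<open>simp add: r_def\<close>)
    then have "norm (\<Sum>i\<in>UNIV. u i x0) \<le> n * (B * r)" by (simp add: n_def)
    then have "norm (?c * (\<Sum>i\<in>UNIV. u i x0)) \<le> (1 / k1) * (n * (B * r))"
      unfolding norm_mult using k1 by (intro mult_mono) (auto simp: norm_divide)
    also have "\<dots> \<le> ((1 + k2) / k1) * (n * (B * r))"
      using k1 k2 n0 B0 r0 by (intro mult_right_mono divide_right_mono) auto
    finally have U: "norm (?c * (\<Sum>i\<in>UNIV. u i x0)) \<le> ((1 + k2) / k1) * (n * (B * r))" .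
    have "f x0 - g x0 = d x0 - ?c * (\<Sum>i\<in>UNIV. u i x0)" by (simp add: d_def)
    then have "norm (f x0 - g x0) \<le> exp ((norm l + 1) * r) * \<epsilon> + ((1 + k2) / k1) * (n * (B * r))"
      using norm_triangle_ineq4[of "d x0" "?c * (\<Sum>i\<in>UNIV. u i x0)"] d U by simp
    also have "\<dots> = C * ((1 + k2) / k1)" by (simp only: C_def \<epsilon>_def distrib_right) (simp add: mult_ac)
    finally show ?thesis by (simp add: f_def m_def)
  qed
  have "C \<ge> 0" unfolding C_def using C2 n0 B0 r0 by (intro add_nonneg_nonneg mult_nonneg_nonneg) auto
  with main show ?thesis by blast
qed

end

section \<open>Local uniformity in the spectral parameter\<close>

lemma G_BC_lipschitz:
  fixes l l' :: "(complex, 'n::{finite,linorder}) vec"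
  assumes k: "0 \<le> k1" "0 \<le> k2" "0 \<le> k3" and C: "norm l \<le> C" "norm l' \<le> C"
  shows "norm (G_BC k1 k2 k3 (- l - cvec (rho_BC k1 k2 k3)) x - G_BC k1 k2 k3 (- l' - cvec (rho_BC k1 k2 k3)) x)
    \<le> exp (2 * (C + 1) * norm x) * norm (l - l')"
proof -
  have "norm (G_BC k1 k2 k3 (- l - cvec (rho_BC k1 k2 k3)) x - G_BC k1 k2 k3 (- l' - cvec (rho_BC k1 k2 k3)) x)
    \<le> exp (2 * (C + 1) * norm x) * norm (- l - cvec (rho_BC k1 k2 k3) - (- l' - cvec (rho_BC k1 k2 k3)))"
    by (rule kernel_lipschitz[OF BC_mult_nonneg[OF k] G_BC_kernel[OF k] G_BC_kernel[OF k]]) (use C in \<open>simp_all add: rho_BC_eq\<close>)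
  also have "- l - cvec (rho_BC k1 k2 k3) - (- l' - cvec (rho_BC k1 k2 k3)) = l' - l" by simp
  finally show ?thesis by (simp only: norm_minus_commute)
qed

lemma G_A_lipschitz:
  fixes l l' :: "(complex, 'n::{finite,linorder}) vec"
  assumes k: "0 \<le> k3" and C: "norm l \<le> C" "norm l' \<le> C"
  shows "norm (G_A k3 (l - cvec (rho_A k3)) x - G_A k3 (l' - cvec (rho_A k3)) x) \<le> exp (2 * (C + 1) * norm x) * norm (l - l')"
proof -
  have "norm (G_A k3 (l - cvec (rho_A k3)) x - G_A k3 (l' - cvec (rho_A k3)) x)
    \<le> exp (2 * (C + 1) * norm x) * norm (l - cvec (rho_A k3) - (l' - cvec (rho_A k3)))"
    by (rule kernel_lipschitz[OF k G_A_kernel(1)[OF k] G_A_kernel(1)[OF k]]) (use C in \<open>simp_all add: rho_A_eq\<close>)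
  then show ?thesis by simp
qed

lemma G_BC_tendsto:
  fixes l :: "(complex, 'n::{finite,linorder}) vec"
  assumes k3: "0 \<le> k3"
  shows "((\<lambda>(k1, k2). G_BC k1 k2 k3 (- l - cvec (rho_BC k1 k2 k3)) x) \<longlongrightarrow> G_A k3 (l - cvec (rho_A k3)) (vlog (cosh2_half x))) mult_filter"
proof (rule tendstoI)
  interpret limit_setup k3 l by unfold_locales (rule k3)
  fix e :: real assume e: "e > 0"
  obtain C where C: "C \<ge> 0" "\<And>k1 k2. 0 < k1 \<Longrightarrow> 0 \<le> k2 \<Longrightarrow>
    norm (G_BC k1 k2 k3 (- l - cvec (rho_BC k1 k2 k3)) x - g x) \<le> C * ((1 + k2) / k1)"
    using convergence_rate[of x] by blast
  \<comment> \<open>in the regime below, \<open>M (1 + k\<^sub>2) \<le> 3 k\<^sub>1\<close>\<close>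
  define M where "M = max 1 (3 * C / e + 1)"
  have M: "M \<ge> 1" "M > 3 * C / e" by (simp_all add: M_def)
  show "eventually (\<lambda>z. dist (case z of (k1, k2) \<Rightarrow> G_BC k1 k2 k3 (- l - cvec (rho_BC k1 k2 k3)) x)
    (G_A k3 (l - cvec (rho_A k3)) (vlog (cosh2_half x))) < e) mult_filter"
    unfolding eventually_mult_filter
  proof (intro exI[of _ M] allI impI, elim conjE)
    fix k1 k2 assume h: "0 \<le> k1" "0 \<le> k2" "M \<le> k1 + k2" "M * k2 \<le> k1"
    have "1 * k2 \<le> M * k2" using M h by (intro mult_right_mono) auto
    then have half: "M \<le> 2 * k1" and k1: "0 < k1" using h M by linarith+
    have "M * (1 + k2) \<le> 3 * k1" using half h by (simp add: distrib_left)
    then have "C * (M * (1 + k2)) \<le> C * (3 * k1)" using C(1) by (rule mult_left_mono)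
    moreover have "3 * C < M * e" using M(2) e by (simp add: divide_less_eq)
    then have "3 * C * k1 < M * e * k1" using k1 by simp
    ultimately have "M * (C * (1 + k2)) < M * (e * k1)" by (simp add: mult_ac)
    then have "C * (1 + k2) < e * k1" using M(1) by simp
    then have "C * ((1 + k2) / k1) < e" using k1 by (simp add: divide_less_eq)
    then show "dist (case (k1, k2) of (k1, k2) \<Rightarrow> G_BC k1 k2 k3 (- l - cvec (rho_BC k1 k2 k3)) x)
      (G_A k3 (l - cvec (rho_A k3)) (vlog (cosh2_half x))) < e"
      using C(2)[OF k1 h(2)] by (simp add: dist_norm g_def G_def)
  qed
qed

text \<open>Pointwise convergence at the finitely many centres of a fine cover suffices.\<close>

lemma uniform_limit_of_equi_Lipschitz:
  fixes F :: "'a \<Rightarrow> 'b::metric_space \<Rightarrow> 'c::metric_space"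
  assumes S: "compact S" and K: "K \<ge> 0"
    and F: "eventually (\<lambda>a. \<forall>z\<in>S. \<forall>w\<in>S. dist (F a z) (F a w) \<le> K * dist z w) A"
    and f: "\<And>z w. z \<in> S \<Longrightarrow> w \<in> S \<Longrightarrow> dist (f z) (f w) \<le> K * dist z w"
    and lim: "\<And>z. z \<in> S \<Longrightarrow> ((\<lambda>a. F a z) \<longlongrightarrow> f z) A"
  shows "uniform_limit S F f A"
proof (rule uniform_limitI)
  fix e :: real assume e: "e > 0"
  \<comment> \<open>\<open>K + 1\<close> instead of \<open>K\<close> allows for \<open>K = 0\<close>\<close>
  define d where "d = e / (3 * (K + 1))"
  have d: "d > 0" using e K by (simp add: d_def)
  have Kd: "K * d < e / 3" using e K by (simp add: d_def field_simps)
  obtain T where T: "T \<subseteq> S" "finite T" "S \<subseteq> (\<Union>c\<in>T. ball c d)"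
    by (rule compactE_image[OF S, of S "\<lambda>c. ball c d"]) (use d in auto)
  have "eventually (\<lambda>a. \<forall>c\<in>T. dist (F a c) (f c) < e / 3) A"
    using T e lim by (intro eventually_ball_finite ballI tendstoD) auto
  with F show "eventually (\<lambda>a. \<forall>z\<in>S. dist (F a z) (f z) < e) A"
  proof eventually_elim
    case (elim a)
    show ?case
    proof
      fix z assume z: "z \<in> S"
      then obtain c where c: "c \<in> T" "dist z c < d" using T(3) by (auto simp: dist_commute)
      have "K * dist z c \<le> K * d" using c K by (intro mult_left_mono) auto
      then have K1: "K * dist z c < e / 3" "K * dist c z < e / 3" using Kd by (simp_all add: dist_commute)
      have cS: "c \<in> S" using c T by blast
      have "dist (F a z) (F a c) \<le> K * dist z c" using elim(1) z cS by blast
      moreover have "dist (f c) (f z) \<le> K * dist c z" using f cS z by blast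
      moreover have "dist (F a c) (f c) < e / 3" using elim(2) c by blast
      moreover have "dist (F a z) (f z) \<le> dist (F a z) (F a c) + dist (F a c) (f c) + dist (f c) (f z)"
        using dist_triangle[of "F a z" "f z" "F a c"] dist_triangle[of "F a c" "f z" "f c"] by linarith
      ultimately show "dist (F a z) (f z) < e" using K1 by linarith
    qed
  qed
qed

theorem theorem6p1:
  fixes k3 :: real and x :: "real ^ ('n :: {finite, linorder})"
  assumes "0 \<le> k3"
  shows "locally_uniform_limit
           (\<lambda>(k1, k2) l. G_BC k1 k2 k3 (- l - cvec (rho_BC k1 k2 k3)) x)
           (\<lambda>l. calG_A k3 (l - cvec (rho_A k3)) (cosh2_half x))
           mult_filter
       \<and> (\<forall>l.
           calG_A k3 (l - cvec (rho_A k3)) (cosh2_half x)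
             = G_A k3 (l - cvec (rho_A k3)) (vlog (cosh2_half x))
         \<and> G_A k3 (l - cvec (rho_A k3)) (vlog (cosh2_half x))
             = (\<Prod>i\<in>UNIV. of_real ((cosh (x $ i / 2))\<^sup>2) powr (bilin l 1 / of_nat CARD('n)))
               * G_A k3 (l - cvec (rho_A k3)) (orth_proj (span A_roots) (vlog (cosh2_half x))))"
proof (intro conjI allI)
  show "locally_uniform_limit
           (\<lambda>(k1, k2) l. G_BC k1 k2 k3 (- l - cvec (rho_BC k1 k2 k3)) x)
           (\<lambda>l. calG_A k3 (l - cvec (rho_A k3)) (cosh2_half x)) mult_filter"
    unfolding locally_uniform_limit_def calG_A_def
  proof
    fix l0 :: "(complex, 'n) vec"
    define C where "C = norm l0 + 1"
    have C0: "C \<ge> 0" by (simp add: C_def)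
    have nC: "norm l \<le> C" if "l \<in> cball l0 1" for l
      using norm_triangle_sub[of l l0] that by (simp add: C_def dist_norm norm_minus_commute)
    let ?y = "vlog (cosh2_half x)"
    define K where "K = exp (2 * (C + 1) * norm x) + exp (2 * (C + 1) * norm ?y)"
    have K: "exp (2 * (C + 1) * norm x) \<le> K" "exp (2 * (C + 1) * norm ?y) \<le> K" by (simp_all add: K_def)
    have K0: "K \<ge> 0" by (simp add: K_def)
    have "uniform_limit (cball l0 1) (\<lambda>(k1, k2) l. G_BC k1 k2 k3 (- l - cvec (rho_BC k1 k2 k3)) x)
      (\<lambda>l. G_A k3 (l - cvec (rho_A k3)) ?y) mult_filter"
    proof (rule uniform_limit_of_equi_Lipschitz[OF compact_cball K0])
      show "eventually (\<lambda>a. \<forall>z\<in>cball l0 1. \<forall>w\<in>cball l0 1. dist ((case a of (k1, k2) \<Rightarrow> \<lambda>l. G_BC k1 k2 k3 (- l - cvec (rho_BC k1 k2 k3)) x) z)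
        ((case a of (k1, k2) \<Rightarrow> \<lambda>l. G_BC k1 k2 k3 (- l - cvec (rho_BC k1 k2 k3)) x) w) \<le> K * dist z w) mult_filter"
        unfolding eventually_mult_filter prod.case dist_norm
        using order_trans[OF G_BC_lipschitz[OF _ _ assms nC nC] mult_right_mono[OF K(1) norm_ge_zero]] by blast
      show "dist (G_A k3 (z - cvec (rho_A k3)) ?y) (G_A k3 (w - cvec (rho_A k3)) ?y) \<le> K * dist z w"
        if "z \<in> cball l0 1" "w \<in> cball l0 1" for z w
        unfolding dist_norm
        by (rule order_trans[OF G_A_lipschitz[OF assms nC[OF that(1)] nC[OF that(2)]] mult_right_mono[OF K(2) norm_ge_zero]])
      show "((\<lambda>a. (case a of (k1, k2) \<Rightarrow> \<lambda>l. G_BC k1 k2 k3 (- l - cvec (rho_BC k1 k2 k3)) x) z) \<longlongrightarrow>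
        G_A k3 (z - cvec (rho_A k3)) ?y) mult_filter" for z
        using G_BC_tendsto[OF assms, of z x] by (simp add: case_prod_unfold)
    qed
    then have "uniform_limit (ball l0 1) (\<lambda>(k1, k2) l. G_BC k1 k2 k3 (- l - cvec (rho_BC k1 k2 k3)) x)
      (\<lambda>l. G_A k3 (l - cvec (rho_A k3)) ?y) mult_filter"
      by (rule uniform_limit_on_subset) (rule ball_subset_cball)
    then show "\<exists>U. open U \<and> l0 \<in> U \<and> uniform_limit U (\<lambda>(k1, k2) l. G_BC k1 k2 k3 (- l - cvec (rho_BC k1 k2 k3)) x)
      (\<lambda>l. G_A k3 (l - cvec (rho_A k3)) ?y) mult_filter"
      by (intro exI[of _ "ball l0 1"] conjI open_ball) simp_all
  qed
next
  fix l :: "(complex, 'n) vec"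
  show "calG_A k3 (l - cvec (rho_A k3)) (cosh2_half x) = G_A k3 (l - cvec (rho_A k3)) (vlog (cosh2_half x))"
    by (rule calG_A_def)
  have "vlog (cosh2_half x) = (\<chi> i. ln ((cosh (x $ i / 2))\<^sup>2))" by (simp add: vec_eq_iff vlog_cosh_nth)
  moreover have "(cosh (x $ i / 2))\<^sup>2 > 0" for i using cosh_real_pos[of "x $ i / 2"] by simp
  ultimately show "G_A k3 (l - cvec (rho_A k3)) (vlog (cosh2_half x))
      = (\<Prod>i\<in>UNIV. of_real ((cosh (x $ i / 2))\<^sup>2) powr (bilin l 1 / of_nat CARD('n)))
        * G_A k3 (l - cvec (rho_A k3)) (orth_proj (span A_roots) (vlog (cosh2_half x)))"
    using G_A_projection[OF assms, of "\<lambda>i. (cosh (x $ i / 2))\<^sup>2" l] by simp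
qed

end
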